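(* Let $k$ be a field of characteristic $p>0$, let $\mathrm{E}=k(\!(t)\!)$ with $t$-adic valuation $v_t$, and let $\mathrm{G}_{\mathrm{E}}$ be the absolute Galois group of $\mathrm{E}$. Let $\delta:\boldsymbol{\mathrm{CW}}(\mathrm{E})\to\mathrm{H}^1(\mathrm{G}_{\mathrm{E}},\mathbb{Q}_p/\mathbb{Z}_p)$ be the Artin–Schreier–Witt morphism, and let $\mathrm{Fil}_d$ denote Kato's filtrations (see context). Then: (1) The map $\Phi:\boldsymbol{\mathrm{CW}}(\mathrm{E})/(\bar{\mathrm{F}}-1)\boldsymbol{\mathrm{CW}}(\mathrm{E})\to \widetilde{\boldsymbol{\mathrm{CW}}}(k)^{(\mathrm{J}_p)}\oplus \boldsymbol{\mathrm{CW}}(k)/(\bar{\mathrm{F}}-1)\boldsymbol{\mathrm{CW}}(k)$ sending the class of $\boldsymbol{f}=\sum_{d>0}\boldsymbol{\lambda}_{-d}t^{-d}+\boldsymbol{f}_0+\boldsymbol{f}^+$ to $\bigl((\sum_{m\ge0}\iota_m(\boldsymbol{\lambda}_{-np^m}))_{n\in\mathrm{J}_p},\ \overline{\boldsymbol{f}_0}\bigr)$ is a well-defined group isomorphism; hence, via $\delta$, $\mathrm{H}^1(\mathrm{G}_{\mathrm{E}},\mathbb{Q}_p/\mathbb{Z}_p)\cong \widetilde{\boldsymbol{\mathrm{CW}}}(k)^{(\mathrm{J}_p)}\oplus \boldsymbol{\mathrm{CW}}(k)/(\bar{\mathrm{F}}-1)\boldsymbol{\mathrm{CW}}(k)$. (2)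 $\mathrm{Fil}_0(\mathrm{H}^1(\mathrm{G}_{\mathrm{E}},\mathbb{Q}_p/\mathbb{Z}_p))=\delta(\boldsymbol{\mathrm{CW}}(k))$, and $\delta$ induces an isomorphism $\boldsymbol{\mathrm{CW}}(k)/(\bar{\mathrm{F}}-1)\boldsymbol{\mathrm{CW}}(k)\cong \mathrm{Fil}_0(\mathrm{H}^1(\mathrm{G}_{\mathrm{E}},\mathbb{Q}_p/\mathbb{Z}_p))$. For $d\ge1$, under the isomorphism of (1), $\mathrm{Fil}_d(\mathrm{H}^1(\mathrm{G}_{\mathrm{E}},\mathbb{Q}_p/\mathbb{Z}_p))$ corresponds to $\bigoplus_{n\in\mathrm{J}_p,\,n\le d}\mathrm{Fil}_{m_{n,d}}(\widetilde{\boldsymbol{\mathrm{CW}}}(k))\oplus \boldsymbol{\mathrm{CW}}(k)/(\bar{\mathrm{F}}-1)\boldsymbol{\mathrm{CW}}(k)$, where $m_{n,d}:=\max\{m\ge0: np^m\le d\}$. Consequently $\mathrm{Gr}_d(\mathrm{H}^1(\mathrm{G}_{\mathrm{E}},\mathbb{Q}_p/\mathbb{Z}_p)):=\mathrm{Fil}_d/\mathrm{Fil}_{d-1}$ is isomorphic to $\mathbf{W}_{v_p(d)}(k)/p\mathbf{W}_{v_p(d)}(k)$ if $d>0$, and to $\boldsymbol{\mathrm{CW}}(k)/(\bar{\mathrm{F}}-1)\boldsymbol{\mathrm{CW}}(k)$ if $d=0$ (here $v_p(d)$ is the $p$-adic valuation of $d$). (3) For $d=np^m>0$ with $(n,p)=1$,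 the map $\mathbf{W}_m(k)\to \mathrm{Gr}_d(\mathrm{H}^1(\mathrm{G}_{\mathrm{E}},\mathbb{Q}_p/\mathbb{Z}_p))$, $\boldsymbol{\lambda}\mapsto$ class of $\delta(\boldsymbol{\lambda}t^{-d})$ (which is the map induced by $\delta$ on $\mathrm{Gr}_d(\boldsymbol{\mathrm{CW}}(\mathrm{E}))\cong \boldsymbol{\mathrm{CW}}^{(-d)}(k)\cong\mathbf{W}_m(k)$) is surjective with kernel $p\mathbf{W}_m(k)$. For $d=0$, the map $\mathrm{Fil}_0(\boldsymbol{\mathrm{CW}}(\mathrm{E}))=\boldsymbol{\mathrm{CW}}(k[[t]])\to \mathrm{Gr}_0(\mathrm{H}^1(\mathrm{G}_{\mathrm{E}},\mathbb{Q}_p/\mathbb{Z}_p))\cong \boldsymbol{\mathrm{CW}}(k)/(\bar{\mathrm{F}}-1)\boldsymbol{\mathrm{CW}}(k)$ induced by $\delta$ is given by substituting $t\mapsto 0$ in the entries and then projecting. (4) For all $d\ge 0$, $\mathrm{Fil}_d(\mathrm{H}^1(\mathrm{G}_{\mathrm{E}},\mathbb{Q}/\mathbb{Z}))=\mathrm{Fil}_d(\mathrm{H}^1(\mathrm{G}_{\mathrm{E}},\mathbb{Q}_p/\mathbb{Z}_p))\oplus\bigoplus_{\ell\ne p}\mathrm{H}^1(\mathrm{G}_{\mathrm{E}},\mathbb{Q}_\ell/\mathbb{Z}_\ell)$; hence $\mathrm{Gr}_d(\mathrm{H}^1(\mathrm{G}_{\mathrm{E}},\mathbb{Q}/\mathbb{Z}))=\mathrm{Gr}_d(\mathrm{H}^1(\mathrm{G}_{\mathrm{E}},\mathbb{Q}_p/\mathbb{Z}_p))$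 for $d>0$, and $\mathrm{Gr}_0(\mathrm{H}^1(\mathrm{G}_{\mathrm{E}},\mathbb{Q}/\mathbb{Z}))=\mathrm{Fil}_0(\mathrm{H}^1(\mathrm{G}_{\mathrm{E}},\mathbb{Q}_p/\mathbb{Z}_p))\oplus\bigoplus_{\ell\neq p}\mathrm{H}^1(\mathrm{G}_{\mathrm{E}},\mathbb{Q}_\ell/\mathbb{Z}_\ell)$.
   Context: No finiteness of a $p$-basis of $k$ is assumed. For a ring $R$ (not necessarily unital), $\mathbf{W}_m(R)$ denotes Witt vectors $(\lambda_0,\dots,\lambda_m)$ of length $m+1$; $\mathrm{V}(\lambda_0,\dots,\lambda_m)=(0,\lambda_0,\dots,\lambda_m)\in\mathbf{W}_{m+1}(R)$ is the Verschiebung; for $\mathbb{F}_p$-algebras $\bar{\mathrm{F}}(\lambda_0,\dots)=(\lambda_0^p,\dots)$. $\boldsymbol{\mathrm{CW}}(R)=\varinjlim(\mathbf{W}_m(R)\xrightarrow{\mathrm{V}}\mathbf{W}_{m+1}(R)\to\cdots)$ (Witt co-vectors $(\dots,0,0,\lambda_0,\dots,\lambda_m)$), and $\widetilde{\boldsymbol{\mathrm{CW}}}(k)=\varinjlim(\mathbf{W}_m(k)\xrightarrow{\mathrm{V}\bar{\mathrm{F}}}\mathbf{W}_{m+1}(k)\to\cdots)$, with canonical maps $\iota_m:\mathbf{W}_m(k)\to\widetilde{\boldsymbol{\mathrm{CW}}}(k)$ and filtration $\mathrm{Fil}_m(\widetilde{\boldsymbol{\mathrm{CW}}}(k)):=\iota_m(\mathbf{W}_m(k))$.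 Note $p\mathbf{W}_m(k)=\{(0,\lambda_1^p,\dots,\lambda_m^p)\}$. Artin–Schreier–Witt: there is an exact sequence $0\to\mathbb{Q}_p/\mathbb{Z}_p\to\boldsymbol{\mathrm{CW}}(\mathrm{E})\xrightarrow{\bar{\mathrm{F}}-1}\boldsymbol{\mathrm{CW}}(\mathrm{E})\xrightarrow{\delta}\mathrm{Hom}^{\mathrm{cont}}(\mathrm{G}_{\mathrm{E}},\mathbb{Q}_p/\mathbb{Z}_p)=\mathrm{H}^1(\mathrm{G}_{\mathrm{E}},\mathbb{Q}_p/\mathbb{Z}_p)\to0$, where for $\boldsymbol{\lambda}\in\mathbf{W}_m(\mathrm{E})$, $\delta(\boldsymbol{\lambda})(\gamma)=\gamma(\boldsymbol{\nu})-\boldsymbol{\nu}\in\mathbb{Z}/p^{m+1}\mathbb{Z}$ with $\boldsymbol{\nu}\in\mathbf{W}_m(\mathrm{E}^{\mathrm{sep}})$, $\bar{\mathrm{F}}(\boldsymbol{\nu})-\boldsymbol{\nu}=\boldsymbol{\lambda}$. Co-monomials: $\mathrm{J}_p=\{n\ge1:(n,p)=1\}$; for $d=np^m$ with $n\in\mathrm{J}_p$ and $\boldsymbol{\lambda}=(\lambda_0,\dots,\lambda_m)\in\mathbf{W}_m(k)$ put $\boldsymbol{\lambda}t^{-d}:=(\dots,0,0,\lambda_0t^{-n},\lambda_1t^{-np},\dots,\lambda_mt^{-np^m})\in\boldsymbol{\mathrm{CW}}(\mathrm{E})$; $\boldsymbol{\mathrm{CW}}^{(-d)}(k)$ is the group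 of such co-monomials, and $\boldsymbol{\lambda}\mapsto\boldsymbol{\lambda}t^{-d}$ is a group isomorphism $\mathbf{W}_m(k)\cong\boldsymbol{\mathrm{CW}}^{(-d)}(k)$. Known fact: every $\boldsymbol{f}\in\boldsymbol{\mathrm{CW}}(k(\!(t)\!))$ is uniquely a finite sum $\boldsymbol{f}=\sum_{d>0}\boldsymbol{\lambda}_{-d}t^{-d}+\boldsymbol{f}_0+\boldsymbol{f}^+$ with $\boldsymbol{\lambda}_{-d}\in\mathbf{W}_{v_p(d)}(k)$, $\boldsymbol{f}_0\in\boldsymbol{\mathrm{CW}}(k)$, $\boldsymbol{f}^+\in\boldsymbol{\mathrm{CW}}(tk[[t]])$. Kato's filtration: for $\boldsymbol{\lambda}=(\lambda_0,\dots,\lambda_s)\in\mathbf{W}_s(\mathrm{E})$ set $v(\boldsymbol{\lambda})=\min_i p^{s-i}v_t(\lambda_i)$ (compatible with $\mathrm{V}$, so defined on $\boldsymbol{\mathrm{CW}}(\mathrm{E})$); $\mathrm{Fil}_d(\boldsymbol{\mathrm{CW}}(\mathrm{E}))=\{\boldsymbol{f}: v(\boldsymbol{f})\ge -d\}$ for $d\ge0$, $\mathrm{Fil}_{-1}=0$; $\mathrm{Fil}_d(\mathrm{H}^1(\mathrm{G}_{\mathrm{E}},\mathbb{Q}_p/\mathbb{Z}_p)):=\delta(\mathrm{Fil}_d(\boldsymbol{\mathrm{CW}}(\mathrm{E})))$, $\mathrm{Fil}_{-1}=0$; $\mathrm{H}^1(\mathrm{G}_{\mathrm{E}},\mathbb{Q}/\mathbb{Z})=\mathrm{Hom}^{\mathrm{cont}}(\mathrm{G}_{\mathrm{E}},\mathbb{Q}/\mathbb{Z})=\bigoplus_\ell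 \mathrm{H}^1(\mathrm{G}_{\mathrm{E}},\mathbb{Q}_\ell/\mathbb{Z}_\ell)$ and $\mathrm{Fil}_d(\mathrm{H}^1(\mathrm{G}_{\mathrm{E}},\mathbb{Q}/\mathbb{Z}))$ is the inverse image of $\mathrm{Fil}_d(\mathrm{H}^1(\mathrm{G}_{\mathrm{E}},\mathbb{Q}_p/\mathbb{Z}_p))$ under the projection onto the $p$-primary component. *)

theory Defs
  imports
    "HOL-Algebra.Algebra"
    "HOL-Algebra.Algebraic_Closure_Type"
    "HOL-Analysis.Abstract_Topology"
    "HOL-Library.Poly_Mapping"
    "HOL-Library.Extended_Real"
    "HOL-Computational_Algebra.Formal_Laurent_Series"
begin

text \<open>
  All abelian groups are HOL-Algebra groups and hence written multiplicatively, although
  they are additive in the usual notation: products below are sums, \<^const>\<open>finprod\<close> is a finite sum,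
  and an \<open>n\<close>-th power is an \<open>n\<close>-fold multiple.
\<close>

section \<open>Groups\<close>

definition group_iso :: "('a, 'c) monoid_scheme \<Rightarrow> ('b, 'd) monoid_scheme \<Rightarrow> ('a \<Rightarrow> 'b) \<Rightarrow> bool" where
  "group_iso G H f \<longleftrightarrow> group G \<and> group H \<and> f \<in> iso G H"

definition quot_map :: "('a \<Rightarrow> 'b) \<Rightarrow> 'a set \<Rightarrow> 'b" where
  "quot_map f A = the_elem (f ` A)"

definition induces_iso ::
  "('a, 'c) monoid_scheme \<Rightarrow> 'a set \<Rightarrow> ('b, 'd) monoid_scheme \<Rightarrow> ('a \<Rightarrow> 'b) \<Rightarrow> bool" where
  "induces_iso G N H f \<longleftrightarrow>
     normal N G \<and> group_hom G H f \<and> (\<forall>x\<in>N. f x = \<one>\<^bsub>H\<^esub>) \<and> group_iso (G Mod N) H (quot_map f)"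

definition gr :: "('a, 'c) monoid_scheme \<Rightarrow> (int \<Rightarrow> 'a set) \<Rightarrow> int \<Rightarrow> 'a set monoid" where
  "gr G F d = (G\<lparr>carrier := F d\<rparr>) Mod F (d - 1)"

definition family_sum :: "('a, 'c) monoid_scheme \<Rightarrow> 'i set \<Rightarrow> ('i \<Rightarrow> 'a) \<Rightarrow> 'a" where
  "family_sum G I x = finprod G x {i \<in> I. x i \<noteq> \<one>\<^bsub>G\<^esub>}"

text \<open>
  The direct limit of \<open>G 0 \<rightarrow> G 1 \<rightarrow> \<dots>\<close> with transition maps \<open>\<phi> m : G m \<rightarrow> G (m + 1)\<close>;
  \<open>fold \<phi> [m..<N]\<close> is the composite \<open>G m \<rightarrow> G N\<close>, and \<open>lim_inj\<close> the canonical map \<open>\<iota>\<^sub>m\<close>.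
\<close>

definition lim_rel ::
  "(nat \<Rightarrow> ('a, 'c) monoid_scheme) \<Rightarrow> (nat \<Rightarrow> 'a \<Rightarrow> 'a) \<Rightarrow> ((nat \<times> 'a) \<times> (nat \<times> 'a)) set" where
  "lim_rel G \<phi> = {((m, x), (n, y)). x \<in> carrier (G m) \<and> y \<in> carrier (G n) \<and>
      (\<exists>N\<ge>max m n. fold \<phi> [m..<N] x = fold \<phi> [n..<N] y)}"

definition lim_inj ::
  "(nat \<Rightarrow> ('a, 'c) monoid_scheme) \<Rightarrow> (nat \<Rightarrow> 'a \<Rightarrow> 'a) \<Rightarrow> nat \<Rightarrow> 'a \<Rightarrow> (nat \<times> 'a) set" where
  "lim_inj G \<phi> m x = lim_rel G \<phi> `` {(m, x)}"

definition seq_lim ::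
  "(nat \<Rightarrow> ('a, 'c) monoid_scheme) \<Rightarrow> (nat \<Rightarrow> 'a \<Rightarrow> 'a) \<Rightarrow> (nat \<times> 'a) set monoid" where
  "seq_lim G \<phi> = \<lparr>carrier = (SIGMA m:UNIV. carrier (G m)) // lim_rel G \<phi>,
     monoid.mult = (\<lambda>A B. \<Union>(m, x)\<in>A. \<Union>(n, y)\<in>B. lim_inj G \<phi> (max m n)
        (fold \<phi> [m..<max m n] x \<otimes>\<^bsub>G (max m n)\<^esub> fold \<phi> [n..<max m n] y)),
     one = lim_inj G \<phi> 0 \<one>\<^bsub>G 0\<^esub>\<rparr>"


section \<open>Witt vectors\<close>

text \<open>
  Integer polynomials in the variables \<open>X\<^sub>0, X\<^sub>1, \<dots>\<close> (\<^term>\<open>Inl i\<close>) and \<open>Y\<^sub>0, Y\<^sub>1, \<dots>\<close> (\<^term>\<open>Inr i\<close>).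
\<close>

type_synonym xypoly = "(nat + nat \<Rightarrow>\<^sub>0 nat) \<Rightarrow>\<^sub>0 int"

definition pvar :: "nat + nat \<Rightarrow> xypoly" where
  "pvar v = Poly_Mapping.single (Poly_Mapping.single v 1) 1"

definition peval :: "(nat + nat \<Rightarrow> 'a::comm_ring_1) \<Rightarrow> xypoly \<Rightarrow> 'a" where
  "peval a P = (\<Sum>m\<in>Poly_Mapping.keys P. of_int (Poly_Mapping.lookup P m) *
      (\<Prod>v\<in>Poly_Mapping.keys m. a v ^ Poly_Mapping.lookup m v))"

definition ghost :: "nat \<Rightarrow> nat \<Rightarrow> (nat \<Rightarrow> 'a::comm_ring_1) \<Rightarrow> 'a" where
  "ghost p n x = (\<Sum>i\<le>n. of_nat (p ^ i) * x i ^ (p ^ (n - i)))"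

text \<open>The integral addition polynomials \<open>S\<^sub>0, S\<^sub>1, \<dots>\<close> of \<open>p\<close>-typical Witt vectors.\<close>

definition witt_sum_poly :: "nat \<Rightarrow> nat \<Rightarrow> xypoly" where
  "witt_sum_poly p = (THE S. \<forall>n. ghost p n S =
      ghost p n (\<lambda>i. pvar (Inl i)) + ghost p n (\<lambda>i. pvar (Inr i)))"

text \<open>
  The additive group \<open>W\<^sub>m(R)\<close> of Witt vectors \<open>(\<lambda>\<^sub>0, \<dots>, \<lambda>\<^sub>m)\<close>, of length \<open>m + 1\<close>, for a not
  necessarily unital subring \<open>R\<close> of a commutative ring. The Verschiebung is \<^term>\<open>Cons 0\<close>.
\<close>

definition witt :: "nat \<Rightarrow> 'a::comm_ring_1 set \<Rightarrow> nat \<Rightarrow> 'a list monoid" where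
  "witt p R m = \<lparr>carrier = {x. length x = Suc m \<and> set x \<subseteq> R},
     monoid.mult = (\<lambda>x y. map (\<lambda>n. peval (case_sum ((!) x) ((!) y)) (witt_sum_poly p n)) [0..<Suc m]),
     one = replicate (Suc m) 0\<rparr>"

definition witt_frob :: "nat \<Rightarrow> 'a::comm_ring_1 list \<Rightarrow> 'a list" where
  "witt_frob p = map (\<lambda>x. x ^ p)"

definition witt_p_multiples :: "nat \<Rightarrow> 'a::comm_ring_1 set \<Rightarrow> nat \<Rightarrow> 'a list set" where
  "witt_p_multiples p R m = (\<lambda>x. x [^]\<^bsub>witt p R m\<^esub> p) ` carrier (witt p R m)"

type_synonym 'a covec = "(nat \<times> 'a list) set"

definition cw :: "nat \<Rightarrow> 'a::comm_ring_1 set \<Rightarrow> 'a covec monoid" where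
  "cw p R = seq_lim (witt p R) (\<lambda>_. Cons 0)"

definition cw_inj :: "nat \<Rightarrow> 'a::comm_ring_1 set \<Rightarrow> nat \<Rightarrow> 'a list \<Rightarrow> 'a covec" where
  "cw_inj p R = lim_inj (witt p R) (\<lambda>_. Cons 0)"

definition cw_map ::
  "nat \<Rightarrow> 'b::comm_ring_1 set \<Rightarrow> ('a::comm_ring_1 \<Rightarrow> 'b) \<Rightarrow> 'a covec \<Rightarrow> 'b covec" where
  "cw_map p S h f = (\<Union>(m, x)\<in>f. cw_inj p S m (map h x))"

text \<open>\<open>(F - 1) CW(R)\<close>: for rings \<open>R\<close> of characteristic \<open>p\<close>, the Frobenius of \<open>CW(R)\<close> is induced by \<open>x \<mapsto> x\<^sup>p\<close>.\<close>

definition cw_wp :: "nat \<Rightarrow> 'a::comm_ring_1 set \<Rightarrow> 'a covec set" where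
  "cw_wp p R = (\<lambda>f. cw_map p R (\<lambda>x. x ^ p) f \<otimes>\<^bsub>cw p R\<^esub> inv\<^bsub>cw p R\<^esub> f) ` carrier (cw p R)"

text \<open>\<open>CW\<close> with a tilde: the limit along \<open>V F\<close> instead of \<open>V\<close>.\<close>

definition cwt :: "nat \<Rightarrow> 'a::comm_ring_1 set \<Rightarrow> 'a covec monoid" where
  "cwt p R = seq_lim (witt p R) (\<lambda>_ x. 0 # witt_frob p x)"

definition cwt_inj :: "nat \<Rightarrow> 'a::comm_ring_1 set \<Rightarrow> nat \<Rightarrow> 'a list \<Rightarrow> 'a covec" where
  "cwt_inj p R = lim_inj (witt p R) (\<lambda>_ x. 0 # witt_frob p x)"

definition cwt_fil :: "nat \<Rightarrow> 'a::comm_ring_1 set \<Rightarrow> nat \<Rightarrow> 'a covec set" where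
  "cwt_fil p R m = cwt_inj p R m ` carrier (witt p R m)"


section \<open>Characters of the absolute Galois group\<close>

definition sep_closure :: "'a::field alg_closure set" where
  "sep_closure = {x. \<exists>f :: 'a poly. Factorial_Ring.irreducible f \<and>
      rsquarefree (map_poly to_ac f) \<and> poly (map_poly to_ac f) x = 0}"

definition abs_gal :: "('a::field alg_closure \<Rightarrow> 'a alg_closure) monoid" where
  "abs_gal = (BijGroup sep_closure)\<lparr>carrier := {\<sigma> \<in> Bij sep_closure.
      (\<forall>x\<in>sep_closure. \<forall>y\<in>sep_closure. \<sigma> (x + y) = \<sigma> x + \<sigma> y \<and> \<sigma> (x * y) = \<sigma> x * \<sigma> y) \<and>
      (\<forall>a. \<sigma> (to_ac a) = to_ac a)}\<rparr>"

text \<open>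
  The Krull topology: its basic open sets are the cosets \<open>\<sigma> Gal(K\<^sup>s\<^sup>e\<^sup>p / K(S))\<close>, with \<open>S\<close> finite.
\<close>

definition krull :: "('a::field alg_closure \<Rightarrow> 'a alg_closure) topology" where
  "krull = topology_generated_by
     {{\<tau> \<in> carrier abs_gal. \<forall>x\<in>S. \<tau> x = \<sigma> x} | \<sigma> S.
        \<sigma> \<in> carrier abs_gal \<and> finite S \<and> S \<subseteq> sep_closure}"

text \<open>
  The group \<open>H\<^sup>1(G, A)\<close> of continuous homomorphisms to a discrete abelian group \<open>A\<close>
  on which \<open>G\<close> acts trivially.
\<close>

definition h1 :: "'b monoid \<Rightarrow> (('a::field alg_closure \<Rightarrow> 'a alg_closure) \<Rightarrow> 'b) monoid" where
  "h1 A = \<lparr>carrier = {\<chi> \<in> hom abs_gal A. \<chi> \<in> extensional (carrier abs_gal) \<and>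
        continuous_map krull (discrete_topology (carrier A)) \<chi>},
     monoid.mult = (\<lambda>\<chi> \<psi>. \<lambda>\<sigma>\<in>carrier abs_gal. \<chi> \<sigma> \<otimes>\<^bsub>A\<^esub> \<psi> \<sigma>),
     one = (\<lambda>\<sigma>\<in>carrier abs_gal. \<one>\<^bsub>A\<^esub>)\<rparr>"

text \<open>
  \<open>\<rat>/\<int>\<close>, and \<open>\<rat>\<^sub>l/\<int>\<^sub>l\<close> in its standard identification with the subgroup \<open>\<int>[1/l]/\<int>\<close> of \<open>\<rat>/\<int>\<close>
  (its \<open>l\<close>-primary component). Under it \<open>\<int>/l\<^sup>n\<close> is embedded by \<open>1 \<mapsto> 1/l\<^sup>n\<close>.
\<close>

definition rat_add :: "rat monoid" where
  "rat_add = \<lparr>carrier = UNIV, monoid.mult = (+), one = 0\<rparr>"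

definition rat_mod_int :: "rat set monoid" where
  "rat_mod_int = rat_add Mod \<int>"

definition rat_class :: "rat \<Rightarrow> rat set" where
  "rat_class r = \<int> #>\<^bsub>rat_add\<^esub> r"

definition prufer :: "nat \<Rightarrow> rat set monoid" where
  "prufer l = rat_mod_int\<lparr>carrier := {rat_class (of_int a / of_nat (l ^ n)) | a n. True}\<rparr>"

type_synonym 'a char = "('a alg_closure \<Rightarrow> 'a alg_closure) \<Rightarrow> rat set"

text \<open>
  The Artin--Schreier--Witt map for a field of characteristic \<open>p\<close>. The element
  \<open>\<gamma>(\<nu>) - \<nu>\<close> of \<open>W\<^sub>m(\<bbbF>\<^sub>p) = \<int>/p\<^sup>m\<^sup>+\<^sup>1\<close> is the \<open>a\<close>-fold multiple of \<open>(1, 0, \<dots>, 0)\<close>; the value does not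
  depend on the choices of the representative \<open>(m, x)\<close>, of \<open>\<nu>\<close> and of \<open>a\<close>.
\<close>

definition asw :: "nat \<Rightarrow> 'a::field covec \<Rightarrow> 'a char" where
  "asw p f = (\<lambda>\<gamma>\<in>carrier abs_gal. THE q. \<exists>m x \<nu> a.
      (m, x) \<in> f \<and> \<nu> \<in> carrier (witt p sep_closure m) \<and>
      witt_frob p \<nu> \<otimes>\<^bsub>witt p sep_closure m\<^esub> inv\<^bsub>witt p sep_closure m\<^esub> \<nu> = map to_ac x \<and>
      map \<gamma> \<nu> \<otimes>\<^bsub>witt p sep_closure m\<^esub> inv\<^bsub>witt p sep_closure m\<^esub> \<nu> =
        (1 # replicate m 0) [^]\<^bsub>witt p sep_closure m\<^esub> (a :: int) \<and>
      q = rat_class (of_int a / of_nat (p ^ (m + 1))))"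


section \<open>Laurent series fields\<close>

definition coprime_nats :: "nat \<Rightarrow> nat set" where
  "coprime_nats p = {n. n \<ge> 1 \<and> coprime n p}"

text \<open>For \<open>d = n p\<^sup>m\<close>: the co-monomial \<open>(\<dots>, 0, x\<^sub>0 t\<^sup>-\<^sup>n, x\<^sub>1 t\<^sup>-\<^sup>n\<^sup>p, \<dots>, x\<^sub>m t\<^sup>-\<^sup>d)\<close>.\<close>

definition comonomial :: "nat \<Rightarrow> nat \<Rightarrow> 'k::field list \<Rightarrow> 'k fls covec" where
  "comonomial p d x = (let m = multiplicity p d; n = d div p ^ m in
     cw_inj p UNIV m (map (\<lambda>i. fls_const (x ! i) * fls_X_intpow (- int (n * p ^ i))) [0..<Suc m]))"

text \<open>
  The data \<open>((x\<^sub>d)\<^sub>d, f\<^sub>0, f\<^sup>+)\<close> of the decomposition \<open>f = \<Sum>\<^sub>d x\<^sub>d t\<^sup>-\<^sup>d + f\<^sub>0 + f\<^sup>+\<close> of an element of \<open>CW(k((t)))\<close>,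
  with \<open>f\<^sub>0\<close> in \<open>CW(k)\<close> and \<open>f\<^sup>+\<close> in \<open>CW(t k[[t]])\<close>.
\<close>

definition laurent_parts ::
  "nat \<Rightarrow> ((nat \<Rightarrow> 'k::field list) \<times> 'k covec \<times> 'k fps covec) set" where
  "laurent_parts p = carrier (sum_group {0<..} (\<lambda>d. witt p UNIV (multiplicity p d))) \<times>
     carrier (cw p UNIV) \<times> carrier (cw p {g. fps_nth g 0 = 0})"

definition laurent_sum ::
  "nat \<Rightarrow> (nat \<Rightarrow> 'k::field list) \<times> 'k covec \<times> 'k fps covec \<Rightarrow> 'k fls covec" where
  "laurent_sum p = (\<lambda>(x, f\<^sub>0, f\<^sub>1).
     finprod (cw p UNIV) (\<lambda>d. comonomial p d (x d))
       {d. d > 0 \<and> x d \<noteq> \<one>\<^bsub>witt p UNIV (multiplicity p d)\<^esub>}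
     \<otimes>\<^bsub>cw p UNIV\<^esub> cw_map p UNIV fls_const f\<^sub>0 \<otimes>\<^bsub>cw p UNIV\<^esub> cw_map p UNIV fps_to_fls f\<^sub>1)"

definition asw_target ::
  "nat \<Rightarrow> ((nat \<Rightarrow> 'k::field covec) \<times> 'k covec set) monoid" where
  "asw_target p = sum_group (coprime_nats p) (\<lambda>_. cwt p UNIV) \<times>\<times> (cw p UNIV Mod cw_wp p UNIV)"

definition asw_phi :: "nat \<Rightarrow> 'k::field fls covec \<Rightarrow> (nat \<Rightarrow> 'k covec) \<times> 'k covec set" where
  "asw_phi p f = (case inv_into (laurent_parts p) (laurent_sum p) f of (x, f\<^sub>0, f\<^sub>1) \<Rightarrow>
     ((\<lambda>n\<in>coprime_nats p. finprod (cwt p UNIV) (\<lambda>m. cwt_inj p UNIV m (x (n * p ^ m)))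
         {m. x (n * p ^ m) \<noteq> \<one>\<^bsub>witt p UNIV m\<^esub>}),
      cw_wp p UNIV #>\<^bsub>cw p UNIV\<^esub> f\<^sub>0))"

definition asw_psi :: "nat \<Rightarrow> 'k::field fls char \<Rightarrow> (nat \<Rightarrow> 'k covec) \<times> 'k covec set" where
  "asw_psi p \<chi> = quot_map (asw_phi p)
     (inv_into (carrier (cw p UNIV Mod cw_wp p UNIV)) (quot_map (asw p)) \<chi>)"

text \<open>The part of \<^const>\<open>asw_target\<close> corresponding to Kato's \<open>Fil\<^sub>d\<close>, for \<open>d \<ge> 1\<close>.\<close>

definition asw_target_fil ::
  "nat \<Rightarrow> nat \<Rightarrow> ((nat \<Rightarrow> 'k::field covec) \<times> 'k covec set) set" where
  "asw_target_fil p d =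
     {y \<in> carrier (sum_group (coprime_nats p) (\<lambda>_. cwt p UNIV)). \<forall>n\<in>coprime_nats p.
        if n \<le> d then y n \<in> cwt_fil p UNIV (Max {m. n * p ^ m \<le> d}) else y n = \<one>\<^bsub>cwt p UNIV\<^esub>} \<times>
     carrier (cw p UNIV Mod cw_wp p UNIV)"

definition fls_val :: "'k::field fls \<Rightarrow> ereal" where
  "fls_val a = (if a = 0 then \<infinity> else ereal (of_int (fls_subdegree a)))"

definition witt_val :: "nat \<Rightarrow> nat \<Rightarrow> 'k::field fls list \<Rightarrow> ereal" where
  "witt_val p s x = Min ((\<lambda>i. ereal (of_nat (p ^ (s - i))) * fls_val (x ! i)) ` {..s})"

definition cw_val :: "nat \<Rightarrow> 'k::field fls covec \<Rightarrow> ereal" where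
  "cw_val p f = (THE v. \<exists>(s, x)\<in>f. v = witt_val p s x)"

definition cw_fil :: "nat \<Rightarrow> int \<Rightarrow> 'k::field fls covec set" where
  "cw_fil p d = (if d < 0 then {\<one>\<^bsub>cw p UNIV\<^esub>}
     else {f \<in> carrier (cw p UNIV). cw_val p f \<ge> ereal (of_int (- d))})"

definition h1_fil :: "nat \<Rightarrow> int \<Rightarrow> 'k::field fls char set" where
  "h1_fil p d = (if d < 0 then {\<one>\<^bsub>h1 (prufer p)\<^esub>} else asw p ` cw_fil p d)"

text \<open>
  The projection of \<open>H\<^sup>1(G, \<rat>/\<int>) = \<Oplus>\<^sub>l H\<^sup>1(G, \<rat>\<^sub>l/\<int>\<^sub>l)\<close> onto its \<open>p\<close>-primary component. As \<open>\<rat>\<^sub>l/\<int>\<^sub>l\<close> is a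
  subgroup of \<open>\<rat>/\<int>\<close>, the summands are subgroups of \<open>H\<^sup>1(G, \<rat>/\<int>)\<close>.
\<close>

definition h1_proj :: "nat \<Rightarrow> 'a::field char \<Rightarrow> 'a char" where
  "h1_proj p \<chi> = inv_into (carrier (sum_group {l. Factorial_Ring.prime l} (\<lambda>l. h1 (prufer l))))
     (family_sum (h1 rat_mod_int) {l. Factorial_Ring.prime l}) \<chi> p"

text \<open>The convention \<open>Fil\<^sub>-\<^sub>1 = 0\<close> (and not the inverse image of \<open>0\<close>) is the one used for \<open>Gr\<^sub>0\<close>.\<close>

definition h1_fil_full :: "nat \<Rightarrow> int \<Rightarrow> 'k::field fls char set" where
  "h1_fil_full p d = (if d < 0 then {\<one>\<^bsub>h1 rat_mod_int\<^esub>}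
     else {\<chi> \<in> carrier (h1 rat_mod_int). h1_proj p \<chi> \<in> h1_fil p d})"

definition h1_split :: "nat \<Rightarrow> int \<Rightarrow> ('k::field fls char \<times> (nat \<Rightarrow> 'k fls char)) monoid" where
  "h1_split p d = (h1 (prufer p))\<lparr>carrier := h1_fil p d\<rparr> \<times>\<times>
     sum_group {l. Factorial_Ring.prime l \<and> l \<noteq> p} (\<lambda>l. h1 (prufer l))"

definition h1_split_sum :: "nat \<Rightarrow> 'k::field fls char \<times> (nat \<Rightarrow> 'k fls char) \<Rightarrow> 'k fls char" where
  "h1_split_sum p = (\<lambda>(\<chi>, x).
     \<chi> \<otimes>\<^bsub>h1 rat_mod_int\<^esub> family_sum (h1 rat_mod_int) {l. Factorial_Ring.prime l \<and> l \<noteq> p} x)"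

end

(*
The leading entry of a co-vector over k((t)) of Kato level d has only finitely many polar
terms; removing them by co-monomials and shifting gives the decomposition of CW(k((t))), and
the same argument shows that Fil_d consists of the sums of co-monomials of degree at most d.
Frobenius sends the co-monomial of x and t^-d to that of VF(x) and t^-(dp). Hence modulo F - 1
the co-monomials of the degrees n p^m, with n fixed, glue to the limit along VF. On
CW(t k[[t]]) the map F - 1 is onto, because the sums of the iterates of F converge.
On the side of characters, the p-torsion is Artin--Schreier theory (additive Hilbert 90), and
the general case follows since multiplication by p on CW is Frobenius. Finally, the image of x
in W_m(k) falls into the previous step of the filtration exactly if x is in VF W_(m-1)(k),
which is p W_m(k).
*)
theory Submission
 imports Defs
begin

section \<open>Integer polynomials and Witt vector addition\<close>

text \<open>Several objects are given only by characterisations, and recovering them shapes the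
  proof. Addition of Witt vectors is the unique solution of the ghost equations: existence is
  Dwork's criterion, and each identity is proved for integer polynomials, where p is not a zero
  divisor, and then specialised to characteristic p. The separable closure is a set of roots; that
  it is a ring closed under Artin--Schreier equations is drawn from linear algebra, since x is
  separable over K exactly if it lies in K[x^p]. The values of \<open>asw\<close> are a definite
  description over all representatives and all solutions, tamed by computing with co-vectors over
  the separable closure instead of vectors of fixed length. As k may be imperfect, its Frobenius is
  only injective, and both limits are treated as systems with injective transition maps. Injectivity
  of Phi modulo F - 1 needs a map back from its target. That Kato's bound defines a subgroup cannot
  be seen entry by entry; after p^s-th powers and multiplication by a Teichmueller representative it
  becomes integrality.\<close>

definition pmono :: "(nat + nat => 'a::comm_ring_1) => (nat + nat \<Rightarrow>\<^sub>0 nat) => 'a" where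
 "pmono a m = (\<Prod>v\<in>Poly_Mapping.keys m. a v ^ Poly_Mapping.lookup m v)"

lemma peval_superset:
 assumes "finite A" "Poly_Mapping.keys P <= A"
 shows "peval a P = (\<Sum>m\<in>A. of_int (Poly_Mapping.lookup P m) * pmono a m)"
 unfolding peval_def pmono_def[symmetric]
 by (rule sum.mono_neutral_left) (use assms in "auto simp: in_keys_iff")

lemma pmono_superset:
 assumes "finite A" "Poly_Mapping.keys m <= A"
 shows "pmono a m = (\<Prod>v\<in>A. a v ^ Poly_Mapping.lookup m v)"
 unfolding pmono_def
 by (rule prod.mono_neutral_left) (use assms in "auto simp: in_keys_iff")

lemma pmono_add: "pmono a (m + n) = pmono a m * pmono a n"
proof -
 let ?A = "Poly_Mapping.keys m \<union> Poly_Mapping.keys n"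
 have "pmono a (m + n) = (\<Prod>v\<in>?A. a v ^ Poly_Mapping.lookup (m + n) v)"
  by (rule pmono_superset) (auto dest: subsetD[OF keys_add])
 also have "\<dots> = (\<Prod>v\<in>?A. a v ^ Poly_Mapping.lookup m v) * (\<Prod>v\<in>?A. a v ^ Poly_Mapping.lookup n v)"
  by (simp add: lookup_add power_add prod.distrib)
 also have "\<dots> = pmono a m * pmono a n"
  by (subst (1 2) pmono_superset[of ?A]) auto
 finally show ?thesis .
qed

lemma pmono_0 [simp]: "pmono a 0 = 1"
 by (simp add: pmono_def)

lemma peval_0 [simp]: "peval a 0 = 0"
 by (simp add: peval_def)

lemma peval_single: "peval a (Poly_Mapping.single m c) = of_int c * pmono a m"
 by (cases "c = 0") (simp_all add: peval_def pmono_def)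

lemma peval_add: "peval a (P + Q) = peval a P + peval a Q"
proof -
 let ?A = "Poly_Mapping.keys P \<union> Poly_Mapping.keys Q"
 have "peval a (P + Q) = (\<Sum>m\<in>?A. of_int (Poly_Mapping.lookup (P + Q) m) * pmono a m)"
  by (rule peval_superset) (auto dest: subsetD[OF keys_add])
 also have "\<dots> = peval a P + peval a Q"
  by (subst (1 2) peval_superset[of ?A]) (auto simp: lookup_add algebra_simps sum.distrib)
 finally show ?thesis .
qed

lemma peval_sum: "peval a (sum f A) = (\<Sum>x\<in>A. peval a (f x))"
 by (induction A rule: infinite_finite_induct) (auto simp: peval_add)

lemma sum_single_keys:
 fixes P :: "'a \<Rightarrow>\<^sub>0 'b::comm_monoid_add"
 shows "P = (\<Sum>m\<in>Poly_Mapping.keys P. Poly_Mapping.single m (Poly_Mapping.lookup P m))"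
proof (rule poly_mapping_eqI)
 fix k
 have "(\<Sum>m\<in>Poly_Mapping.keys P. Poly_Mapping.lookup (Poly_Mapping.single m (Poly_Mapping.lookup P m)) k)
   = (\<Sum>m\<in>Poly_Mapping.keys P. if k = m then Poly_Mapping.lookup P m else 0)"
  by (rule sum.cong) (auto simp: lookup_single when_def)
 also have "\<dots> = Poly_Mapping.lookup P k"
  by (simp add: sum.delta in_keys_iff)
 finally show "Poly_Mapping.lookup P k = Poly_Mapping.lookup
   (\<Sum>m\<in>Poly_Mapping.keys P. Poly_Mapping.single m (Poly_Mapping.lookup P m)) k"
  by (simp add: lookup_sum)
qed

lemma peval_mult: "peval a (P * Q) = peval a P * peval a Q"
proof -
 let ?S = "\<Sum>m\<in>Poly_Mapping.keys P. \<Sum>n\<in>Poly_Mapping.keys Q.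
  Poly_Mapping.single (m + n) (Poly_Mapping.lookup P m * Poly_Mapping.lookup Q n)"
 have "P * Q = (\<Sum>m\<in>Poly_Mapping.keys P. Poly_Mapping.single m (Poly_Mapping.lookup P m)) *
   (\<Sum>m\<in>Poly_Mapping.keys Q. Poly_Mapping.single m (Poly_Mapping.lookup Q m))"
  using sum_single_keys[of P] sum_single_keys[of Q] by simp
 also have "\<dots> = ?S"
  by (simp add: sum_product mult_single)
 finally have PQ: "P * Q = ?S" .
 show ?thesis
  unfolding PQ peval_sum peval_single pmono_add
  by (simp add: peval_def sum_product flip: pmono_def) (simp add: ac_simps)
qed

lemma peval_1 [simp]: "peval a 1 = 1"
 using peval_single[of a 0 1] by (simp add: single_one)

lemma peval_uminus: "peval a (- P) = - peval a P"
 using peval_add[of a P "- P"] by (simp add: eq_neg_iff_add_eq_0 add.commute)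

lemma peval_diff: "peval a (P - Q) = peval a P - peval a Q"
 using peval_add[of a P "- Q"] by (simp add: peval_uminus)

lemma peval_power: "peval a (P ^ n) = peval a P ^ n"
 by (induction n) (auto simp: peval_mult)

lemma peval_of_nat [simp]: "peval a (of_nat n) = of_nat n"
 by (induction n) (auto simp: peval_add)

lemma peval_pvar [simp]: "peval a (pvar v) = a v"
 by (simp add: pvar_def peval_single pmono_def)

text \<open>With \<open>a = pvar\<close> and \<open>peval_pvar_id\<close> this is the induction
  principle for polynomials: a set closed under the ring operations that contains the integers and
  the variables contains everything.\<close>

lemma peval_in:
 assumes "\<And>c. of_int c : R" "\<And>v. a v : R"
  "\<And>x y. x : R ==> y : R ==> x + y : R" "\<And>x y. x : R ==> y : R ==> x * y : R"
 shows "peval a P : R"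
proof -
 have 1: "1 : R" "0 : R" using assms(1)[of 1] assms(1)[of 0] by auto
 have p: "x ^ n : R" if "x : R" for x n
  by (induction n) (use that 1 assms in auto)
 have m: "prod f A : R" if "\<And>x. x : A ==> f x : R" for f :: "nat + nat => 'a" and A
  using that by (induction A rule: infinite_finite_induct) (use 1 assms in auto)
 have s: "sum f A : R" if "\<And>x. x : A ==> f x : R" for f :: "(nat + nat \<Rightarrow>\<^sub>0 nat) => 'a" and A
  using that by (induction A rule: infinite_finite_induct) (use 1 assms in auto)
 show ?thesis unfolding peval_def
  by (intro s assms m p)
qed

lemma peval_pvar_id: "peval pvar P = P"
proof -
 have v: "pvar v ^ n = Poly_Mapping.single (Poly_Mapping.single v n) 1" for v n
  by (induction n) (auto simp: pvar_def mult_single single_one simp flip: single_add)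
 have m: "pmono pvar m = Poly_Mapping.single m 1" for m :: "nat + nat \<Rightarrow>\<^sub>0 nat"
 proof -
  have "(\<Prod>v\<in>A. pvar v ^ f v) = Poly_Mapping.single (\<Sum>v\<in>A. Poly_Mapping.single v (f v)) 1"
   for A :: "(nat + nat) set" and f
   by (induction A rule: infinite_finite_induct) (auto simp: v mult_single single_one)
  then show ?thesis unfolding pmono_def using sum_single_keys[of m] by simp
 qed
 have "of_int c * Poly_Mapping.single m 1 = Poly_Mapping.single m c"
  for c :: int and m :: "nat + nat \<Rightarrow>\<^sub>0 nat"
  by (subst single_of_int[symmetric]) (simp add: mult_single)
 then have "peval pvar P = (\<Sum>m\<in>Poly_Mapping.keys P. Poly_Mapping.single m (Poly_Mapping.lookup P m))"
  unfolding peval_def pmono_def[symmetric] m by simp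
 then show ?thesis using sum_single_keys[of P] by simp
qed

lemma pmono_zero: "m ~= 0 ==> pmono (%_. 0) m = 0"
 unfolding pmono_def
 by (metis finite_keys keys_eq_empty in_keys_iff all_not_in_conv prod_zero power_0_left)

lemma peval_zero: "peval (%_. 0::int) P = Poly_Mapping.lookup P 0"
proof -
 have "peval (%_. 0::int) P = (\<Sum>m\<in>insert 0 (Poly_Mapping.keys P). of_int (Poly_Mapping.lookup P m) * pmono (%_. 0) m)"
  by (rule peval_superset) auto
 also have "\<dots> = (\<Sum>m\<in>{0}. of_int (Poly_Mapping.lookup P m) * pmono (%_. 0) m)"
  by (rule sum.mono_neutral_right) (auto simp: pmono_zero)
 finally show ?thesis by simp
qed

text \<open>
 Subrings need not be unital, so as to include the ideal of power series without constant term.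
\<close>

definition subrng :: "'a::comm_ring_1 set => bool" where
 "subrng R \<longleftrightarrow> 0 : R \<and> (\<forall>x\<in>R. \<forall>y\<in>R. x + y : R \<and> x * y : R) \<and> (\<forall>x\<in>R. - x : R)"

definition rng_hom_on :: "'a::comm_ring_1 set => ('a => 'b::comm_ring_1) => bool" where
 "rng_hom_on R h \<longleftrightarrow> (\<forall>x\<in>R. \<forall>y\<in>R. h (x + y) = h x + h y \<and> h (x * y) = h x * h y)"

lemma subrng_UNIV [simp]: "subrng UNIV" by (simp add: subrng_def)

lemma rng_hom_on_0: "subrng R ==> rng_hom_on R h ==> h 0 = 0"
 unfolding subrng_def rng_hom_on_def by (metis add.right_neutral add_left_cancel)

lemma rng_hom_on_uminus: "subrng R ==> rng_hom_on R h ==> x : R ==> h (- x) = - h x"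
 using rng_hom_on_0[of R h] unfolding subrng_def rng_hom_on_def
 by (metis add.right_inverse add_left_cancel)

text \<open>The vanishing constant term means that only the operations of a non-unital ring occur,
  so the lemma covers the ideal t k[[t]] and maps that need not preserve 1.\<close>

lemma peval_rng_hom:
 assumes R: "subrng R" and h: "rng_hom_on R h" and a: "\<And>v. a v : R" and P: "Poly_Mapping.lookup P 0 = 0"
 shows "peval a P : R \<and> h (peval a P) = peval (%v. h (a v)) P"
proof -
 note Rs = R[unfolded subrng_def] and hs = h[unfolded rng_hom_on_def]
 have pow: "x ^ n : R \<and> h (x ^ n) = h x ^ n" if "x : R" "n > 0" for x n
  using that(2)
  by (induction n rule: nat_induct_non_zero) (use that(1) Rs hs in auto)
 have mon: "pmono a m : R \<and> h (pmono a m) = pmono (%v. h (a v)) m" if "m ~= 0" for m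
 proof -
  have *: "(\<Prod>v\<in>A. a v ^ f v) : R \<and> h (\<Prod>v\<in>A. a v ^ f v) = (\<Prod>v\<in>A. h (a v) ^ f v)"
   if "finite A" "A ~= {}" "\<forall>v\<in>A. f v > 0" for A f
   using that
   by (induction A rule: finite_ne_induct) (use pow a Rs hs in auto)
  show ?thesis unfolding pmono_def
   by (rule *) (use that in "auto simp: in_keys_iff")
 qed
 \<comment> \<open>The coefficients themselves may lie outside \<open>R\<close>; only their
   multiples of elements of \<open>R\<close>, which are repeated sums, are available.\<close>
 have nat: "of_nat n * x : R \<and> h (of_nat n * x) = of_nat n * h x" if "x : R" for n x
  by (induction n) (use that Rs hs rng_hom_on_0[OF R h] in "auto simp: algebra_simps")
 have int: "of_int c * x : R \<and> h (of_int c * x) = of_int c * h x" if "x : R" for c x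
  by (cases c rule: int_cases2)
   (use that nat[OF that] Rs rng_hom_on_uminus[OF R h] in auto)
 have *: "(\<Sum>m\<in>A. of_int (f m) * pmono a m) : R \<and>
   h (\<Sum>m\<in>A. of_int (f m) * pmono a m) = (\<Sum>m\<in>A. of_int (f m) * pmono (%v. h (a v)) m)"
  if "0 \<notin> A" for A and f :: "_ => int"
  using that
  by (induction A rule: infinite_finite_induct)
   (use Rs hs rng_hom_on_0[OF R h] mon int in "auto")
 show ?thesis unfolding peval_def pmono_def[symmetric]
  by (rule *) (simp add: P in_keys_iff)
qed

section \<open>Congruences modulo powers of p\<close>

lemma dvd_freshman:
 fixes x y :: "'a::comm_ring_1"
 assumes "Factorial_Ring.prime p"
 shows "of_nat p dvd (x + y) ^ p - x ^ p - y ^ p"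
proof -
 have p: "p > 0" using assms prime_gt_0_nat by auto
 have "(x + y) ^ p = (\<Sum>k\<le>p. of_nat (p choose k) * x ^ k * y ^ (p - k))"
  by (rule binomial_ring)
 also have "{..p} = insert 0 (insert p {0<..<p})" using p by auto
 also have "(\<Sum>k\<in>insert 0 (insert p {0<..<p}). of_nat (p choose k) * x ^ k * y ^ (p - k)) =
   x ^ p + y ^ p + (\<Sum>k\<in>{0<..<p}. of_nat (p choose k) * x ^ k * y ^ (p - k))"
  using p by simp
 finally have "(x + y) ^ p - x ^ p - y ^ p = (\<Sum>k\<in>{0<..<p}. of_nat (p choose k) * x ^ k * y ^ (p - k))"
  by simp
 moreover have "of_nat p dvd of_nat (p choose k) * x ^ k * y ^ (p - k)" if "k : {0<..<p}" for k
 proof -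
  have "p dvd p choose k" using that assms by (intro dvd_choose_prime) auto
  then have "(of_nat p :: 'a) dvd of_nat (p choose k)" by (metis dvd_def of_nat_mult)
  then show ?thesis by (simp add: dvd_mult2)
 qed
 ultimately show ?thesis by (metis (no_types, lifting) dvd_sum)
qed

text \<open>When x - y is factored out of x^p - y^p, the cofactor is a sum of p products, each
  congruent to y^(p-1) modulo p; so the cofactor is divisible by p and contributes the extra
  power.\<close>

lemma dvd_power_diff:
 fixes x y :: "'a::comm_ring_1"
 assumes "k > 0" "of_nat (p ^ k) dvd x - y"
 shows "of_nat (p ^ Suc k) dvd x ^ p - y ^ p"
proof -
 have d: "of_nat p dvd x - y"
  using assms by (metis dvd_trans dvd_power of_nat_power)
 have "x ^ i - y ^ i = (x - y) * (\<Sum>j<i. y ^ (i - Suc j) * x ^ j)" for i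
  by (rule power_diff_sumr2)
 then have e: "of_nat p dvd x ^ i - y ^ i" for i using d by (metis dvd_mult2)
 have "of_nat p dvd (\<Sum>i<p. y ^ (p - Suc i) * x ^ i) - (\<Sum>i<p. y ^ (p - Suc i) * y ^ i)"
  unfolding sum_subtractf[symmetric] right_diff_distrib[symmetric]
  by (intro dvd_sum dvd_mult e)
 moreover have "(\<Sum>i<p. y ^ (p - Suc i) * y ^ i) = (\<Sum>i<p. y ^ (p - 1))"
  by (rule sum.cong) (auto simp flip: power_add)
 ultimately have "of_nat p dvd (\<Sum>i<p. y ^ (p - Suc i) * x ^ i)"
  by (simp add: dvd_diff_left_iff)
 then have "of_nat (p ^ k) * of_nat p dvd (x - y) * (\<Sum>i<p. y ^ (p - Suc i) * x ^ i)"
  using assms by (intro mult_dvd_mono) auto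
 then show ?thesis by (simp add: power_diff_sumr2[of x p y] mult.commute)
qed

lemma dvd_power_diff_iter:
 fixes x y :: "'a::comm_ring_1"
 assumes "of_nat p dvd x - y"
 shows "of_nat (p ^ Suc k) dvd x ^ (p ^ k) - y ^ (p ^ k)"
proof (induction k)
 case (Suc k)
 have "of_nat (p ^ Suc (Suc k)) dvd (x ^ (p ^ k)) ^ p - (y ^ (p ^ k)) ^ p"
  by (rule dvd_power_diff) (use Suc in auto)
 then show ?case by (simp add: power_mult[symmetric] mult.commute)
qed (use assms in simp)

section \<open>Ghost components and Dwork's criterion\<close>

lemma ghost_Suc: "ghost p (Suc n) x = ghost p n (%i. x i ^ p) + of_nat (p ^ Suc n) * x (Suc n)"
proof -
 have "x i ^ p ^ (Suc n - i) = (x i ^ p) ^ p ^ (n - i)" if "i \<le> n" for i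
  using that by (simp add: Suc_diff_le power_mult)
 then show ?thesis unfolding ghost_def by (simp del: of_nat_power)
qed

lemma ghost_0 [simp]: "ghost p 0 x = x 0" by (simp add: ghost_def)

lemma peval_ghost: "peval a (ghost p n x) = ghost p n (%i. peval a (x i))"
 unfolding ghost_def peval_sum peval_mult peval_power peval_of_nat ..

lemma ghost_cong: "(\<And>i. i \<le> n ==> x i = y i) ==> ghost p n x = ghost p n y"
 by (simp add: ghost_def)

text \<open>The ghost map is injective where p is not a zero divisor. The type argument lets one
  predicate serve for \<open>xypoly\<close> and for \<open>int\<close>.\<close>

definition torsion_free_ring :: "nat => 'a::comm_ring_1 itself => bool" where
 "torsion_free_ring p _ \<longleftrightarrow> (\<forall>x::'a. of_nat p * x = 0 \<longrightarrow> x = 0)"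

lemma torsion_free_power:
 "torsion_free_ring p TYPE('a::comm_ring_1) ==> of_nat (p ^ k) * (x::'a) = 0 ==> x = 0"
proof (induction k arbitrary: x)
 case (Suc k)
 have "of_nat p * (of_nat (p ^ k) * x) = 0" using Suc.prems by (simp add: mult.assoc)
 then have "of_nat (p ^ k) * x = 0" using Suc.prems(1) unfolding torsion_free_ring_def by blast
 then show ?case using Suc.IH Suc.prems(1) by blast
qed simp

lemma of_nat_mult_xypoly: "of_nat n * P = Poly_Mapping.map ((*) (int n)) P" for P :: xypoly
 using mult_map_scale_conv_mult[of "int n" P] by simp

lemma torsion_free_xypoly: "p > 0 ==> torsion_free_ring p TYPE(xypoly)"
 unfolding torsion_free_ring_def of_nat_mult_xypoly map_eq_zero_iff
 by (auto simp: in_keys_iff intro!: poly_mapping_eqI)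

lemma torsion_free_int: "p > 0 ==> torsion_free_ring p TYPE(int)"
 by (simp add: torsion_free_ring_def)

lemma ghost_inj:
 fixes x y :: "nat => 'a::comm_ring_1"
 assumes t: "torsion_free_ring p TYPE('a)" and g: "\<And>n. n \<le> N ==> ghost p n x = ghost p n y"
 shows "n \<le> N ==> x n = y n"
proof (induction n rule: less_induct)
 case (less n)
 have "ghost p n x = (\<Sum>i<n. of_nat (p ^ i) * x i ^ p ^ (n - i)) + of_nat (p ^ n) * x n" for x :: "nat => 'a"
  unfolding ghost_def by (simp add: lessThan_Suc_atMost[symmetric])
 moreover have "(\<Sum>i<n. of_nat (p ^ i) * x i ^ p ^ (n - i)) = (\<Sum>i<n. of_nat (p ^ i) * y i ^ p ^ (n - i))"
  using less by simp
 ultimately have "of_nat (p ^ n) * (x n - y n) = 0"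
  using g[OF less.prems] by (simp add: right_diff_distrib)
 then show ?case using torsion_free_power[OF t] by fastforce
qed

text \<open>The congruence form of \<open>ghost_inj\<close>. In ghost component n the earlier
  entries enter as p^i times p^(n-i)-th powers, so a congruence of them modulo p becomes one modulo
  p^(n+1) in the sum, and only the last entry remains.\<close>

lemma ghost_dvd:
 fixes x y :: "nat => 'a::comm_ring_1"
 assumes t: "torsion_free_ring p TYPE('a)"
  and g: "\<And>n. of_nat (p ^ Suc n) dvd ghost p n x - ghost p n y"
 shows "of_nat p dvd x n - y n"
proof (induction n rule: less_induct)
 case (less n)
 have e: "ghost p n x = (\<Sum>i<n. of_nat (p ^ i) * x i ^ p ^ (n - i)) + of_nat (p ^ n) * x n" for x :: "nat => 'a"
  unfolding ghost_def by (simp add: lessThan_Suc_atMost[symmetric])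
 have "of_nat (p ^ Suc n) dvd of_nat (p ^ i) * (x i ^ p ^ (n - i) - y i ^ p ^ (n - i))" if "i < n" for i
 proof -
  have "p ^ Suc n = p ^ i * p ^ Suc (n - i)"
   using that by (simp flip: power_add power_Suc)
  then show ?thesis
   using dvd_power_diff_iter[OF less.IH[OF that], of "n - i"]
   by (metis of_nat_mult mult_dvd_mono dvd_refl)
 qed
 then have 1: "of_nat (p ^ Suc n) dvd (\<Sum>i<n. of_nat (p ^ i) * (x i ^ p ^ (n - i) - y i ^ p ^ (n - i)))"
  by (intro dvd_sum) auto
 have 2: "ghost p n x - ghost p n y = (\<Sum>i<n. of_nat (p ^ i) * (x i ^ p ^ (n - i) - y i ^ p ^ (n - i)))
   + of_nat (p ^ n) * (x n - y n)"
  unfolding e by (simp add: right_diff_distrib sum_subtractf)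
 have "of_nat (p ^ Suc n) dvd of_nat (p ^ n) * (x n - y n)"
  using g[of n] unfolding 2 dvd_add_right_iff[OF 1] .
 then obtain z where "of_nat (p ^ n) * (x n - y n) = of_nat (p ^ Suc n) * z" by (auto simp: dvd_def)
 then have "of_nat (p ^ n) * ((x n - y n) - of_nat p * z) = 0"
  by (simp add: algebra_simps)
 then have "x n - y n = of_nat p * z" using torsion_free_power[OF t] by fastforce
 then show ?case by simp
qed

text \<open>The polynomials with this property form a subring containing the variables and the
  integers, which is then everything by \<open>peval_in\<close>. Substituting p-th powers for the
  variables is thus a lift of Frobenius, the structure on which \<open>dwork\<close> rests.\<close>

lemma peval_frobenius_dvd:
 assumes "Factorial_Ring.prime p"
 shows "of_nat p dvd peval (%v. pvar v ^ p) P - P ^ p"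
proof -
 define A where "A = {P :: xypoly. of_nat p dvd peval (%v. pvar v ^ p) P - P ^ p}"
 have n: "(of_nat n :: xypoly) : A" for n
 proof (induction n)
  case 0 then show ?case using prime_gt_0_nat[OF assms] by (simp add: A_def zero_power)
 next
  case (Suc n)
  have 1: "of_nat (Suc n) - of_nat (Suc n) ^ p =
    (of_nat n - of_nat n ^ p) - ((of_nat n + 1) ^ p - of_nat n ^ p - (1::xypoly) ^ p)"
   by (simp add: add.commute)
  have "of_nat p dvd (of_nat n - of_nat n ^ p) - ((of_nat n + 1) ^ p - of_nat n ^ p - (1::xypoly) ^ p)"
   using Suc dvd_freshman[OF assms, of "of_nat n" "1::xypoly"]
   unfolding A_def mem_Collect_eq peval_of_nat by (rule dvd_diff)
  then show ?case unfolding A_def mem_Collect_eq peval_of_nat 1 .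
 qed
 have add: "P + Q : A" if "P : A" "Q : A" for P Q
 proof -
  let ?f = "peval (%v. pvar v ^ p)"
  have *: "?f (P + Q) - (P + Q) ^ p = (?f P - P ^ p) + (?f Q - Q ^ p) - ((P + Q) ^ p - P ^ p - Q ^ p)"
   by (simp add: peval_add)
  show ?thesis unfolding A_def mem_Collect_eq *
   by (rule dvd_diff[OF dvd_add dvd_freshman[OF assms]]) (use that in "auto simp: A_def")
 qed
 have mult: "P * Q : A" if "P : A" "Q : A" for P Q
 proof -
  let ?f = "peval (%v. pvar v ^ p)"
  have *: "?f (P * Q) - (P * Q) ^ p = (?f P - P ^ p) * ?f Q + P ^ p * (?f Q - Q ^ p)"
   by (simp add: peval_mult power_mult_distrib algebra_simps)
  show ?thesis unfolding A_def mem_Collect_eq *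
   by (intro dvd_add dvd_mult dvd_mult2) (use that in "auto simp: A_def")
 qed
 have m1: "-1 : A"
 proof -
  have "of_nat p dvd ((1::xypoly) + (-1)) ^ p - 1 ^ p - (-1) ^ p" by (rule dvd_freshman[OF assms])
  moreover have "(0::xypoly) ^ p = 0" using prime_gt_0_nat[OF assms] by (simp add: zero_power)
  ultimately show ?thesis by (simp add: A_def peval_uminus)
 qed
 have "of_int c : A" for c
 proof (cases c rule: int_cases2)
  case (nonpos m)
  then show ?thesis using mult[OF m1 n[of m]] by simp
 qed (use n in simp)
 then have "peval pvar P : A"
  by (rule peval_in) (auto intro: add mult, simp add: A_def)
 then show ?thesis by (simp add: peval_pvar_id A_def)
qed

text \<open>Dwork's criterion. Once the entries up to n are known, ghost equation n + 1 can be
  solved for the next entry as soon as a certain difference is divisible by p^(n+1). The hypothesis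
  compares \<open>w (Suc n)\<close> with the Frobenius lift of \<open>w n\<close>, and
  \<open>dvd_power_diff_iter\<close> compares that lift with the p-th powers of the entries.\<close>

lemma dwork:
 assumes p: "Factorial_Ring.prime p"
  and w: "\<And>n. of_nat (p ^ Suc n) dvd peval (%v. pvar v ^ p) (w n) - w (Suc n)"
 shows "\<exists>S. \<forall>n. ghost p n S = w n"
proof -
 let ?f = "peval (%v. pvar v ^ p) :: xypoly => xypoly"
 have "\<forall>n. \<exists>S. \<forall>i\<le>n. ghost p i S = w i"
 proof
 fix n show "\<exists>S. \<forall>i\<le>n. ghost p i S = w i"
 proof (induction n)
  case 0 show ?case by (rule exI[of _ "%_. w 0"]) simp
 next
  case (Suc n)
  then obtain S where S: "\<And>i. i \<le> n ==> ghost p i S = w i" by auto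
  have "of_nat (p ^ Suc n) dvd of_nat (p ^ i) * ((?f (S i)) ^ p ^ (n - i) - (S i ^ p) ^ p ^ (n - i))"
   if "i \<le> n" for i
  proof -
   have "p ^ Suc n = p ^ i * p ^ Suc (n - i)"
    using that by (simp flip: power_add power_Suc)
   then show ?thesis
    using dvd_power_diff_iter[OF peval_frobenius_dvd[OF p], of "n - i" "S i"]
    by (metis of_nat_mult mult_dvd_mono dvd_refl)
  qed
  then have "of_nat (p ^ Suc n) dvd (\<Sum>i\<le>n. of_nat (p ^ i) * ((?f (S i)) ^ p ^ (n - i) - (S i ^ p) ^ p ^ (n - i)))"
   by (intro dvd_sum) auto
  also have "\<dots> = ?f (ghost p n S) - ghost p n (%i. S i ^ p)"
   unfolding peval_ghost by (simp add: ghost_def right_diff_distrib sum_subtractf)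
  also have "ghost p n S = w n" using S by simp
  finally have "of_nat (p ^ Suc n) dvd w (Suc n) - ghost p n (%i. S i ^ p)"
   using dvd_diff[OF _ w[of n]] by fastforce
  then obtain s where s: "w (Suc n) - ghost p n (%i. S i ^ p) = of_nat (p ^ Suc n) * s"
   by (auto simp: dvd_def)
  define T where "T = S(Suc n := s)"
  have "ghost p i T = w i" if "i \<le> n" for i
   using S[OF that] that by (subst ghost_cong[of i T S]) (auto simp: T_def)
  moreover have "ghost p (Suc n) T = w (Suc n)"
  proof -
   have "ghost p n (%i. T i ^ p) = ghost p n (%i. S i ^ p)"
    by (rule ghost_cong) (auto simp: T_def)
   then show ?thesis unfolding ghost_Suc using s by (simp add: T_def algebra_simps)
  qed
  ultimately have "\<forall>i\<le>Suc n. ghost p i T = w i" by (simp add: le_Suc_eq)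
  then show ?case by blast
 qed
 qed
 \<comment> \<open>The solutions for different n are chosen independently; they agree on common
   indices since the ghost map is injective, so the diagonal is one solution for all n.\<close>
 from choice[OF this] obtain S where "\<forall>n. \<forall>i\<le>n. ghost p i (S n) = w i" ..
 then have S: "ghost p i (S n) = w i" if "i \<le> n" for i n using that by blast
 have t: "torsion_free_ring p TYPE(xypoly)"
  using p prime_gt_0_nat by (intro torsion_free_xypoly) auto
 have *: "S i i = S n i" if "i \<le> n" for n i
  by (rule ghost_inj[OF t, of i]) (use S that in auto)
 have "ghost p n (%i. S i i) = ghost p n (S n)" for n
  by (rule ghost_cong) (rule *)
 then have "\<forall>n. ghost p n (%i. S i i) = w n"
  using S by simp
 then show ?thesis by (rule exI[of _ "%i. S i i"])
qed

lemma frobenius_ghost_vars: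
 "of_nat (p ^ Suc n) dvd peval (%v. pvar v ^ p) (ghost p n (%i. pvar (f i))) - ghost p (Suc n) (%i. pvar (f i))"
 by (simp add: peval_ghost ghost_Suc del: power_Suc of_nat_power)

text \<open>Justifies the definite description in \<open>witt_sum_poly\<close>: Dwork's criterion
  gives a solution, and cancellation of p makes it the only one.\<close>

lemma ghost_witt_sum_poly:
 assumes p: "Factorial_Ring.prime p"
 shows "ghost p n (witt_sum_poly p) = ghost p n (%i. pvar (Inl i)) + ghost p n (%i. pvar (Inr i))"
proof -
 let ?w = "%n. ghost p n (%i. pvar (Inl i)) + ghost p n (%i. pvar (Inr i))"
 have t: "torsion_free_ring p TYPE(xypoly)"
  using p prime_gt_0_nat by (intro torsion_free_xypoly) auto
 have "of_nat (p ^ Suc n) dvd peval (%v. pvar v ^ p) (?w n) - ?w (Suc n)" for n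
  using dvd_add[OF frobenius_ghost_vars[of p n Inl] frobenius_ghost_vars[of p n Inr]]
  unfolding peval_add add_diff_add .
 then obtain S where S: "\<forall>n. ghost p n S = ?w n" using dwork[OF p, of ?w] by blast
 have "\<forall>n. ghost p n (witt_sum_poly p) = ?w n"
  unfolding witt_sum_poly_def
 proof (rule theI[of "%S. \<forall>n. ghost p n S = ?w n", OF S])
  fix T assume T: "\<forall>n. ghost p n T = ?w n"
  show "T = S"
  proof
   fix n show "T n = S n" by (rule ghost_inj[OF t, of n]) (use S T in auto)
  qed
 qed
 then show ?thesis by blast
qed

section \<open>Universal addition and negation of Witt vectors\<close>

definition wadd :: "nat => (nat => 'a::comm_ring_1) => (nat => 'a) => nat => 'a" where
 "wadd p x y n = peval (case_sum x y) (witt_sum_poly p n)"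

text \<open>For p = 2 negation is not componentwise, hence a universal polynomial again; the choice
  is harmless because only the ghost equation is used.\<close>

definition witt_neg_poly :: "nat => nat => xypoly" where
 "witt_neg_poly p = (SOME S. \<forall>n. ghost p n S = - ghost p n (%i. pvar (Inl i)))"

definition wneg :: "nat => (nat => 'a::comm_ring_1) => nat => 'a" where
 "wneg p x n = peval (case_sum x x) (witt_neg_poly p n)"

definition vshift :: "(nat => 'a::zero) => nat => 'a" where
 "vshift x = case_nat 0 x"

lemma vshift_simps [simp]: "vshift x 0 = 0" "vshift x (Suc n) = x n"
 by (simp_all add: vshift_def)

lemma ghost_witt_neg_poly:
 assumes p: "Factorial_Ring.prime p"
 shows "ghost p n (witt_neg_poly p) = - ghost p n (%i. pvar (Inl i))"
proof -
 let ?w = "%n. - ghost p n (%i. pvar (Inl i)) :: xypoly"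
 have "of_nat (p ^ Suc n) dvd peval (%v. pvar v ^ p) (?w n) - ?w (Suc n)" for n
 proof -
  have "of_nat (p ^ Suc n) dvd - (peval (%v. pvar v ^ p) (ghost p n (%i. pvar (Inl i))) - ghost p (Suc n) (%i. pvar (Inl i)))"
   by (subst dvd_minus_iff) (rule frobenius_ghost_vars)
  then show ?thesis unfolding peval_uminus by simp
 qed
 then have "\<exists>S. \<forall>n. ghost p n S = ?w n" by (rule dwork[OF p])
 then have "\<forall>n. ghost p n (witt_neg_poly p) = ?w n"
  unfolding witt_neg_poly_def by (rule someI_ex)
 then show ?thesis by blast
qed

context
 fixes p :: nat
 assumes p: "Factorial_Ring.prime p"
begin

private lemma p0: "p > 0" using prime_gt_0_nat[OF p] .

lemma ghost_wadd: "ghost p n (wadd p x y) = ghost p n x + ghost p n y"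
proof -
 have "ghost p n (wadd p x y) = peval (case_sum x y) (ghost p n (witt_sum_poly p))"
  by (simp add: peval_ghost wadd_def[abs_def])
 then show ?thesis by (simp add: ghost_witt_sum_poly[OF p] peval_add peval_ghost)
qed

lemma ghost_zero: "ghost p n (%_. 0) = 0"
 using p0 by (simp add: ghost_def zero_power)

lemma ghost_ext:
 fixes x y :: "nat => xypoly"
 assumes "\<And>n. ghost p n x = ghost p n y"
 shows "x = y"
proof
 fix n show "x n = y n"
  by (rule ghost_inj[OF torsion_free_xypoly[OF p0], of n]) (use assms in auto)
qed

text \<open>Evaluated at the origin, \<open>S\<close> becomes an integer sequence with vanishing
  ghost components, hence zero. This is the input that \<open>peval_rng_hom\<close> asks for, both
  for sums and for negatives.\<close>

lemma const_free:
 assumes "\<And>n. ghost p n S = ghost p n (%i. pvar (Inl i)) + ghost p n (%i. pvar (Inr i)) \<or>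
  ghost p n S = - ghost p n (%i. pvar (Inl i))"
 shows "Poly_Mapping.lookup (S n) 0 = 0"
proof -
 let ?e = "peval (%_. 0::int)"
 have "ghost p n (%i. ?e (S i)) = ghost p n (%_. 0)" for n
 proof -
  have "ghost p n (%i. ?e (S i)) = ?e (ghost p n S)" by (simp add: peval_ghost)
  also have "\<dots> = 0" using assms[of n]
   by (elim disjE; simp only: peval_add peval_uminus; simp add: peval_ghost ghost_zero)
  finally show ?thesis by (simp add: ghost_zero)
 qed
 then have "?e (S n) = 0"
  by (intro ghost_inj[OF torsion_free_int[OF p0], of n "%i. ?e (S i)" "%_. 0" n]) auto
 then show ?thesis by (simp add: peval_zero)
qed

lemma rng_hom_wadd:
 assumes "subrng R" "rng_hom_on R h" "\<And>i. x i : R" "\<And>i. y i : R"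
 shows "wadd p x y n : R" "h (wadd p x y n) = wadd p (%i. h (x i)) (%i. h (y i)) n"
proof -
 have *: "(%v. h (case_sum x y v)) = case_sum (%i. h (x i)) (%i. h (y i))"
  by (auto split: sum.split)
 have "peval (case_sum x y) (witt_sum_poly p n) : R \<and> h (peval (case_sum x y) (witt_sum_poly p n))
   = peval (%v. h (case_sum x y v)) (witt_sum_poly p n)"
  by (rule peval_rng_hom) (use assms in "auto split: sum.split intro!: const_free simp: ghost_witt_sum_poly[OF p]")
 then show "wadd p x y n : R" "h (wadd p x y n) = wadd p (%i. h (x i)) (%i. h (y i)) n"
  unfolding wadd_def * by auto
qed

lemma wneg_in:
 assumes "subrng R" "\<And>i. x i : R"
 shows "wneg p x n : R"
proof -
 have "peval (case_sum x x) (witt_neg_poly p n) : R \<and> id (peval (case_sum x x) (witt_neg_poly p n))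
   = peval (%v. id (case_sum x x v)) (witt_neg_poly p n)"
  by (rule peval_rng_hom)
   (use assms in "auto split: sum.split intro!: const_free simp: ghost_witt_neg_poly[OF p] rng_hom_on_def")
 then show ?thesis unfolding wneg_def by auto
qed

lemma rng_hom_peval: "rng_hom_on UNIV (peval a)"
 by (simp add: rng_hom_on_def peval_add peval_mult)

lemma peval_wadd: "peval a (wadd p x y n) = wadd p (%i. peval a (x i)) (%i. peval a (y i)) n"
 by (rule rng_hom_wadd[of UNIV]) (auto intro: rng_hom_peval)

text \<open>Setting the variables of index above n to zero leaves the ghost components up to n
  unchanged, so the n-th addition polynomial does not involve them. This is why lists of finite
  length form a group.\<close>

lemma wadd_local:
 assumes "\<And>i. i \<le> n ==> x i = x' i" "\<And>i. i \<le> n ==> y i = y' i"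
 shows "wadd p x y n = wadd p x' y' n"
proof -
 have *: "wadd p x y n = wadd p (%i. if i \<le> n then x i else 0) (%i. if i \<le> n then y i else 0) n"
  for x y :: "nat => 'a"
 proof -
  let ?x = "%i. if i \<le> n then pvar (Inl i) else 0" and ?y = "%i. if i \<le> n then pvar (Inr i) else 0"
  have g: "ghost p i ?x = ghost p i (%i. pvar (Inl i))" "ghost p i ?y = ghost p i (%i. pvar (Inr i))"
   if "i \<le> n" for i
   using that by (auto intro!: ghost_cong)
  have "wadd p ?x ?y n = witt_sum_poly p n"
   by (rule ghost_inj[OF torsion_free_xypoly[OF p0], of n])
    (simp_all add: ghost_wadd ghost_witt_sum_poly[OF p] g)
  then have "wadd p x y n = peval (case_sum x y) (wadd p ?x ?y n)"
   by (simp add: wadd_def[of p x y])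
  also have "\<dots> = wadd p (%i. if i \<le> n then x i else 0) (%i. if i \<le> n then y i else 0) n"
   unfolding peval_wadd by (intro arg_cong2[of _ _ _ _ "%x y. wadd p x y n"] ext) simp_all
  finally show ?thesis .
 qed
 show ?thesis
  by (subst (1 2) *) (intro arg_cong2[of _ _ _ _ "%x y. wadd p x y n"] ext, use assms in auto)
qed

text \<open>Associativity needs three independent vectors, while \<open>xypoly\<close> has two
  families of variables: the even members and the odd members of the first family and the whole
  second family serve as the three.\<close>

definition spec :: "(nat => 'a::comm_ring_1) => (nat => 'a) => (nat => 'a) => nat + nat => 'a" where
 "spec x y z = case_sum (%j. if even j then x (j div 2) else y (j div 2)) z"

private abbreviation (input) "ux \<equiv> %i. pvar (Inl (2 * i))"
private abbreviation (input) "uy \<equiv> %i. pvar (Inl (2 * i + 1))"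
private abbreviation (input) "uz \<equiv> %i. pvar (Inr i)"

lemma spec_vars [simp]:
 "spec x y z (Inl (2 * i)) = x i" "spec x y z (Inl (Suc (2 * i))) = y i" "spec x y z (Inr i) = z i"
 by (simp_all add: spec_def)

lemma wadd_assoc: "wadd p (wadd p x y) z = wadd p x (wadd p y z)"
proof
 fix n
 have u: "wadd p (wadd p ux uy) uz = wadd p ux (wadd p uy uz)"
  by (rule ghost_ext) (simp add: ghost_wadd)
 show "wadd p (wadd p x y) z n = wadd p x (wadd p y z) n"
  using arg_cong[OF fun_cong[OF u, of n], of "peval (spec x y z)"]
  by (simp add: peval_wadd)
qed

lemma wadd_comm: "wadd p x y = wadd p y x"
proof
 fix n
 have u: "wadd p ux uy = wadd p uy ux"
  by (rule ghost_ext) (simp add: ghost_wadd)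
 show "wadd p x y n = wadd p y x n"
  using arg_cong[OF fun_cong[OF u, of n], of "peval (spec x y x)"]
  by (simp add: peval_wadd)
qed

lemma wadd_0_left: "wadd p (%_. 0) x = x"
proof
 fix n
 have u: "wadd p (%_. 0) ux = ux"
  by (rule ghost_ext) (simp add: ghost_wadd ghost_zero)
 show "wadd p (%_. 0) x n = x n"
  using arg_cong[OF fun_cong[OF u, of n], of "peval (spec x x x)"]
  by (simp add: peval_wadd)
qed

lemma wadd_wneg_left: "wadd p (wneg p x) x = (%_. 0)"
proof
 fix n
 have u: "wadd p (witt_neg_poly p) (%i. pvar (Inl i)) = (%_. 0)"
  by (rule ghost_ext) (simp add: ghost_wadd ghost_zero ghost_witt_neg_poly[OF p])
 show "wadd p (wneg p x) x n = 0"
  using arg_cong[OF fun_cong[OF u, of n], of "peval (case_sum x x)"]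
  by (simp add: peval_wadd wneg_def[abs_def])
qed

lemma wadd_first: "wadd p x y 0 = x 0 + y 0"
 using ghost_wadd[of 0 x y] by simp

lemma ghost_vshift: "ghost p (Suc n) (vshift x) = of_nat p * ghost p n x"
 unfolding ghost_def sum.atMost_Suc_shift
 using p0 by (simp add: vshift_def zero_power sum_distrib_left mult.assoc)

lemma peval_vshift: "(%i. peval a (vshift x i)) = vshift (%i. peval a (x i))"
 by (auto simp: vshift_def split: nat.split)

lemma wadd_vshift: "wadd p (vshift x) (vshift y) = vshift (wadd p x y)"
proof
 fix n
 have u: "wadd p (vshift ux) (vshift uy) = vshift (wadd p ux uy)"
 proof (rule ghost_ext)
  fix n show "ghost p n (wadd p (vshift ux) (vshift uy)) = ghost p n (vshift (wadd p ux uy))"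
   by (cases n) (simp_all add: ghost_wadd ghost_vshift wadd_first distrib_left)
 qed
 show "wadd p (vshift x) (vshift y) n = vshift (wadd p x y) n"
  using arg_cong[OF fun_cong[OF u, of n], of "peval (spec x y x)"]
   fun_cong[OF peval_vshift[of "spec x y x" "wadd p ux uy"], of n]
  by (simp add: peval_wadd peval_vshift)
qed

text \<open>The scaling is multiplication by the Teichmueller representative of c: it multiplies
  ghost component n by c^(p^n) and is therefore additive. Its uses are co-monomials and the
  rescaling in Kato's bound.\<close>

lemma wadd_scale:
 "wadd p (%i. c ^ p ^ i * x i) (%i. c ^ p ^ i * y i) n = c ^ p ^ n * wadd p x y n"
proof -
 let ?c = "pvar (Inr 0) :: xypoly"
 have g: "ghost p n (%i. ?c ^ p ^ i * f i) = ?c ^ p ^ n * ghost p n f" for n f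
 proof -
  have "(?c ^ p ^ i * f i) ^ p ^ (n - i) = ?c ^ p ^ n * f i ^ p ^ (n - i)" if "i \<le> n" for i
   using that by (simp add: power_mult_distrib flip: power_mult power_add)
  then show ?thesis unfolding ghost_def by (simp add: sum_distrib_left mult.left_commute)
 qed
 have u: "wadd p (%i. ?c ^ p ^ i * ux i) (%i. ?c ^ p ^ i * uy i) = (%n. ?c ^ p ^ n * wadd p ux uy n)"
  by (rule ghost_ext) (simp only: g ghost_wadd distrib_left)
 show ?thesis
  using arg_cong[OF fun_cong[OF u, of n], of "peval (spec x y (%_. c))"]
  by (simp add: peval_wadd peval_mult peval_power)
qed

text \<open>The identity p = V F in characteristic p. Universally the two sides differ, but their
  ghost components n agree modulo p^(n+1), so the entries agree modulo p, and p is sent to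
  zero.\<close>

lemma wadd_p_multiple:
 fixes x :: "nat => 'a::comm_ring_1"
 assumes "of_nat p = (0::'a)"
 shows "(wadd p x ^^ p) (%_. 0) = vshift (%i. x i ^ p)"
proof
 fix n
 let ?u = "%i. pvar (Inl i) :: xypoly"
 have g: "ghost p n ((wadd p ?u ^^ k) (%_. 0)) = of_nat k * ghost p n ?u" for k n
  by (induction k) (simp_all add: ghost_wadd ghost_zero algebra_simps)
 have d: "of_nat (p ^ Suc n) dvd ghost p n ((wadd p ?u ^^ p) (%_. 0)) - ghost p n (vshift (%i. ?u i ^ p))" for n
 proof (cases n)
  case 0 then show ?thesis unfolding g by (simp add: vshift_def)
 next
  case (Suc m)
  show ?thesis unfolding Suc unfolding g ghost_vshift
   unfolding ghost_Suc unfolding distrib_left add_diff_cancel_left'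
   by (rule dvdI[of _ _ "pvar (Inl (Suc m))"]) (simp add: mult.assoc)
 qed
 have "of_nat p dvd (wadd p ?u ^^ p) (%_. 0) n - vshift (%i. ?u i ^ p) n"
  by (rule ghost_dvd[OF torsion_free_xypoly[OF p0] d])
 then obtain q where q: "(wadd p ?u ^^ p) (%_. 0) n - vshift (%i. ?u i ^ p) n = of_nat p * q"
  by (auto simp: dvd_def)
 let ?e = "peval (case_sum x x)"
 have "(%i. ?e ((wadd p ?u ^^ k) (%_. 0) i)) = (wadd p x ^^ k) (%_. 0)" for k
  by (induction k) (simp_all add: peval_wadd)
 then have "?e ((wadd p ?u ^^ p) (%_. 0) n) = (wadd p x ^^ p) (%_. 0) n" by (rule fun_cong)
 moreover have "?e (vshift (%i. ?u i ^ p) n) = vshift (%i. x i ^ p) n"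
  using fun_cong[OF peval_vshift[of "case_sum x x" "%i. ?u i ^ p"], of n] by (simp add: peval_power)
 moreover have "?e (of_nat p * q) = 0" by (simp add: peval_mult assms)
 ultimately show "(wadd p x ^^ p) (%_. 0) n = vshift (%i. x i ^ p) n"
  using arg_cong[OF q, of ?e] by (simp add: peval_diff)
qed

end

section \<open>Groups of Witt vectors\<close>

text \<open>\<open>wadd\<close> works with sequences and \<open>witt\<close> with lists; by
  \<open>wadd_local\<close> the padding has no influence on the entries in range.\<close>

definition wpad :: "'a::zero list => nat => 'a" where
 "wpad x i = (if i < length x then x ! i else 0)"

definition wlist :: "nat => (nat => 'a) => 'a list" where
 "wlist m f = map f [0..<Suc m]"

lemma wlist_length [simp]: "length (wlist m f) = Suc m"
 by (simp add: wlist_def)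

lemma wlist_nth: "i \<le> m ==> wlist m f ! i = f i"
 by (simp add: wlist_def del: upt_Suc)

lemma wlist_eq_iff: "wlist m f = wlist m g \<longleftrightarrow> (\<forall>i\<le>m. f i = g i)"
 by (auto simp: list_eq_iff_nth_eq wlist_nth less_Suc_eq_le)

lemma wlist_wpad: "length x = Suc m ==> wlist m (wpad x) = x"
 by (rule nth_equalityI) (auto simp: wlist_nth wpad_def)

lemma wlist_Cons: "0 # wlist m f = wlist (Suc m) (vshift f)"
 by (rule nth_equalityI) (auto simp: nth_Cons wlist_nth vshift_def less_Suc_eq_le split: nat.split)

lemma map_wlist: "map h (wlist m f) = wlist m (%i. h (f i))"
 by (simp add: wlist_def)

lemma set_wlist: "set (wlist m f) = f ` {..m}"
 by (simp add: wlist_def atLeast0LessThan lessThan_Suc_atMost del: upt_Suc)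

lemma witt_carrier_iff: "x : carrier (witt p R m) \<longleftrightarrow> length x = Suc m \<and> set x <= R"
 by (simp add: witt_def)

lemma wlist_in: "(\<And>i. i \<le> m ==> f i : R) ==> wlist m f : carrier (witt p R m)"
 by (auto simp: witt_carrier_iff set_wlist)

lemma witt_cases:
 assumes "x : carrier (witt p R m)" "0 : R"
 obtains f where "x = wlist m f" "\<And>i. f i : R"
proof
 show "x = wlist m (wpad x)" using assms by (simp add: wlist_wpad witt_carrier_iff)
 show "wpad x i : R" for i using assms by (auto simp: wpad_def witt_carrier_iff)
qed

lemma witt_one: "\<one>\<^bsub>witt p R m\<^esub> = wlist m (%_. 0)"
 by (simp add: witt_def wlist_def map_replicate_const del: upt_Suc replicate_Suc)

lemma witt_mult_eq: "x \<otimes>\<^bsub>witt p R m\<^esub> y = x \<otimes>\<^bsub>witt p S m\<^esub> y"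
 by (simp add: witt_def)

context
 fixes p :: nat
 assumes p: "Factorial_Ring.prime p"
begin

lemma witt_mult: "wlist m f \<otimes>\<^bsub>witt p R m\<^esub> wlist m g = wlist m (wadd p f g)"
proof -
 have "peval (case_sum ((!) (wlist m f)) ((!) (wlist m g))) (witt_sum_poly p n) = wadd p f g n"
  if "n \<le> m" for n
  unfolding wadd_def[symmetric] by (rule wadd_local[OF p]) (use that in "auto simp: wlist_nth")
 then show ?thesis by (auto simp: witt_def wlist_def[of m "wadd p f g"] simp del: upt_Suc)
qed

lemma comm_group_witt:
 assumes R: "subrng R"
 shows "comm_group (witt p R m)"
proof -
 have R0: "0 : R" using R by (simp add: subrng_def)
 have h: "rng_hom_on R (%x. x)" by (simp add: rng_hom_on_def)
 show ?thesis
 proof (rule comm_groupI)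
  fix x y assume "x : carrier (witt p R m)" "y : carrier (witt p R m)"
  then obtain f g where *: "x = wlist m f" "\<And>i. f i : R" "y = wlist m g" "\<And>i. g i : R"
   using witt_cases[OF _ R0] by metis
  show "x \<otimes>\<^bsub>witt p R m\<^esub> y : carrier (witt p R m)"
   unfolding * witt_mult by (intro wlist_in rng_hom_wadd(1)[OF p R h] *)
  show "x \<otimes>\<^bsub>witt p R m\<^esub> y = y \<otimes>\<^bsub>witt p R m\<^esub> x"
   unfolding * witt_mult by (simp add: wadd_comm[OF p])
  fix z assume "z : carrier (witt p R m)"
  then obtain k where k: "z = wlist m k" using witt_cases[OF _ R0] by metis
  show "x \<otimes>\<^bsub>witt p R m\<^esub> y \<otimes>\<^bsub>witt p R m\<^esub> z = x \<otimes>\<^bsub>witt p R m\<^esub> (y \<otimes>\<^bsub>witt p R m\<^esub> z)"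
   unfolding * k witt_mult by (simp add: wadd_assoc[OF p])
 next
  show "\<one>\<^bsub>witt p R m\<^esub> : carrier (witt p R m)" unfolding witt_one by (rule wlist_in) (rule R0)
 next
  fix x assume "x : carrier (witt p R m)"
  then obtain f where *: "x = wlist m f" "\<And>i. f i : R"
   using witt_cases[OF _ R0] by metis
  show "\<one>\<^bsub>witt p R m\<^esub> \<otimes>\<^bsub>witt p R m\<^esub> x = x"
   unfolding witt_one * witt_mult by (simp add: wadd_0_left[OF p])
  show "\<exists>y\<in>carrier (witt p R m). y \<otimes>\<^bsub>witt p R m\<^esub> x = \<one>\<^bsub>witt p R m\<^esub>"
  proof
   show "wlist m (wneg p f) : carrier (witt p R m)"
    by (intro wlist_in wneg_in[OF p R] *)
   show "wlist m (wneg p f) \<otimes>\<^bsub>witt p R m\<^esub> x = \<one>\<^bsub>witt p R m\<^esub>"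
    unfolding witt_one * witt_mult by (simp add: wadd_wneg_left[OF p])
  qed
 qed
qed

lemma witt_group: "subrng R ==> group (witt p R m)"
 using comm_group_witt comm_group_def by blast

lemma witt_map_hom:
 assumes R: "subrng R" "rng_hom_on R h" "h ` R <= S"
 shows "map h : hom (witt p R m) (witt p S m)"
proof (rule homI)
 have R0: "0 : R" using R by (simp add: subrng_def)
 fix x y assume x: "x : carrier (witt p R m)" then show "map h x : carrier (witt p S m)"
  using R(3) by (auto simp: witt_carrier_iff)
 assume "y : carrier (witt p R m)"
 with x obtain f g where *: "x = wlist m f" "\<And>i. f i : R" "y = wlist m g" "\<And>i. g i : R"
  using witt_cases[OF _ R0] by metis
 show "map h (x \<otimes>\<^bsub>witt p R m\<^esub> y) = map h x \<otimes>\<^bsub>witt p S m\<^esub> map h y"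
  unfolding * witt_mult map_wlist wlist_eq_iff
  by (simp add: rng_hom_wadd(2)[OF p R(1,2)] *)
qed

lemma witt_V_hom:
 assumes R: "subrng R"
 shows "Cons 0 : hom (witt p R m) (witt p R (Suc m))"
proof (rule homI)
 have R0: "0 : R" using R by (simp add: subrng_def)
 fix x y assume x: "x : carrier (witt p R m)" then show "0 # x : carrier (witt p R (Suc m))"
  using R0 by (auto simp: witt_carrier_iff)
 assume "y : carrier (witt p R m)"
 with x obtain f g where *: "x = wlist m f" "\<And>i. f i : R" "y = wlist m g" "\<And>i. g i : R"
  using witt_cases[OF _ R0] by metis
 show "0 # (x \<otimes>\<^bsub>witt p R m\<^esub> y) = (0 # x) \<otimes>\<^bsub>witt p R (Suc m)\<^esub> (0 # y)"
  unfolding * witt_mult wlist_Cons wadd_vshift[OF p] ..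
qed

text \<open>Inductions on the length use this additivity to clear the first entry; the leading zero
  then left is a Verschiebung and can be stripped.\<close>

lemma witt_hd_mult:
 assumes "length x = Suc m" "length y = Suc m"
 shows "hd (x \<otimes>\<^bsub>witt p R m\<^esub> y) = hd x + hd y"
proof -
 have *: "hd (wlist m f) = f 0" for f :: "nat => 'a" by (simp add: hd_conv_nth wlist_nth flip: length_greater_0_conv)
 have "wlist m (wpad x) \<otimes>\<^bsub>witt p R m\<^esub> wlist m (wpad y) = wlist m (wadd p (wpad x) (wpad y))"
  by (rule witt_mult)
 then show ?thesis using assms
  by (simp add: wlist_wpad * wadd_first[OF p] wpad_def hd_conv_nth flip: length_greater_0_conv)
qed

lemma witt_scale_hom:
 assumes R: "subrng R"
 shows "(%x. map (%i. c ^ p ^ i * x ! i) [0..<Suc m]) : hom (witt p R m) (witt p UNIV m)"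
proof (rule homI)
 have R0: "0 : R" using R by (simp add: subrng_def)
 have *: "map (%i. c ^ p ^ i * wlist m f ! i) [0..<Suc m] = wlist m (%i. c ^ p ^ i * f i)" for f
  unfolding wlist_def[of m "%i. c ^ p ^ i * f i"] by (rule map_cong) (auto simp: wlist_nth)
 fix x y assume x: "x : carrier (witt p R m)"
 then show "map (%i. c ^ p ^ i * x ! i) [0..<Suc m] : carrier (witt p UNIV m)"
  by (auto simp: witt_carrier_iff)
 assume "y : carrier (witt p R m)"
 with x obtain f g where f: "x = wlist m f" "\<And>i. f i : R" "y = wlist m g" "\<And>i. g i : R"
  using witt_cases[OF _ R0] by metis
 show "map (%i. c ^ p ^ i * (x \<otimes>\<^bsub>witt p R m\<^esub> y) ! i) [0..<Suc m] =
   map (%i. c ^ p ^ i * x ! i) [0..<Suc m] \<otimes>\<^bsub>witt p UNIV m\<^esub> map (%i. c ^ p ^ i * y ! i) [0..<Suc m]"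
  unfolding f witt_mult * wlist_eq_iff by (simp add: wadd_scale[OF p])
qed

text \<open>This is \<open>wadd_p_multiple\<close> cut back to length m + 1: after the shift the
  last p-th power falls out of range.\<close>

lemma witt_pow_p:
 fixes x :: "'a::comm_ring_1 list"
 assumes "of_nat p = (0::'a)" "length x = Suc m"
 shows "x [^]\<^bsub>witt p R m\<^esub> p = take (Suc m) (0 # witt_frob p x)"
proof -
 have pow: "wlist m f [^]\<^bsub>witt p R m\<^esub> k = wlist m ((wadd p f ^^ k) (%_. 0))" for f :: "nat => 'a" and k :: nat
  by (induction k) (simp_all add: nat_pow_def witt_one witt_mult wadd_comm[OF p])
 have "x [^]\<^bsub>witt p R m\<^esub> p = wlist m (vshift (%i. wpad x i ^ p))"
  using pow[of "wpad x" p] assms by (simp add: wlist_wpad wadd_p_multiple[OF p assms(1)])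
 also have "\<dots> = take (Suc m) (0 # witt_frob p x)"
  by (rule nth_equalityI)
   (use assms in "auto simp: wlist_nth vshift_def witt_frob_def nth_Cons wpad_def less_Suc_eq_le split: nat.split")
 finally show ?thesis .
qed

end

section \<open>Direct limits\<close>

text \<open>Both limits have injective transition maps. Hence equality in the limit can be tested at
  any common level (\<open>rel_iff\<close>), and each group of the system embeds.\<close>

locale inj_dirsys =
 fixes G :: "nat => ('a, 'c) monoid_scheme" and ph :: "nat => 'a => 'a"
 assumes cg: "comm_group (G m)"
  and hm: "ph m : hom (G m) (G (Suc m))"
  and ij: "inj_on (ph m) (carrier (G m))"
begin

lemma grp: "group (G m)" using cg comm_group_def by blast

lemma tr_Suc: "m \<le> N ==> fold ph [m..<Suc N] x = ph N (fold ph [m..<N] x)"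
 by simp

lemma tr_refl [simp]: "fold ph [m..<m] x = x"
 by simp

lemma tr_tr: "m \<le> n ==> n \<le> N ==> fold ph [n..<N] (fold ph [m..<n] x) = fold ph [m..<N] x"
proof (induction N)
 case (Suc N)
 then show ?case by (cases "n = Suc N") (auto simp del: upt_Suc simp: tr_Suc)
qed simp

lemma tr_hom: "m \<le> N ==> fold ph [m..<N] : hom (G m) (G N)"
proof (induction N)
 case 0 then show ?case by (simp add: hom_def Pi_def)
next
 case (Suc N)
 show ?case
 proof (cases "m = Suc N")
  case True then show ?thesis by (simp add: hom_def Pi_def)
 next
  case False
  then have "m \<le> N" using Suc by simp
  then show ?thesis using Group.hom_compose[OF Suc.IH[OF \<open>m \<le> N\<close>] hm[of N]]
   by (simp add: comp_def)
 qed
qed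

lemma tr_closed: "m \<le> N ==> x : carrier (G m) ==> fold ph [m..<N] x : carrier (G N)"
 using tr_hom[of m N] by (auto simp: hom_def Pi_def)

lemma tr_inj: "m \<le> N ==> x : carrier (G m) ==> y : carrier (G m) ==>
  fold ph [m..<N] x = fold ph [m..<N] y \<longleftrightarrow> x = y"
proof (induction N)
 case (Suc N)
 show ?case
 proof (cases "m = Suc N")
  case False
  then have "m \<le> N" using Suc by simp
  then show ?thesis using Suc.IH Suc.prems(2,3) inj_onD[OF ij[of N]] tr_closed[OF \<open>m \<le> N\<close>]
   by (auto simp: tr_Suc simp del: upt_Suc)
 qed simp
qed simp

abbreviation "inj' \<equiv> lim_inj G ph"
abbreviation "L \<equiv> seq_lim G ph"

lemma rel_iff:
 assumes "N \<ge> m" "N \<ge> n" "x : carrier (G m)" "y : carrier (G n)"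
 shows "((m, x), (n, y)) : lim_rel G ph \<longleftrightarrow> fold ph [m..<N] x = fold ph [n..<N] y"
proof
 assume "((m, x), (n, y)) : lim_rel G ph"
 then obtain M where M: "M \<ge> max m n" "fold ph [m..<M] x = fold ph [n..<M] y"
  by (auto simp: lim_rel_def)
 let ?K = "max M N"
 have "fold ph [m..<?K] x = fold ph [n..<?K] y"
  using M tr_tr[of m M ?K x] tr_tr[of n M ?K y] by simp
 then have "fold ph [N..<?K] (fold ph [m..<N] x) = fold ph [N..<?K] (fold ph [n..<N] y)"
  using assms by (simp add: tr_tr)
 then show "fold ph [m..<N] x = fold ph [n..<N] y"
  using assms by (simp add: tr_inj tr_closed)
next
 assume "fold ph [m..<N] x = fold ph [n..<N] y"
 then show "((m, x), (n, y)) : lim_rel G ph" using assms by (auto simp: lim_rel_def)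
qed

lemma rel_equiv: "equiv (SIGMA m:UNIV. carrier (G m)) (lim_rel G ph)"
proof (rule equivI)
 show "refl_on (SIGMA m:UNIV. carrier (G m)) (lim_rel G ph)"
  by (rule refl_onI) (auto simp: lim_rel_def)
 show "sym (lim_rel G ph)" by (rule symI) (force simp: lim_rel_def max.commute)
 show "trans (lim_rel G ph)"
 proof (rule transI, clarify)
  fix a x b y c z
  assume 1: "((a, x), (b, y)) : lim_rel G ph" "((b, y), (c, z)) : lim_rel G ph"
  then have xyz: "x : carrier (G a)" "y : carrier (G b)" "z : carrier (G c)"
   by (auto simp: lim_rel_def)
  let ?N = "max a (max b c)"
  show "((a, x), (c, z)) : lim_rel G ph"
   using 1 xyz rel_iff[of a ?N b x y] rel_iff[of b ?N c y z] rel_iff[of a ?N c x z] by simp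
 qed
 show "lim_rel G ph <= (SIGMA m:UNIV. carrier (G m)) \<times> (SIGMA m:UNIV. carrier (G m))"
  by (auto simp: lim_rel_def)
qed

lemma lim_inj_eq_iff:
 assumes "N \<ge> m" "N \<ge> n" "x : carrier (G m)" "y : carrier (G n)"
 shows "inj' m x = inj' n y \<longleftrightarrow> fold ph [m..<N] x = fold ph [n..<N] y"
 unfolding lim_inj_def rel_iff[OF assms, symmetric]
 by (rule eq_equiv_class_iff[OF rel_equiv]) (use assms in auto)

lemma lim_inj_inj: "x : carrier (G m) ==> y : carrier (G m) ==> inj' m x = inj' m y \<longleftrightarrow> x = y"
 using lim_inj_eq_iff[of m m m x y] by simp

lemma lim_inj_lift: "m \<le> N ==> x : carrier (G m) ==> inj' N (fold ph [m..<N] x) = inj' m x"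
 using lim_inj_eq_iff[of N N m "fold ph [m..<N] x" x] by (simp add: tr_closed)

lemma lim_inj_mem: "(n, y) : inj' m x ==> x : carrier (G m) ==> y : carrier (G n) \<and> inj' n y = inj' m x"
 unfolding lim_inj_def using equiv_class_eq[OF rel_equiv, of "(m, x)" "(n, y)"]
 by (auto simp: lim_rel_def)

lemma lim_inj_self: "x : carrier (G m) ==> (m, x) : inj' m x"
 unfolding lim_inj_def by (rule equiv_class_self[OF rel_equiv]) simp

text \<open>The operations on the limit are unions over all representatives; if every representative
  yields the same class, the union is that class.\<close>

lemma lim_UN:
 assumes "x : carrier (G m)"
  and "\<And>n y. y : carrier (G n) ==> inj' n y = inj' m x ==> F n y = c"
 shows "(\<Union>(n, y)\<in>inj' m x. F n y) = c"
proof -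
 have "F n y = c" if "(n, y) : inj' m x" for n y
  using assms lim_inj_mem[OF that] by blast
 then show ?thesis using lim_inj_self[OF assms(1)] by fast
qed

lemma lim_inj_closed: "x : carrier (G m) ==> inj' m x : carrier L"
 by (auto simp: lim_inj_def seq_lim_def intro!: quotientI)

lemma lim_cases:
 assumes "A : carrier L"
 obtains m x where "x : carrier (G m)" "A = inj' m x"
 using assms by (auto simp: seq_lim_def lim_inj_def elim!: quotientE)

lemma lim_cases_ge:
 assumes "A : carrier L"
 obtains N where "\<And>n. n \<ge> N ==> \<exists>x\<in>carrier (G n). A = inj' n x"
proof -
 obtain m x where x: "x : carrier (G m)" "A = inj' m x" using lim_cases[OF assms] .
 have "\<exists>x\<in>carrier (G n). A = inj' n x" if "n \<ge> m" for n
  using lim_inj_lift[OF that x(1)] tr_closed[OF that x(1)] x(2) by metis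
 then show thesis by (rule that)
qed

lemma lim_cases2:
 assumes "A : carrier L" "B : carrier L"
 obtains m x y where "x : carrier (G m)" "A = inj' m x" "y : carrier (G m)" "B = inj' m y"
proof -
 obtain M N where "\<And>n. n \<ge> M ==> \<exists>x\<in>carrier (G n). A = inj' n x"
  "\<And>n. n \<ge> N ==> \<exists>x\<in>carrier (G n). B = inj' n x"
  using lim_cases_ge[OF assms(1)] lim_cases_ge[OF assms(2)] by metis
 from this(1)[of "max M N"] this(2)[of "max M N"] that show thesis by auto
qed

lemma lim_mult:
 assumes "x : carrier (G m)" "y : carrier (G m)"
 shows "inj' m x \<otimes>\<^bsub>L\<^esub> inj' m y = inj' m (x \<otimes>\<^bsub>G m\<^esub> y)"
proof -
 let ?F = "%m x n y. inj' (max m n) (fold ph [m..<max m n] x \<otimes>\<^bsub>G (max m n)\<^esub> fold ph [n..<max m n] y)"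
 have cl: "a \<otimes>\<^bsub>G i\<^esub> b : carrier (G i)" if "a : carrier (G i)" "b : carrier (G i)" for a b i
  using that grp[of i] by (simp add: group.subgroup_self subgroup.m_closed)
 have F: "?F i a j b = inj' m (x \<otimes>\<^bsub>G m\<^esub> y)"
  if "a : carrier (G i)" "b : carrier (G j)" "inj' i a = inj' m x" "inj' j b = inj' m y" for i a j b
 proof -
  define N where "N = max m (max i j)"
  have N: "m \<le> N" "i \<le> N" "j \<le> N" "max i j \<le> N" by (auto simp: N_def)
  have a: "fold ph [i..<N] a = fold ph [m..<N] x" "fold ph [j..<N] b = fold ph [m..<N] y"
   using that assms lim_inj_eq_iff[of i N m a x] lim_inj_eq_iff[of j N m b y] N by auto
  have "?F i a j b = inj' N (fold ph [max i j..<N] (fold ph [i..<max i j] a \<otimes>\<^bsub>G (max i j)\<^esub> fold ph [j..<max i j] b))"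
   using that N by (intro lim_inj_lift[symmetric] cl tr_closed) auto
  also have "\<dots> = inj' N (fold ph [i..<N] a \<otimes>\<^bsub>G N\<^esub> fold ph [j..<N] b)"
   using that N by (subst hom_mult[OF tr_hom]) (auto intro: tr_closed simp: tr_tr)
  also have "\<dots> = inj' N (fold ph [m..<N] (x \<otimes>\<^bsub>G m\<^esub> y))"
   using assms N by (simp add: a hom_mult[OF tr_hom])
  also have "\<dots> = inj' m (x \<otimes>\<^bsub>G m\<^esub> y)"
   using assms N by (intro lim_inj_lift cl) auto
  finally show ?thesis .
 qed
 have "inj' m x \<otimes>\<^bsub>L\<^esub> inj' m y = (\<Union>(i, a)\<in>inj' m x. \<Union>(j, b)\<in>inj' m y. ?F i a j b)"
  by (simp add: seq_lim_def)
 also have "\<dots> = inj' m (x \<otimes>\<^bsub>G m\<^esub> y)"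
  by (intro lim_UN F assms)
 finally show ?thesis .
qed

lemma lim_one: "\<one>\<^bsub>L\<^esub> = inj' m \<one>\<^bsub>G m\<^esub>"
proof -
 have "inj' m (fold ph [0..<m] \<one>\<^bsub>G 0\<^esub>) = inj' 0 \<one>\<^bsub>G 0\<^esub>"
  by (rule lim_inj_lift) (simp_all add: group.is_monoid[OF grp])
 moreover have "fold ph [0..<m] \<one>\<^bsub>G 0\<^esub> = \<one>\<^bsub>G m\<^esub>"
  using hom_one[OF tr_hom[of 0 m] grp grp] by simp
 ultimately show ?thesis by (simp add: seq_lim_def)
qed

lemma comm_group_lim: "comm_group L"
proof -
 note [simp] = group.is_monoid[OF grp]
 show ?thesis
 proof (rule comm_groupI)
  fix A B assume "A : carrier L" "B : carrier L"
  then obtain m x y where *: "x : carrier (G m)" "A = inj' m x" "y : carrier (G m)" "B = inj' m y"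
   using lim_cases2 by metis
  show "A \<otimes>\<^bsub>L\<^esub> B : carrier L" using * by (simp add: lim_mult lim_inj_closed monoid.m_closed)
  show "A \<otimes>\<^bsub>L\<^esub> B = B \<otimes>\<^bsub>L\<^esub> A"
   using * comm_monoid.m_comm[OF comm_group.axioms(1)[OF cg[of m]]] by (simp add: lim_mult)
 next
  fix A B C assume a: "A : carrier L" "B : carrier L" "C : carrier L"
  obtain N1 N2 N3 where N: "\<And>n. n \<ge> N1 ==> \<exists>x\<in>carrier (G n). A = inj' n x"
   "\<And>n. n \<ge> N2 ==> \<exists>x\<in>carrier (G n). B = inj' n x" "\<And>n. n \<ge> N3 ==> \<exists>x\<in>carrier (G n). C = inj' n x"
   using a lim_cases_ge by metis
  define m where "m = max N1 (max N2 N3)"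
  have "\<exists>x\<in>carrier (G m). A = inj' m x" "\<exists>x\<in>carrier (G m). B = inj' m x" "\<exists>x\<in>carrier (G m). C = inj' m x"
   by (rule N; simp add: m_def)+
  then obtain x y z where *: "x : carrier (G m)" "A = inj' m x" "y : carrier (G m)" "B = inj' m y"
   "z : carrier (G m)" "C = inj' m z"
   by blast
  then show "A \<otimes>\<^bsub>L\<^esub> B \<otimes>\<^bsub>L\<^esub> C = A \<otimes>\<^bsub>L\<^esub> (B \<otimes>\<^bsub>L\<^esub> C)"
   by (simp add: lim_mult monoid.m_closed monoid.m_assoc)
 next
  show "\<one>\<^bsub>L\<^esub> : carrier L" by (simp add: lim_one[of 0] lim_inj_closed)
 next
  fix A assume "A : carrier L"
  then obtain m x where *: "x : carrier (G m)" "A = inj' m x" using lim_cases by metis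
  then show "\<one>\<^bsub>L\<^esub> \<otimes>\<^bsub>L\<^esub> A = A" by (simp add: lim_one[of m] lim_mult)
  have "inv\<^bsub>G m\<^esub> x : carrier (G m)" "inv\<^bsub>G m\<^esub> x \<otimes>\<^bsub>G m\<^esub> x = \<one>\<^bsub>G m\<^esub>"
   using * grp by (auto intro: group.inv_closed group.l_inv)
  then show "\<exists>B\<in>carrier L. B \<otimes>\<^bsub>L\<^esub> A = \<one>\<^bsub>L\<^esub>"
   using * by (intro bexI[of _ "inj' m (inv\<^bsub>G m\<^esub> x)"]) (simp_all add: lim_mult lim_inj_closed lim_one[of m])
 qed
qed

lemma lim_inj_hom: "inj' m : hom (G m) L"
 by (rule homI) (simp_all add: lim_inj_closed lim_mult)

lemma lim_inj_Suc: "x : carrier (G m) ==> inj' (Suc m) (ph m x) = inj' m x"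
 using lim_inj_lift[of m "Suc m" x] by simp

lemma lim_common_level:
 assumes "finite I" "\<And>i. i : I ==> A i : carrier L"
 shows "\<exists>N. \<forall>n\<ge>N. \<forall>i\<in>I. \<exists>x\<in>carrier (G n). A i = inj' n x"
 using assms
proof (induction I)
 case (insert a I)
 then obtain N1 N2 where "\<forall>n\<ge>N1. \<forall>i\<in>I. \<exists>x\<in>carrier (G n). A i = inj' n x"
  "\<And>n. n \<ge> N2 ==> \<exists>x\<in>carrier (G n). A a = inj' n x"
  using lim_cases_ge[of "A a"] by (metis insertCI)
 then show ?case by (intro exI[of _ "max N1 N2"]) auto
qed simp

end

section \<open>Maps induced on quotients\<close>

lemma quot_map_coset:
 assumes "group_hom G H f" "subgroup N G" "\<And>x. x : N ==> f x = \<one>\<^bsub>H\<^esub>" "x : carrier G"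
 shows "quot_map f (N #>\<^bsub>G\<^esub> x) = f x"
proof -
 interpret group_hom G H f by fact
 have "f (n \<otimes>\<^bsub>G\<^esub> x) = f x" if "n : N" for n
  using that assms(3)[OF that] assms(4) subgroup.mem_carrier[OF assms(2) that] by simp
 then have eq: "f y = f x" if "y : N #>\<^bsub>G\<^esub> x" for y
  using that by (auto simp: r_coset_def)
 have "x : N #>\<^bsub>G\<^esub> x" by (rule G.rcos_self) fact+
 then have ne: "N #>\<^bsub>G\<^esub> x ~= {}" by blast
 show ?thesis unfolding quot_map_def by (rule the_elem_image_unique[OF ne eq])
qed

lemma induces_isoI:
 assumes f: "group_hom G H f" and onto: "f ` carrier G = carrier H" and N: "kernel G H f = N"
 shows "induces_iso G N H f"
proof -
 interpret group_hom G H f by fact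
 have "quot_map f : iso (G Mod N) H"
  using FactGroup_iso_set[OF onto] unfolding N quot_map_def[abs_def] .
 moreover have "normal N G" using normal_kernel unfolding N .
 moreover have "\<forall>x\<in>N. f x = \<one>\<^bsub>H\<^esub>" unfolding N[symmetric] by (simp add: kernel_def)
 moreover have "group (G Mod N)" by (rule normal.factorgroup_is_group) fact
 ultimately show ?thesis unfolding induces_iso_def group_iso_def using f H.is_group by blast
qed

lemma comm_group_group: "comm_group G ==> group G"
 by (simp add: comm_group_def)

section \<open>Witt co-vectors\<close>

lemma rng_hom_on_power:
 assumes "subrng R" "rng_hom_on R h" "x : R" "n > 0"
 shows "x ^ n : R" "h (x ^ n) = h x ^ n"
proof -
 have "x ^ n : R \<and> h (x ^ n) = h x ^ n"
  using assms(4)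
  by (induction n rule: nat_induct_non_zero)
   (use assms in "auto simp: subrng_def rng_hom_on_def")
 then show "x ^ n : R" "h (x ^ n) = h x ^ n" by auto
qed

context
 fixes p :: nat
 assumes p: "Factorial_Ring.prime p"
begin

lemma dirsys_V:
 assumes "subrng R"
 shows "inj_dirsys (witt p R) (%_. Cons 0)"
proof (rule inj_dirsys.intro)
 show "comm_group (witt p R m)" for m by (rule comm_group_witt[OF p assms])
 show "Cons 0 : hom (witt p R m) (witt p R (Suc m))" for m by (rule witt_V_hom[OF p assms])
 show "inj_on (Cons 0) (carrier (witt p R m))" for m by (simp add: inj_on_def)
qed

lemmas comm_group_cw = inj_dirsys.comm_group_lim[OF dirsys_V, folded cw_def]
lemmas cw_group = comm_group_cw[THEN comm_group_group]
lemmas cw_inj_closed = inj_dirsys.lim_inj_closed[OF dirsys_V, folded cw_def cw_inj_def]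
lemmas cw_inj_inj = inj_dirsys.lim_inj_inj[OF dirsys_V, folded cw_def cw_inj_def]
lemmas cw_inj_mult = inj_dirsys.lim_mult[OF dirsys_V, folded cw_def cw_inj_def]
lemmas cw_one = inj_dirsys.lim_one[OF dirsys_V, folded cw_def cw_inj_def]
lemmas cw_inj_Suc = inj_dirsys.lim_inj_Suc[OF dirsys_V, folded cw_def cw_inj_def]
lemmas cw_inj_hom = inj_dirsys.lim_inj_hom[OF dirsys_V, folded cw_def cw_inj_def]
lemmas cw_cases = inj_dirsys.lim_cases[OF dirsys_V, folded cw_def cw_inj_def]
lemmas cw_cases_ge = inj_dirsys.lim_cases_ge[OF dirsys_V, folded cw_def cw_inj_def]
lemmas cw_cases2 = inj_dirsys.lim_cases2[OF dirsys_V, folded cw_def cw_inj_def]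
lemmas cw_inj_mem = inj_dirsys.lim_inj_mem[OF dirsys_V, folded cw_def cw_inj_def]
lemmas cw_inj_self = inj_dirsys.lim_inj_self[OF dirsys_V, folded cw_def cw_inj_def]

lemma cw_inj_group_hom: "subrng R ==> group_hom (witt p R m) (cw p R) (cw_inj p R m)"
 by (simp add: group_hom_def group_hom_axioms_def cw_inj_hom cw_group witt_group[OF p])

text \<open>The union in \<open>cw_map\<close> runs over all representatives. It is a single class
  because \<open>h 0 = 0\<close>, so that applying \<open>h\<close> entrywise commutes with the
  Verschiebung.\<close>

lemma cw_map_inj:
 assumes R: "subrng R" "rng_hom_on R h" "h ` R <= S" and S: "subrng S" and x: "x : carrier (witt p R m)"
 shows "cw_map p S h (cw_inj p R m x) = cw_inj p S m (map h x)"
proof -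
 interpret R: inj_dirsys "witt p R" "%_. Cons 0" by (rule dirsys_V[OF R(1)])
 interpret S: inj_dirsys "witt p S" "%_. Cons 0" by (rule dirsys_V[OF S])
 have h0: "h 0 = 0" by (rule rng_hom_on_0[OF R(1,2)])
 have f: "map h (fold (%_. Cons 0) l y) = fold (%_. Cons 0) l (map h y)" for l :: "nat list" and y
  by (induction l arbitrary: y) (auto simp: h0)
 have m: "map h y : carrier (witt p S n)" if "y : carrier (witt p R n)" for y n
  using that R(3) by (auto simp: witt_carrier_iff)
 show ?thesis unfolding cw_map_def cw_inj_def
 proof (rule R.lim_UN[OF x])
  fix n y assume y: "y : carrier (witt p R n)" "R.inj' n y = R.inj' m x"
  let ?N = "max m n"
  have "fold (%_. Cons 0) [n..<?N] y = fold (%_. Cons 0) [m..<?N] x"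
   using y x R.lim_inj_eq_iff[of n ?N m y x] by simp
  then have "map h (fold (%_. Cons 0) [n..<?N] y) = map h (fold (%_. Cons 0) [m..<?N] x)"
   by (rule arg_cong)
  then show "S.inj' n (map h y) = S.inj' m (map h x)"
   unfolding f using S.lim_inj_eq_iff[of n ?N m "map h y" "map h x"] m y x by simp
 qed
qed

lemma cw_map_hom:
 assumes R: "subrng R" "rng_hom_on R h" "h ` R <= S" and S: "subrng S"
 shows "cw_map p S h : hom (cw p R) (cw p S)"
proof (rule homI)
 note mh = witt_map_hom[OF p R]
 fix f g assume f: "f : carrier (cw p R)"
 then show "cw_map p S h f : carrier (cw p S)"
  by (elim cw_cases[OF R(1)]) (use mh in "auto simp: cw_map_inj[OF R S] hom_def Pi_def intro!: cw_inj_closed[OF S]")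
 assume "g : carrier (cw p R)"
 with f obtain m x y where *: "x : carrier (witt p R m)" "f = cw_inj p R m x"
  "y : carrier (witt p R m)" "g = cw_inj p R m y" using cw_cases2[OF R(1)] by metis
 have c: "x \<otimes>\<^bsub>witt p R m\<^esub> y : carrier (witt p R m)"
  using * witt_group[OF p R(1), of m] by (simp add: group.is_monoid monoid.m_closed)
 have d: "map h z : carrier (witt p S m)" if "z : carrier (witt p R m)" for z
  using that mh by (auto simp: hom_def)
 show "cw_map p S h (f \<otimes>\<^bsub>cw p R\<^esub> g) = cw_map p S h f \<otimes>\<^bsub>cw p S\<^esub> cw_map p S h g"
  using * c d hom_mult[OF mh *(1,3)] by (simp add: cw_inj_mult[OF R(1)] cw_inj_mult[OF S] cw_map_inj[OF R S])
qed

lemma cw_map_group_hom: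
 assumes R: "subrng R" "rng_hom_on R h" "h ` R <= S" and S: "subrng S"
 shows "group_hom (cw p R) (cw p S) (cw_map p S h)"
 by (simp add: group_hom_def group_hom_axioms_def cw_map_hom[OF R S] cw_group[OF R(1)] cw_group[OF S])

lemma cw_map_inj_on:
 assumes R: "subrng R" "rng_hom_on R h" "h ` R <= S" and S: "subrng S" and i: "inj_on h R"
 shows "inj_on (cw_map p S h) (carrier (cw p R))"
proof (rule inj_onI)
 fix f g assume f: "f : carrier (cw p R)" "g : carrier (cw p R)" and e: "cw_map p S h f = cw_map p S h g"
 from f obtain m x y where *: "x : carrier (witt p R m)" "f = cw_inj p R m x"
  "y : carrier (witt p R m)" "g = cw_inj p R m y" using cw_cases2[OF R(1)] by metis
 have d: "map h z : carrier (witt p S m)" if "z : carrier (witt p R m)" for z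
  using that witt_map_hom[OF p R] by (auto simp: hom_def)
 have "map h x = map h y" using e * d by (simp add: cw_map_inj[OF R S] cw_inj_inj[OF S])
 moreover have "inj_on h (set x \<union> set y)" using * by (intro inj_on_subset[OF i]) (auto simp: witt_carrier_iff)
 ultimately have "x = y" by (simp add: inj_on_map_eq_map)
 then show "f = g" using * by simp
qed

lemma cw_map_comp:
 assumes R: "subrng R" "rng_hom_on R h" "h ` R <= S" and S: "subrng S" "rng_hom_on S g" "g ` S <= Q" and Q: "subrng Q"
  and f: "f : carrier (cw p R)"
 shows "cw_map p Q g (cw_map p S h f) = cw_map p Q (%x. g (h x)) f"
proof -
 obtain m x where x: "x : carrier (witt p R m)" "f = cw_inj p R m x" using cw_cases[OF R(1) f] .
 have hS: "h x : S" if "x : R" for x using R(3)[unfolded image_subset_iff] that by simp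
 have "rng_hom_on R (%x. g (h x))"
  unfolding rng_hom_on_def using hS R(2)[unfolded rng_hom_on_def] S(2)[unfolded rng_hom_on_def] by simp
 moreover have "(%x. g (h x)) ` R <= Q" using hS S(3) by blast
 moreover have "map h x : carrier (witt p S m)" using witt_map_hom[OF p R] x by (auto simp: hom_def)
 ultimately show ?thesis using x R(1)
  by (simp add: cw_map_inj[OF R S(1)] cw_map_inj[OF S Q] cw_map_inj[OF R(1) _ _ Q] comp_def)
qed

lemma cw_map_cong:
 assumes "subrng R" "f : carrier (cw p R)" "\<And>x. x : R ==> h x = g x"
 shows "cw_map p S h f = cw_map p S g f"
proof -
 have "cw_inj p S n (map h y) = cw_inj p S n (map g y)" if "(n, y) : f" for n y
 proof -
  obtain m x where x: "x : carrier (witt p R m)" and f: "f = cw_inj p R m x"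
   using cw_cases[OF assms(1,2)] .
  have "y : carrier (witt p R n)" using cw_inj_mem[OF assms(1) that[unfolded f] x] by blast
  then have "set y <= R" by (simp add: witt_carrier_iff)
  then have "map h y = map g y" using assms(3) by auto
  then show ?thesis by (rule arg_cong)
 qed
 then show ?thesis unfolding cw_map_def by (auto intro!: SUP_cong)
qed

section \<open>Frobenius minus one on co-vectors\<close>

definition frob_minus_one :: "'a::comm_ring_1 set => 'a covec => 'a covec" where
 "frob_minus_one R f = cw_map p R (%x. x ^ p) f \<otimes>\<^bsub>cw p R\<^esub> inv\<^bsub>cw p R\<^esub> f"

lemma cw_wp_eq: "cw_wp p R = frob_minus_one R ` carrier (cw p R)"
 by (simp add: cw_wp_def frob_minus_one_def)

lemma rng_hom_frob: "CHAR('a::comm_ring_1) = p ==> rng_hom_on R (\<lambda>x::'a. x ^ p)"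
 using p by (simp add: rng_hom_on_def freshmans_dream power_mult_distrib)

context
 fixes R :: "'a::comm_ring_1 set"
 assumes R: "subrng R" and ch: "CHAR('a) = p"
begin

lemma frob_closed: "(\<lambda>x::'a. x ^ p) ` R <= R"
 using rng_hom_on_power(1)[OF R rng_hom_frob[OF ch]] prime_gt_0_nat[OF p] by auto

lemmas frob_group_hom = cw_map_group_hom[OF R rng_hom_frob[OF ch] frob_closed R]
lemmas frob_inj = cw_map_inj[OF R rng_hom_frob[OF ch] frob_closed R]

lemma frob_minus_one_hom: "frob_minus_one R : hom (cw p R) (cw p R)"
proof (rule homI)
 interpret C: comm_group "cw p R" by (rule comm_group_cw[OF R])
 interpret F: group_hom "cw p R" "cw p R" "cw_map p R (%x. x ^ p)" by (rule frob_group_hom)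
 fix f g assume f: "f : carrier (cw p R)" then show "frob_minus_one R f : carrier (cw p R)"
  by (simp add: frob_minus_one_def)
 assume "g : carrier (cw p R)"
 with f show "frob_minus_one R (f \<otimes>\<^bsub>cw p R\<^esub> g) = frob_minus_one R f \<otimes>\<^bsub>cw p R\<^esub> frob_minus_one R g"
  unfolding frob_minus_one_def by (simp add: C.inv_mult C.m_ac)
qed

lemma frob_minus_one_group_hom: "group_hom (cw p R) (cw p R) (frob_minus_one R)"
 by (simp add: group_hom_def group_hom_axioms_def frob_minus_one_hom cw_group[OF R])

lemma subgroup_cw_wp: "subgroup (cw_wp p R) (cw p R)"
 unfolding cw_wp_eq using group_hom.img_is_subgroup[OF frob_minus_one_group_hom] .

lemma normal_cw_wp: "normal (cw_wp p R) (cw p R)"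
 by (rule comm_group.subgroup_imp_normal[OF comm_group_cw[OF R] subgroup_cw_wp])

lemma frob_minus_one_inj:
 assumes x: "x : carrier (witt p R m)"
 shows "frob_minus_one R (cw_inj p R m x) = cw_inj p R m (witt_frob p x \<otimes>\<^bsub>witt p R m\<^esub> inv\<^bsub>witt p R m\<^esub> x)"
proof -
 interpret I: group_hom "witt p R m" "cw p R" "cw_inj p R m" by (rule cw_inj_group_hom[OF R])
 have "map (%x. x ^ p) x : carrier (witt p R m)"
  using witt_map_hom[OF p R rng_hom_frob[OF ch] frob_closed] x by (auto simp: hom_def)
 then show ?thesis unfolding frob_minus_one_def using x by (simp add: frob_inj witt_frob_def)
qed

lemma frob_eq_iff:
 assumes f: "f : carrier (cw p R)" and c: "c : carrier (cw p R)"
 shows "frob_minus_one R f = c \<longleftrightarrow> cw_map p R (%x. x ^ p) f = c \<otimes>\<^bsub>cw p R\<^esub> f"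
proof -
 interpret C: comm_group "cw p R" by (rule comm_group_cw[OF R])
 interpret F: group_hom "cw p R" "cw p R" "cw_map p R (%x. x ^ p)" by (rule frob_group_hom)
 show ?thesis unfolding frob_minus_one_def using f c
  by (metis C.inv_solve_right F.hom_closed)
qed

text \<open>Induction on the length: the scalar equation is solved for the first entry, its
  contribution is subtracted, and the remainder begins with zero, so in the limit it comes from a
  shorter vector. The two uses are the separable closure and t k[[t]].\<close>

lemma cw_wp_surj:
 assumes s: "\<And>c. c : R ==> \<exists>x\<in>R. x ^ p - x = c"
 shows "cw_wp p R = carrier (cw p R)"
proof
 interpret C: comm_group "cw p R" by (rule comm_group_cw[OF R])
 have R0: "0 : R" using R by (simp add: subrng_def)
 show "cw_wp p R <= carrier (cw p R)" by (rule subgroup.subset[OF subgroup_cw_wp])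
 have step: "cw_inj p R m y : cw_wp p R" if y: "y : carrier (witt p R m)"
  and IH: "\<And>n w. m = Suc n ==> w : carrier (witt p R n) ==> cw_inj p R n w : cw_wp p R" for m y
 proof -
  interpret W: comm_group "witt p R m" by (rule comm_group_witt[OF p R])
  interpret I: group_hom "witt p R m" "cw p R" "cw_inj p R m" by (rule cw_inj_group_hom[OF R])
  have len: "length z = Suc m" if "z : carrier (witt p R m)" for z using that by (simp add: witt_carrier_iff)
  have hd_mult: "hd (a \<otimes>\<^bsub>witt p R m\<^esub> b) = hd a + hd b" if "a : carrier (witt p R m)" "b : carrier (witt p R m)" for a b
   by (rule witt_hd_mult[OF p]) (use that len in auto)
  have hd_inv: "hd (inv\<^bsub>witt p R m\<^esub> a) = - hd a" if "a : carrier (witt p R m)" for a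
  proof -
   have "hd (inv\<^bsub>witt p R m\<^esub> a \<otimes>\<^bsub>witt p R m\<^esub> a) = hd \<one>\<^bsub>witt p R m\<^esub>" using that by simp
   also have "\<dots> = 0" by (simp add: witt_def)
   finally have "hd (inv\<^bsub>witt p R m\<^esub> a \<otimes>\<^bsub>witt p R m\<^esub> a) = 0" .
   then show ?thesis unfolding hd_mult[OF W.inv_closed[OF that] that] by (simp add: eq_neg_iff_add_eq_0)
  qed
  have "hd y : R" using y by (cases y) (auto simp: witt_carrier_iff)
  then obtain x where x: "x : R" "x ^ p - x = hd y" using s by blast
  \<comment> \<open>Only the first entry of z is aimed at; whatever z contributes to the later
    entries is absorbed in w.\<close>
  define z where "z = x # replicate m 0"
  have z: "z : carrier (witt p R m)" using x R0 by (auto simp: z_def witt_carrier_iff)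
  have Fz: "witt_frob p z : carrier (witt p R m)"
   using witt_map_hom[OF p R rng_hom_frob[OF ch] frob_closed] z by (auto simp: hom_def witt_frob_def)
  define w where "w = y \<otimes>\<^bsub>witt p R m\<^esub> inv\<^bsub>witt p R m\<^esub> (witt_frob p z \<otimes>\<^bsub>witt p R m\<^esub> inv\<^bsub>witt p R m\<^esub> z)"
  have w: "w : carrier (witt p R m)" using y z Fz by (simp add: w_def)
  have "hd w = 0" unfolding w_def using y z Fz by (simp add: hd_mult hd_inv) (simp add: z_def witt_frob_def x(2)[symmetric])
  then obtain w' where w': "w = 0 # w'" using len[OF w] by (cases w) auto
  have yw: "cw_inj p R m y = cw_inj p R m w \<otimes>\<^bsub>cw p R\<^esub> frob_minus_one R (cw_inj p R m z)"
   unfolding frob_minus_one_inj[OF z] w_def using y z Fz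
   by (subst I.hom_mult[symmetric]) (simp_all add: W.m_assoc W.l_inv)
  have fz: "frob_minus_one R (cw_inj p R m z) : cw_wp p R"
   unfolding cw_wp_eq using z by (intro imageI cw_inj_closed[OF R])
  have red: "cw_inj p R m y : cw_wp p R" if "cw_inj p R m w : cw_wp p R"
   unfolding yw by (rule subgroup.m_closed[OF subgroup_cw_wp that fz])
  show ?thesis
  proof (cases m)
   case 0
   then have "w = \<one>\<^bsub>witt p R m\<^esub>" using w w' by (auto simp: witt_carrier_iff witt_one wlist_def)
   then show ?thesis using red subgroup.one_closed[OF subgroup_cw_wp] by simp
  next
   case (Suc n)
   have "w' : carrier (witt p R n)" using w w' Suc by (auto simp: witt_carrier_iff)
   then show ?thesis using red Suc w' IH by (simp add: cw_inj_Suc[OF R])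
  qed
 qed
 have "cw_inj p R m y : cw_wp p R" if "y : carrier (witt p R m)" for m y
  using that by (induction m arbitrary: y) (auto intro: step)
 then show "carrier (cw p R) <= cw_wp p R" by (auto elim: cw_cases[OF R])
qed

text \<open>Since \<^term>\<open>p = V F\<close> and \<^term>\<open>V\<close> is invisible in the limit, Frobenius lifts are divisible by \<^term>\<open>p\<close>.\<close>

lemma frob_is_p_power:
 assumes f: "f : carrier (cw p R)"
 shows "\<exists>g\<in>carrier (cw p R). g [^]\<^bsub>cw p R\<^esub> p = cw_map p R (%x. x ^ p) f"
proof -
 obtain m x where x: "x : carrier (witt p R m)" "f = cw_inj p R m x" using cw_cases[OF R f] .
 have R0: "0 : R" using R by (simp add: subrng_def)
 \<comment> \<open>Multiplication by p shifts the entries and discards the last one, so any entry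
   may be appended; the shift itself is then undone by the limit.\<close>
 have y: "x @ [0] : carrier (witt p R (Suc m))" using x R0 by (auto simp: witt_carrier_iff)
 interpret I: group_hom "witt p R (Suc m)" "cw p R" "cw_inj p R (Suc m)" by (rule cw_inj_group_hom[OF R])
 have "(x @ [0]) [^]\<^bsub>witt p R (Suc m)\<^esub> p = 0 # witt_frob p x"
  by (subst witt_pow_p[OF p]) (use ch x in "auto simp: witt_carrier_iff witt_frob_def")
 then have "cw_inj p R (Suc m) (x @ [0]) [^]\<^bsub>cw p R\<^esub> p = cw_inj p R (Suc m) (0 # witt_frob p x)"
  using I.hom_nat_pow[OF y, of p] by simp
 also have "\<dots> = cw_inj p R m (witt_frob p x)"
  by (rule cw_inj_Suc[OF R])
   (use witt_map_hom[OF p R rng_hom_frob[OF ch] frob_closed] x in "auto simp: hom_def witt_frob_def")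
 also have "\<dots> = cw_map p R (%x. x ^ p) f" using x by (simp add: frob_inj witt_frob_def)
 finally show ?thesis using cw_inj_closed[OF R y] by blast
qed

end

text \<open>Ring homomorphisms commute with p-th powers. This transports solutions and the image of
  F - 1 between rings, in particular from k and from t k[[t]] to k((t)).\<close>

lemma cw_map_frob_minus_one:
 fixes R :: "'a::comm_ring_1 set" and S :: "'b::comm_ring_1 set"
 assumes R: "subrng R" "rng_hom_on R h" "h ` R <= S" and S: "subrng S"
  and ch: "CHAR('a) = p" "CHAR('b) = p" and f: "f : carrier (cw p R)"
 shows "cw_map p S h (frob_minus_one R f) = frob_minus_one S (cw_map p S h f)"
proof -
 interpret H: group_hom "cw p R" "cw p S" "cw_map p S h" by (rule cw_map_group_hom[OF R S])
 interpret F: group_hom "cw p R" "cw p R" "cw_map p R (%x. x ^ p)" by (rule frob_group_hom[OF R(1) ch(1)])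
 have "cw_map p S h (cw_map p R (%x. x ^ p) f) = cw_map p S (%x. x ^ p) (cw_map p S h f)"
  unfolding cw_map_comp[OF R(1) rng_hom_frob[OF ch(1)] frob_closed[OF R(1) ch(1)] R S f]
   cw_map_comp[OF R S rng_hom_frob[OF ch(2)] frob_closed[OF S ch(2)] S f]
  by (rule cw_map_cong[OF R(1) f])
   (use rng_hom_on_power(2)[OF R(1,2)] prime_gt_0_nat[OF p] in auto)
 then show ?thesis unfolding frob_minus_one_def using f by simp
qed

lemma cw_map_cw_wp:
 fixes R :: "'a::comm_ring_1 set" and S :: "'b::comm_ring_1 set"
 assumes R: "subrng R" "rng_hom_on R h" "h ` R <= S" and S: "subrng S"
  and ch: "CHAR('a) = p" "CHAR('b) = p" and f: "f : cw_wp p R"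
 shows "cw_map p S h f : cw_wp p S"
 using f cw_map_hom[OF R S] unfolding cw_wp_eq
 by (auto simp: cw_map_frob_minus_one[OF R S ch] hom_def)

text \<open>Frobenius of a field is injective, perfect or not, so the system along V F has injective
  transition maps like the one along V.\<close>

lemma dirsys_VF:
 assumes ch: "CHAR('a::field) = p"
 shows "inj_dirsys (witt p (UNIV::'a set)) (%_ x. 0 # witt_frob p x)"
proof (rule inj_dirsys.intro)
 show "comm_group (witt p (UNIV::'a set) m)" for m by (rule comm_group_witt[OF p subrng_UNIV])
 have F: "witt_frob p : hom (witt p (UNIV::'a set) m) (witt p UNIV m)" for m
  unfolding witt_frob_def[abs_def] by (rule witt_map_hom[OF p subrng_UNIV rng_hom_frob[OF ch]]) simp
 show "(%x. 0 # witt_frob p x) : hom (witt p (UNIV::'a set) m) (witt p UNIV (Suc m))" for m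
  using Group.hom_compose[OF F witt_V_hom[OF p subrng_UNIV]] by (simp add: comp_def)
 have "inj (\<lambda>x::'a. x ^ p)"
 proof (rule injI)
  fix x y :: 'a assume xy: "x ^ p = y ^ p"
  have "(x - y + y) ^ p = (x - y) ^ p + y ^ p"
   by (rule freshmans_dream) (use p ch in auto)
  then have "(x - y) ^ p = 0" by (simp add: xy)
  then show "x = y" by simp
 qed
 then show "inj_on (%x. 0 # witt_frob p x) (carrier (witt p (UNIV::'a set) m))" for m
  by (auto intro!: inj_onI simp: witt_frob_def)
qed

lemmas comm_group_cwt = inj_dirsys.comm_group_lim[OF dirsys_VF, folded cwt_def]
lemmas cwt_inj_closed = inj_dirsys.lim_inj_closed[OF dirsys_VF, folded cwt_def cwt_inj_def]
lemmas cwt_inj_inj = inj_dirsys.lim_inj_inj[OF dirsys_VF, folded cwt_def cwt_inj_def]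
lemmas cwt_one = inj_dirsys.lim_one[OF dirsys_VF, folded cwt_def cwt_inj_def]
lemmas cwt_inj_Suc = inj_dirsys.lim_inj_Suc[OF dirsys_VF, folded cwt_def cwt_inj_def]
lemmas cwt_inj_hom = inj_dirsys.lim_inj_hom[OF dirsys_VF, folded cwt_def cwt_inj_def]
lemmas cwt_cases = inj_dirsys.lim_cases[OF dirsys_VF, folded cwt_def cwt_inj_def]

lemma cwt_inj_group_hom: "CHAR('a::field) = p ==> group_hom (witt p (UNIV::'a set) m) (cwt p UNIV) (cwt_inj p UNIV m)"
 by (simp add: group_hom_def group_hom_axioms_def cwt_inj_hom comm_group_cwt comm_group_group witt_group[OF p])

end

section \<open>The separable closure\<close>

text \<open>Linear algebra over the base field inside its algebraic closure; dimensions of finitely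
  generated subalgebras take the place of degrees of extensions.\<close>

interpretation acl: vector_space "\<lambda>(c::'a::field) x. to_ac c * x"
 by unfold_locales (simp_all add: algebra_simps)

definition aev :: "'a::field poly => 'a alg_closure => 'a alg_closure" where
 "aev f x = poly (map_poly to_ac f) x"

lemma aev_add: "aev (f + g) x = aev f x + aev g x"
proof -
 have "map_poly to_ac (f + g) = map_poly to_ac f + map_poly to_ac g"
  by (rule poly_eqI) (simp add: coeff_map_poly)
 then show ?thesis by (simp add: aev_def)
qed

lemma aev_mult: "aev (f * g) x = aev f x * aev g x"
proof -
 have "map_poly to_ac (f * g) = map_poly to_ac f * map_poly to_ac g"
  by (rule poly_eqI) (simp add: coeff_map_poly coeff_mult to_ac_sum)
 then show ?thesis by (simp add: aev_def)
qed

lemma aev_0 [simp]: "aev 0 x = 0" and aev_C [simp]: "aev [:c:] x = to_ac c"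
 by (simp_all add: aev_def map_poly_pCons)

lemma aev_monom [simp]: "aev (monom c n) x = to_ac c * x ^ n"
 by (simp add: aev_def map_poly_monom poly_monom)

lemma aev_sum: "aev (\<Sum>i\<in>A. f i) x = (\<Sum>i\<in>A. aev (f i) x)"
 by (induction A rule: infinite_finite_induct) (simp_all add: aev_add)

lemma aev_altdef: "aev f x = (\<Sum>i\<le>Polynomial.degree f. to_ac (poly.coeff f i) * x ^ i)"
 by (simp add: aev_def poly_altdef coeff_map_poly degree_map_poly)

lemma min_poly_exists:
 fixes x :: "'a::field alg_closure"
 obtains f :: "'a poly" where "Factorial_Ring.irreducible f" "aev f x = 0"
proof -
 define P where "P = (\<lambda>f::'a poly. f ~= 0 \<and> aev f x = 0)"
 obtain f0 where "P f0" using alg_closure_algebraic[of x] unfolding P_def aev_def by metis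
 then obtain f where f: "P f" and min: "\<And>g. P g ==> Polynomial.degree f \<le> Polynomial.degree g"
  using ex_has_least_nat[of P f0 Polynomial.degree] by blast
 have "Factorial_Ring.irreducible f"
 proof (rule Factorial_Ring.irreducibleI)
  show "f ~= 0" using f by (simp add: P_def)
  show "\<not> f dvd 1"
  proof
   assume "f dvd 1"
   then obtain c where "f = [:c:]" using is_unit_polyE by blast
   then show False using f by (auto simp: P_def)
  qed
  fix a b assume ab: "f = a * b"
  then have "a ~= 0" "b ~= 0" using f by (auto simp: P_def)
  then have d: "Polynomial.degree f = Polynomial.degree a + Polynomial.degree b" by (simp add: ab degree_mult_eq)
  have "P a \<or> P b" using f ab \<open>a ~= 0\<close> \<open>b ~= 0\<close> by (auto simp: P_def aev_mult)
  then have "Polynomial.degree b = 0 \<or> Polynomial.degree a = 0" using min d by fastforce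
  then show "a dvd 1 \<or> b dvd 1" using \<open>a ~= 0\<close> \<open>b ~= 0\<close> by (auto simp: is_unit_iff_degree)
 qed
 then show thesis using f that by (auto simp: P_def)
qed

text \<open>A nonzero polynomial of least degree vanishing at x divides every other one, and an
  irreducible one must be associated to it.\<close>

lemma irreducible_dvd:
 fixes x :: "'a::field alg_closure"
 assumes f: "Factorial_Ring.irreducible f" "aev f x = 0" and g: "aev g x = 0"
 shows "f dvd g"
proof -
 define P where "P = (\<lambda>f::'a poly. f ~= 0 \<and> aev f x = 0)"
 have "P f" using f by (auto simp: P_def Factorial_Ring.irreducible_def)
 then obtain m where m: "P m" and min: "\<And>g. P g ==> Polynomial.degree m \<le> Polynomial.degree g"
  using ex_has_least_nat[of P f Polynomial.degree] by blast
 have dvd: "m dvd h" if "aev h x = 0" for h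
 proof -
  have "h = (h div m) * m + h mod m" by simp
  then have "aev h x = aev (h div m) x * aev m x + aev (h mod m) x"
   by (metis aev_add aev_mult)
  then have "aev (h mod m) x = 0" using that m by (simp add: P_def)
  moreover have "h mod m = 0 \<or> Polynomial.degree (h mod m) < Polynomial.degree m"
   using m by (intro degree_mod_less) (simp add: P_def)
  ultimately have "h mod m = 0" using min[of "h mod m"] unfolding P_def by linarith
  then show ?thesis by auto
 qed
 obtain k where k: "f = m * k" using dvd[OF f(2)] by (auto elim: dvdE)
 have "\<not> m dvd 1"
 proof
  assume "m dvd 1"
  then obtain c where "m = [:c:]" using is_unit_polyE by blast
  then show False using m by (auto simp: P_def)
 qed
 then have "k dvd 1" using Factorial_Ring.irreducibleD[OF f(1) k] by blast
 then have "f dvd m" by (simp add: k mult_unit_dvd_iff)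
 then show ?thesis using dvd[OF g] by (rule dvd_trans)
qed

lemma acl_span_mult:
 assumes "x : acl.span S" "y : acl.span T" "\<And>s t. s : S ==> t : T ==> s * t : acl.span U"
 shows "x * y : acl.span U"
proof -
 have 1: "s * y : acl.span U" if "s : S" for s
  using assms(2)
 proof (induction rule: acl.span_induct_alt)
  case (step c t z)
  have "s * (to_ac c * t + z) = to_ac c * (s * t) + s * z" by (simp add: algebra_simps)
  then show ?case using step assms(3)[OF that step(1)] by (simp add: acl.span_add acl.span_scale)
 qed (simp add: acl.span_zero)
 show ?thesis using assms(1)
 proof (induction rule: acl.span_induct_alt)
  case (step c t z)
  have "(to_ac c * t + z) * y = to_ac c * (t * y) + z * y" by (simp add: algebra_simps)
  then show ?case using step 1[OF step(1)] by (simp add: acl.span_add acl.span_scale)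
 qed (simp add: acl.span_zero)
qed

lemma aev_in_span: "aev f x : acl.span ((%i. x ^ i) ` {..Polynomial.degree f})"
 unfolding aev_altdef by (intro acl.span_sum acl.span_scale acl.span_base) auto

lemma powers_in_span:
 fixes x :: "'a::field alg_closure"
 assumes f: "Factorial_Ring.irreducible f" "aev f x = 0"
 shows "x ^ n : acl.span ((%i. x ^ i) ` {..<Polynomial.degree f})"
proof -
 let ?g = "monom (1::'a) n"
 have "?g = (?g div f) * f + ?g mod f" by simp
 then have "aev ?g x = aev (?g div f) x * aev f x + aev (?g mod f) x"
  by (metis aev_add aev_mult)
 then have xn: "x ^ n = aev (?g mod f) x" using f by simp
 have "?g mod f = 0 \<or> Polynomial.degree (?g mod f) < Polynomial.degree f"
  using f(1) by (intro degree_mod_less) (auto simp: Factorial_Ring.irreducible_def)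
 then have "aev (?g mod f) x : acl.span ((%i. x ^ i) ` {..<Polynomial.degree f})"
 proof
  assume "Polynomial.degree (?g mod f) < Polynomial.degree f"
  then have "(%i. x ^ i) ` {..Polynomial.degree (?g mod f)} <= (%i. x ^ i) ` {..<Polynomial.degree f}" by auto
  then show ?thesis using aev_in_span acl.span_mono by blast
 qed (simp add: acl.span_zero)
 then show ?thesis using xn by simp
qed

lemma span_eq_of_card:
 assumes "acl.independent Q" "Q <= acl.span T" "finite T" "card T \<le> card Q"
 shows "acl.span T <= acl.span Q"
proof -
 have "t : acl.span Q" if t: "t : T" for t
 proof (rule ccontr)
  assume *: "t \<notin> acl.span Q"
  then have "acl.independent (insert t Q)" using assms(1) by (rule acl.independent_insertI)
  moreover have "insert t Q <= acl.span T" using t assms(2) acl.span_base by blast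
  ultimately have "finite (insert t Q) \<and> card (insert t Q) \<le> card T"
   by (rule acl.independent_span_bound[OF assms(3)])
  moreover have "t \<notin> Q" using * acl.span_base by blast
  ultimately have "Suc (card Q) \<le> card T" by (metis card_insert_disjoint finite_insert)
  then show False using assms(4) by simp
 qed
 then show ?thesis by (metis acl.span_mono acl.span_span subsetI)
qed

text \<open>
 An element is separable iff it lies in the subalgebra generated by its \<^term>\<open>p\<close>-th power. Linear
 algebra shows that this property is inherited by all elements of a finite-dimensional subalgebra
 that is spanned by its \<^term>\<open>p\<close>-th powers.
\<close>

definition p_generated :: "nat => 'a::field alg_closure => bool" where
 "p_generated p x \<longleftrightarrow> x : acl.span (range (%j. x ^ (p * j)))"

text \<open>The subalgebra generated by z and w. Two generators are enough for sums and products,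
  and for an Artin--Schreier root together with its right-hand side.\<close>

definition alg2 :: "'a::field alg_closure => 'a alg_closure => 'a alg_closure set" where
 "alg2 z w = acl.span (range (\<lambda>(i, j). z ^ i * w ^ j))"

lemma alg2_mult: "x : alg2 z w ==> y : alg2 z w ==> x * y : alg2 z w"
 unfolding alg2_def
proof (erule (1) acl_span_mult)
 fix s t assume "s : range (\<lambda>(i, j). z ^ i * w ^ j)" "t : range (\<lambda>(i, j). z ^ i * w ^ j)"
 then obtain i j k l where "s = z ^ i * w ^ j" "t = z ^ k * w ^ l" by auto
 then have "s * t = (\<lambda>(i, j). z ^ i * w ^ j) (i + k, j + l)" by (simp add: power_add mult_ac)
 then show "s * t : acl.span (range (\<lambda>(i, j). z ^ i * w ^ j))" by (metis acl.span_base rangeI)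
qed

lemma alg2_base: "z : alg2 z w" "w : alg2 z w" "1 : alg2 z w"
proof -
 have "(\<lambda>(i, j). z ^ i * w ^ j) (i, j) : alg2 z w" for i j
  unfolding alg2_def by (intro acl.span_base rangeI)
 from this[of 1 0] this[of 0 1] this[of 0 0]
 show "z : alg2 z w" "w : alg2 z w" "1 : alg2 z w" by simp_all
qed

lemma alg2_closed:
 "x : alg2 z w ==> y : alg2 z w ==> x + y : alg2 z w"
 "x : alg2 z w ==> y : alg2 z w ==> x - y : alg2 z w"
 "x : alg2 z w ==> x ^ n : alg2 z w"
 "to_ac c : alg2 z w"
proof -
 show "x : alg2 z w ==> x ^ n : alg2 z w" by (induction n) (auto intro: alg2_mult alg2_base)
 have "to_ac c * 1 : alg2 z w"
  using alg2_base(3)[of z w] unfolding alg2_def by (rule acl.span_scale)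
 then show "to_ac c : alg2 z w" by simp
qed (auto simp: alg2_def intro: acl.span_add acl.span_diff)

lemma alg2_finite: "\<exists>T. finite T \<and> alg2 z w = acl.span T"
proof -
 obtain f where f: "Factorial_Ring.irreducible f" "aev f z = 0" using min_poly_exists .
 obtain g where g: "Factorial_Ring.irreducible g" "aev g w = 0" using min_poly_exists .
 let ?T = "(\<lambda>(i, j). z ^ i * w ^ j) ` ({..<Polynomial.degree f} \<times> {..<Polynomial.degree g})"
 have "z ^ i * w ^ j : acl.span ?T" for i j
  by (rule acl_span_mult[OF powers_in_span[OF f] powers_in_span[OF g]]) (auto intro!: acl.span_base)
 then have "range (\<lambda>(i, j). z ^ i * w ^ j) <= acl.span ?T" by auto
 then have "alg2 z w <= acl.span ?T" unfolding alg2_def by (metis acl.span_mono acl.span_span)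
 moreover have "acl.span ?T <= alg2 z w" unfolding alg2_def by (rule acl.span_mono) auto
 ultimately show ?thesis by (intro exI[of _ ?T]) auto
qed

context
 fixes p :: nat
 assumes p: "Factorial_Ring.prime p"
begin

text \<open>If p-th powers span the finite-dimensional algebra F = K[z, w], then the p-th powers of
  a basis span F, so by counting they form a basis. For a basis of F that extends one of K[u], the
  p-th powers of the latter are independent in K[u], hence a basis of it, and they lie in
  K[u^p].\<close>

lemma p_generated_alg2:
 fixes z w :: "'a::field alg_closure"
 assumes ch: "CHAR('a) = p" and F: "alg2 z w <= acl.span ((%x. x ^ p) ` alg2 z w)" and u: "u : alg2 z w"
 shows "p_generated p u"
proof -
 have ch': "CHAR('a alg_closure) = p" using ch by simp
 obtain T where T: "finite T" "alg2 z w = acl.span T" using alg2_finite by blast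
 define V where "V = range (%j. u ^ j)"
 have VF: "V <= alg2 z w" unfolding V_def using alg2_closed(3)[OF u] by auto
 \<comment> \<open>The basis of K[u] is taken among the powers of u, so that the p-th powers of its
   members are powers of u^p.\<close>
 obtain B' where B': "B' <= V" "acl.independent B'" "V <= acl.span B'"
  using acl.maximal_independent_subset[of V] by blast
 obtain B where B: "B' <= B" "B <= alg2 z w" "acl.independent B" "alg2 z w <= acl.span B"
  using acl.maximal_independent_subset_extend[of B' "alg2 z w"] B' VF by blast
 have finB: "finite B" using acl.independent_span_bound[OF T(1) B(3)] B(2) T(2) by auto
 let ?P = "(%x. x ^ p) ` B"
 have pw: "x ^ p : acl.span ?P" if "x : acl.span B" for x
  using that
 proof (induction rule: acl.span_induct_alt)
  case base show ?case using prime_gt_0_nat[OF p] by (simp add: acl.span_zero zero_power)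
 next
  case (step c b y)
  have *: "(to_ac c * b + y) ^ p = to_ac (c ^ p) * b ^ p + y ^ p"
   using p ch' by (subst freshmans_dream) (auto simp: power_mult_distrib)
  have "to_ac (c ^ p) * b ^ p : acl.span ?P"
   by (intro acl.span_scale acl.span_base imageI step)
  then show ?case unfolding * using step.IH by (rule acl.span_add)
 qed
 have "(%x. x ^ p) ` alg2 z w <= acl.span ?P"
  by (rule image_subsetI, rule pw) (use B(4) in auto)
 then have "acl.span ((%x. x ^ p) ` alg2 z w) <= acl.span ?P"
  by (rule acl.span_minimal) (rule acl.subspace_span)
 then have BP: "B <= acl.span ?P" using F B(2) by (meson subset_trans)
 have "card B \<le> card ?P" using acl.independent_span_bound[OF _ B(3) BP] finB by auto
 then have card: "card ?P = card B" using card_image_le[OF finB, of "%x. x ^ p"] by simp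
 \<comment> \<open>A dependency would let fewer than \<open>card B\<close> of the p-th powers span
   \<open>B\<close>, against the independence of \<open>B\<close>.\<close>
 have indP: "acl.independent ?P"
 proof
  assume "acl.dependent ?P"
  then obtain a where a: "a : ?P" "a : acl.span (?P - {a})" by (auto simp: acl.dependent_def)
  then have "acl.span ?P = acl.span (?P - {a})"
   using acl.span_redundant[of a "?P - {a}"] by (simp add: insert_absorb)
  then have "card B \<le> card (?P - {a})" using acl.independent_span_bound[OF _ B(3)] BP finB by auto
  moreover have "card (?P - {a}) < card ?P" by (rule card_Diff1_less) (use a finB in auto)
  ultimately show False using card by simp
 qed
 let ?Q = "(%x. x ^ p) ` B'"
 have Q: "?Q <= range (%j. u ^ (p * j))"
 proof
  fix q assume "q : ?Q"
  then obtain j where "q = (u ^ j) ^ p" using B'(1) by (auto simp: V_def)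
  then show "q : range (%j. u ^ (p * j))" by (auto simp: mult.commute simp flip: power_mult)
 qed
 have "acl.span B' <= acl.span ?Q"
 proof (rule span_eq_of_card)
  show "acl.independent ?Q" by (rule acl.independent_mono[OF indP image_mono[OF B(1)]])
  show "?Q <= acl.span B'" using Q B'(3) unfolding V_def by auto
  show "finite B'" using B(1) finB finite_subset by blast
  have "inj_on (%x. x ^ p) B" using card finB by (intro eq_card_imp_inj_on) auto
  then show "card B' \<le> card ?Q" using B(1) by (simp add: card_image inj_on_subset)
 qed
 moreover have "u : acl.span B'" using B'(3) unfolding V_def by (metis power_one_right rangeI subsetD)
 ultimately show ?thesis unfolding p_generated_def using acl.span_mono[OF Q] by blast
qed

text \<open>The span of the p-th powers is closed under products, so it suffices that it contains
  the generators.\<close>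

lemma p_powers_span_alg2:
 fixes z w :: "'a::field alg_closure"
 assumes "z : acl.span ((%x. x ^ p) ` alg2 z w)" "w : acl.span ((%x. x ^ p) ` alg2 z w)"
 shows "alg2 z w <= acl.span ((%x. x ^ p) ` alg2 z w)"
proof -
 let ?M = "acl.span ((%x. x ^ p) ` alg2 z w)"
 have m: "x * y : ?M" if "x : ?M" "y : ?M" for x y
 proof (rule acl_span_mult[OF that])
  fix s t assume "s : (%x. x ^ p) ` alg2 z w" "t : (%x. x ^ p) ` alg2 z w"
  then obtain a b where "a : alg2 z w" "b : alg2 z w" "s = a ^ p" "t = b ^ p" by auto
  then have "s * t = (a * b) ^ p" "a * b : alg2 z w" by (auto simp: power_mult_distrib alg2_mult)
  then show "s * t : ?M" by (auto intro: acl.span_base)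
 qed
 have 1: "1 : ?M" using alg2_base(3)[of z w] by (intro acl.span_base image_eqI[of _ _ 1]) auto
 have pow: "x ^ n : ?M" if "x : ?M" for x n
  by (induction n) (auto intro: 1 m that)
 have "range (\<lambda>(i, j). z ^ i * w ^ j) <= ?M" using assms by (auto intro: m pow)
 then show ?thesis unfolding alg2_def[of z w] by (metis acl.span_mono acl.span_span alg2_def)
qed

lemma p_generated_in_powers:
 assumes "p_generated p z" "z : alg2 a b"
 shows "z : acl.span ((%x. x ^ p) ` alg2 a b)"
proof -
 have "range (%j. z ^ (p * j)) <= (%x. x ^ p) ` alg2 a b"
 proof clarify
  fix j show "z ^ (p * j) : (%x. x ^ p) ` alg2 a b"
   using alg2_closed(3)[OF assms(2), of j] by (intro image_eqI[of _ _ "z ^ j"]) (auto simp: mult.commute simp flip: power_mult)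
 qed
 then show ?thesis using assms(1) acl.span_mono unfolding p_generated_def by blast
qed

lemma p_generated_closed:
 fixes z w :: "'a::field alg_closure"
 assumes "CHAR('a) = p" "p_generated p z" "p_generated p w" "u : alg2 z w"
 shows "p_generated p u"
 by (rule p_generated_alg2[OF assms(1) p_powers_span_alg2 assms(4)])
  (auto intro: p_generated_in_powers assms alg2_base)

text \<open>The equation reads z = z^p - c: the first term is a p-th power, and c is spanned by p-th
  powers already.\<close>

lemma p_generated_artin_schreier:
 fixes z c :: "'a::field alg_closure"
 assumes ch: "CHAR('a) = p" and c: "p_generated p c" and z: "z ^ p - z = c"
 shows "p_generated p z"
proof -
 let ?M = "acl.span ((%x. x ^ p) ` alg2 z c)"
 have c': "c : ?M" by (rule p_generated_in_powers[OF c alg2_base(2)])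
 have "z ^ p : ?M" using alg2_base(1)[of z c] by (intro acl.span_base) auto
 then have "z ^ p - c : ?M" using c' by (rule acl.span_diff)
 moreover have "z ^ p - c = z" unfolding z[symmetric] by simp
 ultimately have "z : ?M" by (rule back_subst[of "%y. y : ?M"])
 then show ?thesis
  by (rule p_generated_alg2[OF ch p_powers_span_alg2[OF _ c'] alg2_base(1)])
qed

end

section \<open>Separability in terms of p-th powers\<close>

lemma card_roots_rsquarefree:
 fixes F :: "'a::alg_closed_field poly"
 assumes "rsquarefree F"
 shows "card {z. poly F z = 0} = Polynomial.degree F"
proof -
 have F: "F ~= 0" using assms by (simp add: rsquarefree_def)
 obtain A where A: "size A = Polynomial.degree F"
  "F = smult (Polynomial.lead_coeff F) (\<Prod>x\<in>#A. [:-x, 1:])"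
  using alg_closed_imp_factorization[OF F] by blast
 have c: "count A x = 1" if "x :# A" for x
 proof (rule ccontr)
  assume "count A x ~= 1"
  then have "count A x \<ge> 2" using that by (metis One_nat_def Suc_1 Suc_leI count_greater_eq_one_iff le_neq_implies_less)
  then have "replicate_mset 2 x <=# A" by (simp add: count_le_replicate_mset_subset_eq)
  then obtain B where "A = replicate_mset 2 x + B" by (metis subset_mset.le_iff_add)
  then have B: "A = add_mset x (add_mset x B)" by (simp add: numeral_2_eq_2)
  have gen: "(\<Prod>z\<in>#add_mset x (add_mset x B). l z) = l x ^ 2 * (\<Prod>z\<in>#B. l z)" for l :: "'a => 'a poly"
   by (simp add: power2_eq_square mult.assoc)
  have "F = [:-x, 1:] ^ 2 * smult (Polynomial.lead_coeff F) (\<Prod>x\<in>#B. [:-x, 1:])"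
   by (subst A(2)) (simp only: B gen mult_smult_right)
  then have "2 \<le> order x F" using F order_divides[of x 2 F] by (metis dvd_triv_left)
  moreover have "order x F = 0 \<or> order x F = 1" using assms unfolding rsquarefree_def by blast
  ultimately show False by linarith
 qed
 have "{z. poly F z = 0} = set_mset A"
  using F by (subst A(2)) (auto simp: poly_prod_mset)
 moreover have "size A = card (set_mset A)"
  unfolding size_multiset_overloaded_eq using c by simp
 ultimately show ?thesis using A(1) by simp
qed

lemma family_independent:
 fixes v :: "'i => 'a::field alg_closure"
 assumes I: "finite I" and v: "\<And>c. (\<Sum>i\<in>I. to_ac (c i) * v i) = 0 ==> \<forall>i\<in>I. c i = 0"
 shows "inj_on v I" "acl.independent (v ` I)"
proof -
 show inj: "inj_on v I"
 proof (rule inj_onI, rule ccontr)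
  fix i j assume ij: "i : I" "j : I" "v i = v j" "i ~= j"
  let ?c = "%k. if k = i then 1 else if k = j then -1 else (0::'a)"
  have "(\<Sum>k\<in>I. to_ac (?c k) * v k) = (\<Sum>k\<in>{i, j}. to_ac (?c k) * v k)"
   by (rule sum.mono_neutral_right) (use I ij in auto)
  also have "\<dots> = 0" using ij by simp
  finally show False using v[of ?c] ij by auto
 qed
 show "acl.independent (v ` I)"
 proof
  assume "acl.dependent (v ` I)"
  then obtain u y where u: "y : v ` I" "u y ~= 0" "(\<Sum>y\<in>v ` I. to_ac (u y) * y) = 0"
   using I by (auto simp: acl.dependent_finite)
  have "(\<Sum>i\<in>I. to_ac (u (v i)) * v i) = 0" using u(3) by (simp add: sum.reindex[OF inj])
  then show False using v[of "%i. u (v i)"] u by auto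
 qed
qed

lemma map_poly_to_ac_mult: "map_poly to_ac (f * g) = map_poly to_ac f * map_poly to_ac (g::'a::field poly)"
 by (rule poly_eqI) (simp add: coeff_map_poly coeff_mult to_ac_sum)

lemma aev_pCons: "aev (pCons c f) x = to_ac c + x * aev f x"
 by (simp add: aev_def map_poly_pCons)

lemma sep_closure_altdef:
 "sep_closure = {x. \<exists>f. Factorial_Ring.irreducible f \<and> rsquarefree (map_poly to_ac f) \<and> aev f x = 0}"
 by (simp add: sep_closure_def aev_def)

context
 fixes p :: nat
 assumes p: "Factorial_Ring.prime p"
begin

text \<open>With r the degree of the irreducible polynomial f of x, the powers x^(p j) for j < r are
  independent and therefore span K[x]. A relation among them is a polynomial G divisible by f;
  extracting p-th roots of its coefficients gives H of degree below r with H(z)^p = G(z), so H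
  vanishes at the r distinct roots of f.\<close>

lemma sep_imp_p_generated:
 fixes x :: "'a::field alg_closure"
 assumes ch: "CHAR('a) = p" and x: "x : sep_closure"
 shows "p_generated p x"
proof -
 have ch': "CHAR('a alg_closure) = p" using ch by simp
 have p0: "p > 0" using prime_gt_0_nat[OF p] .
 obtain f where f: "Factorial_Ring.irreducible f" "rsquarefree (map_poly to_ac f)" "aev f x = 0"
  using x by (auto simp: sep_closure_altdef)
 define r where "r = Polynomial.degree f"
 have card: "card {z. aev f z = 0} = r"
  using card_roots_rsquarefree[OF f(2)] by (simp add: aev_def r_def degree_map_poly)
 let ?v = "%j. x ^ (p * j)"
 have indep: "\<forall>j\<in>{..<r}. c j = 0" if c: "(\<Sum>j<r. to_ac (c j) * ?v j) = 0" for c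
 proof -
  have "\<forall>j. \<exists>y. y ^ p = to_ac (c j)" using nth_root_exists[OF p0] by blast
  from choice[OF this] obtain e where "\<forall>j. e j ^ p = to_ac (c j)" ..
  then have e: "e j ^ p = to_ac (c j)" for j by blast
  define H where "H = (\<Sum>j<r. monom (e j) j)"
  define G where "G = (\<Sum>j<r. monom (c j) (p * j))"
  have "aev G x = 0" using c by (simp add: G_def aev_sum)
  then have "f dvd G" by (rule irreducible_dvd[OF f(1,3)])
  then obtain k where k: "G = f * k" by (auto elim: dvdE)
  have "poly H z = 0" if "aev f z = 0" for z
  proof -
   have "poly H z ^ p = (\<Sum>j<r. (e j * z ^ j) ^ p)"
    unfolding H_def poly_sum poly_monom by (rule freshmans_dream_sum) (use p ch' in auto)
   also have "\<dots> = aev G z"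
    unfolding G_def aev_sum by (rule sum.cong) (auto simp: power_mult_distrib e mult.commute simp flip: power_mult)
   also have "\<dots> = 0" using that by (simp add: k aev_mult)
   finally show ?thesis using p0 by simp
  qed
  then have sub: "{z. aev f z = 0} <= {z. poly H z = 0}" by auto
  have "H = 0"
  proof (rule ccontr)
   assume H: "H ~= 0"
   then have "r \<le> card {z. poly H z = 0}"
    using card_mono[OF poly_roots_finite[OF H] sub] card by simp
   also have "\<dots> \<le> Polynomial.degree H" by (rule card_poly_roots_bound[OF H])
   finally have "r \<le> Polynomial.degree H" .
   moreover have "poly.coeff H i = 0" if "i \<ge> r" for i
    using that by (auto simp: H_def coeff_sum)
   ultimately show False using H by (metis leading_coeff_0_iff)
  qed
  show ?thesis
  proof
   fix j assume "j : {..<r}"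
   then have "poly.coeff H j = e j" by (simp add: H_def coeff_sum)
   then have "e j = 0" using \<open>H = 0\<close> by simp
   then show "c j = 0" using e[of j] p0 by (simp add: zero_power)
  qed
 qed
 have inj: "inj_on ?v {..<r}" and ind: "acl.independent (?v ` {..<r})"
  using family_independent[of "{..<r}" ?v] indep by auto
 have "acl.span ((%i. x ^ i) ` {..<r}) <= acl.span (?v ` {..<r})"
 proof (rule span_eq_of_card[OF ind])
  show "?v ` {..<r} <= acl.span ((%i. x ^ i) ` {..<r})"
   using powers_in_span[OF f(1,3)] unfolding r_def by auto
  show "card ((%i. x ^ i) ` {..<r}) \<le> card (?v ` {..<r})"
   unfolding card_image[OF inj] using card_image_le[of "{..<r}" "%i. x ^ i"] by simp
 qed simp
 moreover have "x : acl.span ((%i. x ^ i) ` {..<r})"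
  using powers_in_span[OF f(1,3), of 1] unfolding r_def by simp
 moreover have "acl.span (?v ` {..<r}) <= acl.span (range ?v)" by (rule acl.span_mono) auto
 ultimately show ?thesis unfolding p_generated_def by blast
qed

text \<open>If x = G(x) with G a polynomial in X^p, then G - X has derivative -1, hence only simple
  roots, and the irreducible polynomial of x divides it.\<close>

lemma p_generated_imp_sep:
 fixes x :: "'a::field alg_closure"
 assumes ch: "CHAR('a) = p" and x: "p_generated p x"
 shows "x : sep_closure"
proof -
 have "\<exists>G. aev G x = y \<and> pderiv G = 0" if "y : acl.span (range (%j. x ^ (p * j)))" for y
  using that
 proof (induction rule: acl.span_induct_alt)
  case base show ?case by (intro exI[of _ 0]) simp
 next
  case (step c b y)
  then obtain j G where "b = x ^ (p * j)" "aev G x = y" "pderiv G = 0" by auto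
  moreover have "(of_nat p :: 'a) = 0" using ch by (metis of_nat_CHAR)
  ultimately show ?case
   by (intro exI[of _ "monom c (p * j) + G"]) (simp add: aev_add pderiv_add pderiv_monom)
 qed
 then obtain G where G: "aev G x = x" "pderiv G = 0" using x unfolding p_generated_def by blast
 define g where "g = G + monom (-1) 1"
 have g: "aev g x = 0" "pderiv g = -1"
  using G by (simp_all add: g_def aev_add pderiv_add pderiv_monom monom_0 one_pCons)
 obtain f where f: "Factorial_Ring.irreducible f" "aev f x = 0" using min_poly_exists .
 have "f dvd g" by (rule irreducible_dvd[OF f g(1)])
 then obtain k where k: "g = f * k" by (auto elim: dvdE)
 let ?F = "map_poly to_ac f"
 have F0: "?F ~= 0" using f(1) by (auto simp: Factorial_Ring.irreducible_def map_poly_eq_0_iff)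
 have "order a ?F = 0 \<or> order a ?F = 1" for a
 proof (rule ccontr)
  assume "\<not> (order a ?F = 0 \<or> order a ?F = 1)"
  then have "2 \<le> order a ?F" by auto
  then have "[:-a, 1:] ^ 2 dvd ?F" using order_divides[of a 2 ?F] by blast
  then have "[:-a, 1:] ^ 2 dvd map_poly to_ac g" unfolding k map_poly_to_ac_mult by (rule dvd_mult2)
  then obtain q where q: "map_poly to_ac g = [:-a, 1:] ^ 2 * q" by (auto elim: dvdE)
  have "pderiv (map_poly to_ac g) = map_poly to_ac (pderiv g)"
   by (rule poly_eqI) (simp add: coeff_map_poly coeff_pderiv)
  also have "\<dots> = -1" unfolding g(2) by (rule poly_eqI) (simp add: coeff_map_poly)
  finally have "poly (pderiv (map_poly to_ac g)) a = -1" by simp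
  moreover have "poly (pderiv (l ^ 2 * q)) a = 0" if "poly l a = 0" for l
   using that by (simp add: pderiv_mult power2_eq_square)
  then have "poly (pderiv (map_poly to_ac g)) a = 0" unfolding q by simp
  ultimately show False by simp
 qed
 then have "rsquarefree ?F" using F0 by (simp add: rsquarefree_def)
 then show ?thesis using f by (auto simp: sep_closure_altdef)
qed

lemma sep_closure_eq: "CHAR('a::field) = p ==> (sep_closure :: 'a alg_closure set) = {x. p_generated p x}"
 using sep_imp_p_generated p_generated_imp_sep by blast

lemma to_ac_sep: "CHAR('a::field) = p ==> to_ac (c::'a) : sep_closure"
proof -
 assume ch: "CHAR('a) = p"
 have "to_ac c * 1 : acl.span (range (%j. to_ac c ^ (p * j)))"
  by (intro acl.span_scale acl.span_base range_eqI[of _ _ 0]) simp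
 then show ?thesis by (simp add: sep_closure_eq[OF ch] p_generated_def)
qed

lemma sep_closed:
 fixes x y :: "'a::field alg_closure"
 assumes ch: "CHAR('a) = p" and xy: "x : sep_closure" "y : sep_closure"
 shows "x + y : sep_closure" "x - y : sep_closure" "x * y : sep_closure" "x ^ n : sep_closure"
 using xy unfolding sep_closure_eq[OF ch] mem_Collect_eq
 by (auto intro!: p_generated_closed[OF p ch, of x y] alg2_closed alg2_mult alg2_base)

lemma subrng_sep: "CHAR('a::field) = p ==> subrng (sep_closure :: 'a alg_closure set)"
 using sep_closed(2)[of 0] to_ac_sep[of 0] by (auto simp: subrng_def sep_closed)

lemma sep_artin_schreier:
 fixes c :: "'a::field alg_closure"
 assumes ch: "CHAR('a) = p" and c: "c : sep_closure"
 shows "\<exists>x\<in>sep_closure. x ^ p - x = c"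
proof -
 have p1: "p > 1" using prime_gt_1_nat[OF p] .
 define f where "f = monom 1 p - monom 1 1 - [:c:]"
 have "poly.coeff f p = 1" using p1 by (simp add: f_def coeff_pCons split: nat.split)
 then have "Polynomial.degree f \<ge> p" by (intro le_degree) simp
 then obtain x where "poly f x = 0" using alg_closed_imp_poly_has_root[of f] p1 by auto
 then have x: "x ^ p - x = c" by (simp add: f_def poly_monom)
 moreover have "x : sep_closure"
  using c p_generated_artin_schreier[OF p ch _ x] by (simp add: sep_closure_eq[OF ch])
 ultimately show ?thesis by blast
qed

end

section \<open>Conjugates and extension of homomorphisms\<close>

text \<open>Conjugacy is expressed by all polynomials vanishing at x, so that no minimal polynomial
  has to be chosen.\<close>

definition conjugates :: "'a::field alg_closure => 'a alg_closure set" where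
 "conjugates x = {y. \<forall>f. aev f x = 0 \<longrightarrow> aev f y = 0}"

lemma conjugates_self: "x : conjugates x"
 by (simp add: conjugates_def)

lemma finite_conjugates: "finite (conjugates x)"
proof -
 obtain f where f: "Factorial_Ring.irreducible f" "aev f x = 0" using min_poly_exists .
 have "map_poly to_ac f ~= 0" using f(1) by (auto simp: Factorial_Ring.irreducible_def map_poly_eq_0_iff)
 then have "finite {y. aev f y = 0}" unfolding aev_def by (rule poly_roots_finite)
 then show ?thesis by (rule finite_subset[rotated]) (use f in "auto simp: conjugates_def")
qed

lemma conjugates_sep: "x : sep_closure ==> y : conjugates x ==> y : sep_closure"
 by (auto simp: sep_closure_altdef conjugates_def)

text \<open>Outside the base field the irreducible polynomial of x has degree above one, and
  separability provides as many roots as the degree.\<close>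

lemma conjugate_exists:
 fixes x :: "'a::field alg_closure"
 assumes "x : sep_closure" "x \<notin> range to_ac"
 shows "\<exists>y\<in>conjugates x. y ~= x"
proof -
 obtain f where f: "Factorial_Ring.irreducible f" "rsquarefree (map_poly to_ac f)" "aev f x = 0"
  using assms(1) by (auto simp: sep_closure_altdef)
 have card: "card {z. aev f z = 0} = Polynomial.degree f"
  using card_roots_rsquarefree[OF f(2)] by (simp add: aev_def degree_map_poly)
 have f0: "f ~= 0" using f(1) by (simp add: Factorial_Ring.irreducible_def)
 have "Polynomial.degree f > 1"
 proof (rule ccontr)
  assume "\<not> Polynomial.degree f > 1"
  then have "f = [:poly.coeff f 0, poly.coeff f 1:]"
   by (intro poly_eqI) (auto simp: coeff_pCons coeff_eq_0 split: nat.split)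
  then obtain a b where ab: "f = [:a, b:]" by blast
  have e: "to_ac a + x * to_ac b = 0" using f(3) by (simp add: ab aev_pCons)
  show False
  proof (cases "b = 0")
   case True then show False using e f0 ab by simp
  next
   case False
   then have "x = to_ac (- a / b)" using e by (simp add: field_simps eq_neg_iff_add_eq_0)
   then show False using assms(2) by blast
  qed
 qed
 then have "\<not> {z. aev f z = 0} <= {x}" using card by (metis card.empty card_insert_disjoint empty_iff finite.emptyI
  One_nat_def less_irrefl subset_singletonD not_less0)
 then obtain y where y: "aev f y = 0" "y ~= x" by auto
 have "aev g y = 0" if g: "aev g x = 0" for g
 proof -
  obtain k where "g = f * k" using irreducible_dvd[OF f(1,3) g] by (auto elim: dvdE)
  then show ?thesis using y by (simp add: aev_mult)
 qed
 then show ?thesis using y by (auto simp: conjugates_def)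
qed

text \<open>Partial \<^term>\<open>K\<close>-homomorphisms are represented by their graphs, which are subalgebras of the product.\<close>

definition graph_alg :: "('a::field alg_closure \<times> 'a alg_closure) set => bool" where
 "graph_alg r \<longleftrightarrow> (\<forall>a. (to_ac a, to_ac a) : r) \<and>
   (\<forall>x x' y y'. (x, x') : r \<longrightarrow> (y, y') : r \<longrightarrow> (x + y, x' + y') : r \<and> (x * y, x' * y') : r)"

text \<open>The graph is closed under differences, so single-valuedness reduces to the fibre over
  zero.\<close>

definition partial_hom :: "('a::field alg_closure \<times> 'a alg_closure) set => bool" where
 "partial_hom r \<longleftrightarrow> graph_alg r \<and> (\<forall>y. (0, y) : r \<longrightarrow> y = 0)"

lemma graph_alg_diff:
 assumes "graph_alg r" "(x, x') : r" "(y, y') : r"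
 shows "(x - y, x' - y') : r"
proof -
 have "(to_ac (-1), to_ac (-1)) : r" using assms(1) unfolding graph_alg_def by blast
 then have "(to_ac (-1) * y, to_ac (-1) * y') : r" using assms unfolding graph_alg_def by blast
 then have "(x + to_ac (-1) * y, x' + to_ac (-1) * y') : r" using assms unfolding graph_alg_def by blast
 then show ?thesis by simp
qed

lemma graph_alg_aev:
 assumes r: "graph_alg r" and x: "(x, x') : r"
 shows "(aev g x, aev g x') : r"
proof (induction g)
 case 0
 have "(to_ac 0, to_ac 0) : r" using r unfolding graph_alg_def by blast
 then show ?case by simp
next
 case (pCons c g)
 have "(x * aev g x, x' * aev g x') : r" using pCons x r unfolding graph_alg_def by blast
 moreover have "(to_ac c, to_ac c) : r" using r unfolding graph_alg_def by blast
 ultimately show ?case using r unfolding graph_alg_def aev_pCons by blast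
qed

lemma partial_hom_unique: "partial_hom r ==> (x, y) : r ==> (x, z) : r ==> y = z"
 using graph_alg_diff[of r x y x z] unfolding partial_hom_def by fastforce

text \<open>An irreducible equation of x has nonzero constant term; dividing by that term expresses
  the inverse as a polynomial in x. So the domains of partial homomorphisms are fields.\<close>

lemma graph_alg_inverse:
 assumes r: "graph_alg r" and x: "(x, x') : r" "x ~= 0"
 shows "\<exists>y. (inverse x, y) : r"
proof -
 obtain f where f: "Factorial_Ring.irreducible f" "aev f x = 0" using min_poly_exists .
 obtain c g where cg: "f = pCons c g" by (metis pCons_cases)
 have e: "to_ac c + x * aev g x = 0" using f(2) by (simp add: cg aev_pCons)
 have "c ~= 0"
 proof
  assume "c = 0"
  then have "aev g x = 0" using e x(2) by simp
  then have "f dvd g" by (rule irreducible_dvd[OF f])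
  moreover have "g ~= 0" using f(1) cg \<open>c = 0\<close> by (auto simp: Factorial_Ring.irreducible_def)
  ultimately have "Polynomial.degree f \<le> Polynomial.degree g" by (rule dvd_imp_degree_le)
  then show False using \<open>g ~= 0\<close> cg by simp
 qed
 then have "inverse x = to_ac (- inverse c) * aev g x"
  using e x(2) by (simp add: field_simps eq_neg_iff_add_eq_0)
 moreover have "(to_ac (- inverse c), to_ac (- inverse c)) : r" using r unfolding graph_alg_def by blast
 ultimately show ?thesis using graph_alg_aev[OF r x(1), of g] r unfolding graph_alg_def by metis
qed

text \<open>Extension by one element: the polynomial of least degree of x over the domain is
  transported along \<open>r\<close>, and x is sent to a root of the transported polynomial.\<close>

lemma partial_hom_extend:
 fixes r :: "('a::field alg_closure \<times> 'a alg_closure) set"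
 assumes r: "partial_hom r"
 shows "\<exists>r' y. partial_hom r' \<and> r <= r' \<and> (x, y) : r'"
proof -
 have ga: "graph_alg r" using r by (simp add: partial_hom_def)
 have rK: "(to_ac a, to_ac a) : r" for a using ga unfolding graph_alg_def by blast
 have radd: "(a + b, a' + b') : r" and rmult: "(a * b, a' * b') : r" if "(a, a') : r" "(b, b') : r" for a a' b b'
  using ga that unfolding graph_alg_def by blast+
 have r0: "y = 0" if "(0, y) : r" for y using r that by (simp add: partial_hom_def)
 have r00: "(0, 0) : r" and r11: "(1, 1) : r" using rK[of 0] rK[of 1] by simp_all
 \<comment> \<open>Pairs of polynomials whose coefficients correspond under \<open>r\<close>; they
   replace the map induced on polynomials over the domain.\<close>
 define P where "P = {(g, h). \<forall>i. (poly.coeff g i, poly.coeff h i) : r}"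
 have rsum: "(\<Sum>i\<in>A. f i, \<Sum>i\<in>A. f' i) : r" if "\<And>i. i : A ==> (f i, f' i) : r" for A :: "nat set" and f f'
  using that by (induction A rule: infinite_finite_induct) (auto intro: r00 radd)
 have Padd: "(g + g', h + h') : P" and Pdiff: "(g - g', h - h') : P" and Pmult: "(g * g', h * h') : P"
  if "(g, h) : P" "(g', h') : P" for g h g' h'
  using that unfolding P_def by (auto intro: radd graph_alg_diff[OF ga] simp: coeff_mult intro!: rsum rmult)
 have Pmon: "(monom c n, monom c' n) : P" if "(c, c') : r" for c c' n
  using that unfolding P_def by (auto intro: r00)
 have P0: "h = 0" if "(0, h) : P" for h
  using that r0 unfolding P_def by (auto intro: poly_eqI)
 define Q where "Q = (%n. \<exists>g h. (g, h) : P \<and> g ~= 0 \<and> poly g x = 0 \<and> Polynomial.degree g = n)"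
 obtain f where f: "Factorial_Ring.irreducible f" "aev f x = 0" using min_poly_exists .
 have "(map_poly to_ac f, map_poly to_ac f) : P" using rK by (auto simp: P_def coeff_map_poly)
 moreover have "map_poly to_ac f ~= 0" using f(1) by (auto simp: Factorial_Ring.irreducible_def map_poly_eq_0_iff)
 ultimately have "\<exists>n. Q n" using f(2) unfolding Q_def aev_def by blast
 then obtain n where n: "Q n" and min: "\<And>k. Q k ==> n \<le> k" by (metis LeastI_ex Least_le)
 obtain m0 k0 where m0: "(m0, k0) : P" "m0 ~= 0" "poly m0 x = 0" "Polynomial.degree m0 = n"
  using n unfolding Q_def by blast
 have "\<exists>u. (inverse (Polynomial.lead_coeff m0), u) : r"
  by (rule graph_alg_inverse[OF ga, of _ "poly.coeff k0 n"]) (use m0 in "auto simp: P_def")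
 then obtain u where u: "(inverse (Polynomial.lead_coeff m0), u) : r" ..
 \<comment> \<open>Making m monic forces the transported polynomial k to be monic of the same
   positive degree, so that it has a root.\<close>
 define m k where "m = monom (inverse (Polynomial.lead_coeff m0)) 0 * m0" and "k = monom u 0 * k0"
 have mk: "(m, k) : P" unfolding m_def k_def by (intro Pmult Pmon u m0)
 have m: "poly.coeff m n = 1" "Polynomial.degree m = n" "poly m x = 0"
  using m0 by (auto simp: m_def monom_0)
 have kc: "poly.coeff k i = (if i = n then 1 else 0)" if "i \<ge> n" for i
 proof -
  have "(poly.coeff m i, poly.coeff k i) : r" using mk by (auto simp: P_def)
  then show ?thesis
   using that m r0 partial_hom_unique[OF r r11] coeff_eq_0[of m i] by (cases "i = n") auto
 qed
 have "n > 0"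
 proof (rule ccontr)
  assume "\<not> n > 0"
  then have "m = [:1:]" using m degree_0_id[of m] by simp
  then show False using m(3) by simp
 qed
 moreover have "n \<le> Polynomial.degree k" using kc[of n] by (intro le_degree) simp
 ultimately obtain y where y: "poly k y = 0" using alg_closed_imp_poly_has_root[of k] by auto
 define r' where "r' = {(poly g x, poly h y) | g h. (g, h) : P}"
 \<comment> \<open>Division with remainder by m, carried out on g and h in parallel: if g vanishes
   at x, then h vanishes at y. This makes the extended graph single-valued.\<close>
 have sv: "poly h y = 0" if "(g, h) : P" "poly g x = 0" for g h
  using that
 proof (induction "Polynomial.degree g" arbitrary: g h rule: less_induct)
  case (less g h)
  show ?case
  proof (cases "g = 0")
   case True then show ?thesis using P0[of h] less.prems by simp
  next
   case False
   let ?d = "Polynomial.degree g"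
   have "n \<le> ?d" using min[of ?d] less.prems False unfolding Q_def by blast
   let ?c = "poly.coeff g ?d" and ?c' = "poly.coeff h ?d"
   let ?g = "g - monom ?c (?d - n) * m" and ?h = "h - monom ?c' (?d - n) * k"
   have c: "(?c, ?c') : r" using less.prems by (auto simp: P_def)
   have P': "(?g, ?h) : P" by (intro Pdiff Pmult Pmon c mk less.prems)
   have z: "poly ?g x = 0" using less.prems m by simp
   have "Polynomial.degree ?g \<le> ?d"
    using \<open>n \<le> ?d\<close> m(2) by (intro degree_diff_le order.trans[OF degree_mult_le]) (auto simp: degree_monom_eq False)
   moreover have "poly.coeff ?g ?d = 0" using \<open>n \<le> ?d\<close> m by (simp add: coeff_monom_mult)
   ultimately have "?g = 0 \<or> Polynomial.degree ?g < ?d" by (rule eq_zero_or_degree_less)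
   then have "poly ?h y = 0"
   proof
    assume "?g = 0" then have "?h = 0" using P' P0 by metis
    then show ?thesis by simp
   qed (use less.hyps P' z in blast)
   then show ?thesis using y by simp
  qed
 qed
 have "(a, a') : r'" if "(a, a') : r" for a a'
  unfolding r'_def using Pmon[OF that, of 0] by (force simp: monom_0)
 then have sub: "r <= r'" by auto
 have "graph_alg r'" unfolding graph_alg_def
 proof (intro conjI allI impI)
  show "(to_ac a, to_ac a) : r'" for a using sub rK by blast
  fix a a' b b' assume "(a, a') : r'" "(b, b') : r'"
  then obtain g h g' h' where *: "(g, h) : P" "(g', h') : P" "a = poly g x" "a' = poly h y" "b = poly g' x" "b' = poly h' y"
   unfolding r'_def by blast
  show "(a + b, a' + b') : r'" using Padd[OF *(1,2)] * unfolding r'_def by force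
  show "(a * b, a' * b') : r'" using Pmult[OF *(1,2)] * unfolding r'_def by force
 qed
 moreover have "\<forall>z. (0, z) : r' \<longrightarrow> z = 0" using sv unfolding r'_def by auto
 moreover have "(x, y) : r'" unfolding r'_def using Pmon[OF r11, of 1] by (force simp: poly_monom)
 ultimately show ?thesis using sub unfolding partial_hom_def by blast
qed

text \<open>Zorn's lemma on graphs ordered by inclusion; a maximal one is total by
  \<open>partial_hom_extend\<close>.\<close>

lemma partial_hom_total:
 fixes r0 :: "('a::field alg_closure \<times> 'a alg_closure) set"
 assumes r0: "partial_hom r0"
 obtains s where "\<And>x y. s (x + y) = s x + s y" "\<And>x y. s (x * y) = s x * s y" "\<And>a. s (to_ac a) = to_ac a"
  "\<And>x y. (x, y) : r0 ==> s x = y"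
proof -
 define A where "A = {r. partial_hom r \<and> r0 <= r}"
 have "\<exists>M\<in>A. \<forall>Z\<in>A. M <= Z \<longrightarrow> Z = M"
 proof (rule subset_Zorn_nonempty)
  show "A ~= {}" using r0 by (auto simp: A_def)
  fix C assume C: "C ~= {}" "subset.chain A C"
  then have CA: "C <= A" and lin: "\<And>r s. r : C ==> s : C ==> r <= s \<or> s <= r"
   by (auto simp: subset.chain_def subset_chain_def)
  obtain r1 where r1: "r1 : C" using C by blast
  have "graph_alg (\<Union>C)" unfolding graph_alg_def
  proof (intro conjI allI impI)
   show "(to_ac a, to_ac a) : \<Union>C" for a
    by (intro UnionI[OF r1]) (use r1 CA in "auto simp: A_def partial_hom_def graph_alg_def")
   fix x x' y y' assume "(x, x') : \<Union>C" "(y, y') : \<Union>C"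
   then obtain r s where "r : C" "s : C" "(x, x') : r" "(y, y') : s" by blast
   then obtain t where t: "t : C" "(x, x') : t" "(y, y') : t" using lin by blast
   then have "graph_alg t" using CA by (auto simp: A_def partial_hom_def)
   then have "(x + y, x' + y') : t" "(x * y, x' * y') : t" using t unfolding graph_alg_def by blast+
   then show "(x + y, x' + y') : \<Union>C" "(x * y, x' * y') : \<Union>C" using t by blast+
  qed
  moreover have "r0 <= \<Union>C" using r1 CA by (auto simp: A_def)
  moreover have "\<forall>y. (0, y) : \<Union>C \<longrightarrow> y = 0" using CA by (auto simp: A_def partial_hom_def)
  ultimately show "\<Union>C \<in> A" by (simp add: A_def partial_hom_def)
 qed
 then obtain r where r: "partial_hom r" "r0 <= r" and max: "\<And>Z. Z : A ==> r <= Z ==> Z = r"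
  by (auto simp: A_def)
 have total: "\<exists>y. (x, y) : r" for x
 proof -
  obtain r' y where r': "partial_hom r'" "r <= r'" "(x, y) : r'" using partial_hom_extend[OF r(1)] by blast
  then have "r' = r" using max[of r'] r(2) by (auto simp: A_def)
  then show ?thesis using r' by blast
 qed
 then obtain s where s: "\<And>x. (x, s x) : r" by metis
 have eq: "s x = y" if "(x, y) : r" for x y using partial_hom_unique[OF r(1) s that] .
 have ga: "graph_alg r" using r by (simp add: partial_hom_def)
 show thesis
 proof
  show "s (x + y) = s x + s y" "s (x * y) = s x * s y" for x y
   using ga s unfolding graph_alg_def by (blast intro: eq)+
  show "s (to_ac a) = to_ac a" for a using ga unfolding graph_alg_def by (blast intro: eq)
  show "s x = y" if "(x, y) : r0" for x y using r(2) that by (blast intro: eq)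
 qed
qed

section \<open>The absolute Galois group and its characters\<close>

text \<open>Dedekind's argument for maps that are multiplicative on a set \<open>M\<close> and
  distinguished by it. In the application \<open>M\<close> consists of the elements fixed by all
  automorphisms that fix a given finite set.\<close>

lemma dedekind_independence:
 fixes c :: "('a::comm_monoid_mult => 'b::field) => 'b" and M :: "'a set"
 assumes "finite A" and M: "1 : M" "\<And>x y. x : M ==> y : M ==> x * y : M"
  and "\<And>f. f : A ==> f 1 = 1" "\<And>f x y. f : A ==> x : M ==> y : M ==> f (x * y) = f x * f y"
  and "\<And>f g. f : A ==> g : A ==> f ~= g ==> \<exists>x\<in>M. f x ~= g x"
  and "\<And>x. x : M ==> (\<Sum>f\<in>A. c f * f x) = 0"
 shows "f : A ==> c f = 0"
 using assms(1,4-)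
proof (induction A arbitrary: c f)
 case (insert g A)
 have 1: "d f = 0" if "f : A" "\<And>x. x : M ==> (\<Sum>f\<in>A. d f * f x) = 0" for d f
  by (rule insert.IH[OF that(1)]) (use insert.prems that(2) in auto)
 have sum: "c g * g x = - (\<Sum>f\<in>A. c f * f x)" if "x : M" for x
  using insert.prems(5)[OF that] insert.hyps by (simp add: eq_neg_iff_add_eq_0)
 have A: "c f = 0" if f: "f : A" for f
 proof -
  have "f ~= g" using insert.hyps f by auto
  then obtain y where y: "y : M" "f y ~= g y" using insert.prems(4) f by blast
  have "(\<Sum>f\<in>A. (c f * (f y - g y)) * f x) = 0" if x: "x : M" for x
  proof -
   have "(\<Sum>f\<in>A. (c f * (f y - g y)) * f x) = (\<Sum>f\<in>A. c f * f (x * y)) - g y * (\<Sum>f\<in>A. c f * f x)"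
    unfolding sum_distrib_left sum_subtractf[symmetric]
    by (rule sum.cong) (use insert.prems(3) x y in "auto simp: algebra_simps")
   also have "\<dots> = - (c g * g (x * y)) + g y * (c g * g x)"
    using sum[OF x] sum[OF M(2)[OF x y(1)]] by simp
   also have "\<dots> = 0" using insert.prems(3)[of g x y] x y by simp
   finally show ?thesis .
  qed
  then have "c f * (f y - g y) = 0" by (rule 1[OF f, of "%f. c f * (f y - g y)"])
  then show ?thesis using y by simp
 qed
 have "c g = 0" using sum[OF M(1)] A insert.prems(2)[of g] by simp
 then show ?case using A insert.prems(1) by auto
qed simp

lemma abs_gal_mult: "sg : carrier abs_gal ==> tu : carrier abs_gal ==> sg \<otimes>\<^bsub>abs_gal\<^esub> tu = compose sep_closure sg tu"
 by (simp add: abs_gal_def BijGroup_def)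

lemma abs_gal_one: "\<one>\<^bsub>abs_gal\<^esub> = (\<lambda>x\<in>sep_closure. x)"
 by (simp add: abs_gal_def BijGroup_def)

lemma abs_galD:
 assumes "sg : carrier abs_gal"
 shows "sg : Bij sep_closure" "x : sep_closure ==> sg x : sep_closure"
  "x : sep_closure ==> y : sep_closure ==> sg (x + y) = sg x + sg y"
  "x : sep_closure ==> y : sep_closure ==> sg (x * y) = sg x * sg y"
  "sg (to_ac a) = to_ac a"
 using assms Bij_imp_funcset[of sg] by (auto simp: abs_gal_def)

lemma abs_gal_mult_apply:
 "sg : carrier abs_gal ==> tu : carrier abs_gal ==> x : sep_closure ==> (sg \<otimes>\<^bsub>abs_gal\<^esub> tu) x = sg (tu x)"
 by (simp add: abs_gal_mult compose_def)

context
 fixes p :: nat and ty :: "'a::field itself"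
 assumes p: "Factorial_Ring.prime p" and ch: "CHAR('a) = p"
begin

private abbreviation (input) "S \<equiv> sep_closure :: 'a alg_closure set"
private abbreviation (input) "G \<equiv> abs_gal :: ('a alg_closure => 'a alg_closure) monoid"

lemmas sepI = sep_closed[OF p ch] to_ac_sep[OF p ch]

lemma group_abs_gal: "group G"
proof -
 interpret B: group "BijGroup S" by (rule group_BijGroup)
 have "subgroup (carrier G) (BijGroup S)"
 proof (rule B.subgroupI)
  show "carrier G <= carrier (BijGroup S)" by (auto simp: abs_gal_def BijGroup_def)
  have "(\<lambda>x\<in>S. x) : carrier G"
   by (auto simp: abs_gal_def id_Bij sepI)
  then show "carrier G ~= {}" by blast
 next
  fix sg assume s: "sg : carrier G"
  note sD = abs_galD[OF s]
  let ?t = "\<lambda>x\<in>S. inv_into S sg x"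
  have t: "?t x : S" "sg (?t x) = x" if "x : S" for x
   using sD(1) that by (auto simp: Bij_def bij_betw_def inv_into_into f_inv_into_f)
  have inj: "x = y" if "sg x = sg y" "x : S" "y : S" for x y
   using sD(1) that by (auto simp: Bij_def bij_betw_def inj_on_def)
  have "?t (x + y) = ?t x + ?t y" "?t (x * y) = ?t x * ?t y" if "x : S" "y : S" for x y
   by (rule inj; use that t sD(3,4) in "simp add: sepI del: restrict_apply")+
  moreover have "?t (to_ac a) = to_ac a" for a
   by (rule inj; use t sD(5) in "simp add: sepI del: restrict_apply")
  ultimately have "?t : carrier G"
   using restrict_inv_into_Bij[OF sD(1)] by (auto simp: abs_gal_def simp del: restrict_apply)
  then show "inv\<^bsub>BijGroup S\<^esub> sg : carrier G" using inv_BijGroup[OF sD(1)] by simp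
 next
  fix sg tu assume st: "sg : carrier G" "tu : carrier G"
  have "sg \<otimes>\<^bsub>BijGroup S\<^esub> tu = compose S sg tu" using st by (simp add: BijGroup_def abs_galD(1))
  moreover have "compose S sg tu : Bij S" using st by (intro compose_Bij abs_galD(1))
  then have "compose S sg tu : carrier G"
   using st by (simp add: abs_gal_def[where ?'a = 'a]) (simp add: compose_def sepI abs_galD st)
  ultimately show "sg \<otimes>\<^bsub>BijGroup S\<^esub> tu : carrier G" by simp
 qed
 then have "group ((BijGroup S)\<lparr>carrier := carrier G\<rparr>)" by (rule B.subgroup_imp_group)
 moreover have "(BijGroup S)\<lparr>carrier := carrier G\<rparr> = G" by (simp add: abs_gal_def)
 ultimately show ?thesis by (rule back_subst[of "group"])
qed

lemma gal_0: "sg : carrier G ==> sg 0 = 0"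
 using abs_galD(5)[of sg 0] by simp

lemma gal_1: "sg : carrier G ==> sg 1 = 1"
 using abs_galD(5)[of sg 1] by simp

lemma gal_rng_hom: "sg : carrier G ==> rng_hom_on S sg"
 using abs_galD[of sg] by (auto simp: rng_hom_on_def)

lemma gal_sum:
 "sg : carrier G ==> (\<And>i. i : A ==> f i : S) ==> (\<Sum>i\<in>A. f i) : S \<and> sg (\<Sum>i\<in>A. f i) = (\<Sum>i\<in>A. sg (f i))"
 by (induction A rule: infinite_finite_induct) (use to_ac_sep[OF p ch, of 0] in "auto simp: gal_0 sepI abs_galD(3)")

lemma gal_aev: "sg : carrier G ==> x : S ==> aev f x : S \<and> sg (aev f x) = aev f (sg x)"
 by (induction f) (use to_ac_sep[OF p ch, of 0] in "auto simp: aev_pCons gal_0 sepI abs_galD")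

lemma gal_conjugates:
 assumes s: "sg : carrier G" and x: "x : S" and y: "y : conjugates x"
 shows "sg y : conjugates x"
 using gal_aev[OF s conjugates_sep[OF x y]] gal_0[OF s] y unfolding conjugates_def mem_Collect_eq by metis

text \<open>A second conjugate y of x gives a partial homomorphism from K[x] to K[y], which extends
  to the whole algebraic closure. Its restriction is an automorphism of the separable closure
  because it permutes every finite set of conjugates, and it moves x.\<close>

lemma fixed_field:
 assumes x: "x : S" and inv: "\<And>sg. sg : carrier G ==> sg x = x"
 shows "x : range to_ac"
proof (rule ccontr)
 assume "x \<notin> range to_ac"
 then obtain y where y: "y : conjugates x" "y ~= x" using conjugate_exists[OF x] by blast
 \<comment> \<open>Single-valued on K[x] because every polynomial vanishing at x vanishes at
   y.\<close>
 define r where "r = {(aev g x, aev g y) | g. True}"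
 have r: "(aev g x, aev g y) : r" for g unfolding r_def by blast
 have "partial_hom r" unfolding partial_hom_def graph_alg_def
 proof (intro conjI allI impI)
  show "(to_ac a, to_ac a) : r" for a using r[of "[:a:]"] by simp
  show "(a + b, a' + b') : r" "(a * b, a' * b') : r" if ab: "(a, a') : r" "(b, b') : r" for a a' b b'
  proof -
   obtain g h where "a = aev g x" "a' = aev g y" "b = aev h x" "b' = aev h y"
    using ab unfolding r_def by blast
   then show "(a + b, a' + b') : r" "(a * b, a' * b') : r"
    using r[of "g + h"] r[of "g * h"] by (simp_all add: aev_add aev_mult)
  qed
  show "z = 0" if "(0, z) : r" for z using that y(1) unfolding r_def conjugates_def by force
 qed
 then obtain s where s: "\<And>x y. s (x + y) = s x + s y" "\<And>x y. s (x * y) = s x * s y" "\<And>a. s (to_ac a) = to_ac a"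
  and sr: "\<And>x y. (x, y) : r ==> s x = y" using partial_hom_total by metis
 have "aev (monom 1 1) x = x" "aev (monom 1 1) y = y" by simp_all
 then have "(x, y) : r" using r[of "monom 1 1"] by simp
 then have sx: "s x = y" by (rule sr)
 have s0: "s 0 = 0" and s1: "s 1 = 1" using s(3)[of 0] s(3)[of 1] by simp_all
 have aev: "s (aev f z) = aev f (s z)" for f z
  by (induction f) (simp_all add: aev_pCons s s0)
 have inj: "inj s"
 proof (rule injI)
  fix a b assume "s a = s b"
  then have e: "s (a - b) = 0" using s(1)[of "a - b" b] by simp
  show "a = b"
  proof (rule ccontr)
   assume "a ~= b"
   then have "s ((a - b) * inverse (a - b)) = 1" by (simp add: s1)
   then show False by (simp add: s(2) e)
  qed
 qed
 \<comment> \<open>An injective self-map of a finite set is onto; this is where surjectivity of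
   \<open>s\<close> on the separable closure comes from.\<close>
 have conj: "s ` conjugates z = conjugates z" for z
 proof (rule endo_inj_surj[OF finite_conjugates])
  show "s ` conjugates z <= conjugates z"
  proof (rule image_subsetI)
   fix w assume w: "w : conjugates z"
   then have "aev f (s w) = s (aev f w)" "aev f z = 0 ==> aev f w = 0" for f
    by (auto simp: aev conjugates_def)
   then show "s w : conjugates z" by (simp add: conjugates_def s0)
  qed
  show "inj_on s (conjugates z)" using inj by (rule inj_on_subset) simp
 qed
 have "s ` S = S"
 proof
  show "s ` S <= S"
  proof (rule image_subsetI)
   fix z assume z: "z : S"
   have "s z : conjugates z" using conj[of z] conjugates_self[of z] by blast
   then show "s z : S" by (rule conjugates_sep[OF z])
  qed
  show "S <= s ` S"
  proof
   fix z assume z: "z : S"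
   obtain w where "w : conjugates z" "z = s w" using conj[of z] conjugates_self[of z] by blast
   then show "z : s ` S" using conjugates_sep[OF z] by blast
  qed
 qed
 then have "bij_betw s S S" using inj by (auto simp: bij_betw_def intro: inj_on_subset)
 then have "restrict s S : Bij S" by (auto simp: Bij_def bij_betw_restrict_eq)
 then have "restrict s S : carrier G" by (auto simp: abs_gal_def sepI s)
 then have "restrict s S x = x" by (rule inv)
 then show False using x sx y by simp
qed

text \<open>Finite Galois-stable sets play the role of finite Galois subextensions.\<close>

lemma stable_superset:
 assumes "finite T" "T <= S"
 obtains T' where "finite T'" "T <= T'" "T' <= S" "\<And>sg x. sg : carrier G ==> x : T' ==> sg x : T'"
proof
 let ?T = "\<Union>x\<in>T. conjugates x"
 show "finite ?T" using assms finite_conjugates by blast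
 show "T <= ?T" using conjugates_self by blast
 show "?T <= S" using assms conjugates_sep by blast
 show "sg x : ?T" if "sg : carrier G" "x : ?T" for sg x using that gal_conjugates assms by blast
qed

text \<open>Automorphisms that agree on \<open>T\<close> differ by one that fixes \<open>T\<close>
  pointwise, and on such an automorphism all data of the finite level given by \<open>T\<close> are
  trivial.\<close>

lemma gal_eq_on:
 assumes s: "sg : carrier G" "tu : carrier G" and T: "T <= S" and eq: "\<And>x. x : T ==> sg x = tu x"
 shows "inv\<^bsub>G\<^esub> tu \<otimes>\<^bsub>G\<^esub> sg : carrier G" "x : T ==> (inv\<^bsub>G\<^esub> tu \<otimes>\<^bsub>G\<^esub> sg) x = x" "tu \<otimes>\<^bsub>G\<^esub> (inv\<^bsub>G\<^esub> tu \<otimes>\<^bsub>G\<^esub> sg) = sg"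
proof -
 interpret G: group G by (rule group_abs_gal)
 show "inv\<^bsub>G\<^esub> tu \<otimes>\<^bsub>G\<^esub> sg : carrier G" using s by simp
 show "tu \<otimes>\<^bsub>G\<^esub> (inv\<^bsub>G\<^esub> tu \<otimes>\<^bsub>G\<^esub> sg) = sg" using s by (simp add: G.m_assoc[symmetric])
 assume x: "x : T"
 then have xS: "x : S" using T by blast
 have "(inv\<^bsub>G\<^esub> tu \<otimes>\<^bsub>G\<^esub> sg) x = (inv\<^bsub>G\<^esub> tu) (tu x)" using s xS eq[OF x] by (simp add: abs_gal_mult_apply)
 also have "\<dots> = (inv\<^bsub>G\<^esub> tu \<otimes>\<^bsub>G\<^esub> tu) x"
  using s xS by (subst abs_gal_mult_apply) auto
 also have "\<dots> = x" using s xS by (simp add: abs_gal_one)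
 finally show "(inv\<^bsub>G\<^esub> tu \<otimes>\<^bsub>G\<^esub> sg) x = x" .
qed

text \<open>The additive map b has values in the base field and factors through a finite quotient.
  Independence of the finitely many restrictions gives an element \<open>tht\<close> of nonzero
  trace, and minus the sum of all b(al) al(tht), divided by the trace, is the required z.\<close>

lemma additive_hilbert_90:
 assumes b: "\<And>sg tu. sg : carrier G ==> tu : carrier G ==> b (sg \<otimes>\<^bsub>G\<^esub> tu) = b sg + b tu"
  and bK: "\<And>sg. sg : carrier G ==> b sg : range to_ac"
  and T0: "finite T0" "T0 <= S" and bT: "\<And>sg. sg : carrier G ==> (\<And>x. x : T0 ==> sg x = x) ==> b sg = 0"
 shows "\<exists>z\<in>S. \<forall>sg\<in>carrier G. sg z - z = b sg"
proof -
 interpret G: group G by (rule group_abs_gal)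
 obtain T where T: "finite T" "T0 <= T" "T <= S" and stable: "\<And>sg x. sg : carrier G ==> x : T ==> sg x : T"
  using stable_superset[OF T0] by metis
 \<comment> \<open>The fixed elements of the subgroup fixing \<open>T\<close> pointwise: on them an
   automorphism depends only on its restriction to the finite stable set \<open>T\<close>.\<close>
 define M where "M = {tht : S. \<forall>tu\<in>carrier G. (\<forall>x\<in>T. tu x = x) \<longrightarrow> tu tht = tht}"
 have MS: "M <= S" by (auto simp: M_def)
 have M1: "1 : M" using to_ac_sep[OF p ch, of 1] by (auto simp: M_def gal_1)
 have Mmult: "x * y : M" if "x : M" "y : M" for x y
  using that by (auto simp: M_def sepI abs_galD(4))
 have TM: "T <= M" using T(3) by (auto simp: M_def)
 have eqM: "sg tht = tu tht" and eqb: "b sg = b tu"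
  if st: "sg : carrier G" "tu : carrier G" and e: "\<And>x. x : T ==> sg x = tu x" and th: "tht : M" for sg tu tht
 proof -
  let ?r = "inv\<^bsub>G\<^esub> tu \<otimes>\<^bsub>G\<^esub> sg"
  note r = gal_eq_on[OF st T(3) e]
  have "?r tht = tht" using th r(1,2) by (auto simp: M_def)
  then show "sg tht = tu tht" using abs_gal_mult_apply[OF st(2) r(1), of tht] r(3) th MS by auto
  have "b ?r = 0" using r(1,2) T(2) by (intro bT) auto
  then show "b sg = b tu" using b[OF st(2) r(1)] r(3) by simp
 qed
 define R where "R = (%sg. restrict sg T) ` carrier G"
 have "R <= T \<rightarrow>\<^sub>E T" using stable by (auto simp: R_def)
 then have finR: "finite R" using finite_PiE[of T "%_. T"] T(1) finite_subset by blast
 have "\<forall>ro\<in>R. \<exists>sg. sg : carrier G \<and> restrict sg T = ro" by (auto simp: R_def)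
 from bchoice[OF this] obtain rep where rep: "\<And>ro. ro : R ==> rep ro : carrier G" "\<And>ro. ro : R ==> restrict (rep ro) T = ro"
  by blast
 \<comment> \<open>One representative for each of the finitely many restrictions to
   \<open>T\<close>, so \<open>A\<close> stands for the finite quotient group; \<open>\<pi>\<close>
   below replaces an automorphism by its representative.\<close>
 define A where "A = rep ` R"
 have finA: "finite A" and AG: "A <= carrier G" using finR rep by (auto simp: A_def)
 define \<pi> where "\<pi> = (%sg. rep (restrict sg T))"
 have pi: "\<pi> sg : A" "\<pi> sg : carrier G" "x : T ==> \<pi> sg x = sg x" if "sg : carrier G" for sg x
  using rep that unfolding A_def R_def \<pi>_def by (blast, blast, metis image_eqI restrict_apply)
 have A_eq: "sg = tu" if st: "sg : A" "tu : A" and e: "\<And>x. x : T ==> sg x = tu x" for sg tu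
 proof -
  obtain ro ro' where r: "ro : R" "sg = rep ro" "ro' : R" "tu = rep ro'" using st unfolding A_def by blast
  have "restrict sg T = restrict tu T" using e by (intro restrict_ext) auto
  then have "ro = ro'" using r rep(2) by simp
  then show ?thesis using r by simp
 qed
 have "A ~= {}" using pi(1)[OF G.one_closed] by blast
 have "\<exists>tht\<in>M. (\<Sum>al\<in>A. al tht) ~= 0"
 proof (rule ccontr)
  assume "\<not> ?thesis"
  then have "(\<Sum>al\<in>A. 1 * al tht) = 0" if "tht : M" for tht using that by simp
  note * = dedekind_independence[OF finA M1 Mmult _ _ _ this]
  obtain al where "al : A" using \<open>A ~= {}\<close> by blast
  then have "(1::'a alg_closure) = 0"
  proof (rule *[rotated -1])
   show "f 1 = 1" if "f : A" for f using that AG gal_1 by blast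
   show "f (x * y) = f x * f y" if "f : A" "x : M" "y : M" for f x y using that AG MS abs_galD(4) by blast
   show "\<exists>x\<in>M. f x ~= g x" if "f : A" "g : A" "f ~= g" for f g using that A_eq TM by blast
  qed
  then show False by simp
 qed
 then obtain tht where tht: "tht : M" and tr: "(\<Sum>al\<in>A. al tht) ~= 0" by blast
 have thtS: "tht : S" using tht MS by blast
 have atht: "al tht : S" if "al : A" for al using that AG thtS abs_galD(2) by blast
 \<comment> \<open>Left multiplication permutes the finite quotient, so sums over \<open>A\<close>
   can be reindexed; injectivity and finiteness give bijectivity.\<close>
 have perm: "(\<Sum>al\<in>A. h (\<pi> (sg \<otimes>\<^bsub>G\<^esub> al))) = (\<Sum>al\<in>A. h al)" if s: "sg : carrier G" for sg and h :: "_ => 'a alg_closure"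
 proof -
  let ?f = "%al. \<pi> (sg \<otimes>\<^bsub>G\<^esub> al)"
  have "inj_on ?f A"
  proof (rule inj_onI)
   fix al bt assume ab: "al : A" "bt : A" "?f al = ?f bt"
   then have abG: "al : carrier G" "bt : carrier G" using AG by auto
   show "al = bt"
   proof (rule A_eq[OF ab(1,2)])
    fix x assume x: "x : T"
    have "(sg \<otimes>\<^bsub>G\<^esub> al) x = (sg \<otimes>\<^bsub>G\<^esub> bt) x"
     using pi(3)[OF G.m_closed[OF s abG(1)] x] pi(3)[OF G.m_closed[OF s abG(2)] x] ab(3) by simp
    then have "sg (al x) = sg (bt x)" using s abG x T(3) by (auto simp: abs_gal_mult_apply)
    moreover have "al x : S" "bt x : S" using abG x T(3) abs_galD(2) by blast+
    moreover have "inj_on sg S" using abs_galD(1)[OF s] by (auto simp: Bij_def bij_betw_def)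
    ultimately show "al x = bt x" by (auto dest: inj_onD)
   qed
  qed
  moreover have "?f ` A <= A" using s AG by (auto intro!: pi(1))
  ultimately have "bij_betw ?f A A" using endo_inj_surj[OF finA] by (auto simp: bij_betw_def)
  then show ?thesis by (rule sum.reindex_bij_betw)
 qed
 have act: "sg (al tht) = \<pi> (sg \<otimes>\<^bsub>G\<^esub> al) tht" "b al = b (\<pi> (sg \<otimes>\<^bsub>G\<^esub> al)) - b sg"
  if s: "sg : carrier G" and a: "al : A" for sg al
 proof -
  have aG: "al : carrier G" using a AG by blast
  have "sg (al tht) = (sg \<otimes>\<^bsub>G\<^esub> al) tht" using s aG thtS by (simp add: abs_gal_mult_apply)
  also have "\<dots> = \<pi> (sg \<otimes>\<^bsub>G\<^esub> al) tht"
   by (rule eqM) (use s aG tht in "auto simp: pi")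
  finally show "sg (al tht) = \<pi> (sg \<otimes>\<^bsub>G\<^esub> al) tht" .
  have "b (sg \<otimes>\<^bsub>G\<^esub> al) = b (\<pi> (sg \<otimes>\<^bsub>G\<^esub> al))"
   by (rule eqb[OF _ _ _ tht]) (use s aG in "auto simp: pi")
  then show "b al = b (\<pi> (sg \<otimes>\<^bsub>G\<^esub> al)) - b sg" using b[OF s aG] by (simp add: eq_diff_eq add.commute)
 qed
 let ?t = "\<Sum>al\<in>A. al tht"
 have tS: "?t : S" using gal_sum[OF G.one_closed, of A "%al. al tht"] atht by blast
 have "sg ?t = ?t" if s: "sg : carrier G" for sg
 proof -
  have "sg ?t = (\<Sum>al\<in>A. sg (al tht))" using gal_sum[OF s, of A "%al. al tht"] atht by blast
  also have "\<dots> = (\<Sum>al\<in>A. \<pi> (sg \<otimes>\<^bsub>G\<^esub> al) tht)" using act(1)[OF s] by (intro sum.cong) auto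
  also have "\<dots> = ?t" by (rule perm[OF s, of "%al. al tht"])
  finally show ?thesis .
 qed
 then have "?t : range to_ac" by (rule fixed_field[OF tS])
 then obtain c where c: "?t = to_ac c" by blast
 have bS: "b sg : S" "tu (b sg) = b sg" if "sg : carrier G" "tu : carrier G" for sg tu
  using bK[OF that(1)] abs_galD(5)[OF that(2)] to_ac_sep[OF p ch] by auto
 let ?w = "\<Sum>al\<in>A. b al * al tht"
 have ba: "b al * al tht : S" if "al : A" for al
  by (rule sepI(3)[OF bS(1)[OF subsetD[OF AG that] G.one_closed] atht[OF that]])
 have w: "?w : S" and sw: "sg ?w = (\<Sum>al\<in>A. sg (b al * al tht))" if s: "sg : carrier G" for sg
  using gal_sum[OF s, of A "%al. b al * al tht"] ba by blast+
 have sw': "sg ?w = ?w - b sg * ?t" if s: "sg : carrier G" for sg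
 proof -
  have "sg (b al * al tht) = b (\<pi> (sg \<otimes>\<^bsub>G\<^esub> al)) * \<pi> (sg \<otimes>\<^bsub>G\<^esub> al) tht - b sg * \<pi> (sg \<otimes>\<^bsub>G\<^esub> al) tht" if a: "al : A" for al
  proof -
   have aG: "al : carrier G" using a AG by blast
   have "sg (b al * al tht) = b al * sg (al tht)" using abs_galD(4)[OF s bS(1)[OF aG s] atht[OF a]] bS(2)[OF aG s] by simp
   then show ?thesis using act[OF s a] by (simp add: left_diff_distrib)
  qed
  then have "sg ?w = (\<Sum>al\<in>A. b (\<pi> (sg \<otimes>\<^bsub>G\<^esub> al)) * \<pi> (sg \<otimes>\<^bsub>G\<^esub> al) tht - b sg * \<pi> (sg \<otimes>\<^bsub>G\<^esub> al) tht)"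
   unfolding sw[OF s] by (intro sum.cong) auto
  also have "\<dots> = (\<Sum>al\<in>A. b al * al tht - b sg * al tht)"
   by (rule perm[OF s, of "%al. b al * al tht - b sg * al tht"])
  finally show ?thesis by (simp add: sum_subtractf sum_distrib_left)
 qed
 \<comment> \<open>The trace c is invariant, hence in the base field. The sign is forced:
   \<open>sg\<close> changes the weighted sum by -b(sg) times the trace.\<close>
 define z where "z = to_ac (- inverse c) * ?w"
 have zS: "z : S" unfolding z_def by (intro sepI w[OF G.one_closed])
 moreover have "sg z - z = b sg" if s: "sg : carrier G" for sg
 proof -
  have "sg z = to_ac (- inverse c) * (?w - b sg * ?t)"
   unfolding z_def abs_galD(4)[OF s to_ac_sep[OF p ch] w[OF s]] abs_galD(5)[OF s] sw'[OF s] ..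
  also have "\<dots> = z + b sg" using tr unfolding c z_def by (simp add: algebra_simps)
  finally show ?thesis by simp
 qed
 ultimately show ?thesis by blast
qed

section \<open>The Krull topology and continuous characters\<close>

lemma topspace_krull: "topspace (krull :: ('a alg_closure => 'a alg_closure) topology) = carrier G"
proof -
 have "sg : topspace krull" if "sg : carrier G" for sg :: "'a alg_closure => 'a alg_closure"
  using that unfolding krull_def topology_generated_by_topspace by blast
 then show ?thesis unfolding krull_def topology_generated_by_topspace by blast
qed

text \<open>Induction over the generation of the topology; for an intersection the two finite sets
  are united.\<close>

lemma krull_nhd:
 assumes "openin krull U" "sg : U"
 shows "\<exists>T. finite T \<and> T <= S \<and> (\<forall>tu\<in>carrier G. (\<forall>x\<in>T. tu x = sg x) \<longrightarrow> tu : U)"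
proof -
 have "generate_topology_on {{tu : carrier G. \<forall>x\<in>T. tu x = sg x} | sg T. sg : carrier G \<and> finite T \<and> T <= S} U"
  using assms(1) by (simp add: krull_def openin_topology_generated_by_iff)
 then show ?thesis using assms(2)
 proof (induction arbitrary: sg)
  case (Int U V)
  obtain T where "finite T" "T <= S" "\<forall>tu\<in>carrier G. (\<forall>x\<in>T. tu x = sg x) \<longrightarrow> tu : U"
   using Int.IH(1)[of sg] Int.prems by blast
  moreover obtain T' where "finite T'" "T' <= S" "\<forall>tu\<in>carrier G. (\<forall>x\<in>T'. tu x = sg x) \<longrightarrow> tu : V"
   using Int.IH(2)[of sg] Int.prems by blast
  ultimately show ?case by (intro exI[of _ "T \<union> T'"]) auto
 next
  case (UN K)
  then obtain k where "k : K" "sg : k" by blast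
  then show ?case using UN.IH[of k sg] by blast
 next
  case (Basis U)
  then obtain ro T where T: "U = {tu : carrier G. \<forall>x\<in>T. tu x = ro x}" "finite T" "T <= S" by blast
  then show ?case using Basis.prems by (intro exI[of _ T]) auto
 qed simp
qed

text \<open>Continuity into a discrete group means that the kernel contains all elements fixing some
  finite set, by translating neighbourhoods of the identity. All later uses of the topology go
  through this form.\<close>

lemma h1_iff:
 assumes A: "group A"
 shows "chi : carrier (h1 A) \<longleftrightarrow> chi : hom G A \<and> chi : extensional (carrier G) \<and>
  (\<exists>T. finite T \<and> T <= S \<and> (\<forall>sg\<in>carrier G. (\<forall>x\<in>T. sg x = x) \<longrightarrow> chi sg = \<one>\<^bsub>A\<^esub>))" (is "?l \<longleftrightarrow> ?r")
proof
 interpret G: group G by (rule group_abs_gal)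
 interpret A: group A by (rule A)
 assume l: ?l
 then have h: "chi : hom G A" "chi : extensional (carrier G)" and c: "continuous_map krull (discrete_topology (carrier A)) chi"
  by (auto simp: h1_def)
 interpret X: group_hom G A chi by (simp add: group_hom_def group_hom_axioms_def h G.is_group A)
 let ?U = "{sg : topspace krull. chi sg : {\<one>\<^bsub>A\<^esub>}}"
 have *: "openin krull ?U" using c by (rule openin_continuous_map_preimage) simp
 have "\<one>\<^bsub>G\<^esub> : ?U" by (simp add: topspace_krull)
 from krull_nhd[OF *(1) this] obtain T where T: "finite T" "T <= S" "\<forall>tu\<in>carrier G. (\<forall>x\<in>T. tu x = \<one>\<^bsub>G\<^esub> x) \<longrightarrow> tu : ?U"
  by blast
 have "chi sg = \<one>\<^bsub>A\<^esub>" if "sg : carrier G" "\<forall>x\<in>T. sg x = x" for sg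
 proof -
  have "\<forall>x\<in>T. sg x = \<one>\<^bsub>G\<^esub> x" using that T(2) by (auto simp: abs_gal_one)
  then show ?thesis using T(3) that(1) by auto
 qed
 then show ?r using h T by blast
next
 interpret G: group G by (rule group_abs_gal)
 interpret A: group A by (rule A)
 assume r: ?r
 then have h: "chi : hom G A" "chi : extensional (carrier G)" by auto
 interpret X: group_hom G A chi by (simp add: group_hom_def group_hom_axioms_def h G.is_group A)
 obtain T where T: "finite T" "T <= S" and chi: "\<forall>sg\<in>carrier G. (\<forall>x\<in>T. sg x = x) \<longrightarrow> chi sg = \<one>\<^bsub>A\<^esub>"
  using r by blast
 have "openin krull {sg : topspace krull. chi sg : U}" for U
 proof -
  let ?B = "%sg. {tu : carrier G. \<forall>x\<in>T. tu x = sg x}"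
  have open_B: "openin krull (?B sg)" if "sg : carrier G" for sg
   unfolding krull_def by (rule topology_generated_by_Basis) (use that T in blast)
  have eq: "chi tu = chi sg" if s: "sg : carrier G" "tu : carrier G" "\<forall>x\<in>T. tu x = sg x" for sg tu
  proof -
   note g = gal_eq_on[OF s(2,1) T(2), OF s(3)[rule_format]]
   have "chi (inv\<^bsub>G\<^esub> sg \<otimes>\<^bsub>G\<^esub> tu) = \<one>\<^bsub>A\<^esub>" using chi g(1,2) by blast
   then show ?thesis using X.hom_mult[OF s(1) g(1)] g(3) s by simp
  qed
  have "chi tu : U" if "sg : carrier G" "chi sg : U" "tu : ?B sg" for sg tu
   using eq[of sg tu] that by simp
  then have "{sg : topspace krull. chi sg : U} = (\<Union>sg\<in>{sg : carrier G. chi sg : U}. ?B sg)"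
   unfolding topspace_krull by blast
  then show ?thesis using open_B by auto
 qed
 moreover have "chi : topspace krull \<rightarrow> carrier A" using X.hom_closed by (auto simp: topspace_krull)
 ultimately have "continuous_map krull (discrete_topology (carrier A)) chi"
  by (auto simp: continuous_map_def)
 then show ?l using h by (simp add: h1_def)
qed

lemma h1_mult_apply: "sg : carrier G ==> (chi \<otimes>\<^bsub>h1 A\<^esub> psi) sg = chi sg \<otimes>\<^bsub>A\<^esub> psi sg"
 by (simp add: h1_def)

lemma h1_one_apply: "sg : carrier G ==> \<one>\<^bsub>h1 A\<^esub> sg = \<one>\<^bsub>A\<^esub>"
 by (simp add: h1_def)

lemma h1_ext:
 "group A ==> chi : carrier (h1 A) ==> psi : carrier (h1 A) ==> (\<And>sg. sg : carrier G ==> chi sg = psi sg) ==> chi = psi"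
 using h1_iff by (blast intro: extensionalityI)

lemma comm_group_h1:
 assumes A: "comm_group A"
 shows "comm_group (h1 A :: (('a alg_closure => 'a alg_closure) => 'b) monoid)"
proof -
 let ?H = "h1 A :: (('a alg_closure => 'a alg_closure) => 'b) monoid"
 interpret G: group G by (rule group_abs_gal)
 interpret A: comm_group A by (rule A)
 note iff = h1_iff[OF A.is_group]
 have cl: "chi sg : carrier A" if "chi : carrier ?H" "sg : carrier G" for chi sg
  using that by (auto simp: iff hom_def)
 have mult: "chi (sg \<otimes>\<^bsub>G\<^esub> tu) = chi sg \<otimes>\<^bsub>A\<^esub> chi tu" if "chi : carrier ?H" "sg : carrier G" "tu : carrier G" for chi sg tu
  using that by (auto simp: iff hom_def)
 have m: "chi \<otimes>\<^bsub>?H\<^esub> psi : carrier ?H" if a: "chi : carrier ?H" "psi : carrier ?H" for chi psi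
 proof -
  obtain T T' where T: "finite T" "T <= S" "\<forall>sg\<in>carrier G. (\<forall>x\<in>T. sg x = x) \<longrightarrow> chi sg = \<one>\<^bsub>A\<^esub>"
   "finite T'" "T' <= S" "\<forall>sg\<in>carrier G. (\<forall>x\<in>T'. sg x = x) \<longrightarrow> psi sg = \<one>\<^bsub>A\<^esub>"
   using a unfolding iff by blast
  have "chi \<otimes>\<^bsub>?H\<^esub> psi : hom G A"
   by (rule homI) (use a in "auto simp: h1_mult_apply cl mult A.m_ac")
  moreover have "chi \<otimes>\<^bsub>?H\<^esub> psi : extensional (carrier G)" by (simp add: h1_def)
  moreover have "\<forall>sg\<in>carrier G. (\<forall>x\<in>T \<union> T'. sg x = x) \<longrightarrow> (chi \<otimes>\<^bsub>?H\<^esub> psi) sg = \<one>\<^bsub>A\<^esub>"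
   using T by (auto simp: h1_mult_apply)
  ultimately show ?thesis unfolding iff using T by (metis finite_UnI Un_least)
 qed
 have o: "\<one>\<^bsub>?H\<^esub> : carrier ?H"
  unfolding iff by (auto simp: h1_def hom_def intro!: exI[of _ "{}"])
 show ?thesis
 proof (rule comm_groupI)
  fix chi psi \<omega> assume a: "chi : carrier ?H" "psi : carrier ?H" "\<omega> : carrier ?H"
  show "chi \<otimes>\<^bsub>?H\<^esub> psi \<otimes>\<^bsub>?H\<^esub> \<omega> = chi \<otimes>\<^bsub>?H\<^esub> (psi \<otimes>\<^bsub>?H\<^esub> \<omega>)"
   by (rule h1_ext[OF A.is_group]) (use a in "auto simp: m h1_mult_apply cl A.m_assoc")
 next
  fix chi psi assume a: "chi : carrier ?H" "psi : carrier ?H"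
  show "chi \<otimes>\<^bsub>?H\<^esub> psi = psi \<otimes>\<^bsub>?H\<^esub> chi"
   by (rule h1_ext[OF A.is_group]) (use a in "auto simp: m h1_mult_apply cl A.m_comm")
 next
  fix chi assume a: "chi : carrier ?H"
  show "\<one>\<^bsub>?H\<^esub> \<otimes>\<^bsub>?H\<^esub> chi = chi"
   by (rule h1_ext[OF A.is_group]) (use a in "auto simp: m o h1_mult_apply h1_one_apply cl")
  define psi where "psi = (\<lambda>sg\<in>carrier G. inv\<^bsub>A\<^esub> chi sg)"
  obtain T where T: "finite T" "T <= S" "\<forall>sg\<in>carrier G. (\<forall>x\<in>T. sg x = x) \<longrightarrow> chi sg = \<one>\<^bsub>A\<^esub>"
   using a unfolding iff by blast
  have "psi : hom G A" by (rule homI) (use a in "auto simp: psi_def cl mult A.inv_mult")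
  moreover have "\<forall>sg\<in>carrier G. (\<forall>x\<in>T. sg x = x) \<longrightarrow> psi sg = \<one>\<^bsub>A\<^esub>" using T by (auto simp: psi_def)
  ultimately have c: "psi : carrier ?H" unfolding iff using T by (auto simp: psi_def)
  moreover have "psi \<otimes>\<^bsub>?H\<^esub> chi = \<one>\<^bsub>?H\<^esub>"
   by (rule h1_ext[OF A.is_group]) (use a in \<open>auto simp: m o c h1_mult_apply h1_one_apply cl\<close>, auto simp: psi_def cl a)
  ultimately show "\<exists>psi\<in>carrier ?H. psi \<otimes>\<^bsub>?H\<^esub> chi = \<one>\<^bsub>?H\<^esub>" by blast
 qed (auto intro: m o)
qed

lemma h1_pow_apply:
 assumes "comm_group A" "chi : carrier (h1 A)" "sg : carrier G"
 shows "(chi [^]\<^bsub>h1 A\<^esub> (n::nat)) sg = chi sg [^]\<^bsub>A\<^esub> n"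
 by (induction n) (simp_all add: nat_pow_def h1_one_apply h1_mult_apply assms)

text \<open>A continuous character factors through a finite set of restrictions, hence takes finitely many values.\<close>

lemma h1_finite_range:
 assumes A: "group A" and chi: "chi : carrier (h1 A)"
 shows "finite (chi ` carrier G)"
proof -
 interpret G: group G by (rule group_abs_gal)
 have h: "chi : hom G A" using chi unfolding h1_iff[OF A] by blast
 interpret X: group_hom G A chi by (simp add: group_hom_def group_hom_axioms_def h G.is_group A)
 obtain T0 where T0: "finite T0" "T0 <= S" "\<forall>sg\<in>carrier G. (\<forall>x\<in>T0. sg x = x) \<longrightarrow> chi sg = \<one>\<^bsub>A\<^esub>"
  using chi unfolding h1_iff[OF A] by blast
 obtain T where T: "finite T" "T0 <= T" "T <= S" and stable: "\<And>sg x. sg : carrier G ==> x : T ==> sg x : T"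
  using stable_superset[OF T0(1,2)] by metis
 let ?R = "(%sg. restrict sg T) ` carrier G"
 have "?R <= T \<rightarrow>\<^sub>E T" using stable by auto
 then have "finite ?R" using finite_PiE[of T "%_. T"] T(1) finite_subset by blast
 moreover have "chi sg = chi (inv_into (carrier G) (%sg. restrict sg T) (restrict sg T))" if s: "sg : carrier G" for sg
 proof -
  let ?t = "inv_into (carrier G) (%sg. restrict sg T) (restrict sg T)"
  have t: "?t : carrier G" "restrict ?t T = restrict sg T"
   using s by (auto intro: inv_into_into f_inv_into_f[of _ "%sg. restrict sg T"])
  then have e: "sg x = ?t x" if "x : T" for x using that by (metis restrict_apply)
  note g = gal_eq_on[OF s t(1) T(3) e]
  have "chi (inv\<^bsub>G\<^esub> ?t \<otimes>\<^bsub>G\<^esub> sg) = \<one>\<^bsub>A\<^esub>" using T0(3) g(1,2) T(2) by blast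
  then show ?thesis using X.hom_mult[OF t(1) g(1)] g(3) t(1) by simp
 qed
 then have "chi ` carrier G <= (%ro. chi (inv_into (carrier G) (%sg. restrict sg T) ro)) ` ?R" by blast
 ultimately show ?thesis using finite_subset by blast
qed

end

section \<open>Subgroups of \<open>\<rat>/\<int>\<close>\<close>

lemma comm_group_rat_add: "comm_group rat_add"
proof (rule comm_groupI)
 show "\<exists>y\<in>carrier rat_add. y \<otimes>\<^bsub>rat_add\<^esub> x = \<one>\<^bsub>rat_add\<^esub>" for x
  by (intro bexI[of _ "- x"]) (simp_all add: rat_add_def)
qed (simp_all add: rat_add_def)

lemma normal_Ints: "normal \<int> rat_add"
proof (rule comm_group.subgroup_imp_normal[OF comm_group_rat_add])
 interpret comm_group rat_add by (rule comm_group_rat_add)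
 have inv: "inv\<^bsub>rat_add\<^esub> x = - x" for x
  by (rule inv_equality) (simp_all add: rat_add_def)
 show "subgroup \<int> rat_add"
  by (rule subgroupI) (auto simp: inv, auto simp: rat_add_def)
qed

lemma rat_class_mult: "rat_class r \<otimes>\<^bsub>rat_mod_int\<^esub> rat_class s = rat_class (r + s)"
 using normal.rcos_sum[OF normal_Ints, of r s] by (simp add: rat_class_def rat_mod_int_def FactGroup_def) (simp add: rat_add_def)

lemma rat_mod_int_carrier: "carrier rat_mod_int = range rat_class"
 by (auto simp: rat_mod_int_def FactGroup_def RCOSETS_def rat_class_def rat_add_def)

lemma rat_mod_int_one: "\<one>\<^bsub>rat_mod_int\<^esub> = rat_class 0"
 by (auto simp: rat_mod_int_def FactGroup_def rat_class_def r_coset_def rat_add_def)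

lemma comm_group_rat_mod_int: "comm_group rat_mod_int"
 unfolding rat_mod_int_def
 using comm_group.abelian_FactGroup[OF comm_group_rat_add] normal_Ints normal_imp_subgroup by blast

lemma rat_class_eq_iff: "rat_class r = rat_class s \<longleftrightarrow> r - s : \<int>"
proof -
 have c: "rat_class t = {i + t | i. i : \<int>}" for t
  by (auto simp: rat_class_def r_coset_def rat_add_def)
 show ?thesis
 proof
  assume "rat_class r = rat_class s"
  moreover have "r : rat_class r" unfolding c by (auto intro!: exI[of _ 0])
  ultimately obtain i where "i : \<int>" "r = i + s" unfolding c by blast
  then show "r - s : \<int>" by simp
 next
  assume d: "r - s : \<int>"
  have "i + r = (i + (r - s)) + s" "i + s = (i - (r - s)) + r" for i by simp_all
  then show "rat_class r = rat_class s" unfolding c using d Ints_add Ints_diff by blast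
 qed
qed

lemma rat_class_pow: "rat_class r [^]\<^bsub>rat_mod_int\<^esub> (n::nat) = rat_class (of_nat n * r)"
 by (induction n) (simp_all add: nat_pow_def rat_mod_int_one rat_class_mult algebra_simps)

lemma rat_class_pow_eq_one:
 assumes "n > 0"
 shows "rat_class r [^]\<^bsub>rat_mod_int\<^esub> (n::nat) = \<one>\<^bsub>rat_mod_int\<^esub> \<longleftrightarrow> (\<exists>a. r = of_int a / of_nat n)"
proof -
 have "rat_class r [^]\<^bsub>rat_mod_int\<^esub> n = \<one>\<^bsub>rat_mod_int\<^esub> \<longleftrightarrow> of_nat n * r : \<int>"
  by (simp add: rat_class_pow rat_mod_int_one rat_class_eq_iff)
 also have "\<dots> \<longleftrightarrow> (\<exists>a. of_nat n * r = of_int a)" by (auto simp: Ints_def)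
 also have "\<dots> \<longleftrightarrow> (\<exists>a. r = of_int a / of_nat n)" using assms by (auto simp: field_simps)
 finally show ?thesis .
qed

text \<open>The torsion description is intrinsic to Q/Z, which makes the subgroup property and the
  comparison with primary parts of \<open>h1\<close> accessible.\<close>

lemma prufer_iff:
 assumes l: "l > 0"
 shows "q : carrier (prufer l) \<longleftrightarrow> q : carrier rat_mod_int \<and> (\<exists>n. q [^]\<^bsub>rat_mod_int\<^esub> (l ^ n) = \<one>\<^bsub>rat_mod_int\<^esub>)"
proof
 assume "q : carrier (prufer l)"
 then obtain a n where "q = rat_class (of_int a / of_nat (l ^ n))" by (auto simp: prufer_def)
 moreover from this have "q [^]\<^bsub>rat_mod_int\<^esub> (l ^ n) = \<one>\<^bsub>rat_mod_int\<^esub>"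
  using rat_class_pow_eq_one[of "l ^ n" "of_int a / of_nat (l ^ n)"] l by auto
 ultimately show "q : carrier rat_mod_int \<and> (\<exists>n. q [^]\<^bsub>rat_mod_int\<^esub> (l ^ n) = \<one>\<^bsub>rat_mod_int\<^esub>)"
  unfolding rat_mod_int_carrier by blast
next
 assume "q : carrier rat_mod_int \<and> (\<exists>n. q [^]\<^bsub>rat_mod_int\<^esub> (l ^ n) = \<one>\<^bsub>rat_mod_int\<^esub>)"
 then obtain r n where "q = rat_class r" "rat_class r [^]\<^bsub>rat_mod_int\<^esub> (l ^ n) = \<one>\<^bsub>rat_mod_int\<^esub>"
  unfolding rat_mod_int_carrier by blast
 then show "q : carrier (prufer l)"
  using rat_class_pow_eq_one[of "l ^ n" r] l unfolding prufer_def by auto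
qed

lemma prufer_simps:
 "(\<otimes>\<^bsub>prufer l\<^esub>) = (\<otimes>\<^bsub>rat_mod_int\<^esub>)" "\<one>\<^bsub>prufer l\<^esub> = \<one>\<^bsub>rat_mod_int\<^esub>"
 by (simp_all add: prufer_def)

lemma subgroup_prufer:
 assumes l: "l > 0"
 shows "subgroup (carrier (prufer l)) rat_mod_int"
proof -
 interpret Q: comm_group rat_mod_int by (rule comm_group_rat_mod_int)
 show ?thesis
 proof (rule Q.subgroupI)
  show "carrier (prufer l) <= carrier rat_mod_int" using prufer_iff[OF l] by blast
  have "\<one>\<^bsub>rat_mod_int\<^esub> : carrier (prufer l)" unfolding prufer_iff[OF l] by simp
  then show "carrier (prufer l) ~= {}" by blast
 next
  fix q assume "q : carrier (prufer l)"
  then show "inv\<^bsub>rat_mod_int\<^esub> q : carrier (prufer l)"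
   unfolding prufer_iff[OF l] by (auto simp: Q.nat_pow_inv)
 next
  fix q r assume "q : carrier (prufer l)" "r : carrier (prufer l)"
  then obtain m n where q: "q : carrier rat_mod_int" "q [^]\<^bsub>rat_mod_int\<^esub> (l ^ m) = \<one>\<^bsub>rat_mod_int\<^esub>"
   and r: "r : carrier rat_mod_int" "r [^]\<^bsub>rat_mod_int\<^esub> (l ^ n) = \<one>\<^bsub>rat_mod_int\<^esub>"
   unfolding prufer_iff[OF l] by blast
  have "q [^]\<^bsub>rat_mod_int\<^esub> (l ^ (m + n)) = \<one>\<^bsub>rat_mod_int\<^esub>"
   using q by (simp add: power_add flip: Q.nat_pow_pow)
  moreover have "r [^]\<^bsub>rat_mod_int\<^esub> (l ^ (m + n)) = \<one>\<^bsub>rat_mod_int\<^esub>"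
   using r by (simp add: power_add mult.commute[of "l ^ m"] flip: Q.nat_pow_pow)
  ultimately have "(q \<otimes>\<^bsub>rat_mod_int\<^esub> r) [^]\<^bsub>rat_mod_int\<^esub> (l ^ (m + n)) = \<one>\<^bsub>rat_mod_int\<^esub>"
   using q(1) r(1) by (simp add: Q.nat_pow_distrib)
  then show "q \<otimes>\<^bsub>rat_mod_int\<^esub> r : carrier (prufer l)" unfolding prufer_iff[OF l] using q(1) r(1) by blast
 qed
qed

lemma comm_group_restrict:
 assumes "comm_group A" "subgroup H A"
 shows "comm_group (A\<lparr>carrier := H\<rparr>)"
proof -
 interpret A: comm_group A by fact
 show ?thesis
  by (rule group.group_comm_groupI[OF A.subgroup_imp_group[OF assms(2)]])
   (use subgroup.mem_carrier[OF assms(2)] in "simp add: A.m_comm")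
qed

lemma comm_group_prufer: "l > 0 ==> comm_group (prufer l)"
 using comm_group_restrict[OF comm_group_rat_mod_int subgroup_prufer] by (simp add: prufer_def)

lemma prufer_carrier: "carrier (prufer l) = {rat_class (of_int a / of_nat (l ^ n)) | a n. True}"
 by (simp add: prufer_def)

section \<open>The Artin--Schreier--Witt map\<close>

text \<open>The unit of the Witt ring, a generator of W_m(F_p) = Z/p^(m+1).\<close>

definition unit_vec :: "nat => 'a::comm_ring_1 list" where
 "unit_vec m = 1 # replicate m 0"

text \<open>X^p - X has at most p roots, and the images of 0, ..., p - 1 are p distinct
  ones.\<close>

lemma prime_field_of_nat:
 fixes z :: "'a::field"
 assumes p: "Factorial_Ring.prime p" and ch: "CHAR('a) = p"
 shows "z ^ p = z \<longleftrightarrow> (\<exists>n. z = of_nat n)"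
proof
 assume "\<exists>n. z = of_nat n"
 then obtain n where "z = of_nat n" ..
 moreover have "(of_nat n :: 'a) ^ p = of_nat n"
 proof (induction n)
  case (Suc n)
  have "(of_nat n + 1 :: 'a) ^ p = of_nat n ^ p + 1 ^ p" by (rule freshmans_dream) (use p ch in auto)
  then show ?case using Suc by (simp add: add.commute)
 qed (use prime_gt_0_nat[OF p] in "simp add: zero_power")
 ultimately show "z ^ p = z" by simp
next
 assume z: "z ^ p = z"
 have p1: "p > 1" using prime_gt_1_nat[OF p] .
 define f where "f = monom 1 p - monom (1::'a) 1"
 have f0: "f ~= 0"
 proof
  assume "f = 0"
  then have "poly.coeff f p = 0" by simp
  then show False using p1 by (simp add: f_def)
 qed
 have root: "poly f x = 0 \<longleftrightarrow> x ^ p = x" for x by (simp add: f_def poly_monom)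
 have fin: "finite {x. poly f x = 0}" by (rule poly_roots_finite[OF f0])
 have "Polynomial.degree f \<le> p" unfolding f_def
  using p1 by (intro degree_diff_le) (auto intro: order.trans[OF degree_monom_le])
 then have le: "card {x. poly f x = 0} \<le> p" using card_poly_roots_bound[OF f0] by simp
 have inj: "inj_on (of_nat :: nat => 'a) {..<p}"
 proof (rule linorder_inj_onI)
  fix i j :: nat assume ij: "i < j" "j : {..<p}"
  show "(of_nat i :: 'a) ~= of_nat j"
  proof
   assume "(of_nat i :: 'a) = of_nat j"
   then have "(of_nat (j - i) :: 'a) = 0" using ij by (simp add: of_nat_diff)
   then have "p dvd j - i" using ch by (simp add: of_nat_eq_0_iff_char_dvd)
   then show False using ij by (auto dest: dvd_imp_le)
  qed
 qed auto
 have "(of_nat n :: 'a) ^ p = of_nat n" for n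
 proof (induction n)
  case (Suc n)
  have "(of_nat n + 1 :: 'a) ^ p = of_nat n ^ p + 1 ^ p" by (rule freshmans_dream) (use p ch in auto)
  then show ?case using Suc by (simp add: add.commute)
 qed (use p1 in "simp add: zero_power")
 then have sub: "of_nat ` {..<p} <= {x. poly f x = 0}" by (auto simp: root)
 have "of_nat ` {..<p} = {x. poly f x = 0}"
  by (rule card_seteq[OF fin sub]) (use le in "simp add: card_image[OF inj]")
 then show "\<exists>n. z = of_nat n" using z root[of z] by auto
qed

context
 fixes p :: nat and ty :: "'a::field itself"
 assumes p: "Factorial_Ring.prime p" and ch: "CHAR('a) = p"
begin

private abbreviation (input) "S9 \<equiv> sep_closure :: 'a alg_closure set"
private abbreviation (input) "G9 \<equiv> abs_gal :: ('a alg_closure => 'a alg_closure) monoid"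
private abbreviation (input) "W \<equiv> witt p S9"
private abbreviation (input) "C \<equiv> cw p S9"

private lemma p0_9: "p > 0" using prime_gt_0_nat[OF p] .
private lemma ch': "CHAR('a alg_closure) = p" using ch by simp
private lemma S9: "subrng S9" by (rule subrng_sep[OF p ch])

lemma unit_vec_in: "unit_vec m : carrier (W m)"
 using to_ac_sep[OF p ch, of 0] to_ac_sep[OF p ch, of 1] by (auto simp: unit_vec_def witt_carrier_iff)

lemma unit_vec_Suc_pow_p: "unit_vec (Suc m) [^]\<^bsub>W (Suc m)\<^esub> p = 0 # unit_vec m"
proof -
 have "unit_vec (Suc m) [^]\<^bsub>W (Suc m)\<^esub> p = take (Suc (Suc m)) (0 # witt_frob p (unit_vec (Suc m)))"
  by (rule witt_pow_p[OF p]) (use of_nat_CHAR[where 'a = "'a alg_closure", unfolded ch'] in "auto simp: unit_vec_def")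
 moreover have "take m (0 # replicate m (0 :: 'a alg_closure)) = replicate m 0"
  using take_replicate[of m "Suc m" "0 :: 'a alg_closure"] by simp
 ultimately show ?thesis using p0_9 by (simp add: unit_vec_def witt_frob_def zero_power)
qed

lemma V_pow: "x : carrier (W m) ==> (0 # x) [^]\<^bsub>W (Suc m)\<^esub> (n::nat) = 0 # x [^]\<^bsub>W m\<^esub> n"
 using group_hom.hom_nat_pow[of "W m" "W (Suc m)" "Cons 0" x n] witt_V_hom[OF p S9, of m] witt_group[OF p S9]
 by (simp add: group_hom_def group_hom_axioms_def)

lemma witt_hd_pow:
 assumes x: "x : carrier (W m)"
 shows "hd (x [^]\<^bsub>W m\<^esub> (n::nat)) = of_nat n * hd x"
proof -
 interpret W: comm_group "W m" by (rule comm_group_witt[OF p S9])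
 have "length y = Suc m" if "y : carrier (W m)" for y using that by (simp add: witt_carrier_iff)
 then have *: "hd (y \<otimes>\<^bsub>W m\<^esub> z) = hd y + hd z" if "y : carrier (W m)" "z : carrier (W m)" for y z
  using that by (intro witt_hd_mult[OF p]) auto
 show ?thesis
 proof (induction n)
  case 0 show ?case by (simp add: witt_def)
 next
  case (Suc n)
  then show ?case using x by (simp add: * algebra_simps)
 qed
qed

text \<open>The first entry detects n modulo p; if p divides n, then p times the unit vector is the
  Verschiebung of a shorter unit vector and the induction continues.\<close>

lemma unit_vec_pow_eq_one: "unit_vec m [^]\<^bsub>W m\<^esub> (n::nat) = \<one>\<^bsub>W m\<^esub> \<longleftrightarrow> p ^ Suc m dvd n"
proof (induction m arbitrary: n)
 case 0
 interpret W: comm_group "W 0" by (rule comm_group_witt[OF p S9])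
 have "unit_vec 0 [^]\<^bsub>W 0\<^esub> n = [of_nat n]"
 proof -
  have "length (unit_vec 0 [^]\<^bsub>W 0\<^esub> n) = 1"
   using W.nat_pow_closed[OF unit_vec_in[of 0], of n] by (simp add: witt_carrier_iff)
  then show ?thesis using witt_hd_pow[OF unit_vec_in[of 0], of n]
   by (cases "unit_vec 0 [^]\<^bsub>W 0\<^esub> n") (auto simp: unit_vec_def)
 qed
 then show ?case using ch' by (simp add: witt_def of_nat_eq_0_iff_char_dvd)
next
 case (Suc m)
 interpret W: comm_group "W (Suc m)" by (rule comm_group_witt[OF p S9])
 show ?case
 proof (cases "p dvd n")
  case True
  then obtain k where k: "n = p * k" by (auto elim: dvdE)
  have "unit_vec (Suc m) [^]\<^bsub>W (Suc m)\<^esub> n = 0 # unit_vec m [^]\<^bsub>W m\<^esub> k"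
   unfolding k using unit_vec_in by (simp add: unit_vec_Suc_pow_p V_pow flip: W.nat_pow_pow)
  then have "unit_vec (Suc m) [^]\<^bsub>W (Suc m)\<^esub> n = \<one>\<^bsub>W (Suc m)\<^esub> \<longleftrightarrow> unit_vec m [^]\<^bsub>W m\<^esub> k = \<one>\<^bsub>W m\<^esub>"
   by (simp add: witt_def[of p S9])
  then show ?thesis using Suc.IH[of k] p0_9 by (simp add: k)
 next
  case False
  have "hd (unit_vec (Suc m) [^]\<^bsub>W (Suc m)\<^esub> n) = (of_nat n :: 'a alg_closure)"
   using witt_hd_pow[OF unit_vec_in[of "Suc m"], of n] by (simp add: unit_vec_def)
  also have "\<dots> ~= 0" using False ch' by (simp add: of_nat_eq_0_iff_char_dvd)
  finally have "unit_vec (Suc m) [^]\<^bsub>W (Suc m)\<^esub> n ~= \<one>\<^bsub>W (Suc m)\<^esub>" by (auto simp: witt_def)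
  moreover have "\<not> p ^ Suc (Suc m) dvd n" using False by (metis dvd_trans dvd_triv_left power_Suc)
  ultimately show ?thesis by blast
 qed
qed

lemma unit_vec_int_pow_eq_one: "unit_vec m [^]\<^bsub>W m\<^esub> (a::int) = \<one>\<^bsub>W m\<^esub> \<longleftrightarrow> int (p ^ Suc m) dvd a"
proof -
 interpret W: comm_group "W m" by (rule comm_group_witt[OF p S9])
 have "W.ord (unit_vec m) dvd n \<longleftrightarrow> p ^ Suc m dvd n" for n
  using W.pow_eq_id[OF unit_vec_in, of n] unit_vec_pow_eq_one[of m n] by simp
 then have "W.ord (unit_vec m) = p ^ Suc m" by (meson dvd_antisym dvd_refl)
 then show ?thesis using W.int_pow_eq_id[OF unit_vec_in, of a] by simp
qed

text \<open>The first entry lies in the prime field, so a multiple of the unit vector removes it;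
  what remains is the Verschiebung of a shorter fixed vector, again a multiple of the unit vector by
  \<open>unit_vec_Suc_pow_p\<close>.\<close>

lemma frob_fixed_vec:
 assumes y: "y : carrier (W m)" "witt_frob p y = y"
 shows "\<exists>n::nat. y = unit_vec m [^]\<^bsub>W m\<^esub> n"
 using assms
proof (induction m arbitrary: y)
 fix m and y :: "'a alg_closure list"
 let ?case = "\<exists>n::nat. y = unit_vec m [^]\<^bsub>W m\<^esub> n"
 { fix m and y :: "'a alg_closure list"
  assume y: "y : carrier (W m)" and fy: "witt_frob p y = y"
  interpret W: comm_group "W m" by (rule comm_group_witt[OF p S9])
  have len: "length z = Suc m" if "z : carrier (W m)" for z using that by (simp add: witt_carrier_iff)
  have F: "witt_frob p : hom (W m) (W m)"
   using witt_map_hom[OF p S9 rng_hom_frob[OF p ch'] frob_closed[OF p S9 ch']] by (simp add: witt_frob_def[abs_def])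
  interpret F: group_hom "W m" "W m" "witt_frob p" by (simp add: group_hom_def group_hom_axioms_def F W.is_group)
  have fu: "witt_frob p (unit_vec m) = (unit_vec m :: 'a alg_closure list)"
   using p0_9 by (simp add: witt_frob_def unit_vec_def zero_power)
  obtain y0 ys where ys: "y = y0 # ys" using len[OF y] by (cases y) auto
  then have "y0 ^ p = y0" using fy by (simp add: witt_frob_def)
  then obtain i where i: "y0 = of_nat i" using prime_field_of_nat[OF p ch'] by blast
  define w where "w = y \<otimes>\<^bsub>W m\<^esub> inv\<^bsub>W m\<^esub> (unit_vec m [^]\<^bsub>W m\<^esub> i)"
  have w: "w : carrier (W m)" using y unit_vec_in by (simp add: w_def)
  have yw: "y = w \<otimes>\<^bsub>W m\<^esub> unit_vec m [^]\<^bsub>W m\<^esub> i" using y unit_vec_in by (simp add: w_def W.m_assoc)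
  have "hd y = hd w + hd (unit_vec m [^]\<^bsub>W m\<^esub> i)"
   by (subst yw, rule witt_hd_mult[OF p]) (use w len unit_vec_in in auto)
  then have "hd w = 0" using witt_hd_pow[OF unit_vec_in, of m i] by (simp add: ys i unit_vec_def)
  then obtain w' where w': "w = 0 # w'" using len[OF w] by (cases w) auto
  have fw: "witt_frob p w = w" using y unit_vec_in fy by (simp add: w_def F.hom_nat_pow fu)
  have "\<exists>i w'. y = (0 # w') \<otimes>\<^bsub>W m\<^esub> unit_vec m [^]\<^bsub>W m\<^esub> (i::nat) \<and> 0 # w' : carrier (W m) \<and> witt_frob p w' = w'"
   using yw w w' fw by (auto simp: witt_frob_def)
 } note red = this
 {
  case 0
  interpret W: comm_group "W 0" by (rule comm_group_witt[OF p S9])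
  obtain i w' where "y = (0 # w') \<otimes>\<^bsub>W 0\<^esub> unit_vec 0 [^]\<^bsub>W 0\<^esub> (i::nat)" "0 # w' : carrier (W 0)"
   using red[OF 0] by blast
  moreover from this have "0 # w' = \<one>\<^bsub>W 0\<^esub>" by (auto simp: witt_carrier_iff witt_def)
  ultimately show ?case using unit_vec_in by auto
 next
  case (Suc m)
  interpret W: comm_group "W (Suc m)" by (rule comm_group_witt[OF p S9])
  obtain i w' where y: "y = (0 # w') \<otimes>\<^bsub>W (Suc m)\<^esub> unit_vec (Suc m) [^]\<^bsub>W (Suc m)\<^esub> (i::nat)"
   and w': "0 # w' : carrier (W (Suc m))" "witt_frob p w' = w'"
   using red[OF Suc.prems] by blast
  have "w' : carrier (W m)" using w' by (auto simp: witt_carrier_iff)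
  then obtain n :: nat where n: "w' = unit_vec m [^]\<^bsub>W m\<^esub> n" using Suc.IH w'(2) by blast
  have "0 # w' = unit_vec (Suc m) [^]\<^bsub>W (Suc m)\<^esub> (p * n)"
   unfolding n using unit_vec_in by (simp add: unit_vec_Suc_pow_p V_pow flip: W.nat_pow_pow)
  then have "y = unit_vec (Suc m) [^]\<^bsub>W (Suc m)\<^esub> (p * n + i)"
   unfolding y using unit_vec_in by (simp add: W.nat_pow_mult)
  then show ?case by blast
 }
qed

text \<open>The identification of the Frobenius-fixed co-vectors with \<open>\<rat>\<^sub>p/\<int>\<^sub>p\<close>, as a relation.\<close>

definition fp_val :: "'a alg_closure covec => rat set => bool" where
 "fp_val f q \<longleftrightarrow> (\<exists>m a. f = cw_inj p S9 m (unit_vec m [^]\<^bsub>W m\<^esub> (a::int)) \<and> q = rat_class (of_int a / of_nat (p ^ (m + 1))))"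

lemma unit_vec_pow_in: "unit_vec m [^]\<^bsub>W m\<^esub> (a::int) : carrier (W m)"
 using group.int_pow_closed[OF witt_group[OF p S9] unit_vec_in] .

text \<open>Since V of the unit vector is p times the longer one, raising the level by k multiplies
  the exponent a by p^k, which leaves the fraction a / p^(m+1) unchanged.\<close>

lemma unit_vec_lift: "cw_inj p S9 m (unit_vec m [^]\<^bsub>W m\<^esub> (a::int)) = cw_inj p S9 (m + k) (unit_vec (m + k) [^]\<^bsub>W (m + k)\<^esub> (int (p ^ k) * a))"
proof (induction k)
 case (Suc k)
 interpret W: comm_group "W (Suc (m + k))" by (rule comm_group_witt[OF p S9])
 let ?b = "int (p ^ k) * a"
 have V: "group_hom (W (m + k)) (W (Suc (m + k))) (Cons 0)"
  using witt_V_hom[OF p S9, of "m + k"] witt_group[OF p S9] by (simp add: group_hom_def group_hom_axioms_def)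
 have "0 # (unit_vec (m + k) [^]\<^bsub>W (m + k)\<^esub> ?b) = (0 # unit_vec (m + k)) [^]\<^bsub>W (Suc (m + k))\<^esub> ?b"
  using group_hom.hom_int_pow[OF V unit_vec_in] .
 also have "\<dots> = unit_vec (Suc (m + k)) [^]\<^bsub>W (Suc (m + k))\<^esub> (int (p ^ Suc k) * a)"
  using unit_vec_in by (simp add: W.int_pow_pow mult.assoc flip: unit_vec_Suc_pow_p int_pow_int)
 finally show ?case
  using Suc cw_inj_Suc[OF p S9 unit_vec_pow_in[of "m + k" ?b]] by simp
qed simp

text \<open>Both representations are lifted to a common level N, where the order p^(N+1) of the unit
  vector decides.\<close>

lemma fp_val_unique:
 assumes "fp_val f q" "fp_val f r"
 shows "q = r"
proof -
 obtain m a where 1: "f = cw_inj p S9 m (unit_vec m [^]\<^bsub>W m\<^esub> (a::int))" "q = rat_class (of_int a / of_nat (p ^ (m + 1)))"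
  using assms(1) unfolding fp_val_def by blast
 obtain n b where 2: "f = cw_inj p S9 n (unit_vec n [^]\<^bsub>W n\<^esub> (b::int))" "r = rat_class (of_int b / of_nat (p ^ (n + 1)))"
  using assms(2) unfolding fp_val_def by blast
 define N where "N = m + n"
 interpret W: comm_group "W N" by (rule comm_group_witt[OF p S9])
 let ?a = "int (p ^ n) * a" and ?b = "int (p ^ m) * b"
 have "cw_inj p S9 N (unit_vec N [^]\<^bsub>W N\<^esub> ?a) = cw_inj p S9 N (unit_vec N [^]\<^bsub>W N\<^esub> ?b)"
  using 1(1) 2(1) unit_vec_lift[of m a n] unit_vec_lift[of n b m] by (simp add: N_def add.commute)
 then have "unit_vec N [^]\<^bsub>W N\<^esub> ?a = unit_vec N [^]\<^bsub>W N\<^esub> ?b"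
  using cw_inj_inj[OF p S9 unit_vec_pow_in unit_vec_pow_in] by blast
 then have "unit_vec N [^]\<^bsub>W N\<^esub> (?a - ?b) = \<one>\<^bsub>W N\<^esub>"
  using unit_vec_in unit_vec_pow_in by (simp add: W.int_pow_diff)
 then have "int (p ^ Suc N) dvd ?a - ?b" by (simp only: unit_vec_int_pow_eq_one)
 then obtain c where "?a - ?b = int (p ^ Suc N) * c" by (auto elim: dvdE)
 then have "of_int (?a - ?b) = (of_int (int (p ^ Suc N) * c) :: rat)" by (rule arg_cong)
 then have e: "of_nat p ^ n * of_int a - of_nat p ^ m * of_int b = (of_nat p * of_nat p ^ m * of_nat p ^ n * of_int c :: rat)"
  by (simp add: N_def power_add)
 have "of_int a / of_nat (p ^ (m + 1)) - of_int b / of_nat (p ^ (n + 1)) = (of_int c :: rat)"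
  using e p0_9 by (simp add: field_simps)
 then show ?thesis unfolding 1 2 rat_class_eq_iff by (metis Ints_of_int)
qed

lemma fp_val_mult:
 assumes "fp_val f q" "fp_val g r"
 shows "fp_val (f \<otimes>\<^bsub>C\<^esub> g) (q \<otimes>\<^bsub>rat_mod_int\<^esub> r)"
proof -
 obtain m a where 1: "f = cw_inj p S9 m (unit_vec m [^]\<^bsub>W m\<^esub> (a::int))" "q = rat_class (of_int a / of_nat (p ^ (m + 1)))"
  using assms(1) unfolding fp_val_def by blast
 obtain n b where 2: "g = cw_inj p S9 n (unit_vec n [^]\<^bsub>W n\<^esub> (b::int))" "r = rat_class (of_int b / of_nat (p ^ (n + 1)))"
  using assms(2) unfolding fp_val_def by blast
 define N where "N = m + n"
 interpret W: comm_group "W N" by (rule comm_group_witt[OF p S9])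
 let ?a = "int (p ^ n) * a" and ?b = "int (p ^ m) * b"
 have f: "f = cw_inj p S9 N (unit_vec N [^]\<^bsub>W N\<^esub> ?a)"
  unfolding 1 N_def by (rule unit_vec_lift)
 have g: "g = cw_inj p S9 N (unit_vec N [^]\<^bsub>W N\<^esub> ?b)"
  unfolding 2 N_def add.commute[of m n] by (rule unit_vec_lift)
 have 3: "f \<otimes>\<^bsub>C\<^esub> g = cw_inj p S9 N (unit_vec N [^]\<^bsub>W N\<^esub> ?a \<otimes>\<^bsub>W N\<^esub> unit_vec N [^]\<^bsub>W N\<^esub> ?b)"
  unfolding f g by (rule cw_inj_mult[OF p S9 unit_vec_pow_in unit_vec_pow_in])
 have 4: "unit_vec N [^]\<^bsub>W N\<^esub> ?a \<otimes>\<^bsub>W N\<^esub> unit_vec N [^]\<^bsub>W N\<^esub> ?b = unit_vec N [^]\<^bsub>W N\<^esub> (?a + ?b)"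
  by (rule W.int_pow_mult[OF unit_vec_in, symmetric])
 have 5: "q \<otimes>\<^bsub>rat_mod_int\<^esub> r = rat_class (of_int (?a + ?b) / of_nat (p ^ (N + 1)))"
 proof -
  have e: "of_int c / of_nat (p ^ (i + 1)) = (of_int (int (p ^ j) * c) / of_nat (p ^ (j + i + 1)) :: rat)" for c i j
  proof -
   have "(of_int (int (p ^ j) * c) :: rat) = of_nat (p ^ j) * of_int c" by simp
   moreover have "of_nat (p ^ (j + i + 1)) = (of_nat (p ^ j) * of_nat (p ^ (i + 1)) :: rat)" by (simp add: power_add)
   ultimately show ?thesis
    by (simp only: nonzero_mult_divide_mult_cancel_left of_nat_eq_0_iff power_eq_0_iff p0_9 neq0_conv)
     (use p0_9 in simp)
  qed
  show ?thesis
   unfolding 1(2) 2(2) rat_class_mult e[of a m n] e[of b n m] N_def add.commute[of n m]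
   by (simp only: add_divide_distrib[symmetric] of_int_add)
 qed
 show ?thesis unfolding fp_val_def using 3[unfolded 4] 5 by blast
qed

lemma fp_val_one_iff: "fp_val f \<one>\<^bsub>rat_mod_int\<^esub> \<longleftrightarrow> f = \<one>\<^bsub>C\<^esub>"
proof
 have *: "\<one>\<^bsub>C\<^esub> = cw_inj p S9 0 (unit_vec 0 [^]\<^bsub>W 0\<^esub> (0::int))"
  by (simp add: cw_one[OF p S9, of 0])
 show "fp_val f \<one>\<^bsub>rat_mod_int\<^esub>" if "f = \<one>\<^bsub>C\<^esub>"
  unfolding fp_val_def that by (intro exI[of _ 0] conjI *) (simp add: rat_mod_int_one)
 assume "fp_val f \<one>\<^bsub>rat_mod_int\<^esub>"
 then obtain m a where f: "f = cw_inj p S9 m (unit_vec m [^]\<^bsub>W m\<^esub> (a::int))" and "rat_class 0 = rat_class (of_int a / of_nat (p ^ (m + 1)))"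
  unfolding fp_val_def rat_mod_int_one by blast
 then have "of_int a / of_nat (p ^ (m + 1)) : (\<int> :: rat set)" using rat_class_eq_iff by (metis diff_zero)
 then obtain c where "of_int a / of_nat (p ^ (m + 1)) = (of_int c :: rat)" by (auto simp: Ints_def)
 then have "(of_int a :: rat) = of_int (c * int (p ^ Suc m))" using p0_9 by (simp add: field_simps)
 then have "a = c * int (p ^ Suc m)" by (simp only: of_int_eq_iff)
 then have "unit_vec m [^]\<^bsub>W m\<^esub> a = \<one>\<^bsub>W m\<^esub>" unfolding unit_vec_int_pow_eq_one by simp
 then show "f = \<one>\<^bsub>C\<^esub>" using f cw_one[OF p S9, of m] by simp
qed

lemma fp_val_in: "fp_val f q ==> q : carrier (prufer p)"
 unfolding fp_val_def prufer_carrier by blast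

lemma gal_group_hom:
 assumes g: "gm : carrier G9"
 shows "group_hom C C (cw_map p S9 gm)"
 by (rule cw_map_group_hom[OF p S9 gal_rng_hom[OF p ch g] _ S9]) (use abs_galD(2)[OF g] in blast)

lemma gal_cw_inj:
 assumes g: "gm : carrier G9" and x: "x : carrier (W m)"
 shows "cw_map p S9 gm (cw_inj p S9 m x) = cw_inj p S9 m (map gm x)"
 by (rule cw_map_inj[OF p S9 gal_rng_hom[OF p ch g] _ S9 x]) (use abs_galD(2)[OF g] in blast)

text \<open>The unit vector has entries 0 and 1, so it is fixed by every automorphism, and so are
  its multiples.\<close>

lemma fp_val_gal:
 assumes g: "gm : carrier G9" and f: "fp_val f q"
 shows "cw_map p S9 gm f = f"
proof -
 obtain m a where f: "f = cw_inj p S9 m (unit_vec m [^]\<^bsub>W m\<^esub> (a::int))"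
  using f unfolding fp_val_def by blast
 have "map gm : hom (W m) (W m)"
  by (rule witt_map_hom[OF p S9 gal_rng_hom[OF p ch g]]) (use abs_galD(2)[OF g] in blast)
 then have M: "group_hom (W m) (W m) (map gm)" using witt_group[OF p S9] by (simp add: group_hom_def group_hom_axioms_def)
 have "map gm (unit_vec m) = unit_vec m"
  using gal_0[OF p ch g] gal_1[OF p ch g] by (simp add: unit_vec_def)
 then have "map gm (unit_vec m [^]\<^bsub>W m\<^esub> a) = unit_vec m [^]\<^bsub>W m\<^esub> a"
  using group_hom.hom_int_pow[OF M unit_vec_in] by simp
 then show ?thesis unfolding f using gal_cw_inj[OF g unit_vec_pow_in] by simp
qed

lemma frob_fixed_fp_val:
 assumes f: "f : carrier C" and F: "cw_map p S9 (%x. x ^ p) f = f"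
 shows "\<exists>q. fp_val f q"
proof -
 obtain m x where x: "x : carrier (W m)" "f = cw_inj p S9 m x" using cw_cases[OF p S9 f] .
 have "cw_inj p S9 m (witt_frob p x) = cw_inj p S9 m x"
  using F frob_inj[OF p S9 ch' x(1)] x by (simp add: witt_frob_def)
 moreover have "witt_frob p x : carrier (W m)"
  using witt_map_hom[OF p S9 rng_hom_frob[OF p ch'] frob_closed[OF p S9 ch']] x(1) by (auto simp: hom_def witt_frob_def)
 ultimately have "witt_frob p x = x" using cw_inj_inj[OF p S9 _ x(1)] by blast
 then obtain n :: nat where "x = unit_vec m [^]\<^bsub>W m\<^esub> n" using frob_fixed_vec[OF x(1)] by blast
 then have "x = unit_vec m [^]\<^bsub>W m\<^esub> int n" by (simp add: int_pow_int)
 then show ?thesis unfolding fp_val_def x by blast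
qed

end

section \<open>Values, kernel and image of the Artin--Schreier--Witt map\<close>

lemma (in comm_group) quotient_cancel:
 assumes "a : carrier G" "x : carrier G" "y : carrier G"
 shows "(a \<otimes> x) \<otimes> inv (a \<otimes> y) = x \<otimes> inv y"
proof -
 have "a \<otimes> (inv a \<otimes> inv y) = inv y" using assms by (simp flip: m_assoc)
 then show ?thesis using assms by (simp add: inv_mult m_assoc m_comm[of a x])
qed

context
 fixes p :: nat and ty :: "'a::field itself"
 assumes p: "Factorial_Ring.prime p" and ch: "CHAR('a) = p"
begin

private abbreviation (input) "S10 \<equiv> sep_closure :: 'a alg_closure set"
private abbreviation (input) "G10 \<equiv> abs_gal :: ('a alg_closure => 'a alg_closure) monoid"
private abbreviation (input) "W10 \<equiv> witt p S10"
private abbreviation (input) "C10 \<equiv> cw p S10"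
private abbreviation (input) "K \<equiv> cw p (UNIV :: 'a set)"
private abbreviation (input) "H \<equiv> h1 (prufer p) :: (('a alg_closure => 'a alg_closure) => rat set) monoid"
private abbreviation (input) "io \<equiv> cw_map p S10 (to_ac :: 'a => 'a alg_closure)"
private abbreviation (input) "d gm nu \<equiv> cw_map p S10 gm nu \<otimes>\<^bsub>C10\<^esub> inv\<^bsub>C10\<^esub> nu"

private lemma p0_10: "p > 0" using prime_gt_0_nat[OF p] .
private lemma ch'_10: "CHAR('a alg_closure) = p" using ch by simp
private lemma S10: "subrng S10" by (rule subrng_sep[OF p ch])
private lemma gG: "group G10" by (rule group_abs_gal[OF p ch])

private lemma iota: "subrng (UNIV :: 'a set)" "rng_hom_on UNIV (to_ac :: 'a => 'a alg_closure)" "range (to_ac :: 'a => 'a alg_closure) <= S10"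
 using to_ac_sep[OF p ch] by (auto simp: rng_hom_on_def)

lemmas iota_inj = cw_map_inj[OF p iota S10]
lemmas iota_group_hom = cw_map_group_hom[OF p iota S10]

private lemma frob_surj:
 assumes "f : carrier C10"
 obtains nu where "nu : carrier C10" "frob_minus_one p S10 nu = f"
proof -
 have "cw_wp p S10 = carrier C10"
  by (rule cw_wp_surj[OF p S10 ch'_10]) (rule sep_artin_schreier[OF p ch])
 then have "f : frob_minus_one p S10 ` carrier C10" using assms by (simp add: cw_wp_eq[OF p])
 then obtain nu where "nu : carrier C10" "f = frob_minus_one p S10 nu" by (rule imageE)
 then show thesis using that[of nu] by simp
qed

private lemma gal_iota:
 assumes g: "gm : carrier G10" and f: "f : carrier K"
 shows "cw_map p S10 gm (io f) = io f"
proof -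
 obtain m x where x: "x : carrier (witt p UNIV m)" "f = cw_inj p UNIV m x" using cw_cases[OF p iota(1) f] .
 have "map to_ac x : carrier (W10 m)" using iota(3) by (auto simp: witt_carrier_iff x(1)[unfolded witt_carrier_iff])
 then show ?thesis
  using gal_cw_inj[OF p ch g, of "map to_ac x" m] x abs_galD(5)[OF g] by (simp add: iota_inj comp_def)
qed

text \<open>Both \<open>nu\<close> and its image under \<open>gm\<close> solve the equation for f,
  since f comes from the base field; their difference is therefore fixed by Frobenius.\<close>

private lemma d_frob_fixed:
 assumes g: "gm : carrier G10" and f: "f : carrier K" and n: "nu : carrier C10" and e: "frob_minus_one p S10 nu = io f"
 shows "cw_map p S10 (%x. x ^ p) (d gm nu) = d gm nu"
proof -
 interpret C10: comm_group C10 by (rule comm_group_cw[OF p S10])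
 interpret F: group_hom C10 C10 "cw_map p S10 (%x. x ^ p)" by (rule frob_group_hom[OF p S10 ch'_10])
 interpret \<Gamma>: group_hom C10 C10 "cw_map p S10 gm" by (rule gal_group_hom[OF p ch g])
 interpret I: group_hom K C10 io by (rule iota_group_hom)
 have gS: "gm ` S10 <= S10" using abs_galD(2)[OF g] by blast
 have if': "io f : carrier C10" using f by simp
 have "frob_minus_one p S10 (cw_map p S10 gm nu) = io f"
  using cw_map_frob_minus_one[OF p S10 gal_rng_hom[OF p ch g] gS S10 ch'_10 ch'_10 n] e gal_iota[OF g f] by simp
 then have F1: "cw_map p S10 (%x. x ^ p) (cw_map p S10 gm nu) = io f \<otimes>\<^bsub>C10\<^esub> cw_map p S10 gm nu"
  using frob_eq_iff[OF p S10 ch'_10 _ if', of "cw_map p S10 gm nu"] n by simp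
 have F2: "cw_map p S10 (%x. x ^ p) nu = io f \<otimes>\<^bsub>C10\<^esub> nu"
  using frob_eq_iff[OF p S10 ch'_10 n if'] e by simp
 show ?thesis using n if' by (simp add: F1 F2 C10.quotient_cancel)
qed

text \<open>Turns the definite description in \<open>asw\<close> into a computation with any
  solution \<open>nu\<close> among the co-vectors of the separable closure. Two solutions differ by
  a Frobenius-fixed co-vector, which the Galois group fixes, so the value does not depend on the
  choice.\<close>

lemma asw_eqI:
 assumes g: "gm : carrier G10" and f: "f : carrier K" and n: "nu : carrier C10"
  and e: "frob_minus_one p S10 nu = io f" and q: "fp_val p (d gm nu) q"
 shows "asw p f gm = q"
proof -
 interpret C10: comm_group C10 by (rule comm_group_cw[OF p S10])
 interpret \<Gamma>: group_hom C10 C10 "cw_map p S10 gm" by (rule gal_group_hom[OF p ch g])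
 interpret I: group_hom K C10 io by (rule iota_group_hom)
 interpret D: group_hom C10 C10 "frob_minus_one p S10" by (rule frob_minus_one_group_hom[OF p S10 ch'_10])
 interpret F: group_hom C10 C10 "cw_map p S10 (%x. x ^ p)" by (rule frob_group_hom[OF p S10 ch'_10])
 define P where "P = (%q. \<exists>m x n a.
   (m, x) : f \<and> n : carrier (W10 m) \<and>
   witt_frob p n \<otimes>\<^bsub>W10 m\<^esub> inv\<^bsub>W10 m\<^esub> n = map to_ac x \<and>
   map gm n \<otimes>\<^bsub>W10 m\<^esub> inv\<^bsub>W10 m\<^esub> n = (1 # replicate m 0) [^]\<^bsub>W10 m\<^esub> (a :: int) \<and>
   q = rat_class (of_int a / of_nat (p ^ (m + 1))))"
 have gW: "map gm x : carrier (W10 m)" if "x : carrier (W10 m)" for x m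
  using that abs_galD(2)[OF g] by (auto simp: witt_carrier_iff)
 have FW: "witt_frob p x : carrier (W10 m)" if "x : carrier (W10 m)" for x m
  using that sepI(4)[OF p ch] by (auto simp: witt_carrier_iff witt_frob_def)
 have iW: "map to_ac x : carrier (W10 m)" if "x : carrier (witt p (UNIV::'a set) m)" for x m
  using that iota(3) by (auto simp: witt_carrier_iff)
 have dW: "d gm (cw_inj p S10 m x) = cw_inj p S10 m (map gm x \<otimes>\<^bsub>W10 m\<^esub> inv\<^bsub>W10 m\<^esub> x)" if x: "x : carrier (W10 m)" for x m
 proof -
  interpret J: group_hom "W10 m" C10 "cw_inj p S10 m" by (rule cw_inj_group_hom[OF p S10])
  show ?thesis using x gW[OF x] by (simp add: gal_cw_inj[OF p ch g x])
 qed
 have uniq: "q' = q" if P: "P q'" for q'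
 proof -
  obtain m x n a where 1: "(m, x) : f" "n : carrier (W10 m)"
   and 2: "witt_frob p n \<otimes>\<^bsub>W10 m\<^esub> inv\<^bsub>W10 m\<^esub> n = map to_ac x"
   and 3: "map gm n \<otimes>\<^bsub>W10 m\<^esub> inv\<^bsub>W10 m\<^esub> n = unit_vec m [^]\<^bsub>W10 m\<^esub> (a :: int)"
   and 4: "q' = rat_class (of_int a / of_nat (p ^ (m + 1)))"
   using P unfolding P_def unit_vec_def by blast
  define \<mu> where "\<mu> = cw_inj p S10 m n"
  have mu: "\<mu> : carrier C10" unfolding \<mu>_def using 1(2) by (rule cw_inj_closed[OF p S10])
  obtain m0 x0 where x0: "x0 : carrier (witt p UNIV m0)" "f = cw_inj p UNIV m0 x0" using cw_cases[OF p iota(1) f] .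
  have x: "x : carrier (witt p UNIV m)" "cw_inj p UNIV m x = f"
   using cw_inj_mem[OF p iota(1) 1(1)[unfolded x0(2)] x0(1)] x0(2) by auto
  have emu: "frob_minus_one p S10 \<mu> = io f"
   unfolding \<mu>_def frob_minus_one_inj[OF p S10 ch'_10 1(2)] 2 x(2)[symmetric] iota_inj[OF x(1)] ..
  define \<delta> where "\<delta> = \<mu> \<otimes>\<^bsub>C10\<^esub> inv\<^bsub>C10\<^esub> nu"
  have dC: "\<delta> : carrier C10" and mud: "\<mu> = \<delta> \<otimes>\<^bsub>C10\<^esub> nu" using mu n by (simp_all add: \<delta>_def C10.m_assoc)
  have "frob_minus_one p S10 \<delta> = \<one>\<^bsub>C10\<^esub>" using mu n e emu f by (simp add: \<delta>_def)
  then have "cw_map p S10 (%x. x ^ p) \<delta> = \<delta>" using frob_eq_iff[OF p S10 ch'_10 dC, of "\<one>\<^bsub>C10\<^esub>"] dC by simp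
  then have "cw_map p S10 gm \<delta> = \<delta>" using frob_fixed_fp_val[OF p ch dC] fp_val_gal[OF p ch g] by blast
  then have "d gm \<mu> = d gm nu" using dC n by (simp add: mud C10.quotient_cancel)
  moreover have "fp_val p (d gm \<mu>) q'" unfolding \<mu>_def dW[OF 1(2)] 3 4 fp_val_def[OF p ch] by blast
  ultimately show ?thesis using fp_val_unique[OF p ch _ q] by simp
 qed
 have "\<exists>q'. P q'"
 proof -
  obtain N1 where N1: "\<And>n. n \<ge> N1 ==> \<exists>x\<in>carrier (witt p UNIV n). f = cw_inj p UNIV n x"
   using cw_cases_ge[OF p iota(1) f] by metis
  obtain N2 where N2: "\<And>m. m \<ge> N2 ==> \<exists>x\<in>carrier (W10 m). nu = cw_inj p S10 m x"
   using cw_cases_ge[OF p S10 n] by metis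
  \<comment> \<open>The description speaks of vectors of one length, so f and \<open>nu\<close> are
    brought to a common level, where the equation in the limit becomes an equation of
    vectors.\<close>
  define m where "m = max N1 N2"
  obtain x where x: "x : carrier (witt p UNIV m)" "f = cw_inj p UNIV m x" using N1[of m] by (auto simp: m_def)
  obtain n where n': "n : carrier (W10 m)" "nu = cw_inj p S10 m n" using N2[of m] by (auto simp: m_def)
  interpret Wm: comm_group "W10 m" by (rule comm_group_witt[OF p S10])
  have "(m, x) : f" using cw_inj_self[OF p iota(1) x(1)] x(2) by simp
  moreover have "witt_frob p n \<otimes>\<^bsub>W10 m\<^esub> inv\<^bsub>W10 m\<^esub> n = map to_ac x"
  proof -
   have "cw_inj p S10 m (witt_frob p n \<otimes>\<^bsub>W10 m\<^esub> inv\<^bsub>W10 m\<^esub> n) = cw_inj p S10 m (map to_ac x)"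
    using e unfolding n'(2) frob_minus_one_inj[OF p S10 ch'_10 n'(1)] x(2) iota_inj[OF x(1)] .
   then show ?thesis using n'(1) FW iW[OF x(1)] by (simp add: cw_inj_inj[OF p S10])
  qed
  moreover have "\<exists>a::int. map gm n \<otimes>\<^bsub>W10 m\<^esub> inv\<^bsub>W10 m\<^esub> n = (1 # replicate m 0) [^]\<^bsub>W10 m\<^esub> a"
  proof -
   let ?y = "map gm n \<otimes>\<^bsub>W10 m\<^esub> inv\<^bsub>W10 m\<^esub> n"
   have y: "?y : carrier (W10 m)" using n'(1) gW by simp
   have "cw_map p S10 (%x. x ^ p) (cw_inj p S10 m ?y) = cw_inj p S10 m ?y"
    using d_frob_fixed[OF g f n e] unfolding n'(2) dW[OF n'(1)] .
   then have "cw_inj p S10 m (witt_frob p ?y) = cw_inj p S10 m ?y"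
    unfolding frob_inj[OF p S10 ch'_10 y] witt_frob_def .
   then have "witt_frob p ?y = ?y" using cw_inj_inj[OF p S10 FW[OF y] y] by blast
   then obtain k :: nat where "?y = unit_vec m [^]\<^bsub>W10 m\<^esub> k" using frob_fixed_vec[OF p ch y] by blast
   then have "?y = (1 # replicate m 0) [^]\<^bsub>W10 m\<^esub> int k" by (simp add: int_pow_int unit_vec_def)
   then show ?thesis by blast
  qed
  ultimately show ?thesis unfolding P_def using n'(1) by blast
 qed
 then have "(THE q. P q) = q" using uniq by (metis the_equality)
 then show ?thesis using g unfolding asw_def P_def by simp
qed

lemma asw_witness:
 assumes f: "f : carrier K"
 obtains nu where "nu : carrier C10" "frob_minus_one p S10 nu = io f" "\<And>gm. gm : carrier G10 ==> fp_val p (d gm nu) (asw p f gm)"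
proof -
 interpret C10: comm_group C10 by (rule comm_group_cw[OF p S10])
 interpret I: group_hom K C10 io by (rule iota_group_hom)
 obtain nu where n: "nu : carrier C10" "frob_minus_one p S10 nu = io f" using frob_surj[of "io f"] f by auto
 have v: "fp_val p (d gm nu) (asw p f gm)" if g: "gm : carrier G10" for gm
 proof -
  interpret \<Gamma>: group_hom C10 C10 "cw_map p S10 gm" by (rule gal_group_hom[OF p ch g])
  have "d gm nu : carrier C10" using n by simp
  then obtain q where q: "fp_val p (d gm nu) q" using frob_fixed_fp_val[OF p ch _ d_frob_fixed[OF g f n]] by blast
  then show ?thesis using asw_eqI[OF g f n q] by simp
 qed
 show thesis by (rule that[OF n v])
qed

lemma gal_mult_cw:
 assumes g: "gm : carrier G10" "gm' : carrier G10" and n: "nu : carrier C10"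
 shows "cw_map p S10 (gm \<otimes>\<^bsub>G10\<^esub> gm') nu = cw_map p S10 gm (cw_map p S10 gm' nu)"
proof -
 have s: "gm ` S10 <= S10" "gm' ` S10 <= S10" using abs_galD(2) g by blast+
 have "cw_map p S10 gm (cw_map p S10 gm' nu) = cw_map p S10 (%x. gm (gm' x)) nu"
  by (rule cw_map_comp[OF p S10 gal_rng_hom[OF p ch g(2)] s(2) S10 gal_rng_hom[OF p ch g(1)] s(1) S10 n])
 also have "\<dots> = cw_map p S10 (gm \<otimes>\<^bsub>G10\<^esub> gm') nu"
  by (rule cw_map_cong[OF p S10 n]) (use g in "simp add: abs_gal_mult_apply")
 finally show ?thesis ..
qed

text \<open>Multiplicativity holds because \<open>d gm' nu\<close> is fixed by \<open>gm\<close>;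
  continuity because \<open>nu\<close> has finitely many entries, and an automorphism fixing them
  fixes \<open>nu\<close>.\<close>

lemma asw_closed:
 assumes f: "f : carrier K"
 shows "asw p f : carrier H"
proof -
 interpret C10: comm_group C10 by (rule comm_group_cw[OF p S10])
 interpret G10: group G10 by (rule gG)
 obtain nu where n: "nu : carrier C10" "frob_minus_one p S10 nu = io f"
  and v: "\<And>gm. gm : carrier G10 ==> fp_val p (d gm nu) (asw p f gm)" using asw_witness[OF f] by blast
 have "asw p f : hom G10 (prufer p)"
 proof (rule homI)
  show "asw p f gm : carrier (prufer p)" if "gm : carrier G10" for gm using fp_val_in[OF p ch v[OF that]] .
  fix gm gm' assume g: "gm : carrier G10" "gm' : carrier G10"
  interpret \<Gamma>: group_hom C10 C10 "cw_map p S10 gm" by (rule gal_group_hom[OF p ch g(1)])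
  interpret \<Gamma>': group_hom C10 C10 "cw_map p S10 gm'" by (rule gal_group_hom[OF p ch g(2)])
  have fx: "cw_map p S10 gm (d gm' nu) = d gm' nu" by (rule fp_val_gal[OF p ch g(1) v[OF g(2)]])
  have "cw_map p S10 gm' nu = d gm' nu \<otimes>\<^bsub>C10\<^esub> nu" using n(1) by (simp add: C10.m_assoc)
  then have "cw_map p S10 gm (cw_map p S10 gm' nu) = cw_map p S10 gm (d gm' nu) \<otimes>\<^bsub>C10\<^esub> cw_map p S10 gm nu"
   using n(1) \<Gamma>.hom_mult[of "d gm' nu" nu] by simp
  then have "d (gm \<otimes>\<^bsub>G10\<^esub> gm') nu = d gm nu \<otimes>\<^bsub>C10\<^esub> d gm' nu"
   unfolding gal_mult_cw[OF g n(1)] fx using n(1) by (simp add: C10.m_ac)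
  then have "fp_val p (d (gm \<otimes>\<^bsub>G10\<^esub> gm') nu) (asw p f gm \<otimes>\<^bsub>rat_mod_int\<^esub> asw p f gm')"
   using fp_val_mult[OF p ch v[OF g(1)] v[OF g(2)]] by simp
  then show "asw p f (gm \<otimes>\<^bsub>G10\<^esub> gm') = asw p f gm \<otimes>\<^bsub>prufer p\<^esub> asw p f gm'"
   unfolding prufer_simps using asw_eqI[OF G10.m_closed[OF g] f n] by blast
 qed
 moreover have "asw p f : extensional (carrier G10)" by (simp add: asw_def)
 moreover have "\<exists>T. finite T \<and> T <= S10 \<and> (\<forall>gm\<in>carrier G10. (\<forall>x\<in>T. gm x = x) \<longrightarrow> asw p f gm = \<one>\<^bsub>prufer p\<^esub>)"
 proof -
  obtain m y where y: "y : carrier (W10 m)" "nu = cw_inj p S10 m y" using cw_cases[OF p S10 n(1)] .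
  have "asw p f gm = \<one>\<^bsub>prufer p\<^esub>" if g: "gm : carrier G10" and T: "\<forall>x\<in>set y. gm x = x" for gm
  proof -
   have "map gm y = y" using T by (simp add: map_idI)
   then have "cw_map p S10 gm nu = nu" using gal_cw_inj[OF p ch g y(1)] y(2) by simp
   then have "d gm nu = \<one>\<^bsub>C10\<^esub>" using n(1) by simp
   then have "fp_val p (d gm nu) \<one>\<^bsub>rat_mod_int\<^esub>" using fp_val_one_iff[OF p ch] by blast
   then show ?thesis unfolding prufer_simps using asw_eqI[OF g f n] by blast
  qed
  moreover have "set y <= S10" using y(1) by (simp add: witt_carrier_iff)
  ultimately show ?thesis by (intro exI[of _ "set y"]) simp
 qed
 ultimately show ?thesis
  unfolding h1_iff[OF p ch comm_group_group[OF comm_group_prufer[OF p0_10]]] by blast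
qed

lemma asw_group_hom: "group_hom K H (asw p)"
proof -
 interpret C10: comm_group C10 by (rule comm_group_cw[OF p S10])
 interpret K: comm_group K by (rule comm_group_cw[OF p iota(1)])
 interpret I: group_hom K C10 io by (rule iota_group_hom)
 interpret D: group_hom C10 C10 "frob_minus_one p S10" by (rule frob_minus_one_group_hom[OF p S10 ch'_10])
 interpret P: comm_group "prufer p" by (rule comm_group_prufer[OF p0_10])
 interpret H: comm_group H by (rule comm_group_h1[OF p ch P.comm_group_axioms])
 have "asw p : hom K H"
 proof (rule homI)
  show "asw p f : carrier H" if "f : carrier K" for f using that by (rule asw_closed)
  fix f g assume fg: "f : carrier K" "g : carrier K"
  obtain nu where n: "nu : carrier C10" "frob_minus_one p S10 nu = io f"
   and v: "\<And>gm. gm : carrier G10 ==> fp_val p (d gm nu) (asw p f gm)" using asw_witness[OF fg(1)] by blast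
  obtain \<mu> where m: "\<mu> : carrier C10" "frob_minus_one p S10 \<mu> = io g"
   and w: "\<And>gm. gm : carrier G10 ==> fp_val p (d gm \<mu>) (asw p g gm)" using asw_witness[OF fg(2)] by blast
  show "asw p (f \<otimes>\<^bsub>K\<^esub> g) = asw p f \<otimes>\<^bsub>H\<^esub> asw p g"
  proof (rule h1_ext[OF p ch P.is_group asw_closed H.m_closed[OF asw_closed asw_closed]])
   show "f \<otimes>\<^bsub>K\<^esub> g : carrier K" "f : carrier K" "g : carrier K" using fg by auto
   fix gm assume g: "gm : carrier G10"
   interpret \<Gamma>: group_hom C10 C10 "cw_map p S10 gm" by (rule gal_group_hom[OF p ch g])
   have e: "frob_minus_one p S10 (nu \<otimes>\<^bsub>C10\<^esub> \<mu>) = io (f \<otimes>\<^bsub>K\<^esub> g)" using n m fg by simp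
   have "d gm (nu \<otimes>\<^bsub>C10\<^esub> \<mu>) = d gm nu \<otimes>\<^bsub>C10\<^esub> d gm \<mu>" using n(1) m(1) by (simp add: C10.inv_mult C10.m_ac)
   then have "fp_val p (d gm (nu \<otimes>\<^bsub>C10\<^esub> \<mu>)) (asw p f gm \<otimes>\<^bsub>rat_mod_int\<^esub> asw p g gm)"
    using fp_val_mult[OF p ch v[OF g] w[OF g]] by simp
   then have "asw p (f \<otimes>\<^bsub>K\<^esub> g) gm = asw p f gm \<otimes>\<^bsub>rat_mod_int\<^esub> asw p g gm"
    using asw_eqI[OF g K.m_closed[OF fg] C10.m_closed[OF n(1) m(1)] e] by blast
   then show "asw p (f \<otimes>\<^bsub>K\<^esub> g) gm = (asw p f \<otimes>\<^bsub>H\<^esub> asw p g) gm"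
    by (simp add: h1_mult_apply[OF p ch g] prufer_simps)
  qed
 qed
 then show ?thesis by (simp add: group_hom_def group_hom_axioms_def)
qed

text \<open>A trivial character means that \<open>nu\<close> is fixed by the Galois group, so its
  entries lie in the base field by \<open>fixed_field\<close> and the equation descends. Conversely,
  a solution over the base field is fixed by every automorphism.\<close>

lemma asw_kernel: "kernel K H (asw p) = cw_wp p (UNIV :: 'a set)"
proof -
 interpret C10: comm_group C10 by (rule comm_group_cw[OF p S10])
 interpret K: comm_group K by (rule comm_group_cw[OF p iota(1)])
 interpret I: group_hom K C10 io by (rule iota_group_hom)
 interpret A: group_hom K H "asw p" by (rule asw_group_hom)
 interpret P: comm_group "prufer p" by (rule comm_group_prufer[OF p0_10])
 have "f : cw_wp p UNIV" if f: "f : carrier K" and one: "asw p f = \<one>\<^bsub>H\<^esub>" for f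
 proof -
  obtain nu where n: "nu : carrier C10" "frob_minus_one p S10 nu = io f"
   and v: "\<And>gm. gm : carrier G10 ==> fp_val p (d gm nu) (asw p f gm)" using asw_witness[OF f] by blast
  obtain m y where y: "y : carrier (W10 m)" "nu = cw_inj p S10 m y" using cw_cases[OF p S10 n(1)] .
  have "map gm y = y" if g: "gm : carrier G10" for gm
  proof -
   interpret \<Gamma>: group_hom C10 C10 "cw_map p S10 gm" by (rule gal_group_hom[OF p ch g])
   have "fp_val p (d gm nu) \<one>\<^bsub>rat_mod_int\<^esub>"
    using v[OF g] one h1_one_apply[OF p ch g, of "prufer p"] by (simp add: prufer_simps)
   then have "d gm nu = \<one>\<^bsub>C10\<^esub>" using fp_val_one_iff[OF p ch] by blast
   then have "cw_map p S10 gm nu = nu" using C10.inv_solve_right[of "\<one>\<^bsub>C10\<^esub>" "cw_map p S10 gm nu" nu] n(1) by simp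
   then have "cw_inj p S10 m (map gm y) = cw_inj p S10 m y" using gal_cw_inj[OF p ch g y(1)] y(2) by simp
   moreover have "map gm y : carrier (W10 m)" using y(1) abs_galD(2)[OF g] by (auto simp: witt_carrier_iff)
   ultimately show ?thesis using cw_inj_inj[OF p S10 _ y(1)] by blast
  qed
  then have fixed: "gm x = x" if "x : set y" "gm : carrier G10" for x gm using that by (metis map_eq_conv map_ident)
  have "x : range to_ac" if x: "x : set y" for x
   by (rule fixed_field[OF p ch]) (use x fixed y(1) in "auto simp: witt_carrier_iff")
  then have yz: "y = map to_ac (map of_ac y)" by (auto simp: to_ac_of_ac map_idI)
  define z where "z = cw_inj p UNIV m (map of_ac y)"
  have z': "map of_ac y : carrier (witt p (UNIV::'a set) m)" using y(1) by (simp add: witt_carrier_iff)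
  have z: "z : carrier K" unfolding z_def by (rule cw_inj_closed[OF p iota(1) z'])
  have "nu = io z" unfolding z_def iota_inj[OF z'] y(2) using yz by simp
  then have "io (frob_minus_one p UNIV z) = io f"
   using n(2) cw_map_frob_minus_one[OF p iota S10 ch ch'_10 z] by simp
  moreover have "inj_on io (carrier K)" by (rule cw_map_inj_on[OF p iota S10]) (simp add: inj_to_ac)
  moreover have "frob_minus_one p UNIV z : carrier K"
   using group_hom.hom_closed[OF frob_minus_one_group_hom[OF p iota(1) ch] z] .
  ultimately have "frob_minus_one p UNIV z = f" using f by (auto dest: inj_onD)
  then show ?thesis unfolding cw_wp_eq[OF p] using z by blast
 qed
 moreover have "asw p f = \<one>\<^bsub>H\<^esub> \<and> f : carrier K" if fw: "f : cw_wp p UNIV" for f :: "'a covec"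
 proof -
  obtain g where g: "g : carrier K" "f = frob_minus_one p UNIV g" using fw unfolding cw_wp_eq[OF p] by blast
  have f: "f : carrier K" unfolding g(2)
   using group_hom.hom_closed[OF frob_minus_one_group_hom[OF p iota(1) ch] g(1)] .
  have e: "frob_minus_one p S10 (io g) = io f" unfolding g(2) using cw_map_frob_minus_one[OF p iota S10 ch ch'_10 g(1)] by simp
  have "asw p f = \<one>\<^bsub>H\<^esub>"
  proof (rule h1_ext[OF p ch P.is_group asw_closed[OF f] A.H.one_closed])
   fix gm assume gg: "gm : carrier G10"
   have "d gm (io g) = \<one>\<^bsub>C10\<^esub>" unfolding gal_iota[OF gg g(1)] using g(1) by simp
   then have "fp_val p (d gm (io g)) \<one>\<^bsub>rat_mod_int\<^esub>" using fp_val_one_iff[OF p ch] by blast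
   then have "asw p f gm = \<one>\<^bsub>rat_mod_int\<^esub>" by (rule asw_eqI[OF gg f I.hom_closed[OF g(1)] e])
   then show "asw p f gm = \<one>\<^bsub>H\<^esub> gm" by (simp add: h1_one_apply[OF p ch gg] prufer_simps)
  qed
  then show ?thesis using f by blast
 qed
 ultimately show ?thesis unfolding kernel_def by blast
qed

text \<open>The values of \<open>chi\<close> are multiples of 1/p and amount to an additive map into
  F_p. Additive Hilbert 90 writes it as sg z - z, and z^p - z is invariant, so the vector of length
  one with entry z^p - z has \<open>chi\<close> as its character.\<close>

lemma asw_p_torsion:
 assumes chi: "chi : carrier H" and tor: "chi [^]\<^bsub>H\<^esub> p = \<one>\<^bsub>H\<^esub>"
 shows "chi : asw p ` carrier K"
proof -
 interpret C10: comm_group C10 by (rule comm_group_cw[OF p S10])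
 interpret P: comm_group "prufer p" by (rule comm_group_prufer[OF p0_10])
 interpret G10: group G10 by (rule gG)
 interpret W10: comm_group "W10 0" by (rule comm_group_witt[OF p S10])
 interpret Q: comm_group rat_mod_int by (rule comm_group_rat_mod_int)
 have hchi: "chi : hom G10 (prufer p)" and "\<exists>T. finite T \<and> T <= S10 \<and> (\<forall>sg\<in>carrier G10. (\<forall>x\<in>T. sg x = x) \<longrightarrow> chi sg = \<one>\<^bsub>prufer p\<^esub>)"
  using chi unfolding h1_iff[OF p ch P.is_group] by blast+
 then obtain T where T: "finite T" "T <= S10" "\<forall>sg\<in>carrier G10. (\<forall>x\<in>T. sg x = x) \<longrightarrow> chi sg = \<one>\<^bsub>rat_mod_int\<^esub>"
  unfolding prufer_simps by blast
 have pw: "(q [^]\<^bsub>prufer p\<^esub> n) = q [^]\<^bsub>rat_mod_int\<^esub> n" for q and n :: nat by (simp add: nat_pow_def prufer_simps)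
 have "\<exists>a::int. chi sg = rat_class (of_int a / of_nat p)" if s: "sg : carrier G10" for sg
 proof -
  have "chi sg : carrier (prufer p)" using hchi s by (auto simp: hom_def)
  then obtain r where r: "chi sg = rat_class r" by (auto simp: prufer_carrier)
  have "rat_class r [^]\<^bsub>rat_mod_int\<^esub> p = \<one>\<^bsub>rat_mod_int\<^esub>"
   using h1_pow_apply[OF p ch P.comm_group_axioms chi s, of p] tor h1_one_apply[OF p ch s, of "prufer p"]
   by (simp add: r pw prufer_simps)
  then show ?thesis using rat_class_pow_eq_one[OF p0_10, of r] r by auto
 qed
 then obtain a where a: "\<And>sg. sg : carrier G10 ==> chi sg = rat_class (of_int (a sg) / of_nat p)" by metis
 \<comment> \<open>Identifies the multiples of 1/p modulo integers with the prime field, so that the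
   values of \<open>chi\<close> can be read inside the algebraic closure.\<close>
 have eq: "rat_class (of_int i / of_nat p) = rat_class (of_int j / of_nat p) \<longleftrightarrow> (of_int i :: 'a alg_closure) = of_int j" for i j
 proof -
  have "rat_class (of_int i / of_nat p) = rat_class (of_int j / of_nat p) \<longleftrightarrow> (\<exists>c. (of_int i / of_nat p - of_int j / of_nat p :: rat) = of_int c)"
   unfolding rat_class_eq_iff by (auto simp: Ints_def)
  also have "\<dots> \<longleftrightarrow> (\<exists>c. i - j = int p * c)"
  proof -
   have "(of_int i / of_nat p - of_int j / of_nat p :: rat) = of_int c \<longleftrightarrow> of_int (i - j) = (of_int (int p * c) :: rat)" for c
    using p0_10 by (simp add: diff_divide_distrib[symmetric] divide_eq_eq mult.commute)
   then show ?thesis unfolding of_int_eq_iff by simp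
  qed
  also have "\<dots> \<longleftrightarrow> int p dvd i - j" by (auto simp: dvd_def)
  also have "\<dots> \<longleftrightarrow> (of_int (i - j) :: 'a alg_closure) = 0" using of_int_eq_0_iff_char_dvd[where ?'a = "'a alg_closure", of "i - j"] unfolding ch'_10 by simp
  finally show ?thesis by simp
 qed
 let ?b = "%sg. of_int (a sg) :: 'a alg_closure"
 have "\<exists>z\<in>S10. \<forall>sg\<in>carrier G10. sg z - z = ?b sg"
 proof (rule additive_hilbert_90[OF p ch _ _ T(1,2)])
  fix sg tu assume s: "sg : carrier G10" "tu : carrier G10"
  have "chi (sg \<otimes>\<^bsub>G10\<^esub> tu) = chi sg \<otimes>\<^bsub>rat_mod_int\<^esub> chi tu" using hom_mult[OF hchi s] by (simp add: prufer_simps)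
  then have "rat_class (of_int (a (sg \<otimes>\<^bsub>G10\<^esub> tu)) / of_nat p) = rat_class (of_int (a sg + a tu) / of_nat p)"
   using s by (simp add: a rat_class_mult add_divide_distrib)
  then show "?b (sg \<otimes>\<^bsub>G10\<^esub> tu) = ?b sg + ?b tu" unfolding eq by simp
 next
  show "?b sg : range to_ac" for sg by (metis rangeI to_ac_of_int)
  fix sg assume s: "sg : carrier G10" "\<And>x. x : T ==> sg x = x"
  then have "rat_class (of_int (a sg) / of_nat p) = rat_class (of_int 0 / of_nat p)"
   using T(3) a[OF s(1)] by (simp add: rat_mod_int_one)
  then show "?b sg = 0" unfolding eq by simp
 qed
 then obtain z where z: "z : S10" "\<And>sg. sg : carrier G10 ==> sg z = z + ?b sg" by (force simp: algebra_simps)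
 have bp: "?b sg ^ p = ?b sg" for sg
 proof -
  obtain n where "?b sg = of_nat n \<or> ?b sg = - of_nat n" by (cases "a sg" rule: int_cases2) auto
  moreover have "(of_nat n :: 'a alg_closure) ^ p = of_nat n" using prime_field_of_nat[OF p ch'_10] by blast
  moreover have "(- of_nat n :: 'a alg_closure) ^ p = - of_nat n"
   using minus_power_prime_CHAR[of p "of_nat n :: 'a alg_closure"] p ch'_10 calculation(2) by simp
  ultimately show ?thesis by (elim disjE) simp_all
 qed
 have "z ^ p - z : range to_ac"
 proof (rule fixed_field[OF p ch])
  show "z ^ p - z : S10" using z by (intro sepI[OF p ch])
  fix sg assume s: "sg : carrier G10"
  have zp: "z ^ p : S10" using z by (intro sepI[OF p ch])
  have "sg (z ^ p - z) = sg (z ^ p) - sg z"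
   using abs_galD(3)[OF s sepI(2)[OF p ch zp z(1)] z(1)] by (simp add: algebra_simps)
  also have "sg (z ^ p) = sg z ^ p" using rng_hom_on_power(2)[OF S10 gal_rng_hom[OF p ch s] z(1) p0_10] .
  also have "sg z ^ p = z ^ p + ?b sg ^ p" unfolding z(2)[OF s] by (rule freshmans_dream) (use p ch'_10 in auto)
  finally show "sg (z ^ p - z) = z ^ p - z" by (simp add: bp z(2)[OF s])
 qed
 then obtain c where c: "z ^ p - z = to_ac c" by blast
 define f where "f = cw_inj p UNIV 0 [c]"
 define nu where "nu = cw_inj p S10 0 [z]"
 have fW: "[c] : carrier (witt p UNIV 0)" and zW: "[x] : carrier (W10 0) \<longleftrightarrow> x : S10" for x
  by (simp_all add: witt_carrier_iff)
 have f: "f : carrier K" unfolding f_def by (rule cw_inj_closed[OF p iota(1) fW])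
 have n: "nu : carrier C10" unfolding nu_def by (rule cw_inj_closed[OF p S10]) (simp add: zW z)
 have add: "cw_inj p S10 0 [x] \<otimes>\<^bsub>C10\<^esub> cw_inj p S10 0 [y] = cw_inj p S10 0 [x + y]" if xy: "x : S10" "y : S10" for x y
 proof -
  have "[x] \<otimes>\<^bsub>W10 0\<^esub> [y] : carrier (W10 0)" using xy by (intro W10.m_closed) (simp_all add: zW)
  then have "length ([x] \<otimes>\<^bsub>W10 0\<^esub> [y]) = 1" by (simp add: witt_carrier_iff)
  then have "[x] \<otimes>\<^bsub>W10 0\<^esub> [y] = [x + y]" using witt_hd_mult[OF p, of "[x]" 0 "[y]" S10] by (cases "[x] \<otimes>\<^bsub>W10 0\<^esub> [y]") auto
  then show ?thesis using xy by (simp add: cw_inj_mult[OF p S10] zW)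
 qed
 have cS: "to_ac c : S10" by (rule to_ac_sep[OF p ch])
 have e: "frob_minus_one p S10 nu = io f"
 proof -
  have if': "io f = cw_inj p S10 0 [to_ac c]" unfolding f_def iota_inj[OF fW] by simp
  have "io f : carrier C10" unfolding if' by (rule cw_inj_closed[OF p S10]) (simp add: zW cS)
  moreover have zc: "to_ac c + z = z ^ p" unfolding c[symmetric] by simp
  have "cw_map p S10 (%x. x ^ p) nu = io f \<otimes>\<^bsub>C10\<^esub> nu"
   unfolding if' nu_def add[OF cS z(1)] zc using frob_inj[OF p S10 ch'_10, of "[z]" 0] z(1) by (simp add: zW)
  ultimately show ?thesis using frob_eq_iff[OF p S10 ch'_10 n] by blast
 qed
 have "asw p f = chi"
 proof (rule h1_ext[OF p ch P.is_group asw_closed[OF f] chi])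
  fix sg assume s: "sg : carrier G10"
  have bS: "?b sg : S10" using to_ac_sep[OF p ch, of "of_int (a sg)"] by simp
  \<comment> \<open>A nonnegative representative, because \<open>witt_hd_pow\<close> gives the first
    entry for natural multiples.\<close>
  define k where "k = nat (a sg mod int p)"
  have k: "(of_nat k :: 'a alg_closure) = ?b sg" "rat_class (of_int (a sg) / of_nat p) = rat_class (of_int (int k) / of_nat p)"
  proof -
   have "int k = a sg mod int p" using p0_10 by (simp add: k_def)
   then have "int p dvd a sg - int k" by (simp add: dvd_minus_mod)
   then have "(of_int (a sg - int k) :: 'a alg_closure) = 0" using of_int_eq_0_iff_char_dvd[where ?'a = "'a alg_closure"] ch'_10 by blast
   then show 1: "(of_nat k :: 'a alg_closure) = ?b sg" by simp
   show "rat_class (of_int (a sg) / of_nat p) = rat_class (of_int (int k) / of_nat p)" unfolding eq using 1 by simp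
  qed
  have u: "unit_vec 0 [^]\<^bsub>W10 0\<^esub> (int k) = [?b sg]"
  proof -
   have "unit_vec 0 [^]\<^bsub>W10 0\<^esub> k : carrier (W10 0)" using unit_vec_in[OF p ch] by simp
   then have "length (unit_vec 0 [^]\<^bsub>W10 0\<^esub> k) = 1" by (simp add: witt_carrier_iff)
   then show ?thesis using witt_hd_pow[OF p ch unit_vec_in[OF p ch], of 0 k] k(1)
    by (cases "unit_vec 0 [^]\<^bsub>W10 0\<^esub> k") (auto simp: unit_vec_def int_pow_int)
  qed
  have "cw_map p S10 sg nu = cw_inj p S10 0 [?b sg] \<otimes>\<^bsub>C10\<^esub> nu"
   unfolding nu_def add[OF bS z(1)] using gal_cw_inj[OF p ch s, of "[z]" 0] z(1) by (simp add: zW z(2)[OF s] add.commute)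
  moreover have "cw_inj p S10 0 [?b sg] : carrier C10" by (rule cw_inj_closed[OF p S10]) (simp add: zW bS)
  ultimately have "d sg nu = cw_inj p S10 0 [?b sg]" using n by (simp add: C10.m_assoc)
  then have "fp_val p (d sg nu) (chi sg)"
   unfolding fp_val_def[OF p ch] a[OF s] k(2) by (intro exI[of _ 0] exI[of _ "int k"]) (simp add: u)
  then show "asw p f sg = chi sg" by (rule asw_eqI[OF s f n e])
 qed
 then show ?thesis using f by blast
qed

text \<open>Induction on the exponent of \<open>chi\<close>. If p chi comes from f, it also comes
  from F f, which is p g for some g; then \<open>chi\<close> minus the character of g is p-torsion.
  Finiteness of the range gives every \<open>chi\<close> an exponent p^r.\<close>

lemma asw_surj: "asw p ` carrier K = carrier H"
proof
 interpret K: comm_group K by (rule comm_group_cw[OF p iota(1)])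
 interpret P: comm_group "prufer p" by (rule comm_group_prufer[OF p0_10])
 interpret H: comm_group H by (rule comm_group_h1[OF p ch P.comm_group_axioms])
 interpret A: group_hom K H "asw p" by (rule asw_group_hom)
 interpret F: group_hom K K "cw_map p UNIV (%x. x ^ p)" by (rule frob_group_hom[OF p iota(1) ch])
 show "asw p ` carrier K <= carrier H" by auto
 have frob: "asw p (cw_map p UNIV (%x. x ^ p) f) = asw p f" if f: "f : carrier K" for f
 proof -
  have "frob_minus_one p UNIV f : kernel K H (asw p)" unfolding asw_kernel cw_wp_eq[OF p] using f by blast
  then have "frob_minus_one p UNIV f : carrier K" "asw p (frob_minus_one p UNIV f) = \<one>\<^bsub>H\<^esub>" by (auto simp: kernel_def)
  moreover have "cw_map p UNIV (%x. x ^ p) f = frob_minus_one p UNIV f \<otimes>\<^bsub>K\<^esub> f"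
   using f unfolding frob_minus_one_def[OF p] by (simp add: K.m_assoc)
  ultimately show ?thesis using f by simp
 qed
 have "chi : asw p ` carrier K" if "chi : carrier H" "chi [^]\<^bsub>H\<^esub> (p ^ r) = \<one>\<^bsub>H\<^esub>" for chi r
  using that
 proof (induction r arbitrary: chi)
  case 0
  then have "chi = \<one>\<^bsub>H\<^esub>" by simp
  then show ?case using A.hom_one K.one_closed by (metis image_eqI)
 next
  case (Suc r)
  have "chi [^]\<^bsub>H\<^esub> p : asw p ` carrier K"
   by (rule Suc.IH) (use Suc.prems in "auto simp: H.nat_pow_pow")
  then obtain f where f: "f : carrier K" "chi [^]\<^bsub>H\<^esub> p = asw p f" by blast
  obtain g where g: "g : carrier K" "g [^]\<^bsub>K\<^esub> p = cw_map p UNIV (%x. x ^ p) f"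
   using frob_is_p_power[OF p iota(1) ch f(1)] by blast
  have "chi [^]\<^bsub>H\<^esub> p = asw p g [^]\<^bsub>H\<^esub> p"
   using f frob[OF f(1)] g A.hom_nat_pow[OF g(1), of p] by simp
  then have "(chi \<otimes>\<^bsub>H\<^esub> inv\<^bsub>H\<^esub> (asw p g)) [^]\<^bsub>H\<^esub> p = \<one>\<^bsub>H\<^esub>"
   using Suc.prems(1) g(1) by (simp add: H.nat_pow_distrib H.nat_pow_inv)
  then have "chi \<otimes>\<^bsub>H\<^esub> inv\<^bsub>H\<^esub> (asw p g) : asw p ` carrier K"
   using Suc.prems(1) g(1) by (intro asw_p_torsion) auto
  then obtain h where h: "h : carrier K" "chi \<otimes>\<^bsub>H\<^esub> inv\<^bsub>H\<^esub> (asw p g) = asw p h" by blast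
  have "asw p (h \<otimes>\<^bsub>K\<^esub> g) = chi \<otimes>\<^bsub>H\<^esub> inv\<^bsub>H\<^esub> (asw p g) \<otimes>\<^bsub>H\<^esub> asw p g" using h g by simp
  also have "\<dots> = chi" using Suc.prems(1) g(1) by (simp add: H.m_assoc)
  finally show ?case using h(1) g(1) by (metis K.m_closed image_eqI)
 qed
 moreover have "\<exists>r. chi [^]\<^bsub>H\<^esub> (p ^ r) = \<one>\<^bsub>H\<^esub>" if chi: "chi : carrier H" for chi
 proof -
  have hchi: "chi : hom G10 (prufer p)" using chi unfolding h1_iff[OF p ch P.is_group] by blast
  have fin: "finite (chi ` carrier G10)" by (rule h1_finite_range[OF p ch P.is_group chi])
  have pw: "(q [^]\<^bsub>prufer p\<^esub> n) = q [^]\<^bsub>rat_mod_int\<^esub> n" for q and n :: nat by (simp add: nat_pow_def prufer_simps)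
  have "\<forall>q\<in>chi ` carrier G10. \<exists>n. q [^]\<^bsub>prufer p\<^esub> (p ^ n) = \<one>\<^bsub>prufer p\<^esub>"
  proof
   fix q assume "q : chi ` carrier G10"
   then have "q : carrier (prufer p)" using hchi by (auto simp: hom_def)
   then show "\<exists>n. q [^]\<^bsub>prufer p\<^esub> (p ^ n) = \<one>\<^bsub>prufer p\<^esub>" unfolding pw prufer_simps using prufer_iff[OF p0_10] by blast
  qed
  from bchoice[OF this] obtain e where e: "\<And>q. q : chi ` carrier G10 ==> q [^]\<^bsub>prufer p\<^esub> (p ^ e q) = \<one>\<^bsub>prufer p\<^esub>" by blast
  define r where "r = Max (e ` chi ` carrier G10)"
  have "chi [^]\<^bsub>H\<^esub> (p ^ r) = \<one>\<^bsub>H\<^esub>"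
  proof (rule h1_ext[OF p ch P.is_group])
   show "chi [^]\<^bsub>H\<^esub> (p ^ r) : carrier H" "\<one>\<^bsub>H\<^esub> : carrier H" using chi by auto
   fix sg assume s: "sg : carrier G10"
   then have q: "chi sg : carrier (prufer p)" using hchi by (auto simp: hom_def)
   have "e (chi sg) \<le> r" unfolding r_def using fin s by (intro Max_ge) auto
   then obtain k where k: "r = e (chi sg) + k" using le_Suc_ex by blast
   have "chi sg [^]\<^bsub>prufer p\<^esub> (p ^ r) = \<one>\<^bsub>prufer p\<^esub>"
    unfolding k power_add using e[of "chi sg"] s q by (simp flip: P.nat_pow_pow)
   then show "(chi [^]\<^bsub>H\<^esub> (p ^ r)) sg = \<one>\<^bsub>H\<^esub> sg"
    by (simp add: h1_pow_apply[OF p ch P.comm_group_axioms chi s] h1_one_apply[OF p ch s])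
  qed
  then show ?thesis by blast
 qed
 ultimately show "carrier H <= asw p ` carrier K" by blast
qed

lemma asw_induces_iso: "induces_iso K (cw_wp p (UNIV :: 'a set)) H (asw p)"
 by (rule induces_isoI[OF asw_group_hom asw_surj asw_kernel])

end

section \<open>Direct sums and lifts to direct limits\<close>

lemma hom_finprod:
 assumes A: "comm_group A" and B: "comm_group B" and f: "f : hom A B" and u: "\<And>i. i : I ==> u i : carrier A"
 shows "f (finprod A u I) = finprod B (%i. f (u i)) I"
proof -
 interpret A: comm_group A by (rule A)
 interpret B: comm_group B by (rule B)
 have f1: "f \<one>\<^bsub>A\<^esub> = \<one>\<^bsub>B\<^esub>" by (rule hom_one[OF f A.is_group B.is_group])
 have fc: "f x : carrier B" if "x : carrier A" for x using f that by (auto simp: hom_def)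
 show ?thesis using u
 proof (induction I rule: infinite_finite_induct)
  case (insert a F)
  then show ?case
   using hom_mult[OF f, of "u a" "finprod A u F"] by (simp add: Pi_iff fc)
 qed (simp_all add: f1)
qed

lemma sum_group_carrierD:
 assumes "\<And>i. i : I ==> group (G i)" "x : carrier (sum_group I G)"
 shows "i : I ==> x i : carrier (G i)" "finite {i : I. x i ~= \<one>\<^bsub>G i\<^esub>}" "x : extensional I"
 using assms by (auto simp: carrier_sum_group PiE_iff)

text \<open>The universal property of the direct sum. The supports of x, y and their product differ,
  so all products are first extended to one finite index set, where the added factors are
  trivial.\<close>

lemma sum_group_lift_hom:
 assumes A: "comm_group A" and G: "\<And>i. i : I ==> group (G i)" and ph: "\<And>i. i : I ==> ph i : hom (G i) A"
 shows "group_hom (sum_group I G) A (%x. finprod A (%i. ph i (x i)) {i : I. x i ~= \<one>\<^bsub>G i\<^esub>})"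
proof -
 interpret A: comm_group A by (rule A)
 have ph1: "ph i \<one>\<^bsub>G i\<^esub> = \<one>\<^bsub>A\<^esub>" if "i : I" for i by (rule hom_one[OF ph[OF that] G[OF that] A.is_group])
 have phc: "ph i a : carrier A" if "i : I" "a : carrier (G i)" for i a using ph that by (auto simp: hom_def)
 have ext: "finprod A (%i. ph i (x i)) {i : I. x i ~= \<one>\<^bsub>G i\<^esub>} = finprod A (%i. ph i (x i)) J"
  if x: "x : carrier (sum_group I G)" and J: "finite J" "{i : I. x i ~= \<one>\<^bsub>G i\<^esub>} <= J" "J <= I" for x J
  by (rule A.finprod_mono_neutral_cong_left[OF J(1,2)])
   (use J(3) sum_group_carrierD(1)[OF G x] in "auto simp: ph1 intro!: phc")
 have gS: "group (sum_group I G)" by (rule sum_group) (rule G)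
 have "(%x. finprod A (%i. ph i (x i)) {i : I. x i ~= \<one>\<^bsub>G i\<^esub>}) : hom (sum_group I G) A"
 proof (rule homI)
  fix x assume x: "x : carrier (sum_group I G)"
  show "finprod A (%i. ph i (x i)) {i : I. x i ~= \<one>\<^bsub>G i\<^esub>} : carrier A"
   by (rule A.finprod_closed) (use sum_group_carrierD(1)[OF G x] phc in auto)
  fix y assume y: "y : carrier (sum_group I G)"
  let ?J = "{i : I. x i ~= \<one>\<^bsub>G i\<^esub>} \<union> {i : I. y i ~= \<one>\<^bsub>G i\<^esub>}"
  have J: "finite ?J" "?J <= I" using sum_group_carrierD(2)[OF G] x y by auto
  have xy: "x \<otimes>\<^bsub>sum_group I G\<^esub> y : carrier (sum_group I G)"
   by (rule monoid.m_closed[OF group.is_monoid[OF gS] x y])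
  have xph: "ph i (x i) : carrier A" if "i : I" for i
   by (rule phc[OF that sum_group_carrierD(1)[OF G x that]])
  have yph: "ph i (y i) : carrier A" if "i : I" for i
   by (rule phc[OF that sum_group_carrierD(1)[OF G y that]])
  have app: "(x \<otimes>\<^bsub>sum_group I G\<^esub> y) i = x i \<otimes>\<^bsub>G i\<^esub> y i" if "i : I" for i using that by simp
  have sub: "{i : I. (x \<otimes>\<^bsub>sum_group I G\<^esub> y) i ~= \<one>\<^bsub>G i\<^esub>} <= ?J"
   using group.is_monoid[OF G] by (auto simp: monoid.r_one)
  have "finprod A (%i. ph i ((x \<otimes>\<^bsub>sum_group I G\<^esub> y) i)) {i : I. (x \<otimes>\<^bsub>sum_group I G\<^esub> y) i ~= \<one>\<^bsub>G i\<^esub>}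
    = finprod A (%i. ph i ((x \<otimes>\<^bsub>sum_group I G\<^esub> y) i)) ?J"
   by (rule ext[OF xy J(1) sub J(2)])
  also have "\<dots> = finprod A (%i. ph i (x i) \<otimes>\<^bsub>A\<^esub> ph i (y i)) ?J"
  proof (rule A.finprod_cong')
   show "(%i. ph i (x i) \<otimes>\<^bsub>A\<^esub> ph i (y i)) : ?J \<rightarrow> carrier A"
    by (rule funcsetI, rule A.m_closed) (use J(2) xph yph in auto)
   fix i assume "i : ?J"
   then have "i : I" by blast
   show "ph i ((x \<otimes>\<^bsub>sum_group I G\<^esub> y) i) = ph i (x i) \<otimes>\<^bsub>A\<^esub> ph i (y i)"
    unfolding app[OF \<open>i : I\<close>]
    by (rule hom_mult[OF ph[OF \<open>i : I\<close>] sum_group_carrierD(1)[OF G x \<open>i : I\<close>] sum_group_carrierD(1)[OF G y \<open>i : I\<close>]])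
  qed simp
  also have "\<dots> = finprod A (%i. ph i (x i)) ?J \<otimes>\<^bsub>A\<^esub> finprod A (%i. ph i (y i)) ?J"
   by (rule A.finprod_multf) (use xph yph in auto)
  also have "\<dots> = finprod A (%i. ph i (x i)) {i : I. x i ~= \<one>\<^bsub>G i\<^esub>} \<otimes>\<^bsub>A\<^esub> finprod A (%i. ph i (y i)) {i : I. y i ~= \<one>\<^bsub>G i\<^esub>}"
   using ext[OF x J(1) _ J(2)] ext[OF y J(1) _ J(2)] by simp
  finally show "finprod A (%i. ph i ((x \<otimes>\<^bsub>sum_group I G\<^esub> y) i)) {i : I. (x \<otimes>\<^bsub>sum_group I G\<^esub> y) i ~= \<one>\<^bsub>G i\<^esub>}
   = finprod A (%i. ph i (x i)) {i : I. x i ~= \<one>\<^bsub>G i\<^esub>} \<otimes>\<^bsub>A\<^esub> finprod A (%i. ph i (y i)) {i : I. y i ~= \<one>\<^bsub>G i\<^esub>}" .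
 qed
 then show ?thesis using gS A.is_group by (simp add: group_hom_def group_hom_axioms_def)
qed

definition single_fun :: "'i set => ('i => ('a, 'c) monoid_scheme) => 'i => 'a => 'i => 'a" where
 "single_fun I G i a = (\<lambda>j\<in>I. if j = i then a else \<one>\<^bsub>G j\<^esub>)"

lemma single_fun_in:
 assumes "\<And>i. i : I ==> group (G i)" "i : I" "a : carrier (G i)"
 shows "single_fun I G i a : carrier (sum_group I G)"
proof -
 have "{j : I. single_fun I G i a j ~= \<one>\<^bsub>G j\<^esub>} <= {i}" by (auto simp: single_fun_def split: if_splits)
 then have "finite {j : I. single_fun I G i a j ~= \<one>\<^bsub>G j\<^esub>}" by (rule finite_subset) simp
 then show ?thesis
  using assms group.is_monoid[OF assms(1)] by (auto simp: carrier_sum_group single_fun_def monoid.one_closed)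
qed

lemma single_fun_lift:
 assumes A: "comm_group A" and i: "i : I" and ph1: "ph i \<one>\<^bsub>G i\<^esub> = \<one>\<^bsub>A\<^esub>" and a: "ph i a : carrier A"
 shows "finprod A (%j. ph j (single_fun I G i a j)) {j : I. single_fun I G i a j ~= \<one>\<^bsub>G j\<^esub>} = ph i a"
proof -
 interpret A: comm_group A by (rule A)
 show ?thesis
 proof (cases "a = \<one>\<^bsub>G i\<^esub>")
  case True
  then have "{j : I. single_fun I G i a j ~= \<one>\<^bsub>G j\<^esub>} = {}" by (auto simp: single_fun_def)
  then show ?thesis by (simp only: A.finprod_empty True ph1)
 next
  case False
  then have "{j : I. single_fun I G i a j ~= \<one>\<^bsub>G j\<^esub>} = {i}" using i by (auto simp: single_fun_def split: if_splits)
  then show ?thesis using i a by (simp add: single_fun_def)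
 qed
qed

text \<open>The universal property of the limit; compatibility with the transition maps makes the
  value independent of the representative picked.\<close>

lemma (in inj_dirsys) lim_lift:
 assumes Q: "group Q" and h: "\<And>m. h m : hom (G m) Q" and c: "\<And>m x. x : carrier (G m) ==> h (Suc m) (ph m x) = h m x"
 shows "\<exists>H \<in> hom L Q. \<forall>m. \<forall>x\<in>carrier (G m). H (inj' m x) = h m x"
proof -
 define H where "H = (%A. let z = (SOME z. z : A) in h (fst z) (snd z))"
 have lift: "h N (fold ph [m..<N] x) = h m x" if "m \<le> N" "x : carrier (G m)" for m N x
  using that(1)
 proof (induction N rule: dec_induct)
  case (step N)
  then show ?case using c[OF tr_closed[OF step(1) that(2)]] tr_Suc[OF step(1)] by (simp del: upt_Suc)
 qed simp
 have H: "H (inj' m x) = h m x" if x: "x : carrier (G m)" for m x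
 proof -
  define z where "z = (SOME z. z : inj' m x)"
  have "z : inj' m x" unfolding z_def using lim_inj_self[OF x] by (rule someI)
  then have z: "snd z : carrier (G (fst z))" "inj' (fst z) (snd z) = inj' m x"
   using lim_inj_mem[of "fst z" "snd z" m x] x by simp_all
  let ?N = "max m (fst z)"
  have "fold ph [fst z..<?N] (snd z) = fold ph [m..<?N] x"
   using lim_inj_eq_iff[of "fst z" ?N m "snd z" x] z x by simp
  then have "h (fst z) (snd z) = h m x" using lift[of "fst z" ?N "snd z"] lift[of m ?N x] z x by simp
  then show ?thesis by (simp add: H_def z_def Let_def)
 qed
 have "H : hom L Q"
 proof (rule homI)
  fix A assume A: "A : carrier L"
  obtain m x where "x : carrier (G m)" "A = inj' m x" using lim_cases[OF A] .
  then show "H A : carrier Q" using H h[of m] by (auto simp: hom_def)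
  fix B assume B: "B : carrier L"
  obtain m x y where x: "x : carrier (G m)" "A = inj' m x" and y: "y : carrier (G m)" "B = inj' m y"
   using lim_cases2[OF A B] .
  have "x \<otimes>\<^bsub>G m\<^esub> y : carrier (G m)" using x y grp[of m] by (simp add: group.is_monoid monoid.m_closed)
  then show "H (A \<otimes>\<^bsub>L\<^esub> B) = H A \<otimes>\<^bsub>Q\<^esub> H B"
   unfolding x(2) y(2) lim_mult[OF x(1) y(1)] using H x y hom_mult[OF h x(1) y(1)] by simp
 qed
 then show ?thesis using H by blast
qed

section \<open>Co-vectors over Laurent series\<close>

lemma CHAR_fls: "CHAR('k::field fls) = CHAR('k)"
 by (rule CHAR_eqI) (simp_all add: fls_of_nat of_nat_eq_0_iff_char_dvd)

lemma CHAR_fps: "CHAR('k::field fps) = CHAR('k)"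
 by (rule CHAR_eqI) (simp_all add: fps_of_nat[symmetric] of_nat_eq_0_iff_char_dvd)

definition fmono :: "'k::field => nat => 'k fls" where
 "fmono c j = fls_const c * fls_X_intpow (- int j)"

lemma fmono_nth: "fls_nth (fmono c j) k = (if k = - int j then c else 0)"
 unfolding fmono_def by (subst mult.commute, subst fls_X_intpow_times_conv_shift(1)) auto

text \<open>A co-monomial of degree d written at level N: entry i carries the exponent d / p^(N -
  i). In the uses below the coefficient is zero wherever this division is not exact.\<close>

definition lvec :: "nat => nat => nat => 'k::field list => 'k fls list" where
 "lvec p d N y = map (%i. fmono (y ! i) (d div p ^ (N - i))) [0..<Suc N]"

lemma lvec_nth: "i \<le> N ==> lvec p d N y ! i = fmono (y ! i) (d div p ^ (N - i))"
 unfolding lvec_def by (subst nth_map_upt) auto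

lemma lvec_length [simp]: "length (lvec p d N y) = Suc N"
 by (simp add: lvec_def)

lemma fmono_0 [simp]: "fmono 0 j = 0" by (simp add: fmono_def)

lemma lvec_Cons: "lvec p d (Suc N) (0 # y) = 0 # lvec p d N y"
 by (rule nth_equalityI) (auto simp: lvec_nth nth_Cons less_Suc_eq_le split: nat.split)

lemma subrng_max_ideal: "subrng {g :: 'k::field fps. fps_nth g 0 = 0}"
 by (auto simp: subrng_def)

lemma rng_hom_const: "rng_hom_on R (fls_const :: 'k::field => 'k fls)"
 by (simp add: rng_hom_on_def fls_plus_const)

lemma rng_hom_fps: "rng_hom_on R (fps_to_fls :: 'k::field fps => 'k fls)"
 by (simp add: rng_hom_on_def fls_times_fps_to_fls)

lemma subgroup_preimage:
 assumes "group_hom G H h" "subgroup B H"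
 shows "subgroup {x : carrier G. h x : B} G"
proof -
 interpret group_hom G H h by fact
 show ?thesis
 proof (rule G.subgroupI)
  have "\<one>\<^bsub>G\<^esub> : {x : carrier G. h x : B}" using subgroup.one_closed[OF assms(2)] by simp
  then show "{x : carrier G. h x : B} ~= {}" by blast
 qed (use subgroup.m_closed[OF assms(2)] subgroup.m_inv_closed[OF assms(2)] in auto)
qed

lemma subgroup_finprod:
 assumes A: "comm_group A" and B: "subgroup B A" and u: "\<And>i. i : I ==> u i : B"
 shows "finprod A u I : B"
proof -
 interpret A: comm_group A by (rule A)
 have c: "x : carrier A" if "x : B" for x using that subgroup.mem_carrier[OF B] by blast
 show ?thesis using u
 proof (induction I rule: infinite_finite_induct)
  case (insert a I)
  then have "finprod A u (insert a I) = u a \<otimes>\<^bsub>A\<^esub> finprod A u I" by (simp add: c)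
  then show ?case using insert subgroup.m_closed[OF B] by simp
 qed (simp_all add: subgroup.one_closed[OF B])
qed

lemma multiplicity_times_power:
 assumes "Factorial_Ring.prime (p::nat)" "n > 0"
 shows "multiplicity p (n * p ^ m) = multiplicity p n + m"
proof -
 have "p ^ m ~= 0" using assms prime_gt_0_nat by auto
 then show ?thesis
  using assms(2) prime_elem_multiplicity_mult_distrib[OF prime_imp_prime_elem[OF assms(1)], of n "p ^ m"]
   multiplicity_same_power[of p m] assms(1) prime_gt_0_nat not_prime_unit by auto
qed

definition laurent_parts_le ::
 "nat => nat => ((nat => 'k::field list) \<times> 'k covec \<times> 'k fps covec) set" where
 "laurent_parts_le p d = {a : laurent_parts p. \<forall>e>d. fst a e = \<one>\<^bsub>witt p UNIV (multiplicity p e)\<^esub>}"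

text \<open>Kato's bound for vectors of length s + 1, with integer subdegrees in place of extended
  real valuations.\<close>

definition kato_vec :: "nat => nat => nat => 'k::field fls list set" where
 "kato_vec p d s = {x. length x = Suc s \<and> (\<forall>i\<le>s. x ! i = 0 \<or> - int d \<le> int (p ^ (s - i)) * fls_subdegree (x ! i))}"

lemma fmono_subdegree: "c ~= 0 ==> fls_subdegree (fmono c j) = - int j"
 by (rule fls_subdegree_eqI) (simp_all add: fmono_nth)

definition integral_fls :: "'k::field fls set" where
 "integral_fls = {g. g = 0 \<or> 0 \<le> fls_subdegree g}"

lemma integral_fls_eq: "integral_fls = range fps_to_fls"
proof (rule Set.set_eqI)
 fix g :: "'a fls"
 show "g : integral_fls \<longleftrightarrow> g : range fps_to_fls"
 proof
  assume "g : integral_fls"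
  then have "fls_nth g k = 0" if "k < 0" for k
   using that unfolding integral_fls_def by (cases "g = 0") auto
  then have "fps_to_fls (fls_regpart g) = g" by (intro fls_eqI) auto
  then show "g : range fps_to_fls" by (metis rangeI)
 qed (auto simp: integral_fls_def fls_subdegree_fls_to_fps)
qed

lemma subrng_integral_fls: "subrng (integral_fls :: 'k::field fls set)"
 unfolding subrng_def integral_fls_eq
 by (auto simp flip: fps_to_fls_plus fls_times_fps_to_fls fps_to_fls_uminus intro: range_eqI[of _ _ 0])

lemma group_isoI:
 assumes "group_hom G H f" "inj_on f (carrier G)" "f ` carrier G = carrier H"
 shows "group_iso G H f"
 using assms unfolding group_iso_def group_hom_def group_hom_axioms_def iso_def bij_betw_def by blast

text \<open>A leading zero contributes an infinite term to the minimum; this is what makes the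
  valuation well defined on co-vectors.\<close>

lemma witt_val_Cons: "witt_val p (Suc s) (0 # x) = witt_val p s (x :: 'k::field fls list)" if "p > 0"
proof -
 have "(%i. ereal (of_nat (p ^ (Suc s - i))) * fls_val ((0 # x) ! i)) ` {..Suc s}
   = insert \<infinity> ((%i. ereal (of_nat (p ^ (s - i))) * fls_val (x ! i)) ` {..s})"
  unfolding atMost_Suc_eq_insert_0 image_insert image_image using that by (simp add: fls_val_def)
 then show ?thesis unfolding witt_val_def by (subst Min_insert[symmetric] | simp)+
qed

lemma witt_val_ge_iff:
 assumes "p > 0" "length x = Suc s"
 shows "ereal (of_int (- int d)) \<le> witt_val p s x \<longleftrightarrow> x : kato_vec p d s"
proof -
 have "ereal (of_int (- int d)) \<le> ereal (of_nat (p ^ (s - i))) * fls_val (x ! i) \<longleftrightarrow>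
   x ! i = 0 \<or> - int d \<le> int (p ^ (s - i)) * fls_subdegree (x ! i)" for i
 proof (cases "x ! i = 0")
  case False
  have "(real_of_int (- int d) \<le> real_of_int (int (p ^ (s - i)) * fls_subdegree (x ! i))) =
   (- int d \<le> int (p ^ (s - i)) * fls_subdegree (x ! i))" by (rule of_int_le_iff)
  then show ?thesis using False by (simp add: fls_val_def)
 qed (use assms(1) in "simp add: fls_val_def")
 then show ?thesis unfolding witt_val_def kato_vec_def using assms(2) by (subst Min_ge_iff) auto
qed

definition polar_phi :: "nat => (nat => 'k::field list) => nat => 'k covec" where
 "polar_phi p x = (\<lambda>n\<in>coprime_nats p. finprod (cwt p UNIV) (%m. cwt_inj p UNIV m (x (n * p ^ m)))
   {m. x (n * p ^ m) ~= \<one>\<^bsub>witt p UNIV m\<^esub>})"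

lemma coprime_nats_multiplicity:
 assumes "Factorial_Ring.prime (p::nat)" "n : coprime_nats p"
 shows "multiplicity p (n * p ^ m) = m" "n * p ^ m > 0"
proof -
 have n: "n > 0" "\<not> p dvd n"
  using assms prime_gt_1_nat[OF assms(1)] coprime_common_divisor_nat[of n p p] by (auto simp: coprime_nats_def)
 show "multiplicity p (n * p ^ m) = m"
  unfolding multiplicity_times_power[OF assms(1) n(1)] by (simp add: not_dvd_imp_multiplicity_0[OF n(2)])
 show "n * p ^ m > 0" using n(1) prime_gt_0_nat[OF assms(1)] by simp
qed

lemma coprime_nats_power_inj:
 assumes "Factorial_Ring.prime (p::nat)" "n : coprime_nats p" "n' : coprime_nats p" "n * p ^ m = n' * p ^ m'"
 shows "n = n' \<and> m = m'"
proof -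
 have m: "m = m'" using coprime_nats_multiplicity(1)[OF assms(1)] assms(2-4) by metis
 have "p ^ m' ~= 0" using prime_gt_0_nat[OF assms(1)] by simp
 then show ?thesis using assms(4) unfolding m by (simp only: mult_cancel2) simp
qed

lemma coprime_nats_decomp:
 assumes "Factorial_Ring.prime (p::nat)" "d > 0"
 obtains n where "n : coprime_nats p" "d = n * p ^ multiplicity p d"
proof -
 have "d ~= 0" "p ~= 0" "\<not> is_unit p" using assms prime_gt_1_nat[OF assms(1)] by auto
 then obtain y where y: "d = p ^ multiplicity p d * y" "\<not> p dvd y" using multiplicity_decompose'[of d p] by metis
 have "y \<ge> 1" using y assms(2) by (cases y) auto
 moreover have "coprime y p" using prime_imp_coprime[OF assms(1) y(2)] by (simp add: coprime_commute)
 ultimately show thesis using that[of y] y(1) by (simp add: coprime_nats_def mult.commute)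
qed

lemma fmono_power: "fmono c j ^ n = fmono (c ^ n) (n * j)"
 unfolding fmono_def power_mult_distrib fls_X_intpow_power by (simp add: fls_const_power)

lemma finite_levels: "Factorial_Ring.prime (p::nat) ==> n \<ge> 1 ==> finite {m. n * p ^ m \<le> d}"
proof (rule finite_subset[of _ "{..d}"])
 assume p: "Factorial_Ring.prime p" and n: "n \<ge> 1"
 show "{m. n * p ^ m \<le> d} <= {..d}"
 proof
  fix m assume "m : {m. n * p ^ m \<le> d}"
  then have "n * p ^ m \<le> d" by simp
  moreover have "p ^ m \<le> n * p ^ m" using n by simp
  ultimately have "p ^ m \<le> d" by linarith
  moreover have "m < p ^ m" using prime_gt_1_nat[OF p] by (simp add: power_gt_expt)
  ultimately show "m : {..d}" by simp
 qed
qed simp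

lemma frob_diff:
 assumes "Factorial_Ring.prime p" "CHAR('a::comm_ring_1) = p"
 shows "((a::'a) - b) ^ p = a ^ p - b ^ p"
proof -
 have "((a - b) + b) ^ p = (a - b) ^ p + b ^ p"
  using rng_hom_frob[OF assms, of UNIV] unfolding rng_hom_on_def by blast
 then show ?thesis by (simp add: algebra_simps)
qed

text \<open>The solution is minus the sum of all c^(p^i); as c has no constant term, c^(p^i) starts
  beyond degree i, so each coefficient stabilises. The partial sums satisfy the equation up to the
  telescoping remainder c^(p^N).\<close>

lemma fps_artin_schreier:
 fixes c :: "'a::comm_ring_1 fps"
 assumes p: "Factorial_Ring.prime p" and ch: "CHAR('a fps) = p" and c: "fps_nth c 0 = 0"
 shows "\<exists>x. fps_nth x 0 = 0 \<and> x ^ p - x = c"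
proof -
 define U where "U N = - (\<Sum>i<N. c ^ p ^ i)" for N :: nat
 have small: "fps_nth (c ^ p ^ i) n = 0" if "n < i" for n i
 proof -
  have "i < p ^ i" using prime_gt_1_nat[OF p] by (simp add: power_gt_expt)
  then have "n < p ^ i" using that by simp
  then show ?thesis using startsby_zero_power_prefix[OF c, of "p ^ i"] by blast
 qed
 have uN: "fps_nth (U N) n = fps_nth (U (Suc n)) n" if "n < N" for n N
  using that
 proof (induction N)
  case (Suc N)
  then show ?case using small[of n N] by (cases "n = N") (simp_all add: U_def)
 qed simp
 \<comment> \<open>Coefficient n is final from the partial sum with n + 1 terms on, since the terms
   c^(p^i) with i > n do not reach degree n.\<close>
 define x where "x = Abs_fps (%n. fps_nth (U (Suc n)) n)"
 have Up: "U N ^ p - U N = c - c ^ p ^ N" for N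
 proof (induction N)
  case 0 then show ?case using prime_gt_0_nat[OF p] by (simp add: U_def zero_power)
 next
  case (Suc N)
  have e: "U (Suc N) = U N - c ^ p ^ N" by (simp add: U_def)
  have "U (Suc N) ^ p = U N ^ p - c ^ p ^ Suc N"
   unfolding e frob_diff[OF p ch] by (simp add: power_mult[symmetric] mult.commute)
  then show ?case using Suc by (simp add: e algebra_simps)
 qed
 \<comment> \<open>The p-th power of a series vanishing up to degree n vanishes there too, so
   replacing x by a partial sum does not disturb coefficient n.\<close>
 have low: "fps_nth (g ^ p) n = 0" if "\<And>i. i \<le> n ==> fps_nth g i = 0" for g :: "'a fps" and n
 proof -
  obtain q where q: "p = Suc q" using prime_gt_0_nat[OF p] by (cases p) auto
  show ?thesis unfolding q power_Suc fps_mult_nth using that by simp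
 qed
 have "x ^ p - x = c"
 proof (rule fps_ext)
  fix n
  let ?U = "U (Suc n)"
  have d: "fps_nth (x - ?U) i = 0" if "i \<le> n" for i using uN[of i "Suc n"] that by (simp add: x_def)
  have "x ^ p - x = (x - ?U) ^ p - (x - ?U) + (?U ^ p - ?U)" unfolding frob_diff[OF p ch] by simp
  then have "fps_nth (x ^ p - x) n = fps_nth ((x - ?U) ^ p) n - fps_nth (x - ?U) n + fps_nth (c - c ^ p ^ Suc n) n"
   unfolding Up by (simp only: fps_sub_nth fps_add_nth)
  then show "fps_nth (x ^ p - x) n = fps_nth c n" using low[OF d] d[of n] small[of n "Suc n"] by simp
 qed
 moreover have "fps_nth x 0 = 0" using c by (simp add: x_def U_def)
 ultimately show ?thesis by blast
qed

section \<open>Graded pieces and primary components\<close>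

text \<open>The common form of the statements on graded pieces: image and kernel of a map into
  \<open>F d\<close> followed by the projection. It serves for co-monomials, for \<open>asw\<close>
  and for the passage from the p-part to all characters.\<close>

lemma gr_map:
 assumes H: "comm_group H" and F: "subgroup (F d) H" "subgroup (F (d - 1)) H" "F (d - 1) <= F d"
  and f: "group_hom A H f" "\<And>a. a : carrier A ==> f a : F d"
 shows "group_hom A (gr H F d) (%a. F (d - 1) #>\<^bsub>H\<^esub> f a)"
  and "(\<And>y. y : F d ==> \<exists>a\<in>carrier A. y \<otimes>\<^bsub>H\<^esub> inv\<^bsub>H\<^esub> f a : F (d - 1)) ==>
   (%a. F (d - 1) #>\<^bsub>H\<^esub> f a) ` carrier A = carrier (gr H F d)"
  and "kernel A (gr H F d) (%a. F (d - 1) #>\<^bsub>H\<^esub> f a) = {a : carrier A. f a : F (d - 1)}"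
proof -
 interpret H: comm_group H by (rule H)
 interpret f: group_hom A H f by (rule f(1))
 let ?G = "H\<lparr>carrier := F d\<rparr>" and ?N = "F (d - 1)"
 interpret G: comm_group ?G by (rule comm_group_restrict[OF H F(1)])
 have sN: "subgroup ?N ?G" by (rule H.subgroup_incl[OF F(2,1,3)])
 have nN: "normal ?N ?G" by (rule G.subgroup_imp_normal[OF sN])
 have co: "?N #>\<^bsub>?G\<^esub> x = ?N #>\<^bsub>H\<^esub> x" for x by (simp add: r_coset_def)
 have Fc: "x : carrier H" if "x : F d" for x using subgroup.subset[OF F(1)] that by blast
 have "f : hom A ?G" using f.homh f(2) by (simp add: hom_def)
 from hom_compose[OF this normal.r_coset_hom_Mod[OF nN]]
 show "group_hom A (gr H F d) (%a. ?N #>\<^bsub>H\<^esub> f a)"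
  unfolding gr_def group_hom_def group_hom_axioms_def comp_def co
  using f.G.is_group normal.factorgroup_is_group[OF nN] by blast
 show "(%a. ?N #>\<^bsub>H\<^esub> f a) ` carrier A = carrier (gr H F d)"
  if onto: "\<And>y. y : F d ==> \<exists>a\<in>carrier A. y \<otimes>\<^bsub>H\<^esub> inv\<^bsub>H\<^esub> f a : ?N"
 proof -
  have "?N #>\<^bsub>H\<^esub> y : (%a. ?N #>\<^bsub>H\<^esub> f a) ` carrier A" if y: "y : F d" for y
  proof -
   obtain a where a: "a : carrier A" "y \<otimes>\<^bsub>H\<^esub> inv\<^bsub>H\<^esub> f a : ?N" using onto[OF y] by blast
   have "(y \<otimes>\<^bsub>H\<^esub> inv\<^bsub>H\<^esub> f a) \<otimes>\<^bsub>H\<^esub> f a : ?N #>\<^bsub>H\<^esub> f a"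
    by (rule H.rcosI[OF a(2) subgroup.subset[OF F(2)]]) (simp add: a(1))
   then have "y : ?N #>\<^bsub>H\<^esub> f a" using a(1) Fc[OF y] by (simp add: H.m_assoc)
   then have "?N #>\<^bsub>H\<^esub> f a = ?N #>\<^bsub>H\<^esub> y" by (rule H.repr_independence[OF _ _ F(2)]) (simp add: a(1))
   then show ?thesis using a(1) by blast
  qed
  then show ?thesis unfolding gr_def carrier_FactGroup co using f(2) by auto
 qed
 have "?N #>\<^bsub>H\<^esub> f a = ?N \<longleftrightarrow> f a : ?N" if a: "a : carrier A" for a
  using H.rcos_self[OF f.hom_closed[OF a] F(2)] H.coset_join2[OF f.hom_closed[OF a] F(2)] by blast
 then show "kernel A (gr H F d) (%a. ?N #>\<^bsub>H\<^esub> f a) = {a : carrier A. f a : ?N}"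
  unfolding kernel_def gr_def by (auto simp: FactGroup_def)
qed

section \<open>Primary decomposition of torsion abelian groups\<close>

definition primary :: "('a, 'c) monoid_scheme => nat => 'a set" where
 "primary H l = {x : carrier H. \<exists>n. x [^]\<^bsub>H\<^esub> (l ^ n) = \<one>\<^bsub>H\<^esub>}"

abbreviation primary_sum :: "('a, 'c) monoid_scheme => nat set => (nat => 'a) monoid" where
 "primary_sum H I \<equiv> sum_group I (%l. H\<lparr>carrier := primary H l\<rparr>)"

context comm_group
begin

lemma subgroup_primary: "subgroup (primary G l) G"
proof (rule subgroupI)
 have "\<one> : primary G l" by (simp add: primary_def)
 then show "primary G l ~= {}" by blast
 show "inv x : primary G l" if "x : primary G l" for x
  using that by (auto simp: primary_def nat_pow_inv)
 fix x y assume "x : primary G l" "y : primary G l"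
 then obtain m n where x: "x : carrier G" "x [^] (l ^ m) = \<one>" and y: "y : carrier G" "y [^] (l ^ n) = \<one>"
  by (auto simp: primary_def)
 have "(x \<otimes> y) [^] (l ^ (m + n)) = (x [^] (l ^ m)) [^] (l ^ n) \<otimes> (y [^] (l ^ n)) [^] (l ^ m)"
  using x(1) y(1) by (simp add: nat_pow_distrib nat_pow_pow power_add mult.commute)
 then show "x \<otimes> y : primary G l" using x y unfolding primary_def by auto
qed (auto simp: primary_def)

lemma primary_group: "group (G\<lparr>carrier := primary G l\<rparr>)"
 by (rule subgroup.subgroup_is_group[OF subgroup_primary is_group])

lemma family_sum_group_hom: "group_hom (primary_sum G I) G (family_sum G I)"
proof -
 have "(%x. x) : hom (G\<lparr>carrier := primary G i\<rparr>) G" for i by (auto simp: hom_def primary_def)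
 from sum_group_lift_hom[where ph="%_ x. x" and I=I, OF comm_group_axioms primary_group this]
 show ?thesis by (simp add: family_sum_def[abs_def])
qed

lemma primary_sumD:
 assumes "x : carrier (primary_sum G I)"
 shows "i : I ==> x i : primary G i" "finite {i : I. x i ~= \<one>}" "x : extensional I" "i : I ==> x i : carrier G"
 using sum_group_carrierD[OF primary_group assms] by (auto simp: primary_def)

text \<open>In a relation each \<open>x l\<close> is the inverse of the product of the other terms,
  so it is killed by a product of powers of other primes as well as by a power of l; its order
  divides two coprime numbers.\<close>

lemma family_sum_inj:
 assumes I: "\<And>l. l : I ==> Factorial_Ring.prime l"
 shows "inj_on (family_sum G I) (carrier (primary_sum G I))"
 unfolding group_hom.inj_on_one_iff[OF family_sum_group_hom]
proof (intro allI impI)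
 fix x assume x: "x : carrier (primary_sum G I)" and 1: "family_sum G I x = \<one>"
 let ?S = "{l : I. x l ~= \<one>}"
 note xD = primary_sumD[OF x]
 have "\<forall>l\<in>I. \<exists>n. x l [^] (l ^ n) = \<one>" using xD(1) by (auto simp: primary_def)
 from bchoice[OF this] obtain e where e: "\<And>l. l : I ==> x l [^] (l ^ e l) = \<one>" by blast
 have "x l = \<one>" if l: "l : I" for l
 proof (rule ccontr)
  assume ne: "x l ~= \<one>"
  let ?R = "?S - {l}"
  define y where "y = finprod G x ?R"
  define m where "m = (\<Prod>j\<in>?R. j ^ e j)"
  have y: "y : carrier G" unfolding y_def by (rule finprod_closed) (use xD(4) in auto)
  have S: "?S = insert l ?R" using l ne by auto
  have "finprod G x (insert l ?R) = x l \<otimes> y" unfolding y_def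
   by (rule finprod_insert) (use xD(2,4) l in auto)
  then have xy: "x l \<otimes> y = \<one>" using 1 unfolding family_sum_def S[symmetric] by simp
  have sub: "subgroup {z : carrier G. z [^] m = \<one>} G"
   by (rule subgroupI) (auto simp: nat_pow_distrib nat_pow_inv intro!: exI[of _ \<one>])
  have "x j [^] m = \<one>" if j: "j : ?R" for j
  proof -
   have "j ^ e j dvd m" unfolding m_def by (rule dvd_prodI) (use xD(2) j in auto)
   then obtain k where "m = j ^ e j * k" by blast
   then show ?thesis using e[of j] xD(4)[of j] j by (simp flip: nat_pow_pow)
  qed
  then have "y : {z : carrier G. z [^] m = \<one>}"
   unfolding y_def by (intro subgroup_finprod[OF comm_group_axioms sub]) (use xD(4) in auto)
  then have "(x l \<otimes> y) [^] m = x l [^] m" using xD(4)[OF l] by (simp add: nat_pow_distrib)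
  then have "x l [^] m = \<one>" unfolding xy by simp
  then have o: "ord (x l) dvd m" "ord (x l) dvd l ^ e l" using e[OF l] pow_eq_id[OF xD(4)[OF l]] by blast+
  have "coprime m (l ^ e l)"
   unfolding m_def by (intro prod_coprime_left) (use I l in "auto intro!: primes_coprime")
  then have "ord (x l) = 1" using o coprime_common_divisor_nat by blast
  then show False using ne ord_eq_1[OF xD(4)[OF l]] by simp
 qed
 then show "x = \<one>\<^bsub>primary_sum G I\<^esub>" by (intro extensionalityI[OF xD(3)]) auto
qed

text \<open>Strong induction on an exponent N = l^e k with k prime to l. Bezout coefficients express
  x through its l^e-th power, which has the smaller exponent k, and its k-th power, which is
  l-primary.\<close>

lemma family_sum_surj:
 assumes tors: "\<And>x. x : carrier G ==> \<exists>N>0. x [^] (N::nat) = \<one>"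
 shows "family_sum G {l. Factorial_Ring.prime l} ` carrier (primary_sum G {l. Factorial_Ring.prime l}) = carrier G"
  (is "?f ` carrier ?S = _")
proof
 interpret f: group_hom ?S G ?f by (rule family_sum_group_hom)
 show "?f ` carrier ?S <= carrier G" by auto
 have B: "subgroup (?f ` carrier ?S) G" by (rule f.img_is_subgroup)
 have prim: "x : ?f ` carrier ?S" if l: "Factorial_Ring.prime l" and x: "x : primary G l" for l x
 proof -
  have xc: "x : carrier G" using x by (simp add: primary_def)
  let ?y = "single_fun {l. Factorial_Ring.prime l} (%l. G\<lparr>carrier := primary G l\<rparr>) l x"
  have y: "?y : carrier ?S" by (rule single_fun_in[OF primary_group]) (use l x in simp_all)
  have e: "?f ?y = x"
   using single_fun_lift[where ph="%_ x. x" and G="%l. G\<lparr>carrier := primary G l\<rparr>" and i=l and a=x and I="{l. Factorial_Ring.prime l}", OF comm_group_axioms] l xc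
   by (simp add: family_sum_def)
  show ?thesis using imageI[OF y, of ?f] unfolding e .
 qed
 have "x : ?f ` carrier ?S" if "N > 0" "x : carrier G" "x [^] N = \<one>" for N :: nat and x
  using that
 proof (induction N arbitrary: x rule: less_induct)
  case (less N)
  show ?case
  proof (cases "N = 1")
   case True
   then show ?thesis using less.prems subgroup.one_closed[OF B] by simp
  next
   case False
   then obtain l where l: "Factorial_Ring.prime l" "l dvd N" using prime_factor_nat by blast
   have l1: "l > 1" using prime_gt_1_nat[OF l(1)] .
   obtain k where k: "N = l ^ multiplicity l N * k" "\<not> l dvd k"
    using multiplicity_decompose'[of N l] less.prems(1) l1 by auto
   define e where "e = multiplicity l N"
   have "e ~= 0" using k(2) l(2) k(1) unfolding e_def by (metis mult_1 power_0)
   then have "1 < l ^ e" by (intro one_less_power[OF l1]) simp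
   moreover have "k > 0" using k(1) less.prems(1) by (cases k) auto
   ultimately have kN: "k < N" using k(1) unfolding e_def[symmetric] by simp
   have N: "N = l ^ e * k" using k(1) unfolding e_def .
   have "coprime (l ^ e) k" using prime_imp_coprime[OF l(1) k(2)] by simp
   then have "gcd (int (l ^ e)) (int k) = 1" by (simp only: coprime_int_iff[symmetric] coprime_iff_gcd_eq_1)
   then obtain a b where ab: "a * int (l ^ e) + b * int k = 1" using bezout_int[of "int (l ^ e)" "int k"] by metis
   note x = less.prems(2)
   have 1: "x [^] (l ^ e) : ?f ` carrier ?S"
    by (rule less.IH[OF kN \<open>k > 0\<close>]) (use less.prems x in "auto simp: nat_pow_pow N")
   have 2: "x [^] k : ?f ` carrier ?S"
    by (rule prim[OF l(1)]) (use less.prems x in "auto simp: primary_def nat_pow_pow N mult.commute intro!: exI[of _ e]")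
   have "x = x [^] (a * int (l ^ e) + b * int k)" unfolding ab using x by (simp add: int_pow_1)
   also have "\<dots> = (x [^] (l ^ e)) [^] a \<otimes> (x [^] k) [^] b"
    using x by (simp only: int_pow_mult int_pow_pow[symmetric] mult.commute[of _ "int _"] int_pow_int nat_pow_closed)
   finally show ?thesis using subgroup.m_closed[OF B subgroup_int_pow_closed[OF B 1] subgroup_int_pow_closed[OF B 2]] by metis
  qed
 qed
 then show "carrier G <= ?f ` carrier ?S" using tors by blast
qed

text \<open>Separates the p-component from a family; read backwards it describes all families with a
  prescribed value at p.\<close>

lemma family_sum_split:
 assumes p: "p : I" and x: "x : carrier (primary_sum G (I - {p}))" and a: "a : primary G p"
 shows "(\<lambda>l\<in>I. if l = p then a else x l) : carrier (primary_sum G I)"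
  "family_sum G I (\<lambda>l\<in>I. if l = p then a else x l) = a \<otimes> family_sum G (I - {p}) x"
proof -
 let ?y = "\<lambda>l\<in>I. if l = p then a else x l" and ?S = "{l : I - {p}. x l ~= \<one>}"
 note xD = primary_sumD[OF x]
 have ac: "a : carrier G" using a by (simp add: primary_def)
 have sub: "{l : I. ?y l ~= \<one>} <= insert p ?S" by auto
 have fin: "finite (insert p ?S)" using xD(2) by simp
 have y: "?y l : primary G l" if "l : I" for l using that xD(1) a by simp
 show "?y : carrier (primary_sum G I)"
  using finite_subset[OF sub fin] y by (subst carrier_sum_group[OF primary_group]) auto
 have yc: "?y l : carrier G" if "l : insert p ?S" for l using y[of l] that p by (auto simp: primary_def)
 have "family_sum G I ?y = finprod G ?y (insert p ?S)"
  unfolding family_sum_def by (rule finprod_mono_neutral_cong_left[OF fin sub]) (use p xD(4) ac in auto)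
 also have "\<dots> = ?y p \<otimes> finprod G ?y ?S" by (rule finprod_insert[OF xD(2)]) (use xD(4) ac p in auto)
 also have "finprod G ?y ?S = finprod G x ?S" by (rule finprod_cong') (use xD(4) in auto)
 also have "?y p = a" using p by simp
 finally show "family_sum G I ?y = a \<otimes> family_sum G (I - {p}) x" unfolding family_sum_def[of G "I - {p}"] .
qed

end

section \<open>Characters with values in Q/Z and their primary parts\<close>

context
 fixes p :: nat and ty :: "'a::field itself"
 assumes p: "Factorial_Ring.prime p" and ch: "CHAR('a) = p"
begin

private abbreviation (input) "H16 \<equiv> h1 rat_mod_int :: 'a char monoid"

private lemma cR: "comm_group rat_mod_int" by (rule comm_group_rat_mod_int)
private lemma cH: "comm_group H16" by (rule comm_group_h1[OF p ch cR])

text \<open>The range of \<open>chi\<close> is finite, so the exponents of its values are bounded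
  within the divisibility chain \<open>s\<close>. The chain is n! for torsion and l^n for l-primary
  characters.\<close>

lemma h1_uniform_exponent:
 assumes chi: "chi : carrier H16" and s: "\<And>m n :: nat. m \<le> n ==> s m dvd s n"
  and t: "\<And>sg. sg : carrier abs_gal ==> \<exists>n. chi sg [^]\<^bsub>rat_mod_int\<^esub> (s n :: nat) = \<one>\<^bsub>rat_mod_int\<^esub>"
 shows "\<exists>n. chi [^]\<^bsub>H16\<^esub> s n = \<one>\<^bsub>H16\<^esub>"
proof -
 interpret R: comm_group rat_mod_int by (rule cR)
 interpret H16: comm_group H16 by (rule cH)
 have hom: "chi : hom abs_gal rat_mod_int" using chi unfolding h1_iff[OF p ch R.is_group] by blast
 have fin: "finite (chi ` carrier abs_gal)" by (rule h1_finite_range[OF p ch R.is_group chi])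
 have "\<forall>q\<in>chi ` carrier abs_gal. \<exists>n. q [^]\<^bsub>rat_mod_int\<^esub> s n = \<one>\<^bsub>rat_mod_int\<^esub>" using t by blast
 from bchoice[OF this] obtain e where e: "\<And>q. q : chi ` carrier abs_gal ==> q [^]\<^bsub>rat_mod_int\<^esub> s (e q) = \<one>\<^bsub>rat_mod_int\<^esub>" by blast
 define r where "r = Max (e ` chi ` carrier abs_gal)"
 have "chi [^]\<^bsub>H16\<^esub> s r = \<one>\<^bsub>H16\<^esub>"
 proof (rule h1_ext[OF p ch R.is_group])
  show "chi [^]\<^bsub>H16\<^esub> s r : carrier H16" "\<one>\<^bsub>H16\<^esub> : carrier H16" using chi by auto
  fix sg :: "'a alg_closure => 'a alg_closure" assume g: "sg : carrier abs_gal"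
  then have q: "chi sg : carrier rat_mod_int" using hom by (auto simp: hom_def)
  have "e (chi sg) \<le> r" unfolding r_def using fin g by (intro Max_ge) auto
  then obtain k where k: "s r = s (e (chi sg)) * k" using s by blast
  have "chi sg [^]\<^bsub>rat_mod_int\<^esub> s r = \<one>\<^bsub>rat_mod_int\<^esub>"
   unfolding k using e[OF imageI[OF g]] q by (simp flip: R.nat_pow_pow)
  then show "(chi [^]\<^bsub>H16\<^esub> s r) sg = \<one>\<^bsub>H16\<^esub> sg"
   by (simp add: h1_pow_apply[OF p ch cR chi g] h1_one_apply[OF p ch g])
 qed
 then show ?thesis by blast
qed

lemma h1_torsion:
 assumes chi: "chi : carrier H16"
 shows "\<exists>N>0. chi [^]\<^bsub>H16\<^esub> (N::nat) = \<one>\<^bsub>H16\<^esub>"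
proof -
 interpret R: comm_group rat_mod_int by (rule cR)
 have "\<exists>n. chi [^]\<^bsub>H16\<^esub> (fact n :: nat) = \<one>\<^bsub>H16\<^esub>"
 proof (rule h1_uniform_exponent[OF chi])
  show "m \<le> n ==> (fact m :: nat) dvd fact n" for m n by (rule fact_dvd)
  fix sg :: "'a alg_closure => 'a alg_closure" assume "sg : carrier abs_gal"
  then have q: "chi sg : carrier rat_mod_int" using chi unfolding h1_iff[OF p ch R.is_group] by (auto simp: hom_def)
  then obtain r where r: "chi sg = rat_class r" unfolding rat_mod_int_carrier by blast
  obtain a b where ab: "r = of_int a / of_int b" "b > 0" by (metis Fract_of_int_quotient Rat_cases)
  have "r = of_int a / of_nat (nat b)" using ab by simp
  then have "chi sg [^]\<^bsub>rat_mod_int\<^esub> nat b = \<one>\<^bsub>rat_mod_int\<^esub>" unfolding r using rat_class_pow_eq_one[of "nat b" r] ab(2) by auto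
  moreover have "nat b dvd fact (nat b)" by (rule dvd_fact) (use ab(2) in auto)
  then obtain k where "fact (nat b) = nat b * k" by (rule dvdE)
  ultimately have "chi sg [^]\<^bsub>rat_mod_int\<^esub> (fact (nat b) :: nat) = \<one>\<^bsub>rat_mod_int\<^esub>" using q by (simp flip: R.nat_pow_pow)
  then show "\<exists>n. chi sg [^]\<^bsub>rat_mod_int\<^esub> (fact n :: nat) = \<one>\<^bsub>rat_mod_int\<^esub>" by blast
 qed
 then show ?thesis using fact_gt_zero by blast
qed

text \<open>A character is l-primary exactly if its values are; one direction needs the uniform
  exponent. This turns the groups of characters into instances of the abstract
  decomposition.\<close>

lemma h1_prufer_eq:
 assumes l: "l > 0"
 shows "h1 (prufer l) = H16\<lparr>carrier := primary H16 l\<rparr>"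
proof -
 interpret R: comm_group rat_mod_int by (rule cR)
 interpret P: comm_group "prufer l" by (rule comm_group_prufer[OF l])
 have "chi : carrier (h1 (prufer l)) \<longleftrightarrow> chi : primary H16 l" for chi :: "'a char"
 proof
  assume chi: "chi : carrier (h1 (prufer l))"
  have cl: "chi sg : carrier (prufer l)" if "sg : carrier abs_gal" for sg
   using chi that unfolding h1_iff[OF p ch P.is_group] by (auto simp: hom_def)
  have "chi : hom abs_gal rat_mod_int"
   using chi cl prufer_iff[OF l] unfolding h1_iff[OF p ch P.is_group] hom_def prufer_simps by blast
  then have H16: "chi : carrier H16"
   using chi unfolding h1_iff[OF p ch P.is_group] h1_iff[OF p ch R.is_group] prufer_simps by blast
  have "\<exists>n. chi [^]\<^bsub>H16\<^esub> (l ^ n) = \<one>\<^bsub>H16\<^esub>"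
   by (rule h1_uniform_exponent[OF H16]) (use cl prufer_iff[OF l] in "auto intro: le_imp_power_dvd")
  then show "chi : primary H16 l" using H16 by (simp add: primary_def)
 next
  assume "chi : primary H16 l"
  then obtain n where H16: "chi : carrier H16" "chi [^]\<^bsub>H16\<^esub> (l ^ n) = \<one>\<^bsub>H16\<^esub>" by (auto simp: primary_def)
  have hom: "chi : hom abs_gal rat_mod_int" using H16 unfolding h1_iff[OF p ch R.is_group] by blast
  have "chi sg : carrier (prufer l)" if g: "sg : carrier abs_gal" for sg
  proof -
   have "chi sg [^]\<^bsub>rat_mod_int\<^esub> (l ^ n) = \<one>\<^bsub>rat_mod_int\<^esub>"
    using h1_pow_apply[OF p ch cR H16(1) g, of "l ^ n"] unfolding H16(2) h1_one_apply[OF p ch g] by simp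
   then show ?thesis unfolding prufer_iff[OF l] using hom g by (auto simp: hom_def)
  qed
  then have "chi : hom abs_gal (prufer l)" using hom unfolding hom_def prufer_simps by blast
  then show "chi : carrier (h1 (prufer l))"
   using H16(1) unfolding h1_iff[OF p ch P.is_group] h1_iff[OF p ch R.is_group] prufer_simps by blast
 qed
 then have "carrier (h1 (prufer l)) = primary H16 l" by blast
 moreover have "h1 (prufer l) = H16\<lparr>carrier := carrier (h1 (prufer l))\<rparr>" by (simp add: h1_def prufer_simps)
 ultimately show ?thesis by simp
qed

end

lemma sum_group_cong:
 assumes "\<And>i. i : I ==> G i = G' i"
 shows "sum_group I G = sum_group I G'"
proof -
 have "(\<Pi>\<^sub>E i\<in>I. carrier (G i)) = (\<Pi>\<^sub>E i\<in>I. carrier (G' i))" by (rule PiE_cong) (simp add: assms)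
 moreover have "(%x y. \<lambda>i\<in>I. x i \<otimes>\<^bsub>G i\<^esub> y i) = (%x y. \<lambda>i\<in>I. x i \<otimes>\<^bsub>G' i\<^esub> y i)"
  by (intro ext restrict_ext[THEN fun_cong]) (simp add: assms)
 moreover have "(\<lambda>i\<in>I. \<one>\<^bsub>G i\<^esub>) = (\<lambda>i\<in>I. \<one>\<^bsub>G' i\<^esub>)" by (rule restrict_ext) (simp add: assms)
 ultimately have "product_group I G = product_group I G'" unfolding product_group_def by simp
 moreover have "{x : \<Pi>\<^sub>E i\<in>I. carrier (G i). finite {i : I. x i ~= \<one>\<^bsub>G i\<^esub>}} = {x : \<Pi>\<^sub>E i\<in>I. carrier (G' i). finite {i : I. x i ~= \<one>\<^bsub>G' i\<^esub>}}"
 proof -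
  have "{i : I. x i ~= \<one>\<^bsub>G i\<^esub>} = {i : I. x i ~= \<one>\<^bsub>G' i\<^esub>}" for x using assms by auto
  then show ?thesis using \<open>(\<Pi>\<^sub>E i\<in>I. carrier (G i)) = (\<Pi>\<^sub>E i\<in>I. carrier (G' i))\<close> by simp
 qed
 ultimately show ?thesis unfolding sum_group_def by simp
qed

lemma quot_map_group_hom:
 assumes f: "group_hom G H f" and N: "normal N G" "\<And>x. x : N ==> f x = \<one>\<^bsub>H\<^esub>"
 shows "group_hom (G Mod N) H (quot_map f)"
proof -
 interpret group_hom G H f by (rule f)
 have sN: "subgroup N G" using N(1) by (simp add: normal_def)
 note q = quot_map_coset[OF f sN N(2)]
 have "quot_map f : hom (G Mod N) H"
 proof (rule homI)
  fix a assume "a : carrier (G Mod N)"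
  then obtain x where x: "x : carrier G" "a = N #>\<^bsub>G\<^esub> x" by (auto simp: carrier_FactGroup)
  then show "quot_map f a : carrier H" by (simp add: q)
  fix b assume "b : carrier (G Mod N)"
  then obtain y where y: "y : carrier G" "b = N #>\<^bsub>G\<^esub> y" by (auto simp: carrier_FactGroup)
  have "a \<otimes>\<^bsub>G Mod N\<^esub> b = N #>\<^bsub>G\<^esub> (x \<otimes>\<^bsub>G\<^esub> y)" unfolding x(2) y(2) using normal.rcos_sum[OF N(1) x(1) y(1)] by (simp add: FactGroup_def)
  then show "quot_map f (a \<otimes>\<^bsub>G Mod N\<^esub> b) = quot_map f a \<otimes>\<^bsub>H\<^esub> quot_map f b" using x y by (simp add: q)
 qed
 then show ?thesis using normal.factorgroup_is_group[OF N(1)] H.is_group by (simp add: group_hom_def group_hom_axioms_def)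
qed

lemma group_iso_inverse:
 assumes "group_iso G H f"
 shows "\<exists>h. group_iso H G h"
 using assms group.iso_set_sym unfolding group_iso_def by blast

lemma kernel_trivial_group_iso:
 assumes f: "group_hom G H f" "f ` carrier G = carrier H" and k: "\<And>x. x : carrier G ==> f x = \<one>\<^bsub>H\<^esub> ==> x = \<one>\<^bsub>G\<^esub>"
 shows "group_iso G H f"
 by (rule group_isoI[OF f(1) _ f(2)]) (use k group_hom.inj_on_one_iff[OF f(1)] in blast)

context comm_group
begin

text \<open>Stated for an arbitrary subgroup \<open>B\<close> of the p-primary part, to be applied
  with a step of Kato's filtration. The last claim, which splits off a member of \<open>B\<close>
  and leaves an element without p-part, provides surjectivity onto graded pieces.\<close>

lemma primary_split:
 fixes P :: "nat set" and p :: nat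
 defines "P \<equiv> {l. Factorial_Ring.prime l}"
 defines "proj \<equiv> %x. inv_into (carrier (primary_sum G P)) (family_sum G P) x p"
 assumes p: "Factorial_Ring.prime p" and tors: "\<And>x. x : carrier G ==> \<exists>N>0. x [^] (N::nat) = \<one>"
  and B: "subgroup B G" "B <= primary G p"
 shows "group_iso (G\<lparr>carrier := B\<rparr> \<times>\<times> primary_sum G (P - {p})) (G\<lparr>carrier := {x : carrier G. proj x : B}\<rparr>)
   (\<lambda>(a, x). a \<otimes> family_sum G (P - {p}) x)"
  and "subgroup {x : carrier G. proj x : B} G"
  and "\<And>a. a : primary G p ==> proj a = a"
  and "\<And>x. x : carrier G ==> proj x : B ==> \<exists>a\<in>B. x \<otimes> inv a : carrier G \<and> proj (x \<otimes> inv a) = \<one>"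
proof -
 let ?R = "primary_sum G (P - {p})" and ?S = "\<lambda>(a, x). a \<otimes> family_sum G (P - {p}) x"
 let ?Q = "G\<lparr>carrier := B\<rparr> \<times>\<times> ?R" and ?U = "{x : carrier G. proj x : B}"
 interpret R: group_hom ?R G "family_sum G (P - {p})" by (rule family_sum_group_hom)
 have pP: "p : P" using p by (simp add: P_def)
 have inj: "inj_on (family_sum G P) (carrier (primary_sum G P))" by (rule family_sum_inj) (simp add: P_def)
 have pr: "a : carrier G" if "a : primary G p" for a using that by (simp add: primary_def)
 have Bc: "a : carrier G" if "a : B" for a using subgroup.subset[OF B(1)] that by blast
 have S: "proj (a \<otimes> family_sum G (P - {p}) x) = a" if a: "a : primary G p" and x: "x : carrier ?R" for a x
  unfolding proj_def family_sum_split(2)[OF pP x a, symmetric] inv_into_f_f[OF inj family_sum_split(1)[OF pP x a]]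
  using pP by simp
 have gQ: "group ?Q" by (rule DirProd_group[OF subgroup.subgroup_is_group[OF B(1) is_group] R.G.is_group])
 have hom: "group_hom ?Q G ?S"
 proof -
  have "?S : hom ?Q G"
   by (rule homI) (use Bc in "auto simp: m_ac R.hom_mult simp del: mult_sum_group")
  then show ?thesis using gQ is_group by (simp add: group_hom_def group_hom_axioms_def)
 qed
 have img: "?S ` carrier ?Q = ?U"
 proof
  show "?S ` carrier ?Q <= ?U" using S B(2) Bc by (auto simp: subset_iff)
  show "?U <= ?S ` carrier ?Q"
  proof
   fix z assume z: "z : ?U"
   then have "z : family_sum G P ` carrier (primary_sum G P)" using family_sum_surj[OF tors] unfolding P_def by blast
   then obtain y where y: "y : carrier (primary_sum G P)" "z = family_sum G P y" by blast
   note yD = primary_sumD[OF y(1)]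
   have yp: "y p : B" using z inv_into_f_f[OF inj y(1)] unfolding y(2) proj_def by simp
   define x where "x = restrict y (P - {p})"
   have "finite {l : P - {p}. x l ~= \<one>}" by (rule finite_subset[OF _ yD(2)]) (auto simp: x_def)
   then have x: "x : carrier ?R" using yD(1) by (subst carrier_sum_group[OF primary_group]) (auto simp: x_def)
   have "(\<lambda>l\<in>P. if l = p then y p else x l) = y"
    by (rule extensionalityI[OF _ yD(3)]) (auto simp: x_def)
   then have "z = ?S (y p, x)" using family_sum_split(2)[OF pP x yD(1)[OF pP]] y(2) by simp
   then show "z : ?S ` carrier ?Q" by (rule image_eqI) (use yp x in simp)
  qed
 qed
 show sU: "subgroup ?U G" unfolding img[symmetric] by (rule group_hom.img_is_subgroup[OF hom])
 have "inj_on ?S (carrier ?Q)"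
 proof (rule inj_onI, clarify)
  fix a x b y assume ax: "(a, x) : carrier ?Q" and bY: "(b, y) : carrier ?Q"
   and e: "a \<otimes> family_sum G (P - {p}) x = b \<otimes> family_sum G (P - {p}) y"
  have a: "a : primary G p" "x : carrier ?R" using ax B(2) by auto
  have b: "b : primary G p" "y : carrier ?R" using bY B(2) by auto
  have *: "(\<lambda>l\<in>P. if l = p then a else x l) = (\<lambda>l\<in>P. if l = p then b else y l)"
   by (rule inj_onD[OF inj trans[OF family_sum_split(2)[OF pP a(2,1)] trans[OF e family_sum_split(2)[OF pP b(2,1), symmetric]]]
      family_sum_split(1)[OF pP a(2,1)] family_sum_split(1)[OF pP b(2,1)]])
  have l: "(if l = p then a else x l) = (if l = p then b else y l)" if "l : P" for l
   using fun_cong[OF *, of l] that by (simp only: restrict_apply if_True)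
  have "x l = y l" if "l : P - {p}" for l using l[of l] that by simp
  then have "x = y" by (rule extensionalityI[OF primary_sumD(3)[OF a(2)] primary_sumD(3)[OF b(2)]])
  then show "a = b \<and> x = y" using l[OF pP] by simp
 qed
 moreover have "group_hom ?Q (G\<lparr>carrier := ?U\<rparr>) ?S"
  using group_hom.homh[OF hom] img gQ subgroup.subgroup_is_group[OF sU is_group]
  unfolding group_hom_def group_hom_axioms_def hom_def by auto
 ultimately show "group_iso ?Q (G\<lparr>carrier := ?U\<rparr>) ?S"
  by (intro group_isoI) (simp_all only: img, simp)
 have o: "family_sum G (P - {p}) \<one>\<^bsub>?R\<^esub> = \<one>" "\<one>\<^bsub>?R\<^esub> : carrier ?R" by (rule R.hom_one) (rule R.G.one_closed)
 show "proj a = a" if "a : primary G p" for a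
  using S[OF that o(2)] pr[OF that] unfolding o(1) by simp
 show "\<exists>a\<in>B. x \<otimes> inv a : carrier G \<and> proj (x \<otimes> inv a) = \<one>" if "x : carrier G" "proj x : B" for x
 proof -
  have "x : ?S ` carrier ?Q" unfolding img using that by blast
  then obtain a r where ar: "a : B" "r : carrier ?R" "x = a \<otimes> family_sum G (P - {p}) r" by auto
  have f: "family_sum G (P - {p}) r : carrier G" using ar(2) by (rule R.hom_closed)
  have e: "x \<otimes> inv a = \<one> \<otimes> family_sum G (P - {p}) r" unfolding ar(3) m_comm[OF Bc[OF ar(1)] f] using Bc[OF ar(1)] f by (simp add: m_assoc)
  have "\<one> : primary G p" by (rule subgroup.one_closed[OF subgroup_primary])
  then have "proj (x \<otimes> inv a) = \<one>" unfolding e by (rule S[OF _ ar(2)])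
  moreover have "x \<otimes> inv a : carrier G" using that(1) Bc[OF ar(1)] by simp
  ultimately show ?thesis using ar(1) by blast
 qed
qed

end

section \<open>Co-monomials over k((t))\<close>

context
 fixes p :: nat and ty :: "'k::field itself"
 assumes p: "Factorial_Ring.prime p" and ch: "CHAR('k) = p"
begin

private abbreviation (input) "E \<equiv> cw p (UNIV :: 'k fls set)"
private abbreviation (input) "K11 \<equiv> cw p (UNIV :: 'k set)"
private abbreviation (input) "M \<equiv> {g :: 'k fps. fps_nth g 0 = 0}"
private abbreviation (input) "Wk \<equiv> witt p (UNIV :: 'k set)"
private abbreviation (input) "WE \<equiv> witt p (UNIV :: 'k fls set)"
private abbreviation (input) "v \<equiv> multiplicity p"

private lemma p0_11: "p > 0" using prime_gt_0_nat[OF p] .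
private lemma chE: "CHAR('k fls) = p" by (simp add: CHAR_fls ch)
private lemma gk: "group (Wk m)" by (rule witt_group[OF p subrng_UNIV])
private lemma cgE: "comm_group (WE m)" by (rule comm_group_witt[OF p subrng_UNIV])
private lemma cE: "comm_group E" by (rule comm_group_cw[OF p subrng_UNIV])
private lemma cK: "comm_group K11" by (rule comm_group_cw[OF p subrng_UNIV])
private lemma cM: "comm_group (cw p M)" by (rule comm_group_cw[OF p subrng_max_ideal])

lemma const_group_hom: "group_hom K11 E (cw_map p UNIV fls_const)"
 by (rule cw_map_group_hom[OF p subrng_UNIV rng_hom_const _ subrng_UNIV]) simp

lemma fps_group_hom: "subrng R ==> group_hom (cw p R) E (cw_map p UNIV (fps_to_fls :: 'k fps => 'k fls))"
 by (rule cw_map_group_hom[OF p _ rng_hom_fps _ subrng_UNIV]) simp_all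

lemma WE_in: "length x = Suc m ==> x : carrier (WE m)"
 by (simp add: witt_carrier_iff)

lemma dvd_div_power:
 assumes "d > 0" "i \<le> v d"
 shows "d div p ^ v d * p ^ i = d div p ^ (v d - i)"
proof -
 have "p ^ v d dvd d" by (rule multiplicity_dvd)
 then obtain n where n: "d = p ^ v d * n" by (auto elim: dvdE)
 have e: "p ^ v d = p ^ (v d - i) * p ^ i" using assms(2) by (simp flip: power_add)
 have "d div p ^ v d = n" using n p0_11 by (metis nonzero_mult_div_cancel_left power_not_zero neq0_conv)
 moreover have "d = p ^ (v d - i) * (p ^ i * n)" using n e by (metis mult.assoc)
 then have "d div p ^ (v d - i) = p ^ i * n" using p0_11 by (metis nonzero_mult_div_cancel_left power_not_zero neq0_conv)
 ultimately show ?thesis by simp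
qed

lemma comonomial_lvec:
 assumes "d > 0"
 shows "comonomial p d (x :: 'k list) = cw_inj p UNIV (v d) (lvec p d (v d) x)"
proof -
 have "map (%i. fls_const (x ! i) * fls_X_intpow (- int (d div p ^ v d * p ^ i))) [0..<Suc (v d)] = lvec p d (v d) x"
  unfolding lvec_def fmono_def using dvd_div_power[OF assms] by (intro map_cong) (auto simp del: of_nat_mult)
 then show ?thesis unfolding comonomial_def Let_def by (rule arg_cong)
qed

text \<open>The map is entrywise inclusion of constants followed by multiplication by the
  Teichmueller representative of t^(-n), where n is the prime-to-p part of d, and both are
  additive.\<close>

lemma lvec_hom:
 assumes d: "d > 0"
 shows "lvec p d (v d) : hom (Wk (v d)) (WE (v d))"
proof -
 let ?n = "d div p ^ v d"
 have h1: "map fls_const : hom (Wk (v d)) (WE (v d))"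
  by (rule witt_map_hom[OF p subrng_UNIV rng_hom_const]) simp
 note h = Group.hom_compose[OF h1 witt_scale_hom[OF p subrng_UNIV, of "fls_X_intpow (- int ?n)" "v d"]]
 have e: "lvec p d (v d) x = ((%x. map (%i. fls_X_intpow (- int ?n) ^ p ^ i * x ! i) [0..<Suc (v d)]) \<circ> map fls_const) x"
  if x: "x : carrier (Wk (v d))" for x
 proof -
  have "fmono (x ! i) (d div p ^ (v d - i)) = fls_X_intpow (- int ?n) ^ p ^ i * map fls_const x ! i" if "i \<le> v d" for i
  proof -
   have "int (p ^ i) * - int ?n = - int (d div p ^ (v d - i))"
    by (simp flip: dvd_div_power[OF d that])
   then have "fls_X_intpow (- int ?n) ^ p ^ i = (fls_X_intpow (- int (d div p ^ (v d - i))) :: 'k fls)"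
    unfolding fls_X_intpow_power by (rule arg_cong)
   then show ?thesis unfolding fmono_def using x that by (simp add: witt_carrier_iff mult.commute)
  qed
  then show ?thesis unfolding lvec_def comp_def by (intro map_cong) auto
 qed
 show ?thesis
 proof (rule homI)
  show "lvec p d (v d) x : carrier (WE (v d))" for x by (rule WE_in) simp
  fix x y assume xy: "x : carrier (Wk (v d))" "y : carrier (Wk (v d))"
  have xy2: "x \<otimes>\<^bsub>Wk (v d)\<^esub> y : carrier (Wk (v d))" using xy gk by (simp add: group.is_monoid monoid.m_closed)
  show "lvec p d (v d) (x \<otimes>\<^bsub>Wk (v d)\<^esub> y) = lvec p d (v d) x \<otimes>\<^bsub>WE (v d)\<^esub> lvec p d (v d) y"
   unfolding e[OF xy(1)] e[OF xy(2)] e[OF \<open>x \<otimes>\<^bsub>Wk (v d)\<^esub> y : _\<close>] by (rule hom_mult[OF h xy])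
 qed
qed

lemma comonomial_hom:
 assumes d: "d > 0"
 shows "comonomial p d : hom (Wk (v d)) E"
proof -
 have "cw_inj p UNIV (v d) \<circ> lvec p d (v d) : hom (Wk (v d)) E"
  by (rule Group.hom_compose[OF lvec_hom[OF d] cw_inj_hom[OF p subrng_UNIV]])
 moreover have "(comonomial p d :: 'k list => _) = cw_inj p UNIV (v d) \<circ> lvec p d (v d)"
  by (rule ext) (simp add: comonomial_lvec[OF d])
 ultimately show ?thesis by simp
qed

text \<open>Co-monomials of different degrees live at different levels; padding the coefficients
  with zeros brings them to one level N so that they can be added there.\<close>

lemma comonomial_lift:
 assumes d: "d > 0" and x: "x : carrier (Wk (v d))" and N: "v d \<le> N"
 shows "comonomial p d x = cw_inj p UNIV N (lvec p d N (replicate (N - v d) 0 @ x))"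
 using N
proof (induction N rule: dec_induct)
 case base then show ?case by (simp add: comonomial_lvec[OF d])
next
 case (step N)
 have "cw_inj p UNIV (Suc N) (0 # lvec p d N (replicate (N - v d) 0 @ x)) = cw_inj p UNIV N (lvec p d N (replicate (N - v d) 0 @ x))"
  by (rule cw_inj_Suc[OF p subrng_UNIV]) (rule WE_in, simp)
 then show ?case using step by (simp add: Suc_diff_le flip: lvec_Cons)
qed

lemma hd_finprod:
 assumes "\<And>d. d : D ==> u d : carrier (WE N)"
 shows "hd (finprod (WE N) u D) = (\<Sum>d\<in>D. hd (u d))"
proof -
 interpret W: comm_group "WE N" by (rule cgE)
 have h1: "hd \<one>\<^bsub>WE N\<^esub> = 0" by (simp add: witt_def)
 show ?thesis using assms
 proof (induction D rule: infinite_finite_induct)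
  case (insert a D)
  have "finprod (WE N) u D : carrier (WE N)" using insert by (intro W.finprod_closed) auto
  then have "length (finprod (WE N) u D) = Suc N" by (simp add: witt_carrier_iff)
  moreover have "length (u a) = Suc N" using insert.prems[of a] by (simp add: witt_carrier_iff)
  ultimately have "hd (u a \<otimes>\<^bsub>WE N\<^esub> finprod (WE N) u D) = hd (u a) + hd (finprod (WE N) u D)"
   by (intro witt_hd_mult[OF p])
  then show ?case using insert by simp
 qed (simp_all add: h1)
qed

text \<open>The first components determine the top-level parts, because the exponents \<^term>\<open>d div p ^ N\<close> are distinct.\<close>

lemma lvec_first_zero:
 assumes D: "finite D" "\<And>d. d : D ==> d > 0"
  and adm: "\<And>d. d : D ==> \<not> p ^ N dvd d ==> y d ! 0 = 0"
  and z: "z0 : carrier (Wk N)" "z1 : carrier (witt p M N)"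
  and eq: "finprod (WE N) (%d. lvec p d N (y d)) D \<otimes>\<^bsub>WE N\<^esub> (map fls_const z0 \<otimes>\<^bsub>WE N\<^esub> map fps_to_fls z1) = \<one>\<^bsub>WE N\<^esub>"
 shows "(\<forall>d\<in>D. y d ! 0 = 0) \<and> z0 ! 0 = 0 \<and> z1 ! 0 = 0"
proof -
 interpret W: comm_group "WE N" by (rule cgE)
 have hdm: "hd (a \<otimes>\<^bsub>WE N\<^esub> b) = hd a + hd b" if "a : carrier (WE N)" "b : carrier (WE N)" for a b
  using that by (intro witt_hd_mult[OF p]) (simp_all add: witt_carrier_iff)
 have l: "lvec p d N (y d) : carrier (WE N)" for d by (rule WE_in) simp
 have zl: "length z0 = Suc N" "length z1 = Suc N" using z by (simp_all add: witt_carrier_iff)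
 have m: "map fls_const z0 : carrier (WE N)" "map fps_to_fls z1 : carrier (WE N)"
  using zl by (auto intro: WE_in)
 have hz: "hd (map fls_const z0) = fls_const (z0 ! 0)" "hd (map fps_to_fls z1) = fps_to_fls (z1 ! 0)"
  using zl by (cases z0; simp) (cases z1; use zl in simp)
 have hl: "hd (lvec p d N (y d)) = fmono (y d ! 0) (d div p ^ N)" for d
  using lvec_nth[of 0 N p d "y d"] by (subst hd_conv_nth) (auto simp flip: length_0_conv)
 have F: "finprod (WE N) (%d. lvec p d N (y d)) D : carrier (WE N)" using l by simp
 have e: "(\<Sum>d\<in>D. fmono (y d ! 0) (d div p ^ N)) + (fls_const (z0 ! 0) + fps_to_fls (z1 ! 0)) = 0"
 proof -
  have "hd (finprod (WE N) (%d. lvec p d N (y d)) D \<otimes>\<^bsub>WE N\<^esub> (map fls_const z0 \<otimes>\<^bsub>WE N\<^esub> map fps_to_fls z1)) = 0"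
   unfolding eq by (simp add: witt_def)
  then show ?thesis
   using hdm[OF F W.m_closed[OF m]] hdm[OF m] hd_finprod[of D "%d. lvec p d N (y d)" N] l
   by (simp add: hl hz)
 qed
 have nth_sum: "fls_nth (\<Sum>d\<in>D. fmono (y d ! 0) (d div p ^ N)) k = (\<Sum>d\<in>D. fls_nth (fmono (y d ! 0) (d div p ^ N)) k)" for k
  by (induction D rule: infinite_finite_induct) auto
 have y0: "y d ! 0 = 0" if d: "d : D" for d
 proof (cases "p ^ N dvd d")
  case True
  define k where "k = - int (d div p ^ N)"
  have "d div p ^ N > 0" using True D(2)[OF d] p0_11 by (auto simp: dvd_div_eq_0_iff)
  then have k: "k < 0" by (simp add: k_def)
  have "fls_nth (fmono (y c ! 0) (c div p ^ N)) k = (if c = d then y d ! 0 else 0)" if c: "c : D" for c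
  proof (cases "p ^ N dvd c")
   case True
   then have "c div p ^ N = d div p ^ N \<longleftrightarrow> c = d" using \<open>p ^ N dvd d\<close> by (metis dvd_div_eq_iff)
   then show ?thesis by (auto simp: fmono_nth k_def)
  next
   case False
   then have "c ~= d" using True by auto
   then show ?thesis using adm[OF c False] by (simp add: fmono_nth)
  qed
  then have "fls_nth (\<Sum>d\<in>D. fmono (y d ! 0) (d div p ^ N)) k = (\<Sum>c\<in>D. if c = d then y d ! 0 else 0)"
   unfolding nth_sum by (rule sum.cong[OF refl])
  also have "\<dots> = y d ! 0" using D(1) d by simp
  finally have "y d ! 0 = fls_nth ((\<Sum>d\<in>D. fmono (y d ! 0) (d div p ^ N)) + (fls_const (z0 ! 0) + fps_to_fls (z1 ! 0))) k"
   using k by simp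
  then show ?thesis unfolding e by simp
 qed (use adm d in blast)
 then have "(\<Sum>d\<in>D. fmono (y d ! 0) (d div p ^ N)) = 0" by simp
 then have e2: "fls_const (z0 ! 0) + fps_to_fls (z1 ! 0) = 0" using e by simp
 have "z1 ! 0 : M" using z(2) by (cases z1) (auto simp: witt_carrier_iff)
 then have "fls_nth (fls_const (z0 ! 0) + fps_to_fls (z1 ! 0)) 0 = z0 ! 0" by simp
 then have "z0 ! 0 = 0" unfolding e2 by simp
 moreover from this have "z1 ! 0 = 0" using e2 by simp
 ultimately show ?thesis using y0 by blast
qed

lemma zero_Cons: "length x = Suc m ==> x ! 0 = 0 ==> x = 0 # tl x"
 by (cases x) auto

text \<open>Induction on N: \<open>lvec_first_zero\<close> clears all first entries, and the whole
  relation is then the Verschiebung of a relation one level lower. The divisibility condition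
  depends only on N - i and survives the shift.\<close>

lemma lvec_independent:
 assumes D: "finite D" "\<And>d. d : D ==> d > 0" and "\<And>d. d : D ==> y d : carrier (Wk N)"
  and "\<And>d i. d : D ==> i \<le> N ==> \<not> p ^ (N - i) dvd d ==> y d ! i = 0"
  and "z0 : carrier (Wk N)" "z1 : carrier (witt p M N)"
  and "finprod (WE N) (%d. lvec p d N (y d)) D \<otimes>\<^bsub>WE N\<^esub> (map fls_const z0 \<otimes>\<^bsub>WE N\<^esub> map fps_to_fls z1) = \<one>\<^bsub>WE N\<^esub>"
 shows "(\<forall>d\<in>D. y d = \<one>\<^bsub>Wk N\<^esub>) \<and> z0 = \<one>\<^bsub>Wk N\<^esub> \<and> z1 = \<one>\<^bsub>witt p M N\<^esub>"
 using assms(3-)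
proof (induction N arbitrary: y z0 z1)
 case (0 y z0 z1)
 have f: "(\<forall>d\<in>D. y d ! 0 = 0) \<and> z0 ! 0 = 0 \<and> z1 ! 0 = 0"
  by (rule lvec_first_zero[OF D _ 0(3,4,5)]) simp_all
 have o: "x = [0]" if "length x = Suc 0" "x ! 0 = 0" for x :: "'b::zero list"
  using that by (cases x) auto
 have one: "\<one>\<^bsub>witt p R 0\<^esub> = [0]" for R :: "'b::comm_ring_1 set" by (simp add: witt_def)
 have "y d = [0]" if "d : D" for d using f 0(1)[OF that] that by (intro o) (auto simp: witt_carrier_iff)
 moreover have "z0 = [0]" "z1 = [0]" using f 0(3,4) by (auto intro!: o simp: witt_carrier_iff)
 ultimately show ?case by (simp add: one)
next
 case (Suc N y z0 z1)
 interpret W: comm_group "WE N" by (rule cgE)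
 have adm: "y d ! 0 = 0" if "d : D" "\<not> p ^ Suc N dvd d" for d
  using Suc.prems(2)[of d 0] that by simp
 have f: "(\<forall>d\<in>D. y d ! 0 = 0) \<and> z0 ! 0 = 0 \<and> z1 ! 0 = 0"
  by (rule lvec_first_zero[OF D adm Suc.prems(3,4,5)])
 have y: "y d = 0 # tl (y d)" if "d : D" for d using f Suc.prems(1)[OF that] that by (intro zero_Cons) (auto simp: witt_carrier_iff)
 have z0: "z0 = 0 # tl z0" and z1: "z1 = 0 # tl z1"
  using f Suc.prems(3,4) by (intro zero_Cons; simp add: witt_carrier_iff)+
 have tl: "tl x : carrier (witt p R N)" if "x : carrier (witt p R (Suc N))" for x :: "'b::comm_ring_1 list" and R
  using that by (cases x) (auto simp: witt_carrier_iff)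
 have l: "lvec p d N (tl (y d)) : carrier (WE N)" for d by (rule WE_in) simp
 have m: "map fls_const (tl z0) : carrier (WE N)" "map fps_to_fls (tl z1) : carrier (WE N)"
  using tl[OF Suc.prems(3)] tl[OF Suc.prems(4)] by (auto simp: witt_carrier_iff)
 note V = witt_V_hom[OF p subrng_UNIV, of N, where ?'a = "'k fls"]
 let ?F = "finprod (WE N) (%d. lvec p d N (tl (y d))) D"
 have Fc: "?F : carrier (WE N)" using l by simp
 have F: "finprod (WE (Suc N)) (%d. lvec p d (Suc N) (y d)) D = 0 # ?F"
 proof -
  have "finprod (WE (Suc N)) (%d. lvec p d (Suc N) (y d)) D = finprod (WE (Suc N)) (%d. 0 # lvec p d N (tl (y d))) D"
  proof (rule comm_monoid.finprod_cong'[OF comm_group.axioms(1)[OF cgE]])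
   show "(%d. 0 # lvec p d N (tl (y d))) : D \<rightarrow> carrier (WE (Suc N))" by (intro funcsetI WE_in) simp
   show "lvec p d (Suc N) (y d) = 0 # lvec p d N (tl (y d))" if "d : D" for d
    by (subst y[OF that]) (rule lvec_Cons)
  qed simp
  also have "\<dots> = 0 # ?F" by (rule hom_finprod[OF cgE cgE V, symmetric]) (rule l)
  finally show ?thesis .
 qed
 have "0 # (?F \<otimes>\<^bsub>WE N\<^esub> (map fls_const (tl z0) \<otimes>\<^bsub>WE N\<^esub> map fps_to_fls (tl z1)))
   = (0 # ?F) \<otimes>\<^bsub>WE (Suc N)\<^esub> ((0 # map fls_const (tl z0)) \<otimes>\<^bsub>WE (Suc N)\<^esub> (0 # map fps_to_fls (tl z1)))"
  using hom_mult[OF V Fc W.m_closed[OF m]] hom_mult[OF V m] by simp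
 also have "\<dots> = \<one>\<^bsub>WE (Suc N)\<^esub>"
 proof -
  have "0 # map fls_const (tl z0) = map fls_const z0" by (subst (2) z0) simp
  moreover have "0 # map fps_to_fls (tl z1) = map fps_to_fls z1" by (subst (2) z1) simp
  ultimately show ?thesis using Suc.prems(5) unfolding F by simp
 qed
 also have "\<dots> = 0 # \<one>\<^bsub>WE N\<^esub>" by (simp add: witt_def)
 finally have "?F \<otimes>\<^bsub>WE N\<^esub> (map fls_const (tl z0) \<otimes>\<^bsub>WE N\<^esub> map fps_to_fls (tl z1)) = \<one>\<^bsub>WE N\<^esub>" by simp
 moreover have "tl (y d) ! i = 0" if "d : D" "i \<le> N" "\<not> p ^ (N - i) dvd d" for d i
 proof -
  have "y d ! Suc i = 0" using Suc.prems(2)[of d "Suc i"] that by simp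
  then show ?thesis by (subst (asm) y[OF that(1)]) simp
 qed
 ultimately have IH: "(\<forall>d\<in>D. tl (y d) = \<one>\<^bsub>Wk N\<^esub>) \<and> tl z0 = \<one>\<^bsub>Wk N\<^esub> \<and> tl z1 = \<one>\<^bsub>witt p M N\<^esub>"
  by (intro Suc.IH tl Suc.prems(1,3,4)) auto
 have one: "\<one>\<^bsub>witt p R (Suc N)\<^esub> = 0 # \<one>\<^bsub>witt p R N\<^esub>" for R :: "'b::comm_ring_1 set" by (simp add: witt_def)
 show ?case unfolding one using IH y z0 z1 by metis
qed

section \<open>The Laurent decomposition\<close>

private abbreviation (input) "PG \<equiv> sum_group {0<..} (%d. Wk (v d)) \<times>\<times> (K11 \<times>\<times> cw p M)"

lemma group_PG: "group PG"
 by (intro DirProd_group sum_group gk comm_group_group cK cM)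

lemma laurent_parts_eq: "laurent_parts p = carrier PG"
 by (simp add: laurent_parts_def DirProd_def)

lemma polar_group_hom: "group_hom (sum_group {0<..} (%d. Wk (v d))) E (%x. finprod E (%d. comonomial p d (x d)) {d : {0<..}. x d ~= \<one>\<^bsub>Wk (v d)\<^esub>})"
 by (rule sum_group_lift_hom[OF cE gk comonomial_hom]) simp

lemma laurent_sum_apply:
 "laurent_sum p (x, f0, f1) = finprod E (%d. comonomial p d (x d)) {d : {0<..}. x d ~= \<one>\<^bsub>Wk (v d)\<^esub>} \<otimes>\<^bsub>E\<^esub> cw_map p UNIV fls_const f0
  \<otimes>\<^bsub>E\<^esub> cw_map p UNIV fps_to_fls f1"
 by (simp add: laurent_sum_def)

lemma laurent_sum_group_hom: "group_hom PG E (laurent_sum p)"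
proof -
 interpret E: comm_group E by (rule cE)
 interpret T: group_hom "sum_group {0<..} (%d. Wk (v d))" E "%x. finprod E (%d. comonomial p d (x d)) {d : {0<..}. x d ~= \<one>\<^bsub>Wk (v d)\<^esub>}"
  by (rule polar_group_hom)
 interpret C: group_hom K11 E "cw_map p UNIV fls_const" by (rule const_group_hom)
 interpret P: group_hom "cw p M" E "cw_map p UNIV fps_to_fls" by (rule fps_group_hom[OF subrng_max_ideal])
 have "laurent_sum p : hom PG E"
 proof (rule homI)
  fix a assume a: "a : carrier PG"
  obtain x f0 f1 where a': "a = (x, f0, f1)" by (metis prod.collapse)
  have A: "x : carrier (sum_group {0<..} (%d. Wk (v d)))" "f0 : carrier K11" "f1 : carrier (cw p M)"
   using a by (simp_all add: a' DirProd_def)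
  show "laurent_sum p a : carrier E" unfolding a' laurent_sum_apply
   by (intro E.m_closed T.hom_closed C.hom_closed P.hom_closed A)
  fix b assume b: "b : carrier PG"
  obtain y g0 g1 where b': "b = (y, g0, g1)" by (metis prod.collapse)
  have B: "y : carrier (sum_group {0<..} (%d. Wk (v d)))" "g0 : carrier K11" "g1 : carrier (cw p M)"
   using b by (simp_all add: b' DirProd_def)
  have ab: "a \<otimes>\<^bsub>PG\<^esub> b = (x \<otimes>\<^bsub>sum_group {0<..} (%d. Wk (v d))\<^esub> y, f0 \<otimes>\<^bsub>K11\<^esub> g0, f1 \<otimes>\<^bsub>cw p M\<^esub> g1)"
   by (simp add: a' b' DirProd_def del: mult_sum_group)
  show "laurent_sum p (a \<otimes>\<^bsub>PG\<^esub> b) = laurent_sum p a \<otimes>\<^bsub>E\<^esub> laurent_sum p b"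
   unfolding ab unfolding a' b' laurent_sum_apply
    T.hom_mult[OF A(1) B(1)] C.hom_mult[OF A(2) B(2)] P.hom_mult[OF A(3) B(3)]
   using T.hom_closed[OF A(1)] C.hom_closed[OF A(2)] P.hom_closed[OF A(3)]
    T.hom_closed[OF B(1)] C.hom_closed[OF B(2)] P.hom_closed[OF B(3)]
   by (simp add: E.m_ac del: mult_sum_group)
 qed
 then show ?thesis using group_PG E.is_group by (simp add: group_hom_def group_hom_axioms_def)
qed

text \<open>All parts are represented at one level, where the relation is an equation of Witt
  vectors to which \<open>lvec_independent\<close> applies.\<close>

lemma laurent_sum_trivial:
 assumes a: "(x, f0, f1) : carrier PG" and s: "laurent_sum p (x, f0, f1) = \<one>\<^bsub>E\<^esub>"
 shows "(x, f0, f1) = \<one>\<^bsub>PG\<^esub>"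
proof -
 interpret E: comm_group E by (rule cE)
 have A: "x : carrier (sum_group {0<..} (%d. Wk (v d)))" "f0 : carrier K11" "f1 : carrier (cw p M)"
  using a by (simp_all add: DirProd_def)
 note xD = sum_group_carrierD[OF gk A(1)]
 define D where "D = {d : {0<..}. x d ~= \<one>\<^bsub>Wk (v d)\<^esub>}"
 have D: "finite D" "\<And>d. d : D ==> d > 0" using xD(2) by (auto simp: D_def)
 have xc: "x d : carrier (Wk (v d))" if "d : D" for d using xD(1)[of d] D(2)[OF that] by simp
 obtain N0 where N0: "\<And>n. n \<ge> N0 ==> \<exists>z\<in>carrier (Wk n). f0 = cw_inj p UNIV n z"
  using cw_cases_ge[OF p subrng_UNIV A(2)] by metis
 obtain N1 where N1: "\<And>n. n \<ge> N1 ==> \<exists>z\<in>carrier (witt p M n). f1 = cw_inj p M n z"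
  using cw_cases_ge[OF p subrng_max_ideal A(3)] by metis
 \<comment> \<open>A level at which \<open>f0\<close>, \<open>f1\<close> and every nontrivial polar
   part can be represented.\<close>
 define N where "N = Max (insert N0 (insert N1 (v ` D)))"
 have N: "N0 \<le> N" "N1 \<le> N" "\<And>d. d : D ==> v d \<le> N"
  using D(1) unfolding N_def by (auto intro!: Max_ge simp del: Max_insert)
 obtain z0 where z0: "z0 : carrier (Wk N)" "f0 = cw_inj p UNIV N z0" using N0[OF N(1)] by blast
 obtain z1 where z1: "z1 : carrier (witt p M N)" "f1 = cw_inj p M N z1" using N1[OF N(2)] by blast
 interpret W: comm_group "WE N" by (rule cgE)
 interpret J: group_hom "WE N" E "cw_inj p UNIV N" by (rule cw_inj_group_hom[OF p subrng_UNIV])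
 \<comment> \<open>Padding the part of degree d to level N puts zeros in the positions i < N - v(d),
   exactly those for which p^(N - i) does not divide d, as the independence lemma demands.\<close>
 define y where "y = (%d. replicate (N - v d) 0 @ x d)"
 have yc: "y d : carrier (Wk N)" if "d : D" for d
  using xc[OF that] N(3)[OF that] by (auto simp: y_def witt_carrier_iff)
 have adm: "y d ! i = 0" if d: "d : D" and i: "i \<le> N" and nd: "\<not> p ^ (N - i) dvd d" for d i
 proof -
  have "\<not> N - i \<le> v d" using nd multiplicity_dvd'[of "N - i" p d] by blast
  then have "i < N - v d" by linarith
  then show ?thesis by (simp add: y_def nth_append)
 qed
 have l: "lvec p d N (y d) : carrier (WE N)" for d by (rule WE_in) simp
 have m: "map fls_const z0 : carrier (WE N)" "map fps_to_fls z1 : carrier (WE N)"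
  using z0 z1 by (auto simp: witt_carrier_iff)
 let ?F = "finprod (WE N) (%d. lvec p d N (y d)) D"
 have Fc: "?F : carrier (WE N)" using l by simp
 have "finprod E (%d. comonomial p d (x d)) D = finprod E (%d. cw_inj p UNIV N (lvec p d N (y d))) D"
 proof (rule E.finprod_cong')
  show "(%d. cw_inj p UNIV N (lvec p d N (y d))) : D \<rightarrow> carrier E" using l by (intro funcsetI J.hom_closed)
  show "comonomial p d (x d) = cw_inj p UNIV N (lvec p d N (y d))" if "d : D" for d
   unfolding y_def by (rule comonomial_lift[OF D(2)[OF that] xc[OF that] N(3)[OF that]])
 qed simp
 also have "\<dots> = cw_inj p UNIV N ?F" by (rule hom_finprod[OF cgE cE J.homh, symmetric]) (rule l)
 finally have "laurent_sum p (x, f0, f1) = cw_inj p UNIV N ?F \<otimes>\<^bsub>E\<^esub> cw_inj p UNIV N (map fls_const z0) \<otimes>\<^bsub>E\<^esub> cw_inj p UNIV N (map fps_to_fls z1)"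
  unfolding laurent_sum_apply D_def[symmetric] z0(2) z1(2)
   cw_map_inj[OF p subrng_UNIV rng_hom_const subset_UNIV subrng_UNIV z0(1)]
   cw_map_inj[OF p subrng_max_ideal rng_hom_fps subset_UNIV subrng_UNIV z1(1)] by simp
 also have "\<dots> = cw_inj p UNIV N (?F \<otimes>\<^bsub>WE N\<^esub> (map fls_const z0 \<otimes>\<^bsub>WE N\<^esub> map fps_to_fls z1))"
  using Fc m by (simp add: E.m_assoc)
 finally have "cw_inj p UNIV N (?F \<otimes>\<^bsub>WE N\<^esub> (map fls_const z0 \<otimes>\<^bsub>WE N\<^esub> map fps_to_fls z1)) = cw_inj p UNIV N \<one>\<^bsub>WE N\<^esub>"
  using s by (simp add: cw_one[OF p subrng_UNIV, of N, symmetric])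
 then have "?F \<otimes>\<^bsub>WE N\<^esub> (map fls_const z0 \<otimes>\<^bsub>WE N\<^esub> map fps_to_fls z1) = \<one>\<^bsub>WE N\<^esub>"
  using cw_inj_inj[OF p subrng_UNIV W.m_closed[OF Fc W.m_closed[OF m]] W.one_closed] by simp
 then have ind: "(\<forall>d\<in>D. y d = \<one>\<^bsub>Wk N\<^esub>) \<and> z0 = \<one>\<^bsub>Wk N\<^esub> \<and> z1 = \<one>\<^bsub>witt p M N\<^esub>"
  by (intro lvec_independent[OF D yc adm z0(1) z1(1)]) auto
 have "x d = \<one>\<^bsub>Wk (v d)\<^esub>" if d: "d : D" for d
 proof (rule nth_equalityI)
  show "length (x d) = length \<one>\<^bsub>Wk (v d)\<^esub>" using xc[OF d] by (simp add: witt_carrier_iff witt_def[of p "UNIV::'k set"])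
  fix i assume i: "i < length (x d)"
  have "y d ! (N - v d + i) = x d ! i" by (simp add: y_def nth_append)
  moreover have "y d ! (N - v d + i) = 0"
   using ind d i xc[OF d] N(3)[OF d] by (simp add: witt_def[of p "UNIV::'k set"] del: replicate_Suc)
  ultimately show "x d ! i = \<one>\<^bsub>Wk (v d)\<^esub> ! i" using i xc[OF d] by (simp add: witt_def[of p "UNIV::'k set"] del: replicate_Suc)
 qed
 then have "x d = \<one>\<^bsub>Wk (v d)\<^esub>" if "0 < d" for d
  using that unfolding D_def by (cases "x d = \<one>\<^bsub>Wk (v d)\<^esub>") auto
 then have "x = (\<lambda>d\<in>{0<..}. \<one>\<^bsub>Wk (v d)\<^esub>)" by (intro extensionalityI[OF xD(3)]) auto
 moreover have "f0 = \<one>\<^bsub>K11\<^esub>"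
  unfolding cw_one[OF p subrng_UNIV, of N] z0(2) by (rule arg_cong[OF conjunct1[OF conjunct2[OF ind]]])
 moreover have "f1 = \<one>\<^bsub>cw p M\<^esub>"
  unfolding cw_one[OF p subrng_max_ideal, of N] z1(2) by (rule arg_cong[OF conjunct2[OF conjunct2[OF ind]]])
 ultimately show ?thesis by (simp add: DirProd_def)
qed

lemma laurent_sum_inj: "inj_on (laurent_sum p) (carrier PG)"
 unfolding group_hom.inj_on_one_iff[OF laurent_sum_group_hom]
 using laurent_sum_trivial by auto

private abbreviation (input) "SG \<equiv> sum_group {0<..} (%d. Wk (v d))"
private abbreviation (input) "fil d \<equiv> laurent_sum p ` (laurent_parts_le p d :: ((nat => 'k list) \<times> 'k covec \<times> 'k fps covec) set)"

private lemma gS: "group SG" by (rule sum_group) (rule gk)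
lemma subgroup_parts_le: "subgroup (laurent_parts_le p d) PG"
proof -
 interpret G: group PG by (rule group_PG)
 have "subgroup {x : carrier SG. \<forall>e>d. x e = \<one>\<^bsub>Wk (v e)\<^esub>} SG"
 proof (rule group.subgroupI[OF gS])
  have "\<one>\<^bsub>SG\<^esub> : {x : carrier SG. \<forall>e>d. x e = \<one>\<^bsub>Wk (v e)\<^esub>}" using monoid.one_closed[OF group.is_monoid[OF gS]] by (simp only: mem_Collect_eq) simp
  then show "{x : carrier SG. \<forall>e>d. x e = \<one>\<^bsub>Wk (v e)\<^esub>} ~= {}" by blast
 next
  show "{x : carrier SG. \<forall>e>d. x e = \<one>\<^bsub>Wk (v e)\<^esub>} <= carrier SG" by blast
 next
  fix x assume x: "x : {x : carrier SG. \<forall>e>d. x e = \<one>\<^bsub>Wk (v e)\<^esub>}"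
  then have xc: "x : carrier SG" by blast
  have "inv\<^bsub>SG\<^esub> x : carrier SG" by (rule group.inv_closed[OF gS xc])
  moreover have "(inv\<^bsub>SG\<^esub> x) e = \<one>\<^bsub>Wk (v e)\<^esub>" if "e > d" for e
   using x that by (subst inv_sum_group[OF gk xc]) (simp add: monoid.inv_one[OF group.is_monoid[OF gk]])
  ultimately show "inv\<^bsub>SG\<^esub> x : {x : carrier SG. \<forall>e>d. x e = \<one>\<^bsub>Wk (v e)\<^esub>}" by blast
 next
  fix x y assume x: "x : {x : carrier SG. \<forall>e>d. x e = \<one>\<^bsub>Wk (v e)\<^esub>}" and y: "y : {x : carrier SG. \<forall>e>d. x e = \<one>\<^bsub>Wk (v e)\<^esub>}"
  have "x \<otimes>\<^bsub>SG\<^esub> y : carrier SG" using x y by (intro monoid.m_closed[OF group.is_monoid[OF gS]]) auto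
  moreover have "(x \<otimes>\<^bsub>SG\<^esub> y) e = \<one>\<^bsub>Wk (v e)\<^esub>" if "e > d" for e
   using x y that by (simp add: monoid.r_one[OF group.is_monoid[OF gk]] monoid.one_closed[OF group.is_monoid[OF gk]])
  ultimately show "x \<otimes>\<^bsub>SG\<^esub> y : {x : carrier SG. \<forall>e>d. x e = \<one>\<^bsub>Wk (v e)\<^esub>}" by blast
 qed
 moreover have "group_hom PG SG fst"
  using group_PG gS by (auto simp: group_hom_def group_hom_axioms_def hom_def mult_DirProd' simp del: mult_sum_group)
 ultimately have "subgroup {a : carrier PG. fst a : {x : carrier SG. \<forall>e>d. x e = \<one>\<^bsub>Wk (v e)\<^esub>}} PG"
  by (intro subgroup_preimage)
 moreover have "{a : carrier PG. fst a : {x : carrier SG. \<forall>e>d. x e = \<one>\<^bsub>Wk (v e)\<^esub>}} = laurent_parts_le p d"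
  unfolding laurent_parts_le_def laurent_parts_eq by auto
 ultimately show ?thesis by simp
qed

lemma subgroup_fil: "subgroup (fil d) E"
 by (rule group_hom.subgroup_img_is_subgroup[OF laurent_sum_group_hom subgroup_parts_le])

lemma ones_closed: "\<one>\<^bsub>SG\<^esub> : carrier SG" "\<one>\<^bsub>K11\<^esub> : carrier K11" "\<one>\<^bsub>cw p M\<^esub> : carrier (cw p M)"
 by (rule monoid.one_closed, rule group.is_monoid, rule gS comm_group_group[OF cK] comm_group_group[OF cM])+

lemma polar_one: "finprod E (%d. comonomial p d (\<one>\<^bsub>SG\<^esub> d)) {d : {0<..}. \<one>\<^bsub>SG\<^esub> d ~= \<one>\<^bsub>Wk (v d)\<^esub>} = \<one>\<^bsub>E\<^esub>"
proof -
 have "{d : {0<..}. \<one>\<^bsub>SG\<^esub> d ~= \<one>\<^bsub>Wk (v d)\<^esub>} = {}" by auto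
 then show ?thesis by (simp only: comm_monoid.finprod_empty[OF comm_group.axioms(1)[OF cE]])
qed

lemma laurent_sum_single:
 assumes e: "e > 0" and x: "x : carrier (Wk (v e))"
 shows "laurent_sum p (single_fun {0<..} (%d. Wk (v d)) e x, \<one>\<^bsub>K11\<^esub>, \<one>\<^bsub>cw p M\<^esub>) = comonomial p e x"
  "(single_fun {0<..} (%d. Wk (v d)) e x, \<one>\<^bsub>K11\<^esub>, \<one>\<^bsub>cw p M\<^esub>) : carrier PG"
  "e \<le> d ==> (single_fun {0<..} (%d. Wk (v d)) e x, \<one>\<^bsub>K11\<^esub>, \<one>\<^bsub>cw p M\<^esub>) : laurent_parts_le p d"
proof -
 interpret E: comm_group E by (rule cE)
 have c: "comonomial p e x : carrier E" using comonomial_hom[OF e] x by (auto simp: hom_def)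
 have l: "finprod E (%d. comonomial p d (single_fun {0<..} (%d. Wk (v d)) e x d)) {d : {0<..}. single_fun {0<..} (%d. Wk (v d)) e x d ~= \<one>\<^bsub>Wk (v d)\<^esub>} = comonomial p e x"
  by (rule single_fun_lift[where I="{0<..}" and G="%d. Wk (v d)" and ph="comonomial p" and i=e, OF cE _ hom_one[OF comonomial_hom[OF e] gk E.is_group] c]) (use e in simp)
 show "laurent_sum p (single_fun {0<..} (%d. Wk (v d)) e x, \<one>\<^bsub>K11\<^esub>, \<one>\<^bsub>cw p M\<^esub>) = comonomial p e x"
  unfolding laurent_sum_apply l
  using group_hom.hom_one[OF const_group_hom] group_hom.hom_one[OF fps_group_hom[OF subrng_max_ideal]] c by simp
 show 1: "(single_fun {0<..} (%d. Wk (v d)) e x, \<one>\<^bsub>K11\<^esub>, \<one>\<^bsub>cw p M\<^esub>) : carrier PG"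
  using single_fun_in[OF gk, of e "{0<..}" x v] e x ones_closed by simp
 show "(single_fun {0<..} (%d. Wk (v d)) e x, \<one>\<^bsub>K11\<^esub>, \<one>\<^bsub>cw p M\<^esub>) : laurent_parts_le p d" if "e \<le> d"
  unfolding laurent_parts_le_def laurent_parts_eq using 1 that by (auto simp: single_fun_def)
qed

lemma laurent_sum_const:
 assumes f: "f : carrier K11"
 shows "laurent_sum p (\<one>\<^bsub>SG\<^esub>, f, \<one>\<^bsub>cw p M\<^esub>) = cw_map p UNIV fls_const f" "(\<one>\<^bsub>SG\<^esub>, f, \<one>\<^bsub>cw p M\<^esub>) : carrier PG"
  "(\<one>\<^bsub>SG\<^esub>, f, \<one>\<^bsub>cw p M\<^esub>) : laurent_parts_le p d"
proof -
 interpret E: comm_group E by (rule cE)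
 interpret C: group_hom K11 E "cw_map p UNIV fls_const" by (rule const_group_hom)
 show "laurent_sum p (\<one>\<^bsub>SG\<^esub>, f, \<one>\<^bsub>cw p M\<^esub>) = cw_map p UNIV fls_const f"
  unfolding laurent_sum_apply polar_one
  using group_hom.hom_one[OF fps_group_hom[OF subrng_max_ideal]] f by simp
 show 1: "(\<one>\<^bsub>SG\<^esub>, f, \<one>\<^bsub>cw p M\<^esub>) : carrier PG" using ones_closed f by simp
 show "(\<one>\<^bsub>SG\<^esub>, f, \<one>\<^bsub>cw p M\<^esub>) : laurent_parts_le p d"
  unfolding laurent_parts_le_def laurent_parts_eq using 1 by auto
qed

lemma laurent_sum_fps:
 assumes f: "f : carrier (cw p M)"
 shows "laurent_sum p (\<one>\<^bsub>SG\<^esub>, \<one>\<^bsub>K11\<^esub>, f) = cw_map p UNIV fps_to_fls f" "(\<one>\<^bsub>SG\<^esub>, \<one>\<^bsub>K11\<^esub>, f) : carrier PG"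
  "(\<one>\<^bsub>SG\<^esub>, \<one>\<^bsub>K11\<^esub>, f) : laurent_parts_le p d"
proof -
 interpret E: comm_group E by (rule cE)
 interpret C: group_hom "cw p M" E "cw_map p UNIV fps_to_fls" by (rule fps_group_hom[OF subrng_max_ideal])
 show "laurent_sum p (\<one>\<^bsub>SG\<^esub>, \<one>\<^bsub>K11\<^esub>, f) = cw_map p UNIV fps_to_fls f"
  unfolding laurent_sum_apply polar_one
  using group_hom.hom_one[OF const_group_hom] f by simp
 show 1: "(\<one>\<^bsub>SG\<^esub>, \<one>\<^bsub>K11\<^esub>, f) : carrier PG" using ones_closed f by simp
 show "(\<one>\<^bsub>SG\<^esub>, \<one>\<^bsub>K11\<^esub>, f) : laurent_parts_le p d"
  unfolding laurent_parts_le_def laurent_parts_eq using 1 by auto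
qed

text \<open>
 Kato's condition on a vector is integrality of its \<^term>\<open>s\<close>-fold Frobenius twist after rescaling;
 hence it defines a subgroup.
\<close>

lemma subgroup_kato_vec: "subgroup (kato_vec p d s) (WE s)"
proof -
 let ?c = "fls_X_intpow (- int d) :: 'k fls"
 let ?sc = "%x. map (%i. ?c ^ p ^ i * x ! i) [0..<Suc s]"
 let ?O = "witt p (integral_fls :: 'k fls set) s"
 have sc: "group_hom ?O (WE s) ?sc"
  unfolding group_hom_def group_hom_axioms_def
  by (intro conjI witt_scale_hom[OF p subrng_integral_fls] witt_group[OF p subrng_integral_fls] witt_group[OF p subrng_UNIV])
 have img: "subgroup (?sc ` carrier ?O) (WE s)" by (rule group_hom.img_is_subgroup[OF sc])
 have rh: "rng_hom_on UNIV (\<lambda>x::'k fls. x ^ p ^ s)"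
  using p chE by (simp add: rng_hom_on_def power_mult_distrib freshmans_dream')
 have F: "group_hom (WE s) (WE s) (map (%x. x ^ p ^ s))"
  using witt_map_hom[OF p subrng_UNIV rh] witt_group[OF p subrng_UNIV]
  by (simp add: group_hom_def group_hom_axioms_def)
 have cp: "?c ^ p ^ i = fls_X_intpow (- (int d * int (p ^ i)))" for i
  unfolding fls_X_intpow_power by (simp add: mult.commute)
 have ps: "int (p ^ s) = int (p ^ i) * int (p ^ (s - i))" if "i \<le> s" for i
  using that by (simp flip: of_nat_mult power_add)
 have "x : kato_vec p d s \<longleftrightarrow> x : carrier (WE s) \<and> map (%x. x ^ p ^ s) x : ?sc ` carrier ?O" for x :: "'k fls list"
 proof
  assume x: "x : kato_vec p d s"
  \<comment> \<open>Undoes the scaling: Kato's condition on entry i, multiplied by p^i, says that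
    p^s times the subdegree plus d p^i is nonnegative, which is integrality of entry i of u. Without
    the p^s-th powers the exponent of t would be d / p^(s - i), in general not an integer.\<close>
  define u where "u = map (%i. fls_X_intpow (int d * int (p ^ i)) * x ! i ^ p ^ s) [0..<Suc s]"
  have un: "u ! i = fls_X_intpow (int d * int (p ^ i)) * x ! i ^ p ^ s" if "i \<le> s" for i
   unfolding u_def using that by (subst nth_map_upt) auto
  have "u ! i : integral_fls" if i: "i \<le> s" for i
  proof (cases "x ! i = 0")
   case True then show ?thesis using p0_11 by (simp add: un[OF i] integral_fls_def zero_power)
  next
   case False
   then have "- int d \<le> int (p ^ (s - i)) * fls_subdegree (x ! i)" using x i by (auto simp: kato_vec_def)
   then have "int (p ^ i) * (- int d) \<le> int (p ^ i) * (int (p ^ (s - i)) * fls_subdegree (x ! i))"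
    by (rule mult_left_mono) simp
   then have "0 \<le> int d * int (p ^ i) + int (p ^ s) * fls_subdegree (x ! i)"
    unfolding ps[OF i] by (simp add: algebra_simps)
   moreover have "fls_subdegree (u ! i) = int d * int (p ^ i) + int (p ^ s) * fls_subdegree (x ! i)"
    unfolding un[OF i] using False by (subst fls_subdegree_mult) (simp_all add: fls_subdegree_pow fls_X_intpow_nonzero)
   ultimately show ?thesis by (simp add: integral_fls_def)
  qed
  then have "u : carrier ?O"
   unfolding witt_carrier_iff by (auto simp: u_def in_set_conv_nth simp del: upt_Suc)
  moreover have "map (%x. x ^ p ^ s) x = ?sc u"
  proof (rule nth_equalityI)
   show "length (map (%x. x ^ p ^ s) x) = length (?sc u)" using x by (simp add: kato_vec_def)
   fix i assume "i < length (map (%x. x ^ p ^ s) x)"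
   then have i: "i \<le> s" "i < length x" using x by (auto simp: kato_vec_def)
   have "?sc u ! i = ?c ^ p ^ i * u ! i" using i by (subst nth_map_upt) auto
   also have "\<dots> = fls_X_intpow (- (int d * int (p ^ i))) * fls_X_intpow (int d * int (p ^ i)) * x ! i ^ p ^ s"
    unfolding cp un[OF i(1)] by (simp add: mult.assoc)
   also have "fls_X_intpow (- (int d * int (p ^ i))) * fls_X_intpow (int d * int (p ^ i)) = (1 :: 'k fls)"
    by (subst fls_X_intpow_times_fls_X_intpow) simp
   finally show "map (%x. x ^ p ^ s) x ! i = ?sc u ! i" using i by simp
  qed
  moreover have "x : carrier (WE s)" using x by (simp add: kato_vec_def witt_carrier_iff)
  ultimately show "x : carrier (WE s) \<and> map (%x. x ^ p ^ s) x : ?sc ` carrier ?O" by blast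
 next
  assume "x : carrier (WE s) \<and> map (%x. x ^ p ^ s) x : ?sc ` carrier ?O"
  then obtain u where x: "length x = Suc s" and u: "u : carrier ?O" "map (%x. x ^ p ^ s) x = ?sc u"
   by (auto simp: witt_carrier_iff)
  have "x ! i = 0 \<or> - int d \<le> int (p ^ (s - i)) * fls_subdegree (x ! i)" if i: "i \<le> s" for i
  proof (cases "x ! i = 0")
   case False
   have "x ! i ^ p ^ s = map (%x. x ^ p ^ s) x ! i" using i x by simp
   also have "\<dots> = ?c ^ p ^ i * u ! i" unfolding u(2) using i by (subst nth_map_upt) auto
   finally have e: "x ! i ^ p ^ s = ?c ^ p ^ i * u ! i" .
   then have u0: "u ! i ~= 0" using False by auto
   have "u ! i : integral_fls" using u(1) i by (auto simp: witt_carrier_iff)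
   then have "0 \<le> fls_subdegree (u ! i)" using u0 by (simp add: integral_fls_def)
   moreover have "fls_subdegree (x ! i ^ p ^ s) = - (int d * int (p ^ i)) + fls_subdegree (u ! i)"
    unfolding e cp using u0 by (subst fls_subdegree_mult) (simp_all add: fls_shift_eq0_iff)
   ultimately have "- (int d * int (p ^ i)) \<le> int (p ^ s) * fls_subdegree (x ! i)"
    by (simp add: fls_subdegree_pow)
   then have "int (p ^ i) * (- int d) \<le> int (p ^ i) * (int (p ^ (s - i)) * fls_subdegree (x ! i))"
    unfolding ps[OF i] by (simp add: algebra_simps)
   then have "- int d \<le> int (p ^ (s - i)) * fls_subdegree (x ! i)"
    by (rule mult_left_le_imp_le) (use p0_11 in simp)
   then show ?thesis by blast
  qed simp
  then show "x : kato_vec p d s" using x by (simp add: kato_vec_def)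
 qed
 then have "kato_vec p d s = {x : carrier (WE s). map (%x. x ^ p ^ s) x : ?sc ` carrier ?O}" by blast
 then show ?thesis using subgroup_preimage[OF F img] by simp
qed

section \<open>Existence of the Laurent decomposition\<close>

lemma lvec_shift:
 "cw_inj p UNIV (t + s) (lvec p e (t + s) (replicate t 0 @ y)) = cw_inj p UNIV s (lvec p e s (y :: 'k list))"
proof (induction t)
 case (Suc t)
 have "cw_inj p UNIV (Suc (t + s)) (0 # lvec p e (t + s) (replicate t 0 @ y)) = cw_inj p UNIV (t + s) (lvec p e (t + s) (replicate t 0 @ y))"
  by (rule cw_inj_Suc[OF p subrng_UNIV]) (simp add: witt_carrier_iff)
 then show ?case using Suc by (simp add: lvec_Cons)
qed simp

text \<open>Realises a prescribed first entry a by a vector that obeys Kato's bound and is a sum of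
  admissible parts. The induction is on the pole order of a: a term b t^(-(N+1)) is the first entry
  of a co-monomial of degree (N + 1) p^s, which is at most d by hypothesis.\<close>

lemma kato_leading_term:
 assumes "N * p ^ s \<le> d" "\<And>j. j > N ==> fls_nth a (- int j) = 0"
 shows "\<exists>w\<in>kato_vec p d s. hd w = a \<and> cw_inj p UNIV s w : fil d"
 using assms
proof (induction N arbitrary: a)
 interpret W: comm_group "WE s" by (rule cgE)
 interpret B: subgroup "kato_vec p d s" "WE s" by (rule subgroup_kato_vec)
 have hdm: "hd (a \<otimes>\<^bsub>WE s\<^esub> b) = hd a + hd b" if "a : kato_vec p d s" "b : kato_vec p d s" for a b
  using that by (intro witt_hd_mult[OF p]) (simp_all add: kato_vec_def)
 have mult: "\<exists>w\<in>kato_vec p d s. hd w = hd a + hd b \<and> cw_inj p UNIV s w : fil d"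
  if ab: "a : kato_vec p d s" "b : kato_vec p d s" "cw_inj p UNIV s a : fil d" "cw_inj p UNIV s b : fil d" for a b
 proof (intro bexI conjI)
  show "a \<otimes>\<^bsub>WE s\<^esub> b : kato_vec p d s" by (rule B.m_closed[OF ab(1,2)])
  show "hd (a \<otimes>\<^bsub>WE s\<^esub> b) = hd a + hd b" by (rule hdm[OF ab(1,2)])
  show "cw_inj p UNIV s (a \<otimes>\<^bsub>WE s\<^esub> b) : fil d"
   using cw_inj_mult[OF p subrng_UNIV B.mem_carrier[OF ab(1)] B.mem_carrier[OF ab(2)]]
    subgroup.m_closed[OF subgroup_fil ab(3,4)] by simp
 qed
 {
  case (0 a)
  define g where "g = fls_regpart a"
  have a: "a = fps_to_fls g"
  proof (rule fls_eqI)
   fix k :: int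
   show "fls_nth a k = fls_nth (fps_to_fls g) k"
   proof (cases "k < 0")
    case True
    then have "k = - int (nat (- k))" "nat (- k) > 0" by auto
    then have "fls_nth a k = 0" using 0(2)[of "nat (- k)"] by simp
    then show ?thesis using True by simp
   qed (simp add: g_def)
  qed
  define c where "c = fps_nth g 0"
  \<comment> \<open>Without poles the first entry splits into its constant term and a series in t
    k[[t]], which belong to CW(k) and to CW(t k[[t]]).\<close>
  define w1 where "w1 = c # replicate s 0"
  define h where "h = g - fps_const c"
  define w2 where "w2 = h # replicate s 0"
  have w1: "w1 : carrier (Wk s)" and w2: "w2 : carrier (witt p M s)"
   by (auto simp: w1_def w2_def c_def h_def witt_carrier_iff)
  have k1: "map fls_const w1 : kato_vec p d s" and k2: "map fps_to_fls w2 : kato_vec p d s"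
   by (auto simp: kato_vec_def w1_def w2_def nth_Cons fls_subdegree_fls_to_fps intro!: order.trans[OF _ mult_nonneg_nonneg] split: nat.split)
  have "cw_inj p UNIV s (map fls_const w1) = laurent_sum p (\<one>\<^bsub>SG\<^esub>, cw_inj p UNIV s w1, \<one>\<^bsub>cw p M\<^esub>)"
   unfolding laurent_sum_const(1)[OF cw_inj_closed[OF p subrng_UNIV w1]]
   by (rule cw_map_inj[OF p subrng_UNIV rng_hom_const subset_UNIV subrng_UNIV w1, symmetric])
  then have f1: "cw_inj p UNIV s (map fls_const w1) : fil d"
   using laurent_sum_const(3)[OF cw_inj_closed[OF p subrng_UNIV w1]] by blast
  have "cw_inj p UNIV s (map fps_to_fls w2) = laurent_sum p (\<one>\<^bsub>SG\<^esub>, \<one>\<^bsub>K11\<^esub>, cw_inj p M s w2)"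
   unfolding laurent_sum_fps(1)[OF cw_inj_closed[OF p subrng_max_ideal w2]]
   by (rule cw_map_inj[OF p subrng_max_ideal rng_hom_fps subset_UNIV subrng_UNIV w2, symmetric])
  then have f2: "cw_inj p UNIV s (map fps_to_fls w2) : fil d"
   using laurent_sum_fps(3)[OF cw_inj_closed[OF p subrng_max_ideal w2]] by blast
  have "hd (map fls_const w1) + hd (map fps_to_fls w2) = a"
   by (simp add: w1_def w2_def h_def a)
  then show ?case using mult[OF k1 k2 f1 f2] by simp
 next
  case (Suc N a)
  define b where "b = fls_nth a (- int (Suc N))"
  define a' where "a' = a - fmono b (Suc N)"
  have "\<exists>w\<in>kato_vec p d s. hd w = a' \<and> cw_inj p UNIV s w : fil d"
  proof (rule Suc.IH)
   show "N * p ^ s \<le> d" using Suc.prems(1) by simp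
   fix j assume j: "j > N"
   show "fls_nth a' (- int j) = 0"
   proof (cases "j = Suc N")
    case True
    then show ?thesis by (simp add: a'_def b_def fmono_nth)
   next
    case False
    then have "j > Suc N" using j by simp
    then show ?thesis using Suc.prems(2)[of j] by (simp add: a'_def fmono_nth)
   qed
  qed
  then obtain w where w: "w : kato_vec p d s" "hd w = a'" "cw_inj p UNIV s w : fil d" by blast
  define m where "m = fmono b (Suc N) # replicate s 0"
  define e where "e = Suc N * p ^ s"
  have ve: "v e = v (Suc N) + s" and e0: "e > 0"
   unfolding e_def by (rule multiplicity_times_power[OF p], simp) (use p0_11 in simp)
  have ed: "e \<le> d" using Suc.prems(1) by (simp add: e_def)
  \<comment> \<open>The coefficient vector for degree e has v(N + 1) + s + 1 entries; the leading
    zeros put b at the place that is the first entry at level s.\<close>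
  let ?x = "replicate (v (Suc N)) 0 @ (b # replicate s 0)"
  have x: "?x : carrier (Wk (v e))" by (simp add: witt_carrier_iff ve)
  have lm: "lvec p e s (b # replicate s 0) = m"
  proof (rule nth_equalityI)
   show "length (lvec p e s (b # replicate s 0)) = length m" by (simp add: m_def)
   fix i assume "i < length (lvec p e s (b # replicate s 0))"
   then have "i \<le> s" by simp
   then show "lvec p e s (b # replicate s 0) ! i = m ! i"
    using p0_11 by (cases i) (simp_all add: lvec_nth m_def e_def)
  qed
  have "comonomial p e ?x = cw_inj p UNIV s m"
   unfolding comonomial_lvec[OF e0] ve lm[symmetric] by (rule lvec_shift)
  then have fm: "cw_inj p UNIV s m : fil d"
   unfolding laurent_sum_single(1)[OF e0 x, symmetric]
   by (rule image_eqI[OF sym]) (rule laurent_sum_single(3)[OF e0 x ed])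
  have km: "m : kato_vec p d s"
  proof -
   have "m ! i = 0 \<or> - int d \<le> int (p ^ (s - i)) * fls_subdegree (m ! i)" if "i \<le> s" for i
   proof (cases "i = 0 \<and> b ~= 0")
    case True
    have "int (p ^ s) * fls_subdegree (fmono b (Suc N)) = - int e" using True by (simp add: fmono_subdegree e_def algebra_simps)
    then show ?thesis using True ed by (simp add: m_def)
   qed (use that in "auto simp: m_def nth_Cons split: nat.split")
   then show ?thesis by (simp add: kato_vec_def m_def)
  qed
  have "hd w + hd m = a" using w(2) by (simp add: m_def a'_def)
  then show ?case using mult[OF w(1) km w(3) fm] by simp
 }
qed

text \<open>The bound limits the pole order of the first entry to d / p^s, so
  \<open>kato_leading_term\<close> applies; after subtraction the first entry is zero, and the same
  bound holds one level lower.\<close>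

lemma kato_vec_in_fil:
 assumes "x : kato_vec p d s"
 shows "cw_inj p UNIV s x : fil d"
 using assms
proof (induction s arbitrary: x)
 have red: "\<exists>w. w : kato_vec p d s \<and> hd w = 0 \<and> (cw_inj p UNIV s w : fil d \<longrightarrow> cw_inj p UNIV s x : fil d)"
  if x: "x : kato_vec p d s" for s and x :: "'k fls list"
 proof -
  interpret W: comm_group "WE s" by (rule cgE)
  interpret B: subgroup "kato_vec p d s" "WE s" by (rule subgroup_kato_vec)
  have hd: "hd x = x ! 0" using x by (simp add: kato_vec_def hd_conv_nth flip: length_greater_0_conv)
  have "\<exists>w\<in>kato_vec p d s. hd w = hd x \<and> cw_inj p UNIV s w : fil d"
  proof (rule kato_leading_term)
   show "d div p ^ s * p ^ s \<le> d" by simp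
   fix j assume j: "j > d div p ^ s"
   have "x ! 0 = 0 \<or> - int d \<le> int (p ^ s) * fls_subdegree (x ! 0)" using x unfolding kato_vec_def by force
   then show "fls_nth (hd x) (- int j) = 0"
   proof
    assume h: "- int d \<le> int (p ^ s) * fls_subdegree (x ! 0)"
    have "d < j * p ^ s" using j p0_11 by (simp add: div_less_iff_less_mult)
    then have "int d < int (p ^ s) * int j" by (simp only: mult.commute[of "p ^ s"] of_nat_mult[symmetric] of_nat_less_iff)
    then have "int (p ^ s) * (- int j) < int (p ^ s) * fls_subdegree (x ! 0)" using h by simp
    then have "- int j < fls_subdegree (x ! 0)" by (rule mult_left_less_imp_less) simp
    then show ?thesis unfolding hd by simp
   qed (simp add: hd)
  qed
  then obtain w where w: "w : kato_vec p d s" "hd w = hd x" "cw_inj p UNIV s w : fil d" by blast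
  let ?y = "x \<otimes>\<^bsub>WE s\<^esub> inv\<^bsub>WE s\<^esub> w"
  have y: "?y : kato_vec p d s" using x w(1) by (intro B.m_closed B.m_inv_closed)
  have xy: "x = ?y \<otimes>\<^bsub>WE s\<^esub> w" using x w(1) by (simp add: W.m_assoc B.mem_carrier)
  have "hd (?y \<otimes>\<^bsub>WE s\<^esub> w) = hd ?y + hd w"
   by (rule witt_hd_mult[OF p]) (use y w(1) in "simp_all add: kato_vec_def")
  then have "hd ?y = 0" using xy w(2) by simp
  moreover have "cw_inj p UNIV s x : fil d" if "cw_inj p UNIV s ?y : fil d"
   using subgroup.m_closed[OF subgroup_fil that w(3)]
    cw_inj_mult[OF p subrng_UNIV B.mem_carrier[OF y] B.mem_carrier[OF w(1)]] xy by simp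
  ultimately show ?thesis using y by blast
 qed
 {
  case 0
  then obtain w :: "'k fls list" where w: "w : kato_vec p d 0" "hd w = 0" and i: "cw_inj p UNIV 0 w : fil d \<longrightarrow> cw_inj p UNIV 0 x : fil d"
   using red by blast
  have "w = \<one>\<^bsub>WE 0\<^esub>" using w by (cases w) (auto simp: kato_vec_def witt_def)
  then have "cw_inj p UNIV 0 w = \<one>\<^bsub>E\<^esub>" unfolding cw_one[OF p subrng_UNIV, of 0] by simp
  then show ?case using i subgroup.one_closed[OF subgroup_fil] by simp
 next
  case (Suc s)
  then obtain w :: "'k fls list" where w: "w : kato_vec p d (Suc s)" "hd w = 0"
   and i: "cw_inj p UNIV (Suc s) w : fil d \<longrightarrow> cw_inj p UNIV (Suc s) x : fil d" using red by blast
  then obtain w' where w': "w = 0 # w'" by (cases w) (auto simp: kato_vec_def)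
  have "w' ! j = 0 \<or> - int d \<le> int (p ^ (s - j)) * fls_subdegree (w' ! j)" if "j \<le> s" for j
  proof -
   have "w ! Suc j = 0 \<or> - int d \<le> int (p ^ (Suc s - Suc j)) * fls_subdegree (w ! Suc j)"
    using w(1) that unfolding kato_vec_def by blast
   then show ?thesis by (simp add: w')
  qed
  then have "w' : kato_vec p d s" using w(1) by (simp add: kato_vec_def w')
  then have "cw_inj p UNIV s w' : fil d" by (rule Suc.IH)
  moreover have "cw_inj p UNIV (Suc s) w = cw_inj p UNIV s w'"
   unfolding w' by (rule cw_inj_Suc[OF p subrng_UNIV]) (use w(1) in "simp add: w' kato_vec_def witt_carrier_iff")
  ultimately show ?case using i by simp
 }
qed

lemma laurent_sum_bij: "bij_betw (laurent_sum p) (carrier PG) (carrier E)"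
proof (rule bij_betw_imageI[OF laurent_sum_inj])
 interpret L: group_hom PG E "laurent_sum p" by (rule laurent_sum_group_hom)
 show "laurent_sum p ` carrier PG = carrier E"
 proof
  show "laurent_sum p ` carrier PG <= carrier E" by auto
  show "carrier E <= laurent_sum p ` carrier PG"
  proof
   fix f assume "f : carrier E"
   then obtain s x where x: "x : carrier (WE s)" "f = cw_inj p UNIV s x" using cw_cases[OF p subrng_UNIV] by metis
   \<comment> \<open>A crude bound is enough: the sum dominates every weighted pole order in the
     vector, so each co-vector lies in some step of the filtration.\<close>
   define d where "d = (\<Sum>i\<le>s. nat (int (p ^ (s - i)) * \<bar>fls_subdegree (x ! i)\<bar>))"
   have "- int d \<le> int (p ^ (s - i)) * fls_subdegree (x ! i)" if "i \<le> s" for i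
   proof -
    have "nat (int (p ^ (s - i)) * \<bar>fls_subdegree (x ! i)\<bar>) \<le> d"
     unfolding d_def by (rule member_le_sum) (use that in auto)
    then have "int (p ^ (s - i)) * \<bar>fls_subdegree (x ! i)\<bar> \<le> int d" by simp
    moreover have "- (int (p ^ (s - i)) * \<bar>fls_subdegree (x ! i)\<bar>) \<le> int (p ^ (s - i)) * fls_subdegree (x ! i)"
     unfolding mult_minus_right[symmetric] by (rule mult_left_mono) auto
    ultimately show ?thesis by linarith
   qed
   then have "x : kato_vec p d s" using x(1) by (simp add: kato_vec_def witt_carrier_iff)
   then have "f : fil d" unfolding x(2) by (rule kato_vec_in_fil)
   then show "f : laurent_sum p ` carrier PG" unfolding laurent_parts_le_def laurent_parts_eq by blast
  qed
 qed
qed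

section \<open>Kato's filtration\<close>

private abbreviation (input) "parts d \<equiv> (laurent_parts_le p d :: ((nat => 'k list) \<times> 'k covec \<times> 'k fps covec) set)"

private lemma gE: "group E" by (rule comm_group_group[OF cE])
text \<open>All representatives are related by leading zeros, which do not change
  \<open>witt_val\<close>; so each of them meets the definite description in
  \<open>cw_val\<close>.\<close>

lemma cw_val_inj:
 assumes x: "x : carrier (WE s)"
 shows "cw_val p (cw_inj p UNIV s x) = witt_val p s x"
proof -
 have f: "witt_val p N (fold (%_. Cons 0) [m..<N] z) = witt_val p m z" if "m \<le> N" for m N and z :: "'k fls list"
  using that by (induction N rule: dec_induct) (simp_all add: witt_val_Cons[OF p0_11])
 have "witt_val p t y = witt_val p s x" if ty: "(t, y) : cw_inj p UNIV s x" for t y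
 proof -
  have y: "y : carrier (WE t)" "cw_inj p UNIV t y = cw_inj p UNIV s x"
   using cw_inj_mem[OF p subrng_UNIV ty x] by blast+
  let ?N = "max t s"
  have "fold (%_. Cons 0) [t..<?N] y = fold (%_. Cons 0) [s..<?N] x"
   using y(2) unfolding cw_inj_def inj_dirsys.lim_inj_eq_iff[OF dirsys_V[OF p subrng_UNIV] max.cobounded1 max.cobounded2 y(1) x] .
  then show ?thesis using f[of t ?N y] f[of s ?N x] by simp
 qed
 then show ?thesis unfolding cw_val_def
  using cw_inj_self[OF p subrng_UNIV x] by (intro the_equality) blast+
qed

lemma cw_fil_inj:
 assumes x: "x : carrier (WE s)"
 shows "cw_inj p UNIV s x : cw_fil p (int d) \<longleftrightarrow> x : kato_vec p d s"
 using cw_inj_closed[OF p subrng_UNIV x] witt_val_ge_iff[OF p0_11, of x s d] x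
 by (simp add: cw_fil_def cw_val_inj[OF x] witt_carrier_iff)

lemma cw_fil_cases:
 assumes "f : cw_fil p (int d)"
 obtains s x where "x : carrier (WE s)" "x : kato_vec p d s" "f = cw_inj p UNIV s x"
proof -
 have "f : carrier E" using assms by (simp add: cw_fil_def)
 then obtain s x where x: "x : carrier (WE s)" "f = cw_inj p UNIV s x" using cw_cases[OF p subrng_UNIV] by metis
 then show thesis using that[OF x(1) _ x(2)] cw_fil_inj[OF x(1)] assms by blast
qed

lemma subgroup_cw_fil: "subgroup (cw_fil p (int d) :: 'k fls covec set) E"
proof -
 interpret E: comm_group E by (rule cE)
 note K11 = subgroup_kato_vec[of d]
 have sub: "cw_fil p (int d) <= carrier E" by (auto simp: cw_fil_def)
 show ?thesis
 proof (rule E.subgroupI[OF sub])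
  have "\<one>\<^bsub>E\<^esub> : cw_fil p (int d)"
   unfolding cw_one[OF p subrng_UNIV, of 0]
   by (rule iffD2[OF cw_fil_inj subgroup.one_closed[OF K11]]) (rule monoid.one_closed[OF group.is_monoid[OF witt_group[OF p subrng_UNIV]]])
  then show "cw_fil p (int d) ~= ({} :: 'k fls covec set)" by blast
 next
  fix f :: "'k fls covec" assume "f : cw_fil p (int d)"
  then obtain s x where x: "x : carrier (WE s)" "x : kato_vec p d s" "f = cw_inj p UNIV s x" by (rule cw_fil_cases)
  have i: "inv\<^bsub>WE s\<^esub> x : kato_vec p d s" by (rule subgroup.m_inv_closed[OF K11 x(2)])
  show "inv\<^bsub>E\<^esub> f : cw_fil p (int d)"
   unfolding x(3) group_hom.hom_inv[OF cw_inj_group_hom[OF p subrng_UNIV] x(1), symmetric]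
   by (rule iffD2[OF cw_fil_inj i]) (rule subgroup.mem_carrier[OF K11 i])
 next
  fix f g :: "'k fls covec" assume fg: "f : cw_fil p (int d)" "g : cw_fil p (int d)"
  then have "f : carrier E" "g : carrier E" using sub by blast+
  then obtain s x y where xy: "x : carrier (WE s)" "f = cw_inj p UNIV s x" "y : carrier (WE s)" "g = cw_inj p UNIV s y"
   by (rule cw_cases2[OF p subrng_UNIV])
  have k: "x \<otimes>\<^bsub>WE s\<^esub> y : kato_vec p d s"
   using fg xy cw_fil_inj[OF xy(1)] cw_fil_inj[OF xy(3)] by (intro subgroup.m_closed[OF K11]) blast+
  show "f \<otimes>\<^bsub>E\<^esub> g : cw_fil p (int d)"
   unfolding xy(2,4) cw_inj_mult[OF p subrng_UNIV xy(1,3)]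
   by (rule iffD2[OF cw_fil_inj k]) (rule subgroup.mem_carrier[OF K11 k])
 qed
qed

lemma comonomial_in_cw_fil:
 assumes "e > 0" "e \<le> d"
 shows "comonomial p e (x :: 'k list) : cw_fil p (int d)"
proof -
 have "lvec p e (v e) x : kato_vec p d (v e)"
  unfolding kato_vec_def
 proof (intro CollectI conjI allI impI)
  fix i assume i: "i \<le> v e"
  have "e div p ^ (v e - i) * p ^ (v e - i) \<le> d" using assms(2) by (rule order.trans[OF div_times_less_eq_dividend])
  then have "int (p ^ (v e - i)) * int (e div p ^ (v e - i)) \<le> int d"
   by (simp only: mult.commute of_nat_mult[symmetric] of_nat_le_iff)
  then show "lvec p e (v e) x ! i = 0 \<or> - int d \<le> int (p ^ (v e - i)) * fls_subdegree (lvec p e (v e) x ! i)"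
   unfolding lvec_nth[OF i] by (cases "x ! i = 0") (simp_all add: fmono_subdegree)
 qed simp
 then show ?thesis unfolding comonomial_lvec[OF assms(1)]
  by (intro iffD2[OF cw_fil_inj]) (simp_all add: witt_carrier_iff)
qed

lemma fps_in_cw_fil:
 assumes R: "subrng R" and f: "f : carrier (cw p R)"
 shows "cw_map p UNIV fps_to_fls (f :: 'k fps covec) : cw_fil p (int d)"
proof -
 obtain s x where x: "x : carrier (witt p R s)" "f = cw_inj p R s x" using cw_cases[OF p R f] .
 have "0 \<le> int (p ^ (s - i)) * fls_subdegree (fps_to_fls (x ! i))" for i
  by (intro mult_nonneg_nonneg) (simp_all add: fls_subdegree_fls_to_fps)
 then have "- int d \<le> int (p ^ (s - i)) * fls_subdegree (fps_to_fls (x ! i))" for i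
  by (rule order.trans[rotated]) simp
 then have "map fps_to_fls x : kato_vec p d s" using x(1) by (simp add: kato_vec_def witt_carrier_iff)
 then show ?thesis unfolding x(2) cw_map_inj[OF p R rng_hom_fps subset_UNIV subrng_UNIV x(1)]
  using x(1) by (intro iffD2[OF cw_fil_inj]) (simp_all add: witt_carrier_iff)
qed

lemma const_eq_fps:
 "f : carrier K11 ==> cw_map p UNIV fls_const f = cw_map p UNIV fps_to_fls (cw_map p UNIV fps_const f)"
 by (subst cw_map_comp[OF p subrng_UNIV _ subset_UNIV subrng_UNIV rng_hom_fps subset_UNIV subrng_UNIV])
  (auto simp: rng_hom_on_def)

lemma const_in_cw_fil:
 assumes f: "f : carrier K11"
 shows "cw_map p UNIV fls_const f : cw_fil p (int d)"
 unfolding const_eq_fps[OF f]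
 by (rule fps_in_cw_fil[OF subrng_UNIV], rule group_hom.hom_closed[OF cw_map_group_hom[OF p subrng_UNIV _ subset_UNIV subrng_UNIV] f])
  (auto simp: rng_hom_on_def)

lemma cw_fil_eq: "cw_fil p (int d) = laurent_sum p ` parts d"
proof
 show "cw_fil p (int d) <= laurent_sum p ` parts d"
 proof
  fix f :: "'k fls covec" assume "f : cw_fil p (int d)"
  then obtain s x where "x : carrier (WE s)" "x : kato_vec p d s" "f = cw_inj p UNIV s x" by (rule cw_fil_cases)
  then show "f : laurent_sum p ` parts d" using kato_vec_in_fil by blast
 qed
 show "laurent_sum p ` parts d <= cw_fil p (int d)"
 proof
  fix f assume "f : laurent_sum p ` parts d"
  then obtain x f0 f1 where a: "(x, f0, f1) : parts d" and f: "f = laurent_sum p (x, f0, f1)" by auto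
  have 1: "f0 : carrier K11" "f1 : carrier (cw p M)" "\<forall>e>d. x e = \<one>\<^bsub>Wk (v e)\<^esub>"
   using a unfolding laurent_parts_le_def laurent_parts_def by auto
  show "f : cw_fil p (int d)"
   unfolding f laurent_sum_apply
  proof (intro subgroup.m_closed[OF subgroup_cw_fil] subgroup_finprod[OF cE subgroup_cw_fil])
   fix e assume "e : {d : {0<..}. x d ~= \<one>\<^bsub>Wk (v d)\<^esub>}"
   then show "comonomial p e (x e) : cw_fil p (int d)" using 1(3) by (intro comonomial_in_cw_fil) (auto simp: not_less[symmetric])
  qed (use 1 in "auto intro: const_in_cw_fil fps_in_cw_fil[OF subrng_max_ideal]")
 qed
qed

lemma fps_group_iso: "group_iso (cw p (UNIV :: 'k fps set)) (E\<lparr>carrier := cw_fil p 0\<rparr>) (cw_map p UNIV fps_to_fls)"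
 and cw_fil_0: "cw_fil p 0 = cw_map p UNIV fps_to_fls ` carrier (cw p (UNIV :: 'k fps set))"
proof -
 show e: "cw_fil p 0 = cw_map p UNIV fps_to_fls ` carrier (cw p (UNIV :: 'k fps set))"
 proof
  show "cw_map p UNIV fps_to_fls ` carrier (cw p (UNIV :: 'k fps set)) <= cw_fil p 0"
   using fps_in_cw_fil[OF subrng_UNIV, of _ 0] by auto
  show "cw_fil p 0 <= cw_map p UNIV fps_to_fls ` carrier (cw p (UNIV :: 'k fps set))"
  proof
   fix f :: "'k fls covec" assume "f : cw_fil p 0"
   then have "f : cw_fil p (int 0)" by simp
   then obtain s x where x: "x : carrier (WE s)" "x : kato_vec p 0 s" "f = cw_inj p UNIV s x" by (rule cw_fil_cases)
   define y where "y = map fls_regpart x"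
   have y: "y : carrier (witt p UNIV s)" using x(1) by (simp add: y_def witt_carrier_iff)
   have "map fps_to_fls y = x"
   proof (rule nth_equalityI)
    fix i assume "i < length (map fps_to_fls y)"
    then have i: "i \<le> s" "i < length x" using x(1) by (auto simp: y_def witt_carrier_iff)
    then have "x ! i = 0 \<or> 0 \<le> int (p ^ (s - i)) * fls_subdegree (x ! i)" using x(2) by (auto simp: kato_vec_def)
    moreover have "0 < int (p ^ (s - i))" using p0_11 by simp
    ultimately have "x ! i : integral_fls" unfolding integral_fls_def by (simp only: mem_Collect_eq zero_le_mult_iff) linarith
    then obtain g where "x ! i = fps_to_fls g" unfolding integral_fls_eq by blast
    then show "map fps_to_fls y ! i = x ! i" using i by (simp add: y_def)
   qed (simp add: y_def)
   then have "f = cw_map p UNIV fps_to_fls (cw_inj p UNIV s y)"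
    unfolding cw_map_inj[OF p subrng_UNIV rng_hom_fps subset_UNIV subrng_UNIV y] x(3) by simp
   then show "f : cw_map p UNIV fps_to_fls ` carrier (cw p (UNIV :: 'k fps set))"
    using cw_inj_closed[OF p subrng_UNIV y] by blast
  qed
 qed
 have h: "cw_map p UNIV fps_to_fls : hom (cw p (UNIV :: 'k fps set)) E"
  by (rule cw_map_hom[OF p subrng_UNIV rng_hom_fps subset_UNIV subrng_UNIV])
 have g: "group (cw p (UNIV :: 'k fps set))" by (rule cw_group[OF p subrng_UNIV])
 have "group (E\<lparr>carrier := cw_fil p 0\<rparr>)" using subgroup.subgroup_is_group[OF subgroup_cw_fil[of 0] gE] by simp
 then have "group_hom (cw p (UNIV :: 'k fps set)) (E\<lparr>carrier := cw_fil p 0\<rparr>) (cw_map p UNIV fps_to_fls)"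
  unfolding group_hom_def group_hom_axioms_def e using g h by (auto simp: hom_def)
 moreover have "inj_on (cw_map p UNIV fps_to_fls) (carrier (cw p (UNIV :: 'k fps set)))"
  by (rule cw_map_inj_on[OF p subrng_UNIV rng_hom_fps subset_UNIV subrng_UNIV]) (auto intro: injI)
 ultimately show "group_iso (cw p (UNIV :: 'k fps set)) (E\<lparr>carrier := cw_fil p 0\<rparr>) (cw_map p UNIV fps_to_fls)"
  by (rule group_isoI) (simp add: e)
qed

text \<open>Subtracting the part of degree d from the data of f leaves data concentrated in degrees
  at most d - 1.\<close>

lemma cw_fil_leading_term:
 assumes d: "d > 0" and f: "f : cw_fil p (int d)"
 shows "\<exists>x\<in>carrier (Wk (v d)). f \<otimes>\<^bsub>E\<^esub> inv\<^bsub>E\<^esub> comonomial p d x : cw_fil p (int d - 1)"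
proof -
 interpret P: group PG by (rule group_PG)
 interpret L: group_hom PG E "laurent_sum p" by (rule laurent_sum_group_hom)
 have fst: "group_hom PG SG fst"
  using group_PG gS by (auto simp: group_hom_def group_hom_axioms_def hom_def mult_DirProd' simp del: mult_sum_group)
 obtain a where a: "a : parts d" "f = laurent_sum p a" using f unfolding cw_fil_eq by blast
 have ac: "a : carrier PG" using a(1) unfolding laurent_parts_le_def laurent_parts_eq by blast
 define x where "x = fst a"
 have xc: "x : carrier SG" unfolding x_def by (rule group_hom.hom_closed[OF fst ac])
 have xd: "x d : carrier (Wk (v d))" by (rule sum_group_carrierD(1)[OF gk xc]) (use d in simp)
 define s where "s = (single_fun {0<..} (%d. Wk (v d)) d (x d), \<one>\<^bsub>K11\<^esub>, \<one>\<^bsub>cw p M\<^esub>)"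
 note s = laurent_sum_single[OF d xd, folded s_def]
 have fs: "fst s : carrier SG" by (rule group_hom.hom_closed[OF fst s(2)])
 have "a \<otimes>\<^bsub>PG\<^esub> inv\<^bsub>PG\<^esub> s : parts (d - 1)"
 proof -
  have "fst (a \<otimes>\<^bsub>PG\<^esub> inv\<^bsub>PG\<^esub> s) e = \<one>\<^bsub>Wk (v e)\<^esub>" if e: "e > d - 1" for e
  proof -
   have "fst (a \<otimes>\<^bsub>PG\<^esub> inv\<^bsub>PG\<^esub> s) = x \<otimes>\<^bsub>SG\<^esub> inv\<^bsub>SG\<^esub> fst s"
    using group_hom.hom_mult[OF fst ac P.inv_closed[OF s(2)]] unfolding group_hom.hom_inv[OF fst s(2)] x_def .
   moreover have "(x \<otimes>\<^bsub>SG\<^esub> inv\<^bsub>SG\<^esub> fst s) e = x e \<otimes>\<^bsub>Wk (v e)\<^esub> inv\<^bsub>Wk (v e)\<^esub> (fst s e)"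
    using e d by (subst inv_sum_group[OF gk fs]) simp
   moreover have "fst s e = x e"
   proof (cases "e = d")
    case False
    then have "e > d" using e by simp
    then have "x e = \<one>\<^bsub>Wk (v e)\<^esub>" using a(1) by (simp add: laurent_parts_le_def x_def)
    then show ?thesis using e d False by (simp add: s_def single_fun_def)
   qed (use d in "simp add: s_def single_fun_def")
   moreover have "x e : carrier (Wk (v e))" by (rule sum_group_carrierD(1)[OF gk xc]) (use e d in simp)
   ultimately show ?thesis using group.r_inv[OF gk] by metis
  qed
  moreover have "a \<otimes>\<^bsub>PG\<^esub> inv\<^bsub>PG\<^esub> s : carrier PG" by (rule P.m_closed[OF ac P.inv_closed[OF s(2)]])
  ultimately show ?thesis unfolding laurent_parts_le_def laurent_parts_eq by blast
 qed
 then have "laurent_sum p (a \<otimes>\<^bsub>PG\<^esub> inv\<^bsub>PG\<^esub> s) : cw_fil p (int (d - 1))" unfolding cw_fil_eq by (rule imageI)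
 moreover have "laurent_sum p (a \<otimes>\<^bsub>PG\<^esub> inv\<^bsub>PG\<^esub> s) = f \<otimes>\<^bsub>E\<^esub> inv\<^bsub>E\<^esub> comonomial p d (x d)"
  using L.hom_mult[OF ac P.inv_closed[OF s(2)]] unfolding L.hom_inv[OF s(2)] s(1) a(2) .
 moreover have "int (d - 1) = int d - 1" using d by simp
 ultimately show ?thesis using xd by (intro bexI[of _ "x d"]) simp_all
qed

text \<open>By uniqueness of the decomposition, the part of degree d of a member of step d - 1 is
  trivial.\<close>

lemma comonomial_cw_fil_pred:
 assumes d: "d > 0" and x: "x : carrier (Wk (v d))" and f: "comonomial p d x : cw_fil p (int d - 1)"
 shows "x = \<one>\<^bsub>Wk (v d)\<^esub>"
proof -
 note s = laurent_sum_single[OF d x]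
 have e: "int d - 1 = int (d - 1)" using d by simp
 obtain a where a: "a : parts (d - 1)" "comonomial p d x = laurent_sum p a"
  using f unfolding e cw_fil_eq by (rule imageE)
 have ac: "a : carrier PG" using a(1) unfolding laurent_parts_le_def laurent_parts_eq by blast
 have "a = (single_fun {0<..} (%d. Wk (v d)) d x, \<one>\<^bsub>K11\<^esub>, \<one>\<^bsub>cw p M\<^esub>)"
  by (rule inj_onD[OF laurent_sum_inj _ ac s(2)]) (rule trans[OF a(2)[symmetric] s(1)[symmetric]])
 then have "fst a = single_fun {0<..} (%d. Wk (v d)) d x" by (simp only: fst_conv)
 then have "fst a d = x" using d by (simp add: single_fun_def)
 moreover have "fst a d = \<one>\<^bsub>Wk (v d)\<^esub>"
  using a(1) d unfolding laurent_parts_le_def by (simp only: mem_Collect_eq)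
 ultimately show ?thesis by simp
qed

section \<open>The isomorphism Phi\<close>

private abbreviation (input) "wpE \<equiv> cw_wp p (UNIV :: 'k fls set)"
private abbreviation (input) "wpK \<equiv> cw_wp p (UNIV :: 'k set)"
private abbreviation (input) "J \<equiv> coprime_nats p"
private abbreviation (input) "CT \<equiv> cwt p (UNIV :: 'k set)"
private abbreviation (input) "ST \<equiv> sum_group J (%_. CT)"
private abbreviation (input) "T \<equiv> asw_target p :: ((nat => 'k covec) \<times> 'k covec set) monoid"
private abbreviation (input) "FE \<equiv> cw_map p UNIV (\<lambda>x::'k fls. x ^ p)"

private lemma cCT: "comm_group CT" by (rule comm_group_cwt[OF p ch])
private lemma gCT: "group CT" by (rule comm_group_group[OF cCT])
private lemma gST: "group ST" by (rule sum_group) (rule gCT)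
private lemma nK: "normal wpK K11" by (rule normal_cw_wp[OF p subrng_UNIV ch])
private lemma nE: "normal wpE E" by (rule normal_cw_wp[OF p subrng_UNIV chE])
private lemma cQK: "comm_group (K11 Mod wpK)" by (rule comm_group.abelian_FactGroup[OF cK subgroup_cw_wp[OF p subrng_UNIV ch]])
private lemma cQE: "comm_group (E Mod wpE)" by (rule comm_group.abelian_FactGroup[OF cE subgroup_cw_wp[OF p subrng_UNIV chE]])

lemma comm_group_ST: "comm_group ST"
proof (rule group.group_comm_groupI[OF gST])
 fix x y assume xy: "x : carrier ST" "y : carrier ST"
 interpret C: comm_group CT by (rule cCT)
 show "x \<otimes>\<^bsub>ST\<^esub> y = y \<otimes>\<^bsub>ST\<^esub> x"
  using sum_group_carrierD(1)[OF gCT xy(1)] sum_group_carrierD(1)[OF gCT xy(2)]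
  by (simp add: C.m_comm cong: restrict_cong)
qed

lemma comm_group_asw_target: "comm_group T"
 unfolding asw_target_def
proof (rule group.group_comm_groupI[OF DirProd_group[OF gST comm_group_group[OF cQK]]])
 fix x y assume "x : carrier (ST \<times>\<times> (K11 Mod wpK))" "y : carrier (ST \<times>\<times> (K11 Mod wpK))"
 then show "x \<otimes>\<^bsub>ST \<times>\<times> (K11 Mod wpK)\<^esub> y = y \<otimes>\<^bsub>ST \<times>\<times> (K11 Mod wpK)\<^esub> x"
  using comm_monoid.m_comm[OF comm_group.axioms(1)[OF comm_group_ST]] comm_monoid.m_comm[OF comm_group.axioms(1)[OF cQK]]
  by (auto simp: mult_DirProd' mem_Times_iff simp del: mult_sum_group mult_FactGroup)
qed

section \<open>Phi on the polar parts\<close>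

lemma cwt_lift_group_hom: "group_hom (sum_group UNIV Wk) CT
  (%y. finprod CT (%m. cwt_inj p UNIV m (y m)) {m : UNIV. y m ~= \<one>\<^bsub>Wk m\<^esub>})"
 by (rule sum_group_lift_hom[OF cCT gk cwt_inj_hom[OF p ch]])

lemma polar_phi_apply:
 "n : J ==> polar_phi p x n = finprod CT (%m. cwt_inj p UNIV m (x (n * p ^ m))) {m : UNIV. x (n * p ^ m) ~= \<one>\<^bsub>Wk m\<^esub>}"
 by (simp add: polar_phi_def)

lemma polar_phi_one:
 assumes "n : J" "\<And>m. x (n * p ^ m) = \<one>\<^bsub>Wk m\<^esub>"
 shows "polar_phi p x n = \<one>\<^bsub>CT\<^esub>"
proof -
 have "{m : UNIV. x (n * p ^ m) ~= \<one>\<^bsub>Wk m\<^esub>} = {}" using assms(2) by blast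
 then show ?thesis unfolding polar_phi_apply[OF assms(1)] by (simp only: comm_monoid.finprod_empty[OF comm_group.axioms(1)[OF cCT]])
qed

text \<open>For n prime to p the degrees n p^m are distinct and have p-adic valuation m, so the
  parts along this ray form an element of the direct sum of all W_m(k).\<close>

lemma ray_in:
 assumes n: "n : J" and x: "x : carrier SG"
 shows "(%m. x (n * p ^ m)) : carrier (sum_group UNIV Wk)"
proof -
 note nm = coprime_nats_multiplicity[OF p n]
 have "inj_on (%m. n * p ^ m) UNIV" using nm(1) by (auto intro: inj_on_inverseI)
 then have "finite ((%m. n * p ^ m) -` {d : {0<..}. x d ~= \<one>\<^bsub>Wk (v d)\<^esub>})"
  by (rule finite_vimageI[OF sum_group_carrierD(2)[OF gk x]])
 moreover have "(%m. n * p ^ m) -` {d : {0<..}. x d ~= \<one>\<^bsub>Wk (v d)\<^esub>} = {m. x (n * p ^ m) ~= \<one>\<^bsub>Wk m\<^esub>}"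
  using nm by auto
 moreover have "x (n * p ^ m) : carrier (Wk m)" for m
  using sum_group_carrierD(1)[OF gk x, of "n * p ^ m"] nm by simp
 ultimately show ?thesis by (subst carrier_sum_group[OF gk]) auto
qed

lemma polar_phi_mult:
 assumes n: "n : J" and x: "x : carrier SG" and y: "y : carrier SG"
 shows "polar_phi p (x \<otimes>\<^bsub>SG\<^esub> y) n = polar_phi p x n \<otimes>\<^bsub>CT\<^esub> polar_phi p y n"
proof -
 note nm = coprime_nats_multiplicity[OF p n]
 have e: "(x \<otimes>\<^bsub>SG\<^esub> y) (n * p ^ m) = ((%m. x (n * p ^ m)) \<otimes>\<^bsub>sum_group UNIV Wk\<^esub> (%m. y (n * p ^ m))) m" for m
  using nm by simp
 show ?thesis
  unfolding polar_phi_apply[OF n] e by (rule group_hom.hom_mult[OF cwt_lift_group_hom ray_in[OF n x] ray_in[OF n y]])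
qed

text \<open>A nontrivial component at n needs a nontrivial part in some degree n p^m, and n is
  recovered from that degree by removing the power of p; so only finitely many n occur.\<close>

lemma polar_phi_closed:
 assumes x: "x : carrier SG"
 shows "polar_phi p x : carrier ST"
proof -
 have "polar_phi p x n : carrier CT" if "n : J" for n
  unfolding polar_phi_apply[OF that] by (rule group_hom.hom_closed[OF cwt_lift_group_hom ray_in[OF that x]])
 moreover have "finite {n : J. polar_phi p x n ~= \<one>\<^bsub>CT\<^esub>}"
 proof (rule finite_subset)
  show "{n : J. polar_phi p x n ~= \<one>\<^bsub>CT\<^esub>} <= (%d. d div p ^ v d) ` {d : {0<..}. x d ~= \<one>\<^bsub>Wk (v d)\<^esub>}"
  proof
   fix n assume n: "n : {n : J. polar_phi p x n ~= \<one>\<^bsub>CT\<^esub>}"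
   then have nJ: "n : J" by blast
   obtain m where "x (n * p ^ m) ~= \<one>\<^bsub>Wk m\<^esub>" using polar_phi_one[OF nJ, of x] n by blast
   then have m: "n * p ^ m : {d : {0<..}. x d ~= \<one>\<^bsub>Wk (v d)\<^esub>}"
    using coprime_nats_multiplicity[OF p nJ] by simp
   have "n = (%d. d div p ^ v d) (n * p ^ m)" using coprime_nats_multiplicity(1)[OF p nJ] p0_11 by simp
   then show "n : (%d. d div p ^ v d) ` {d : {0<..}. x d ~= \<one>\<^bsub>Wk (v d)\<^esub>}" by (rule image_eqI) (rule m)
  qed
  show "finite ((%d. d div p ^ v d) ` {d : {0<..}. x d ~= \<one>\<^bsub>Wk (v d)\<^esub>})"
   by (rule finite_imageI[OF sum_group_carrierD(2)[OF gk x]])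
 qed
 ultimately show ?thesis by (subst carrier_sum_group[OF gCT]) (auto simp: polar_phi_def)
qed

lemma polar_phi_single:
 assumes n: "n : J" and a: "a : carrier (Wk m)" and xa: "\<And>i. x (n * p ^ i) = single_fun UNIV Wk m a i"
 shows "polar_phi p x n = cwt_inj p UNIV m a"
 unfolding polar_phi_apply[OF n] xa
 by (rule single_fun_lift[where ph="cwt_inj p UNIV" and G=Wk and I=UNIV and i=m, OF cCT UNIV_I cwt_one[OF p ch, symmetric]
    cwt_inj_closed[OF p ch a]])

text \<open>Injectivity of \<open>laurent_sum\<close> resolves the \<open>inv_into\<close> in
  \<open>asw_phi\<close>; from here on Phi is computed from any decomposition at hand.\<close>

lemma asw_phi_eq:
 assumes "(x, f0, f1) : carrier PG"
 shows "asw_phi p (laurent_sum p (x, f0, f1)) = (polar_phi p x, wpK #>\<^bsub>K11\<^esub> f0)"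
 unfolding asw_phi_def laurent_parts_eq inv_into_f_f[OF laurent_sum_inj assms] prod.case polar_phi_def ..

lemma laurent_cases:
 assumes "f : carrier E"
 obtains x f0 f1 where "(x, f0, f1) : carrier PG" "f = laurent_sum p (x, f0, f1)"
  "x : carrier SG" "f0 : carrier K11" "f1 : carrier (cw p M)"
proof -
 have "f : laurent_sum p ` carrier PG" using assms laurent_sum_bij unfolding bij_betw_def by blast
 then obtain a where a: "a : carrier PG" "f = laurent_sum p a" by blast
 obtain x f0 f1 where e: "a = (x, f0, f1)" by (rule prod_cases3)
 show thesis using that[of x f0 f1] a unfolding e DirProd_def by simp
qed

lemma asw_phi_group_hom: "group_hom E T (asw_phi p)"
proof -
 have "asw_phi p : hom E T"
 proof (rule homI)
  fix f assume "f : carrier E"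
  then obtain x f0 f1 where f: "(x, f0, f1) : carrier PG" "f = laurent_sum p (x, f0, f1)"
   "x : carrier SG" "f0 : carrier K11" "f1 : carrier (cw p M)" by (rule laurent_cases)
  have q: "wpK #>\<^bsub>K11\<^esub> f0 : carrier (K11 Mod wpK)" using f(4) by (auto simp: carrier_FactGroup)
  show "asw_phi p f : carrier T" unfolding f(2) asw_phi_eq[OF f(1)] asw_target_def
   using polar_phi_closed[OF f(3)] q by simp
  fix g assume "g : carrier E"
  then obtain y g0 g1 where g: "(y, g0, g1) : carrier PG" "g = laurent_sum p (y, g0, g1)"
   "y : carrier SG" "g0 : carrier K11" "g1 : carrier (cw p M)" by (rule laurent_cases)
  have m: "(x, f0, f1) \<otimes>\<^bsub>PG\<^esub> (y, g0, g1) = (x \<otimes>\<^bsub>SG\<^esub> y, f0 \<otimes>\<^bsub>K11\<^esub> g0, f1 \<otimes>\<^bsub>cw p M\<^esub> g1)" by (simp only: mult_DirProd)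
  have c: "(x \<otimes>\<^bsub>SG\<^esub> y, f0 \<otimes>\<^bsub>K11\<^esub> g0, f1 \<otimes>\<^bsub>cw p M\<^esub> g1) : carrier PG"
   unfolding m[symmetric] by (rule monoid.m_closed[OF group.is_monoid[OF group_PG] f(1) g(1)])
  have fg: "f \<otimes>\<^bsub>E\<^esub> g = laurent_sum p (x \<otimes>\<^bsub>SG\<^esub> y, f0 \<otimes>\<^bsub>K11\<^esub> g0, f1 \<otimes>\<^bsub>cw p M\<^esub> g1)"
   unfolding f(2) g(2) m[symmetric] by (rule group_hom.hom_mult[OF laurent_sum_group_hom f(1) g(1), symmetric])
  have "polar_phi p (x \<otimes>\<^bsub>SG\<^esub> y) = (\<lambda>n\<in>J. polar_phi p x n \<otimes>\<^bsub>CT\<^esub> polar_phi p y n)"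
  proof (rule extensionalityI[of _ J])
   show "polar_phi p (x \<otimes>\<^bsub>SG\<^esub> y) : extensional J" by (simp add: polar_phi_def)
  qed (use polar_phi_mult[OF _ f(3) g(3)] in "simp_all del: mult_sum_group")
  then have 1: "polar_phi p (x \<otimes>\<^bsub>SG\<^esub> y) = polar_phi p x \<otimes>\<^bsub>ST\<^esub> polar_phi p y" by (simp only: mult_sum_group)
  have 2: "wpK #>\<^bsub>K11\<^esub> (f0 \<otimes>\<^bsub>K11\<^esub> g0) = (wpK #>\<^bsub>K11\<^esub> f0) \<otimes>\<^bsub>K11 Mod wpK\<^esub> (wpK #>\<^bsub>K11\<^esub> g0)"
   using normal.rcos_sum[OF nK f(4) g(4)] by (simp add: FactGroup_def)
  have 3: "asw_phi p (f \<otimes>\<^bsub>E\<^esub> g) = (polar_phi p x \<otimes>\<^bsub>ST\<^esub> polar_phi p y, (wpK #>\<^bsub>K11\<^esub> f0) \<otimes>\<^bsub>K11 Mod wpK\<^esub> (wpK #>\<^bsub>K11\<^esub> g0))"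
   unfolding fg asw_phi_eq[OF c] 1 2 ..
  have 4: "asw_phi p f = (polar_phi p x, wpK #>\<^bsub>K11\<^esub> f0)" unfolding f(2) by (rule asw_phi_eq[OF f(1)])
  have 5: "asw_phi p g = (polar_phi p y, wpK #>\<^bsub>K11\<^esub> g0)" unfolding g(2) by (rule asw_phi_eq[OF g(1)])
  show "asw_phi p (f \<otimes>\<^bsub>E\<^esub> g) = asw_phi p f \<otimes>\<^bsub>T\<^esub> asw_phi p g"
   unfolding 3 4 5 asw_target_def mult_DirProd ..
 qed
 then show ?thesis using gE comm_group_group[OF comm_group_asw_target] by (simp add: group_hom_def group_hom_axioms_def)
qed

lemma SG_one_apply: "n : J ==> \<one>\<^bsub>SG\<^esub> (n * p ^ m) = \<one>\<^bsub>Wk m\<^esub>"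
 using coprime_nats_multiplicity[OF p] by simp

lemma polar_phi_SG_one: "polar_phi p \<one>\<^bsub>SG\<^esub> = \<one>\<^bsub>ST\<^esub>"
proof (rule extensionalityI[of _ J])
 show "polar_phi p \<one>\<^bsub>SG\<^esub> n = \<one>\<^bsub>ST\<^esub> n" if "n : J" for n
  unfolding polar_phi_one[OF that SG_one_apply[OF that]] using that by simp
qed (simp_all add: polar_phi_def)

lemma asw_phi_const:
 "f : carrier K11 ==> asw_phi p (cw_map p UNIV fls_const f) = (\<one>\<^bsub>ST\<^esub>, wpK #>\<^bsub>K11\<^esub> f)"
 unfolding laurent_sum_const(1)[symmetric] asw_phi_eq[OF laurent_sum_const(2)] polar_phi_SG_one ..

lemma asw_target_one: "\<one>\<^bsub>T\<^esub> = (\<one>\<^bsub>ST\<^esub>, wpK)"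
 unfolding asw_target_def DirProd_def FactGroup_def by simp

lemma wpK_coset_one: "wpK #>\<^bsub>K11\<^esub> \<one>\<^bsub>K11\<^esub> = wpK"
 by (rule group.coset_mult_one[OF comm_group_group[OF cK]]) (rule subgroup.subset[OF subgroup_cw_wp[OF p subrng_UNIV ch]])

lemma asw_phi_fps:
 "f : carrier (cw p M) ==> asw_phi p (cw_map p UNIV fps_to_fls f) = \<one>\<^bsub>T\<^esub>"
 unfolding laurent_sum_fps(1)[symmetric] asw_phi_eq[OF laurent_sum_fps(2)] polar_phi_SG_one asw_target_one
  wpK_coset_one ..

lemma asw_phi_comonomial:
 assumes n: "n : J" and a: "a : carrier (Wk m)"
 shows "asw_phi p (comonomial p (n * p ^ m) a) = (single_fun J (%_. CT) n (cwt_inj p UNIV m a), wpK)"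
proof -
 note nm = coprime_nats_multiplicity[OF p n]
 have a': "a : carrier (Wk (v (n * p ^ m)))" unfolding nm by (rule a)
 define s where "s = single_fun {0<..} (%d. Wk (v d)) (n * p ^ m) a"
 have sn: "s (n' * p ^ i) = (if n' = n then single_fun UNIV Wk m a i else \<one>\<^bsub>Wk i\<^esub>)" if n': "n' : J" for n' i
  using coprime_nats_multiplicity[OF p n'] coprime_nats_power_inj[OF p n' n, of i m] by (auto simp: s_def single_fun_def)
 have "polar_phi p s = single_fun J (%_. CT) n (cwt_inj p UNIV m a)"
 proof (rule extensionalityI[of _ J])
  fix n' assume n': "n' : J"
  show "polar_phi p s n' = single_fun J (%_. CT) n (cwt_inj p UNIV m a) n'"
  proof (cases "n' = n")
   case True
   have "polar_phi p s n = cwt_inj p UNIV m a" by (rule polar_phi_single[OF n a]) (simp add: sn[OF n])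
   then show ?thesis unfolding True using n by (simp add: single_fun_def)
  next
   case False
   then have "polar_phi p s n' = \<one>\<^bsub>CT\<^esub>" by (intro polar_phi_one[OF n']) (simp add: sn[OF n'])
   then show ?thesis using n' False by (simp add: single_fun_def)
  qed
 qed (simp_all add: polar_phi_def single_fun_def)
 then show ?thesis
  unfolding laurent_sum_single(1)[OF nm(2) a', symmetric]
   asw_phi_eq[OF laurent_sum_single(2)[OF nm(2) a']] wpK_coset_one s_def by (simp only:)
qed

section \<open>Frobenius and the kernel of Phi\<close>

text \<open>Reduces the comparison of two homomorphisms on polar parts to single co-monomials; the
  uses are the invariance of Phi under Frobenius and the map back from the target of Phi.\<close>

lemma laurent_hom_cong:
 assumes A: "comm_group A" and h: "group_hom E A h" "group_hom E A h'"
  and eq: "\<And>d x. d > 0 ==> x : carrier (Wk (v d)) ==> h (comonomial p d x) = h' (comonomial p d x)"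
  and x: "x : carrier SG"
 shows "h (finprod E (%d. comonomial p d (x d)) {d : {0<..}. x d ~= \<one>\<^bsub>Wk (v d)\<^esub>})
  = h' (finprod E (%d. comonomial p d (x d)) {d : {0<..}. x d ~= \<one>\<^bsub>Wk (v d)\<^esub>})"
proof -
 let ?D = "{d : {0<..}. x d ~= \<one>\<^bsub>Wk (v d)\<^esub>}"
 have xd: "x d : carrier (Wk (v d))" if "d : ?D" for d using sum_group_carrierD(1)[OF gk x] that by blast
 have c: "comonomial p d (x d) : carrier E" if "d : ?D" for d
  using comonomial_hom[of d] xd[OF that] that by (auto simp: hom_def)
 have "finprod A (%d. h (comonomial p d (x d))) ?D = finprod A (%d. h' (comonomial p d (x d))) ?D"
 proof (rule comm_monoid.finprod_cong'[OF comm_group.axioms(1)[OF A] refl])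
  show "h (comonomial p d (x d)) = h' (comonomial p d (x d))" if "d : ?D" for d using eq[OF _ xd[OF that]] that by blast
  show "(%d. h' (comonomial p d (x d))) : ?D \<rightarrow> carrier A" using group_hom.hom_closed[OF h(2) c] by blast
 qed
 moreover have "h (finprod E (%d. comonomial p d (x d)) ?D) = finprod A (%d. h (comonomial p d (x d))) ?D"
  by (rule hom_finprod[OF cE A group_hom.homh[OF h(1)]]) (rule c)
 moreover have "h' (finprod E (%d. comonomial p d (x d)) ?D) = finprod A (%d. h' (comonomial p d (x d))) ?D"
  by (rule hom_finprod[OF cE A group_hom.homh[OF h(2)]]) (rule c)
 ultimately show ?thesis by (simp only:)
qed

text \<open>Taking p-th powers multiplies the exponents by p and keeps the length, whereas degree d
  p asks for one more entry; the missing one is a leading zero, which the limit ignores.\<close>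

lemma frob_comonomial:
 assumes d: "d > 0" and x: "x : carrier (Wk (v d))"
 shows "FE (comonomial p d x) = comonomial p (d * p) (0 # witt_frob p x)"
proof -
 have vd: "v (d * p) = Suc (v d)" using multiplicity_times_power[OF p d, of 1] by simp
 have l: "lvec p d (v d) x : carrier (witt p UNIV (v d))" "lvec p (d * p) (v d) (witt_frob p x) : carrier (witt p UNIV (v d))"
  by (simp_all add: witt_carrier_iff)
 have dp: "d * p > 0" using d p0_11 by simp
 have "map (%x. x ^ p) (lvec p d (v d) x) = lvec p (d * p) (v d) (witt_frob p x)"
 proof (rule nth_equalityI)
  fix i assume "i < length (map (%x. x ^ p) (lvec p d (v d) x))"
  then have i: "i \<le> v d" "i < length x" using x by (simp_all add: witt_carrier_iff)
  have "p ^ (v d - i) dvd d" by (rule multiplicity_dvd') simp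
  then have "p * (d div p ^ (v d - i)) = d * p div p ^ (v d - i)" by (simp add: div_mult_swap mult.commute)
  then show "map (%x. x ^ p) (lvec p d (v d) x) ! i = lvec p (d * p) (v d) (witt_frob p x) ! i"
   using i by (simp add: lvec_nth fmono_power witt_frob_def)
 qed simp
 then show ?thesis
  unfolding comonomial_lvec[OF d] comonomial_lvec[OF dp] vd lvec_Cons
   cw_inj_Suc[OF p subrng_UNIV l(2)] frob_inj[OF p subrng_UNIV chE l(1)] by simp
qed

lemma frob_witt: "x : carrier (Wk m) ==> witt_frob p x : carrier (Wk m)" "x : carrier (Wk m) ==> 0 # witt_frob p x : carrier (Wk (Suc m))"
 by (simp_all add: witt_carrier_iff witt_frob_def)

lemma frob_coset:
 assumes "f : carrier (cw p (UNIV :: 'b::field set))" "CHAR('b) = p"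
 shows "cw_wp p UNIV #>\<^bsub>cw p UNIV\<^esub> cw_map p UNIV (%x. x ^ p) f = cw_wp p UNIV #>\<^bsub>cw p UNIV\<^esub> f"
proof -
 interpret C: comm_group "cw p (UNIV :: 'b set)" by (rule comm_group_cw[OF p subrng_UNIV])
 have F: "cw_map p UNIV (%x. x ^ p) f : carrier (cw p UNIV)"
  by (rule group_hom.hom_closed[OF frob_group_hom[OF p subrng_UNIV assms(2)] assms(1)])
 have "cw_map p UNIV (%x. x ^ p) f : cw_wp p UNIV #>\<^bsub>cw p UNIV\<^esub> f"
  using assms(1) F unfolding r_coset_def cw_wp_def
  by (intro UN_I[OF imageI[OF assms(1)]]) (simp add: C.m_assoc)
 then show ?thesis by (rule C.repr_independence[OF _ assms(1) subgroup_cw_wp[OF p subrng_UNIV assms(2)], symmetric])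
qed

private lemma gQE: "group (E Mod wpE)" by (rule comm_group_group[OF cQE])

lemma cw_wp_max_ideal: "cw_wp p M = carrier (cw p M)"
proof (rule cw_wp_surj[OF p subrng_max_ideal])
 show "CHAR('k fps) = p" by (simp add: CHAR_fps ch)
 fix c assume "c : M"
 then show "\<exists>x\<in>M. x ^ p - x = c" using fps_artin_schreier[OF p, of c] CHAR_fps[where ?'k='k] ch by auto
qed

lemma frob_map:
 assumes R: "subrng R" "rng_hom_on R (h :: 'b::field fps => 'k fls)" and f: "f : carrier (cw p R)" and c: "CHAR('b fps) = p"
 shows "FE (cw_map p UNIV h f) = cw_map p UNIV h (cw_map p R (%x. x ^ p) f)"
proof -
 have r: "rng_hom_on UNIV (\<lambda>x::'k fls. x ^ p)" by (rule rng_hom_frob[OF p chE])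
 show ?thesis
  unfolding cw_map_comp[OF p R subset_UNIV subrng_UNIV r subset_UNIV subrng_UNIV f]
   cw_map_comp[OF p R(1) rng_hom_frob[OF p c] frob_closed[OF p R(1) c] R subset_UNIV subrng_UNIV f]
  by (rule cw_map_cong[OF p R(1) f]) (rule rng_hom_on_power(2)[OF R _ p0_11, symmetric])
qed

lemma frob_map_const:
 assumes f: "f : carrier K11"
 shows "FE (cw_map p UNIV fls_const f) = cw_map p UNIV fls_const (cw_map p UNIV (%x. x ^ p) f)"
proof -
 have r: "rng_hom_on UNIV (\<lambda>x::'k fls. x ^ p)" by (rule rng_hom_frob[OF p chE])
 show ?thesis
  unfolding cw_map_comp[OF p subrng_UNIV rng_hom_const subset_UNIV subrng_UNIV r subset_UNIV subrng_UNIV f]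
   cw_map_comp[OF p subrng_UNIV rng_hom_frob[OF p ch] subset_UNIV subrng_UNIV rng_hom_const subset_UNIV subrng_UNIV f]
  by (rule cw_map_cong[OF p subrng_UNIV f]) (simp add: fls_const_power)
qed

lemma comonomial_frob_J:
 assumes "n : J" "a : carrier (Wk m)"
 shows "FE (comonomial p (n * p ^ m) a) = comonomial p (n * p ^ Suc m) (0 # witt_frob p a)"
  "comonomial p (n * p ^ m) a : carrier E"
proof -
 note nm = coprime_nats_multiplicity[OF p assms(1), of m]
 have a: "a : carrier (Wk (v (n * p ^ m)))" unfolding nm by (rule assms(2))
 show "FE (comonomial p (n * p ^ m) a) = comonomial p (n * p ^ Suc m) (0 # witt_frob p a)"
  unfolding frob_comonomial[OF nm(2) a] power_Suc2 mult.assoc ..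
 show "comonomial p (n * p ^ m) a : carrier E" using comonomial_hom[OF nm(2)] a by (auto simp: hom_def)
qed

text \<open>Checked on the three kinds of parts: for co-monomials it is the transition relation of
  the limit along V F, for constants it is equality of classes modulo F - 1, and on t k[[t]] both
  sides are trivial.\<close>

lemma asw_phi_frob:
 assumes f: "f : carrier E"
 shows "asw_phi p (FE f) = asw_phi p f"
proof -
 interpret F: group_hom E E FE by (rule frob_group_hom[OF p subrng_UNIV chE])
 interpret A: group_hom E T "asw_phi p" by (rule asw_phi_group_hom)
 obtain x f0 f1 where x: "(x, f0, f1) : carrier PG" "f = laurent_sum p (x, f0, f1)"
  "x : carrier SG" "f0 : carrier K11" "f1 : carrier (cw p M)" using f by (rule laurent_cases)
 have h: "group_hom E T (%f. asw_phi p (FE f))"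
  unfolding group_hom_def group_hom_axioms_def using gE A.H.is_group by (auto simp: hom_def)
 let ?P = "finprod E (%d. comonomial p d (x d)) {d : {0<..}. x d ~= \<one>\<^bsub>Wk (v d)\<^esub>}"
 have P: "asw_phi p (FE ?P) = asw_phi p ?P"
 proof (rule laurent_hom_cong[OF comm_group_asw_target h asw_phi_group_hom _ x(3)])
  fix d and a :: "'k list" assume d: "d > 0" and a: "a : carrier (Wk (v d))"
  obtain n where n: "n : J" "d = n * p ^ v d" by (rule coprime_nats_decomp[OF p d])
  have "asw_phi p (FE (comonomial p (n * p ^ v d) a)) = asw_phi p (comonomial p (n * p ^ v d) a)"
   unfolding comonomial_frob_J(1)[OF n(1) a] asw_phi_comonomial[OF n(1) frob_witt(2)[OF a]]
    asw_phi_comonomial[OF n(1) a] cwt_inj_Suc[OF p ch a] ..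
  then show "asw_phi p (FE (comonomial p d a)) = asw_phi p (comonomial p d a)" unfolding n(2)[symmetric] .
 qed
 have C: "asw_phi p (FE (cw_map p UNIV fls_const f0)) = asw_phi p (cw_map p UNIV fls_const f0)"
  unfolding frob_map_const[OF x(4)] asw_phi_const[OF x(4)]
   asw_phi_const[OF group_hom.hom_closed[OF frob_group_hom[OF p subrng_UNIV ch] x(4)]] frob_coset[OF x(4) ch] ..
 have chF: "CHAR('k fps) = p" by (simp add: CHAR_fps ch)
 have S: "asw_phi p (FE (cw_map p UNIV fps_to_fls f1)) = asw_phi p (cw_map p UNIV fps_to_fls f1)"
  unfolding frob_map[OF subrng_max_ideal rng_hom_fps x(5) chF] asw_phi_fps[OF x(5)]
  by (rule asw_phi_fps[OF group_hom.hom_closed[OF frob_group_hom[OF p subrng_max_ideal chF] x(5)]])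
 have c: "?P : carrier E" "cw_map p UNIV fls_const f0 : carrier E" "cw_map p UNIV fps_to_fls f1 : carrier E"
  using group_hom.hom_closed[OF polar_group_hom x(3)] group_hom.hom_closed[OF const_group_hom x(4)]
   group_hom.hom_closed[OF fps_group_hom[OF subrng_max_ideal] x(5)] by blast+
 show ?thesis unfolding x(2) laurent_sum_apply using c P C S by simp
qed

text \<open>Injectivity on polar parts. The classes of co-monomials modulo F - 1 are compatible
  along V F, so they define a map \<open>U\<close> from the direct sum of the limits back to
  CW(k((t))) modulo F - 1. On co-monomials \<open>U\<close> after the first component of Phi is the
  class map, hence also on their sums.\<close>

lemma asw_phi_polar_trivial:
 assumes x: "x : carrier SG" and 1: "polar_phi p x = \<one>\<^bsub>ST\<^esub>"
 shows "finprod E (%d. comonomial p d (x d)) {d : {0<..}. x d ~= \<one>\<^bsub>Wk (v d)\<^esub>} : wpE"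
proof -
 have com: "wpE #>\<^bsub>E\<^esub> comonomial p (n * p ^ Suc m) (0 # witt_frob p a) = wpE #>\<^bsub>E\<^esub> comonomial p (n * p ^ m) a"
  if "n : J" "a : carrier (Wk m)" for n m a
  unfolding comonomial_frob_J(1)[OF that, symmetric] by (rule frob_coset[OF comonomial_frob_J(2)[OF that] chE])
 have ch1: "(%a. wpE #>\<^bsub>E\<^esub> comonomial p (n * p ^ m) a) : hom (Wk m) (E Mod wpE)" if n: "n : J" for n m
  using hom_compose[OF comonomial_hom[OF coprime_nats_multiplicity(2)[OF p n, of m]] normal.r_coset_hom_Mod[OF nE]]
  unfolding coprime_nats_multiplicity(1)[OF p n] comp_def .
 have "\<forall>n\<in>J. \<exists>kp. kp : hom CT (E Mod wpE) \<and> (\<forall>m. \<forall>a\<in>carrier (Wk m). kp (cwt_inj p UNIV m a) = wpE #>\<^bsub>E\<^esub> comonomial p (n * p ^ m) a)"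
 proof
  fix n assume n: "n : J"
  show "\<exists>kp. kp : hom CT (E Mod wpE) \<and> (\<forall>m. \<forall>a\<in>carrier (Wk m). kp (cwt_inj p UNIV m a) = wpE #>\<^bsub>E\<^esub> comonomial p (n * p ^ m) a)"
   using inj_dirsys.lim_lift[OF dirsys_VF[OF p ch] gQE ch1[OF n] com[OF n], folded cwt_def cwt_inj_def] by blast
 qed
 from bchoice[OF this] obtain kp where kp: "\<And>n. n : J ==> kp n : hom CT (E Mod wpE)"
  "\<And>n m a. n : J ==> a : carrier (Wk m) ==> kp n (cwt_inj p UNIV m a) = wpE #>\<^bsub>E\<^esub> comonomial p (n * p ^ m) a" by blast
 define U where "U = (%y. finprod (E Mod wpE) (%n. kp n (y n)) {n : J. y n ~= \<one>\<^bsub>CT\<^esub>})"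
 have U: "group_hom ST (E Mod wpE) U" unfolding U_def by (rule sum_group_lift_hom[OF cQE gCT kp(1)])
 have fst: "fst : hom T ST" unfolding asw_target_def by (auto simp: hom_def mult_DirProd' simp del: mult_sum_group)
 have h: "group_hom E (E Mod wpE) (%f. U (fst (asw_phi p f)))"
  using hom_compose[OF hom_compose[OF group_hom.homh[OF asw_phi_group_hom] fst] group_hom.homh[OF U]]
  unfolding group_hom_def group_hom_axioms_def comp_def using gE gQE by blast
 have h': "group_hom E (E Mod wpE) (%f. wpE #>\<^bsub>E\<^esub> f)"
  unfolding group_hom_def group_hom_axioms_def using gE gQE normal.r_coset_hom_Mod[OF nE] by blast
 let ?P = "finprod E (%d. comonomial p d (x d)) {d : {0<..}. x d ~= \<one>\<^bsub>Wk (v d)\<^esub>}"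
 have eq: "U (fst (asw_phi p ?P)) = wpE #>\<^bsub>E\<^esub> ?P"
 proof (rule laurent_hom_cong[OF cQE h h' _ x])
  fix d and a :: "'k list" assume d: "d > 0" and a: "a : carrier (Wk (v d))"
  obtain n where n: "n : J" "d = n * p ^ v d" by (rule coprime_nats_decomp[OF p d])
  have k: "kp n (cwt_inj p UNIV (v d) a) : carrier (E Mod wpE)"
   using kp(1)[OF n(1)] cwt_inj_closed[OF p ch a] by (auto simp: hom_def)
  have "U (fst (asw_phi p (comonomial p (n * p ^ v d) a))) = wpE #>\<^bsub>E\<^esub> comonomial p (n * p ^ v d) a"
   unfolding asw_phi_comonomial[OF n(1) a] fst_conv U_def kp(2)[OF n(1) a, symmetric]
   by (rule single_fun_lift[where ph=kp and G="%_. CT", OF cQE n(1) hom_one[OF kp(1)[OF n(1)] gCT gQE] k])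
  then show "U (fst (asw_phi p (comonomial p d a))) = wpE #>\<^bsub>E\<^esub> comonomial p d a" unfolding n(2)[symmetric] .
 qed
 have Pc: "?P : carrier E" by (rule group_hom.hom_closed[OF polar_group_hom x])
 have o: "\<one>\<^bsub>K11\<^esub> : carrier K11" "\<one>\<^bsub>cw p M\<^esub> : carrier (cw p M)"
  using ones_closed by blast+
 have xo: "(x, \<one>\<^bsub>K11\<^esub>, \<one>\<^bsub>cw p M\<^esub>) : carrier PG" using x o unfolding DirProd_def by simp
 have "laurent_sum p (x, \<one>\<^bsub>K11\<^esub>, \<one>\<^bsub>cw p M\<^esub>) = ?P"
  unfolding laurent_sum_apply group_hom.hom_one[OF const_group_hom]
   group_hom.hom_one[OF fps_group_hom[OF subrng_max_ideal]]
  using Pc group.is_monoid[OF gE] by (simp add: monoid.r_one)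
 then have "fst (asw_phi p ?P) = \<one>\<^bsub>ST\<^esub>" using asw_phi_eq[OF xo] 1 by (simp only: fst_conv)
 then have "wpE #>\<^bsub>E\<^esub> ?P = wpE"
  unfolding eq[symmetric] using group_hom.hom_one[OF U] by (simp add: FactGroup_def)
 then show ?thesis using group.rcos_self[OF gE Pc subgroup_cw_wp[OF p subrng_UNIV chE]] by simp
qed

text \<open>The three parts of a kernel element lie in the image of F - 1 for separate reasons:
  \<open>asw_phi_polar_trivial\<close>, the second component of Phi, and solvability on t
  k[[t]].\<close>

lemma asw_phi_kernel: "kernel E T (asw_phi p) = wpE"
proof
 interpret A: group_hom E T "asw_phi p" by (rule asw_phi_group_hom)
 interpret F: group_hom E E FE by (rule frob_group_hom[OF p subrng_UNIV chE])
 show "wpE <= kernel E T (asw_phi p)"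
  unfolding cw_wp_def kernel_def by (auto simp: asw_phi_frob)
 show "kernel E T (asw_phi p) <= wpE"
 proof
  fix f assume "f : kernel E T (asw_phi p)"
  then have f: "f : carrier E" "asw_phi p f = \<one>\<^bsub>T\<^esub>" by (auto simp: kernel_def)
  obtain x f0 f1 where x: "(x, f0, f1) : carrier PG" "f = laurent_sum p (x, f0, f1)"
   "x : carrier SG" "f0 : carrier K11" "f1 : carrier (cw p M)" using f(1) by (rule laurent_cases)
  have "polar_phi p x = \<one>\<^bsub>ST\<^esub> \<and> wpK #>\<^bsub>K11\<^esub> f0 = wpK"
   using f(2) unfolding x(2) asw_phi_eq[OF x(1)] asw_target_one by (simp only: prod.inject)
  then have 1: "polar_phi p x = \<one>\<^bsub>ST\<^esub>" and 0: "f0 : wpK"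
   using group.rcos_self[OF comm_group_group[OF cK] x(4) subgroup_cw_wp[OF p subrng_UNIV ch]] by simp_all
  have chF: "CHAR('k fps) = p" by (simp add: CHAR_fps ch)
  have f1: "f1 : cw_wp p M" unfolding cw_wp_max_ideal by (rule x(5))
  show "f : wpE"
   unfolding x(2) laurent_sum_apply
   by (intro subgroup.m_closed[OF subgroup_cw_wp[OF p subrng_UNIV chE]] asw_phi_polar_trivial[OF x(3) 1]
     cw_map_cw_wp[OF p subrng_UNIV rng_hom_const subset_UNIV subrng_UNIV ch chE 0]
     cw_map_cw_wp[OF p subrng_max_ideal rng_hom_fps subset_UNIV subrng_UNIV chF chE f1])
 qed
qed

section \<open>Phi and Kato's filtration\<close>

lemma subgroup_cwt_fil: "subgroup (cwt_fil p UNIV m) CT"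
 unfolding cwt_fil_def by (rule group_hom.img_is_subgroup[OF cwt_inj_group_hom[OF p ch]])

lemma cwt_fil_mono: "m \<le> N ==> cwt_fil p (UNIV :: 'k set) m <= cwt_fil p UNIV N"
proof (induction N rule: dec_induct)
 case (step N)
 have "cwt_fil p (UNIV :: 'k set) N <= cwt_fil p UNIV (Suc N)"
  unfolding cwt_fil_def
 proof (rule image_subsetI)
  fix a assume a: "a : carrier (Wk N)"
  show "cwt_inj p UNIV N a : cwt_inj p UNIV (Suc N) ` carrier (Wk (Suc N))"
   using imageI[OF frob_witt(2)[OF a], of "cwt_inj p UNIV (Suc N)"] unfolding cwt_inj_Suc[OF p ch a] .
 qed
 then show ?case using step by blast
qed simp

text \<open>For fixed n the parts of degree n p^m at most d all land in the step given by the
  largest such m, because the steps increase with m. Conversely, co-monomials of that single largest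
  degree already produce the whole step.\<close>

lemma asw_phi_cw_fil: "asw_phi p ` cw_fil p (int d) = (asw_target_fil p d :: ((nat => 'k covec) \<times> 'k covec set) set)"
proof
 show "asw_phi p ` cw_fil p (int d) <= (asw_target_fil p d :: ((nat => 'k covec) \<times> 'k covec set) set)"
 proof (rule image_subsetI)
  fix f :: "'k fls covec" assume "f : cw_fil p (int d)"
  then obtain x f0 f1 where a: "(x, f0, f1) : laurent_parts_le p d" "f = laurent_sum p (x, f0, f1)"
   unfolding cw_fil_eq by auto
  have aP: "(x, f0, f1) : carrier PG" and x1: "\<And>e. e > d ==> x e = \<one>\<^bsub>Wk (v e)\<^esub>"
   using a(1) unfolding laurent_parts_le_def laurent_parts_eq by auto
  have x: "x : carrier SG" "f0 : carrier K11" using aP unfolding DirProd_def by auto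
  have "if n \<le> d then polar_phi p x n : cwt_fil p UNIV (Max {m. n * p ^ m \<le> d}) else polar_phi p x n = \<one>\<^bsub>CT\<^esub>" if n: "n : J" for n
  proof (cases "n \<le> d")
   case True
   note nm = coprime_nats_multiplicity[OF p n]
   have "n \<ge> 1" using n by (simp add: coprime_nats_def)
   note fin = finite_levels[OF p this, of d]
   have "cwt_inj p UNIV m (x (n * p ^ m)) : cwt_fil p UNIV (Max {m. n * p ^ m \<le> d})" if m: "x (n * p ^ m) ~= \<one>\<^bsub>Wk m\<^esub>" for m
   proof -
    have "\<not> n * p ^ m > d" using x1[of "n * p ^ m"] m nm by auto
    then have "m \<le> Max {m. n * p ^ m \<le> d}" by (intro Max_ge[OF fin]) simp
    moreover have "x (n * p ^ m) : carrier (Wk m)" using sum_group_carrierD(1)[OF gk x(1), of "n * p ^ m"] nm by simp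
    ultimately show ?thesis using cwt_fil_mono unfolding cwt_fil_def by blast
   qed
   then have "polar_phi p x n : cwt_fil p UNIV (Max {m. n * p ^ m \<le> d})"
    unfolding polar_phi_apply[OF n] by (intro subgroup_finprod[OF cCT subgroup_cwt_fil]) blast
   then show ?thesis using True by simp
  next
   case False
   have "x (n * p ^ m) = \<one>\<^bsub>Wk m\<^esub>" for m
   proof -
    have "d < n * 1" using False by simp
    also have "\<dots> \<le> n * p ^ m" using p0_11 by (intro mult_left_mono) auto
    finally show ?thesis using x1 coprime_nats_multiplicity[OF p n] by metis
   qed
   then show ?thesis using False polar_phi_one[OF n] by simp
  qed
  then have "polar_phi p x : {y : carrier ST. \<forall>n\<in>J. if n \<le> d then y n : cwt_fil p UNIV (Max {m. n * p ^ m \<le> d}) else y n = \<one>\<^bsub>CT\<^esub>}"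
   using polar_phi_closed[OF x(1)] by blast
  moreover have "wpK #>\<^bsub>K11\<^esub> f0 : carrier (K11 Mod wpK)" using x(2) by (auto simp: carrier_FactGroup)
  ultimately show "asw_phi p f : asw_target_fil p d"
   unfolding a(2) asw_phi_eq[OF aP] asw_target_fil_def by (rule SigmaI)
 qed
 show "(asw_target_fil p d :: ((nat => 'k covec) \<times> 'k covec set) set) <= asw_phi p ` cw_fil p (int d)"
 proof
  fix z :: "(nat => 'k covec) \<times> 'k covec set" assume "z : asw_target_fil p d"
  then obtain y c where z: "z = (y, c)" "y : carrier ST" "c : carrier (K11 Mod wpK)"
   and y: "\<And>n. n : J ==> if n \<le> d then y n : cwt_fil p UNIV (Max {m. n * p ^ m \<le> d}) else y n = \<one>\<^bsub>CT\<^esub>"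
   unfolding asw_target_fil_def by blast
  obtain f0 where f0: "f0 : carrier K11" "c = wpK #>\<^bsub>K11\<^esub> f0" using z(3) by (auto simp: carrier_FactGroup)
  define N where "N n = Max {m. n * p ^ m \<le> d}" for n
  have N: "n * p ^ N n \<le> d" if "n : J" "n \<le> d" for n
  proof -
   have "n \<ge> 1" using that by (simp add: coprime_nats_def)
   moreover have "0 : {m. n * p ^ m \<le> d}" using that(2) by simp
   ultimately show ?thesis using Max_in[OF finite_levels[OF p]] unfolding N_def by (metis (mono_tags, lifting) empty_iff mem_Collect_eq)
  qed
  have "\<forall>n\<in>{n : J. n \<le> d}. \<exists>a. a : carrier (Wk (N n)) \<and> y n = cwt_inj p UNIV (N n) a"
   using y unfolding N_def cwt_fil_def by fastforce
  from bchoice[OF this] obtain a where a: "\<And>n. n : J ==> n \<le> d ==> a n : carrier (Wk (N n)) \<and> y n = cwt_inj p UNIV (N n) (a n)" by blast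
  \<comment> \<open>Puts the chosen vector in the single degree n p^(N n) of each ray with n at most
    d, and nothing elsewhere.\<close>
  define x where "x = (\<lambda>e\<in>{0<..}. let n = e div p ^ v e in if n \<le> d \<and> v e = N n then a n else \<one>\<^bsub>Wk (v e)\<^esub>)"
  have xn: "x (n * p ^ m) = (if n \<le> d \<and> m = N n then a n else \<one>\<^bsub>Wk m\<^esub>)" if n: "n : J" for n m
  proof -
   note nm = coprime_nats_multiplicity[OF p n, of m]
   have q: "n * p ^ m div p ^ m = n" using p0_11 by simp
   show ?thesis unfolding x_def Let_def restrict_apply greaterThan_iff nm(1) q using nm(2) by simp
  qed
  have xe: "x e : carrier (Wk (v e)) \<and> (e > d \<longrightarrow> x e = \<one>\<^bsub>Wk (v e)\<^esub>)" if e0: "e > 0" for e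
  proof -
   obtain n where n: "n : J" "e = n * p ^ v e" by (rule coprime_nats_decomp[OF p e0])
   have "x e = (if n \<le> d \<and> v e = N n then a n else \<one>\<^bsub>Wk (v e)\<^esub>)" using xn[OF n(1), of "v e"] unfolding n(2)[symmetric] .
   then show ?thesis
    using a[OF n(1)] N[OF n(1)] n(2) monoid.one_closed[OF group.is_monoid[OF gk]] by (cases "n \<le> d \<and> v e = N n") auto
  qed
  have "finite {e : {0<..}. x e ~= \<one>\<^bsub>Wk (v e)\<^esub>}"
   by (rule finite_subset[of _ "{..d}"]) (use xe in "auto simp: not_less[symmetric]")
  then have x: "x : carrier SG" by (subst carrier_sum_group[OF gk]) (use xe in "auto simp: x_def")
  have o: "\<one>\<^bsub>cw p M\<^esub> : carrier (cw p M)" using ones_closed by blast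
  have P: "(x, f0, \<one>\<^bsub>cw p M\<^esub>) : carrier PG" using x f0 o unfolding DirProd_def by simp
  have "polar_phi p x = y"
  proof (rule extensionalityI[of _ J])
   fix n assume n: "n : J"
   show "polar_phi p x n = y n"
   proof (cases "n \<le> d")
    case True
    have "polar_phi p x n = cwt_inj p UNIV (N n) (a n)"
     by (rule polar_phi_single[OF n]) (use a[OF n True] xn[OF n] True in "auto simp: single_fun_def")
    then show ?thesis using a[OF n True] by simp
   next
    case False
    then show ?thesis using polar_phi_one[OF n] xn[OF n] y[OF n] by simp
   qed
  qed (use sum_group_carrierD(3)[OF gCT z(2)] in "simp_all add: polar_phi_def")
  then have "z = asw_phi p (laurent_sum p (x, f0, \<one>\<^bsub>cw p M\<^esub>))"
   unfolding asw_phi_eq[OF P] z(1) f0(2) by (simp only:)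
  moreover have "(x, f0, \<one>\<^bsub>cw p M\<^esub>) : laurent_parts_le p d"
   unfolding laurent_parts_le_def laurent_parts_eq using P xe by simp
  ultimately show "z : asw_phi p ` cw_fil p (int d)" unfolding cw_fil_eq by blast
 qed
qed

text \<open>An element of the target has finitely many nontrivial components, each in some step of
  its limit, so it lies in the image of one sufficiently large step of Kato's filtration.\<close>

lemma asw_phi_surj: "asw_phi p ` carrier E = carrier T"
proof
 show "asw_phi p ` carrier E <= carrier T" using group_hom.hom_closed[OF asw_phi_group_hom] by blast
 show "carrier T <= asw_phi p ` carrier E"
 proof
  fix z assume "z : carrier T"
  then obtain y c where z: "z = (y, c)" "y : carrier ST" "c : carrier (K11 Mod wpK)" unfolding asw_target_def DirProd_def by auto
  have "\<forall>n\<in>J. \<exists>m. y n : cwt_fil p UNIV m"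
  proof
   fix n assume "n : J"
   then obtain m a where "a : carrier (Wk m)" "y n = cwt_inj p UNIV m a"
    using cwt_cases[OF p ch sum_group_carrierD(1)[OF gCT z(2)]] by metis
   then show "\<exists>m. y n : cwt_fil p UNIV m" unfolding cwt_fil_def by blast
  qed
  from bchoice[OF this] obtain l where l: "\<And>n. n : J ==> y n : cwt_fil p UNIV (l n)" by blast
  let ?S = "{n : J. y n ~= \<one>\<^bsub>CT\<^esub>}"
  have fin: "finite ?S" by (rule sum_group_carrierD(2)[OF gCT z(2)])
  \<comment> \<open>Large enough that, for every n in the support, n is at most d and
    \<open>l n\<close> does not exceed the top level belonging to d.\<close>
  define d where "d = (\<Sum>n\<in>?S. n * p ^ l n)"
  have "if n \<le> d then y n : cwt_fil p UNIV (Max {m. n * p ^ m \<le> d}) else y n = \<one>\<^bsub>CT\<^esub>" if n: "n : J" for n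
  proof (cases "y n = \<one>\<^bsub>CT\<^esub>")
   case True
   then show ?thesis using subgroup.one_closed[OF subgroup_cwt_fil] by simp
  next
   case False
   have n1: "n \<ge> 1" using n by (simp add: coprime_nats_def)
   have nd: "n * p ^ l n \<le> d" unfolding d_def by (rule member_le_sum) (use n False fin in auto)
   have "n * 1 \<le> n * p ^ l n" using p0_11 by (intro mult_left_mono) auto
   from order.trans[OF this nd] have "n \<le> d" by simp
   moreover have "l n \<le> Max {m. n * p ^ m \<le> d}" by (rule Max_ge[OF finite_levels[OF p n1]]) (simp add: nd)
   ultimately show ?thesis using l[OF n] cwt_fil_mono by auto
  qed
  then have "z : asw_target_fil p d" unfolding z(1) asw_target_fil_def using z(2,3) by blast
  then show "z : asw_phi p ` carrier E" unfolding asw_phi_cw_fil[symmetric] by (auto simp: cw_fil_def)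
 qed
qed

lemma asw_phi_induces_iso: "induces_iso E wpE T (asw_phi p)"
 by (rule induces_isoI[OF asw_phi_group_hom asw_phi_surj asw_phi_kernel])

section \<open>Kato's filtration on characters\<close>

private abbreviation (input) "Hp \<equiv> h1 (prufer p) :: 'k fls char monoid"
private abbreviation (input) "Hf \<equiv> h1 rat_mod_int :: 'k fls char monoid"
private abbreviation (input) "primes \<equiv> {l. Factorial_Ring.prime (l::nat)}"

private lemma cHp: "comm_group Hp" by (rule comm_group_h1[OF p chE comm_group_prufer[OF p0_11]])
private lemma cHf: "comm_group Hf" by (rule comm_group_h1[OF p chE comm_group_rat_mod_int])
private lemma ghA: "group_hom E Hp (asw p)" by (rule asw_group_hom[OF p chE])
private lemma ghC: "group_hom K11 E (cw_map p UNIV fls_const)" by (rule const_group_hom)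

lemma asw_psi_group_iso: "group_iso Hp T (asw_psi p)"
proof -
 have "quot_map (asw p) : iso (E Mod wpE) Hp" "quot_map (asw_phi p) : iso (E Mod wpE) T"
  using asw_induces_iso[OF p chE] asw_phi_induces_iso unfolding induces_iso_def group_iso_def by blast+
 then have "quot_map (asw_phi p) \<circ> inv_into (carrier (E Mod wpE)) (quot_map (asw p)) : iso Hp T"
  using group.iso_set_sym[OF comm_group_group[OF cQE]] iso_set_trans by blast
 moreover have "asw_psi p = quot_map (asw_phi p) \<circ> inv_into (carrier (E Mod wpE)) (quot_map (asw p))"
  by (rule ext) (simp only: asw_psi_def comp_def)
 ultimately show ?thesis
  unfolding group_iso_def using comm_group_group[OF cHp] comm_group_group[OF comm_group_asw_target] by metis
qed

text \<open>Replaces the chosen inverse image in \<open>asw_psi\<close> by an arbitrary preimage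
  under \<open>asw\<close>; this is how the filtration is transported.\<close>

lemma asw_psi_asw:
 assumes f: "f : carrier E"
 shows "asw_psi p (asw p f) = asw_phi p f"
proof -
 note i = asw_induces_iso[OF p chE] asw_phi_induces_iso
 have inj: "inj_on (quot_map (asw p)) (carrier (E Mod wpE))"
  using i(1) unfolding induces_iso_def group_iso_def iso_def bij_betw_def by blast
 have c: "wpE #>\<^bsub>E\<^esub> f : carrier (E Mod wpE)" using f by (auto simp: carrier_FactGroup)
 have s: "subgroup wpE E" by (rule subgroup_cw_wp[OF p subrng_UNIV chE])
 have q: "quot_map (asw p) (wpE #>\<^bsub>E\<^esub> f) = asw p f" "quot_map (asw_phi p) (wpE #>\<^bsub>E\<^esub> f) = asw_phi p f"
  using i unfolding induces_iso_def by (auto intro!: quot_map_coset[OF _ s _ f])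
 show ?thesis unfolding asw_psi_def q(1)[symmetric] inv_into_f_f[OF inj c] by (rule q(2))
qed

text \<open>Since \<open>asw_psi\<close> is injective, membership in the image of a step can be
  tested on the side of Phi, where the step is explicit.\<close>

lemma asw_in_h1_fil: "f : carrier E ==> asw p f : h1_fil p (int d) \<longleftrightarrow> asw_phi p f : asw_target_fil p d"
proof
 assume f: "f : carrier E"
 have cE': "g : carrier E" if "g : cw_fil p (int d)" for g :: "'k fls covec" using that by (simp add: cw_fil_def)
 show "asw_phi p f : asw_target_fil p d" if h: "asw p f : h1_fil p (int d)"
 proof -
  obtain g where g: "g : cw_fil p (int d)" "asw p f = asw p g" using h by (auto simp: h1_fil_def)
  have "asw_phi p f = asw_phi p g"
   unfolding asw_psi_asw[OF f, symmetric] asw_psi_asw[OF cE'[OF g(1)], symmetric] g(2) ..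
  then show ?thesis using g(1) asw_phi_cw_fil[of d] by blast
 qed
 show "asw p f : h1_fil p (int d)" if h: "asw_phi p f : asw_target_fil p d"
 proof -
  obtain g where g: "g : cw_fil p (int d)" "asw_phi p f = asw_phi p g"
   using h unfolding asw_phi_cw_fil[of d, symmetric] by blast
  have inj: "inj_on (asw_psi p) (carrier Hp)"
   using asw_psi_group_iso unfolding group_iso_def iso_def bij_betw_def by blast
  have "asw_psi p (asw p f) = asw_psi p (asw p g)" unfolding asw_psi_asw[OF f] asw_psi_asw[OF cE'[OF g(1)]] by (rule g(2))
  then have "asw p f = asw p g"
   by (rule inj_onD[OF inj _ group_hom.hom_closed[OF ghA f] group_hom.hom_closed[OF ghA cE'[OF g(1)]]])
  then show ?thesis using g(1) by (simp add: h1_fil_def)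
 qed
qed

lemma h1_fil_image: "h1_fil p (int d) = asw p ` cw_fil p (int d)"
 by (simp add: h1_fil_def)

lemma subgroup_h1_fil: "subgroup (h1_fil p (int d)) Hp"
 unfolding h1_fil_image by (rule group_hom.subgroup_img_is_subgroup[OF ghA subgroup_cw_fil])

lemma subgroup_h1_fil_neg: "subgroup (h1_fil p (- 1)) Hp"
 unfolding h1_fil_def using group.triv_subgroup[OF comm_group_group[OF cHp]] by simp

lemma asw_psi_h1_fil: "asw_psi p ` h1_fil p (int d) = (asw_target_fil p d :: ((nat => 'k covec) \<times> 'k covec set) set)"
proof -
 have "asw_psi p ` h1_fil p (int d) = asw_phi p ` (cw_fil p (int d) :: 'k fls covec set)"
  unfolding h1_fil_image image_image by (rule image_cong[OF refl]) (simp add: asw_psi_asw cw_fil_def)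
 then show ?thesis unfolding asw_phi_cw_fil .
qed

lemma cw_fil_pred_subset: "cw_fil p (int d) <= (cw_fil p (int (Suc d)) :: 'k fls covec set)"
proof
 fix f :: "'k fls covec" assume f: "f : cw_fil p (int d)"
 have "ereal (of_int (- int (Suc d))) \<le> ereal (of_int (- int d))" by simp
 also have "\<dots> \<le> cw_val p f" using f by (simp add: cw_fil_def)
 finally show "f : cw_fil p (int (Suc d))" using f by (simp add: cw_fil_def)
qed

private lemma pred:
 assumes "d > (0::nat)"
 shows "subgroup (cw_fil p (int d - 1)) E" "cw_fil p (int d - 1) <= (cw_fil p (int d) :: 'k fls covec set)"
  "subgroup (h1_fil p (int d - 1)) Hp" "h1_fil p (int d - 1) <= (h1_fil p (int d) :: 'k fls char set)"
proof -
 obtain e where "d = Suc e" using assms by (cases d) auto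
 then have e: "int d - 1 = int e" "d = Suc e" by simp_all
 show "subgroup (cw_fil p (int d - 1)) E" "subgroup (h1_fil p (int d - 1)) Hp"
  unfolding e(1) by (rule subgroup_cw_fil) (rule subgroup_h1_fil)
 show 1: "cw_fil p (int d - 1) <= (cw_fil p (int d) :: 'k fls covec set)" unfolding e(1) unfolding e(2) by (rule cw_fil_pred_subset)
 show "h1_fil p (int d - 1) <= (h1_fil p (int d) :: 'k fls char set)"
  using image_mono[OF 1, of "asw p"] unfolding e(1) h1_fil_image .
qed

private lemma asw_const_hom: "group_hom K11 Hp (%f. asw p (cw_map p (UNIV :: 'k fls set) fls_const f))"
 using hom_compose[OF group_hom.homh[OF ghC] group_hom.homh[OF ghA]]
 unfolding group_hom_def group_hom_axioms_def comp_def using comm_group_group[OF cK] comm_group_group[OF cHp] by blast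

section \<open>Degree zero and constant terms\<close>

lemma asw_fps:
 assumes f: "f : carrier (cw p M)"
 shows "asw p (cw_map p UNIV fps_to_fls f) = \<one>\<^bsub>Hp\<^esub>"
proof -
 have chF: "CHAR('k fps) = p" by (simp add: CHAR_fps ch)
 have "f : cw_wp p M" unfolding cw_wp_max_ideal by (rule f)
 from cw_map_cw_wp[OF p subrng_max_ideal rng_hom_fps subset_UNIV subrng_UNIV chF chE this]
 show ?thesis unfolding asw_kernel[OF p chE, symmetric] by (simp add: kernel_def)
qed

text \<open>Subtracting the constant term leaves a co-vector that can be represented with entries in
  t k[[t]], and there the character is trivial.\<close>

lemma asw_constant_term:
 assumes f: "f : carrier (cw p (UNIV :: 'k fps set))"
 shows "cw_map p UNIV (%a. fps_nth a 0) f : carrier K11"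
  "asw p (cw_map p UNIV fps_to_fls f) = asw p (cw_map p UNIV fls_const (cw_map p UNIV (%a. fps_nth a 0) f))"
proof -
 let ?P = "cw p (UNIV :: 'k fps set)"
 have r0: "rng_hom_on UNIV (\<lambda>a :: 'k fps. fps_nth a 0)" by (simp add: rng_hom_on_def)
 have rc: "rng_hom_on UNIV (fps_const :: 'k => 'k fps)" by (simp add: rng_hom_on_def)
 interpret Z: group_hom ?P K11 "cw_map p UNIV (%a. fps_nth a 0)" by (rule cw_map_group_hom[OF p subrng_UNIV r0 subset_UNIV subrng_UNIV])
 interpret C: group_hom K11 ?P "cw_map p UNIV fps_const" by (rule cw_map_group_hom[OF p subrng_UNIV rc subset_UNIV subrng_UNIV])
 interpret F: group_hom ?P E "cw_map p UNIV fps_to_fls" by (rule fps_group_hom[OF subrng_UNIV])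
 interpret A: group_hom E Hp "asw p" by (rule ghA)
 let ?f0 = "cw_map p UNIV (%a. fps_nth a 0) f"
 show c: "?f0 : carrier K11" using f by simp
 have zc: "cw_map p UNIV (%a. fps_nth a 0) (cw_map p UNIV fps_const g) = g" if g: "g : carrier K11" for g
 proof -
  obtain s x where x: "x : carrier (Wk s)" "g = cw_inj p UNIV s x" using cw_cases[OF p subrng_UNIV g] .
  have m: "map fps_const x : carrier (witt p UNIV s)" using x(1) by (simp add: witt_carrier_iff)
  show ?thesis unfolding x(2) cw_map_inj[OF p subrng_UNIV rc subset_UNIV subrng_UNIV x(1)] cw_map_inj[OF p subrng_UNIV r0 subset_UNIV subrng_UNIV m]
   by (simp add: comp_def)
 qed
 let ?g = "f \<otimes>\<^bsub>?P\<^esub> inv\<^bsub>?P\<^esub> cw_map p UNIV fps_const ?f0"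
 have g: "?g : carrier ?P" using f by simp
 have g1: "cw_map p UNIV (%a. fps_nth a 0) ?g = \<one>\<^bsub>K11\<^esub>"
  using f zc[OF c] by (simp add: Z.H.r_inv)
 obtain s z where z: "z : carrier (witt p UNIV s)" "?g = cw_inj p UNIV s z" using cw_cases[OF p subrng_UNIV g] .
 have mz: "map (%a. fps_nth a 0) z : carrier (Wk s)" using z(1) by (simp add: witt_carrier_iff)
 have "cw_inj p UNIV s (map (%a. fps_nth a 0) z) = cw_inj p UNIV s \<one>\<^bsub>Wk s\<^esub>"
  using g1 unfolding z(2) cw_map_inj[OF p subrng_UNIV r0 subset_UNIV subrng_UNIV z(1)] cw_one[OF p subrng_UNIV, of s] .
 then have "map (%a. fps_nth a 0) z = \<one>\<^bsub>Wk s\<^esub>"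
  using cw_inj_inj[OF p subrng_UNIV mz monoid.one_closed[OF group.is_monoid[OF gk]]] by simp
 then have m0: "map (%a. fps_nth a 0) z = replicate (Suc s) 0" by (simp add: witt_def)
 have "set z <= M"
 proof
  fix a assume "a : set z"
  then have "fps_nth a 0 : set (map (%a. fps_nth a 0) z)" by simp
  then show "a : M" unfolding m0 set_replicate_conv_if by simp
 qed
 then have zM: "z : carrier (witt p M s)" using z(1) by (simp add: witt_carrier_iff)
 have "cw_map p UNIV fps_to_fls ?g = cw_map p UNIV fps_to_fls (cw_inj p M s z)"
  unfolding z(2) cw_map_inj[OF p subrng_UNIV rng_hom_fps subset_UNIV subrng_UNIV z(1)]
   cw_map_inj[OF p subrng_max_ideal rng_hom_fps subset_UNIV subrng_UNIV zM] ..
 then have "asw p (cw_map p UNIV fps_to_fls ?g) = \<one>\<^bsub>Hp\<^esub>" using asw_fps[OF cw_inj_closed[OF p subrng_max_ideal zM]] by simp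
 moreover have "cw_map p UNIV fps_to_fls ?g = cw_map p UNIV fps_to_fls f \<otimes>\<^bsub>E\<^esub> inv\<^bsub>E\<^esub> cw_map p UNIV fls_const ?f0"
  unfolding const_eq_fps[OF c] using f by simp
 moreover have cc: "cw_map p UNIV fls_const ?f0 : carrier E" unfolding const_eq_fps[OF c] using f by simp
 ultimately have "asw p (cw_map p UNIV fps_to_fls f) \<otimes>\<^bsub>Hp\<^esub> inv\<^bsub>Hp\<^esub> asw p (cw_map p UNIV fls_const ?f0) = \<one>\<^bsub>Hp\<^esub>"
  using f by simp
 then show "asw p (cw_map p UNIV fps_to_fls f) = asw p (cw_map p UNIV fls_const ?f0)"
  using f cc A.H.inv_solve_right'[of "\<one>\<^bsub>Hp\<^esub>" "asw p (cw_map p UNIV fps_to_fls f)" "asw p (cw_map p UNIV fls_const ?f0)"] by simp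
qed

lemma h1_fil_0: "h1_fil p 0 = asw p ` cw_map p UNIV fls_const ` carrier K11"
proof -
 have e: "h1_fil p 0 = asw p ` cw_map p UNIV fps_to_fls ` carrier (cw p (UNIV :: 'k fps set))"
  by (simp add: h1_fil_def cw_fil_0)
 show ?thesis
 proof
  show "h1_fil p 0 <= asw p ` cw_map p UNIV fls_const ` carrier K11" unfolding e using asw_constant_term by blast
  show "asw p ` cw_map p UNIV fls_const ` carrier K11 <= h1_fil p 0"
   using const_in_cw_fil[of _ 0] by (auto simp: h1_fil_def)
 qed
qed

text \<open>\<open>asw\<close> and Phi have the same kernel, and the second component of Phi on
  constants is the class modulo F - 1; so a constant co-vector with trivial character is F g - g
  already over k.\<close>

lemma asw_const_kernel: "kernel K11 Hp (%f. asw p (cw_map p UNIV fls_const f)) = wpK"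
proof (rule Set.set_eqI)
 fix f
 have "f : wpK \<longleftrightarrow> wpK #>\<^bsub>K11\<^esub> f = wpK" if "f : carrier K11"
  using group.rcos_self[OF comm_group_group[OF cK] that subgroup_cw_wp[OF p subrng_UNIV ch]]
   group.coset_join2[OF comm_group_group[OF cK] that subgroup_cw_wp[OF p subrng_UNIV ch]] by blast
 moreover have "asw p (cw_map p UNIV fls_const f) = \<one>\<^bsub>Hp\<^esub> \<longleftrightarrow> asw_phi p (cw_map p UNIV fls_const f) = \<one>\<^bsub>T\<^esub>" if "f : carrier K11"
  using group_hom.hom_closed[OF ghC that] asw_kernel[OF p chE] asw_phi_kernel unfolding kernel_def by blast
 moreover have "asw_phi p (cw_map p UNIV fls_const f) = \<one>\<^bsub>T\<^esub> \<longleftrightarrow> wpK #>\<^bsub>K11\<^esub> f = wpK" if "f : carrier K11"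
  unfolding asw_phi_const[OF that] asw_target_one by (simp only: prod.inject simp_thms)
 moreover have "wpK <= carrier K11" by (rule subgroup.subset[OF subgroup_cw_wp[OF p subrng_UNIV ch]])
 ultimately show "f : kernel K11 Hp (%f. asw p (cw_map p UNIV fls_const f)) \<longleftrightarrow> f : wpK" unfolding kernel_def by blast
qed

lemma asw_const_induces_iso:
 "induces_iso K11 wpK (Hp\<lparr>carrier := h1_fil p 0\<rparr>) (%f. asw p (cw_map p UNIV fls_const f))"
proof (rule induces_isoI)
 have s: "subgroup (h1_fil p 0) Hp" using subgroup_h1_fil[of 0] by simp
 show "group_hom K11 (Hp\<lparr>carrier := h1_fil p 0\<rparr>) (%f. asw p (cw_map p UNIV fls_const f))"
  using group_hom.homh[OF asw_const_hom] subgroup.subgroup_is_group[OF s comm_group_group[OF cHp]] comm_group_group[OF cK]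
  unfolding group_hom_def group_hom_axioms_def hom_def h1_fil_0 by auto
 show "(%f. asw p (cw_map p UNIV fls_const f)) ` carrier K11 = carrier (Hp\<lparr>carrier := h1_fil p 0\<rparr>)"
  unfolding h1_fil_0 image_image by simp
 show "kernel K11 (Hp\<lparr>carrier := h1_fil p 0\<rparr>) (%f. asw p (cw_map p UNIV fls_const f)) = wpK"
  using asw_const_kernel by (simp add: kernel_def)
qed

text \<open>Step -1 is trivial, so the kernel of the map to the quotient is that of
  \<open>asw\<close> on constants.\<close>

lemma gr_0_induces_iso:
 "induces_iso K11 wpK (gr Hp (h1_fil p) 0) (%f. h1_fil p (- 1) #>\<^bsub>Hp\<^esub> asw p (cw_map p UNIV fls_const f))"
proof -
 have s: "subgroup (h1_fil p 0) Hp" using subgroup_h1_fil[of 0] by simp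
 have sub: "h1_fil p (- 1) <= (h1_fil p 0 :: 'k fls char set)" using subgroup.one_closed[OF s] by (simp add: h1_fil_def)
 have m: "0 - 1 = (- 1 :: int)" by simp
 have f: "asw p (cw_map p UNIV fls_const a) : h1_fil p 0" if "a : carrier K11" for a using that unfolding h1_fil_0 by blast
 note g = gr_map[where F="h1_fil p" and d=0, unfolded m, OF cHp s subgroup_h1_fil_neg sub asw_const_hom f]
 show ?thesis
 proof (rule induces_isoI[OF g(1)])
  show "(%a. h1_fil p (- 1) #>\<^bsub>Hp\<^esub> asw p (cw_map p UNIV fls_const a)) ` carrier K11 = carrier (gr Hp (h1_fil p) 0)"
  proof (rule g(2))
   fix y :: "'k fls char" assume "y : h1_fil p 0"
   then obtain a where a: "a : carrier K11" "y = asw p (cw_map p UNIV fls_const a)" unfolding h1_fil_0 by blast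
   have "y \<otimes>\<^bsub>Hp\<^esub> inv\<^bsub>Hp\<^esub> asw p (cw_map p UNIV fls_const a) : h1_fil p (- 1)"
    unfolding a(2) using group.r_inv[OF comm_group_group[OF cHp] group_hom.hom_closed[OF asw_const_hom a(1)]]
    by (simp add: h1_fil_def)
   then show "\<exists>a\<in>carrier K11. y \<otimes>\<^bsub>Hp\<^esub> inv\<^bsub>Hp\<^esub> asw p (cw_map p UNIV fls_const a) : h1_fil p (- 1)" using a(1) by blast
  qed
  have m1: "h1_fil p (- 1) = {\<one>\<^bsub>Hp\<^esub>}" by (simp add: h1_fil_def)
  have "{a : carrier K11. asw p (cw_map p UNIV fls_const a) : h1_fil p (- 1)} = wpK"
   unfolding m1 asw_const_kernel[symmetric] kernel_def by blast
  with g(3) show "kernel K11 (gr Hp (h1_fil p) 0) (%a. h1_fil p (- 1) #>\<^bsub>Hp\<^esub> asw p (cw_map p UNIV fls_const a)) = wpK"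
   by (rule trans)
 qed
qed

text \<open>The inverse isomorphism is evaluated by exhibiting a preimage: the class of the constant
  term, which has the same character as f.\<close>

lemma gr_0_constant_term:
 assumes f: "f : carrier (cw p (UNIV :: 'k fps set))"
 shows "inv_into (carrier (K11 Mod wpK)) (quot_map (%f. h1_fil p (- 1) #>\<^bsub>Hp\<^esub> asw p (cw_map p UNIV fls_const f)))
   (h1_fil p (- 1) #>\<^bsub>Hp\<^esub> asw p (cw_map p UNIV fps_to_fls f)) = wpK #>\<^bsub>K11\<^esub> cw_map p UNIV (%a. fps_nth a 0) f"
proof -
 let ?k = "%f. h1_fil p (- 1) #>\<^bsub>Hp\<^esub> asw p (cw_map p UNIV fls_const f)"
 note i = gr_0_induces_iso
 have inj: "inj_on (quot_map ?k) (carrier (K11 Mod wpK))"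
  using i unfolding induces_iso_def group_iso_def iso_def bij_betw_def by blast
 note c = asw_constant_term[OF f]
 have q: "quot_map ?k (wpK #>\<^bsub>K11\<^esub> cw_map p UNIV (%a. fps_nth a 0) f) = ?k (cw_map p UNIV (%a. fps_nth a 0) f)"
  using i unfolding induces_iso_def by (intro quot_map_coset[OF _ subgroup_cw_wp[OF p subrng_UNIV ch] _ c(1)]) blast+
 have "wpK #>\<^bsub>K11\<^esub> cw_map p UNIV (%a. fps_nth a 0) f : carrier (K11 Mod wpK)" using c(1) by (auto simp: carrier_FactGroup)
 from inv_into_f_f[OF inj this] show ?thesis unfolding q c(2) .
qed

section \<open>Graded pieces in positive degree\<close>

private lemma comonomial_group_hom:
 assumes n: "n : J"
 shows "group_hom (Wk m) E (comonomial p (n * p ^ m))"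
 using comonomial_hom[OF coprime_nats_multiplicity(2)[OF p n, of m]] gk gE
 unfolding coprime_nats_multiplicity(1)[OF p n] group_hom_def group_hom_axioms_def by blast

lemma comonomial_cw_fil_pred_J:
 assumes n: "n : J" and a: "a : carrier (Wk m)" and f: "comonomial p (n * p ^ m) a : cw_fil p (int (n * p ^ m) - 1)"
 shows "a = \<one>\<^bsub>Wk m\<^esub>"
 using comonomial_cw_fil_pred[OF coprime_nats_multiplicity(2)[OF p n, of m] _ f] a
 unfolding coprime_nats_multiplicity(1)[OF p n] by blast

lemma comonomial_group_iso:
 assumes n: "n : J"
 shows "group_iso (Wk m) (E\<lparr>carrier := comonomial p (n * p ^ m) ` carrier (Wk m)\<rparr>) (comonomial p (n * p ^ m))"
proof (rule kernel_trivial_group_iso)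
 interpret C: group_hom "Wk m" E "comonomial p (n * p ^ m)" by (rule comonomial_group_hom[OF n])
 show "group_hom (Wk m) (E\<lparr>carrier := comonomial p (n * p ^ m) ` carrier (Wk m)\<rparr>) (comonomial p (n * p ^ m))"
  using C.homh gk subgroup.subgroup_is_group[OF C.img_is_subgroup gE] unfolding group_hom_def group_hom_axioms_def hom_def by auto
 fix a assume a: "a : carrier (Wk m)" "comonomial p (n * p ^ m) a = \<one>\<^bsub>E\<lparr>carrier := comonomial p (n * p ^ m) ` carrier (Wk m)\<rparr>\<^esub>"
 have "comonomial p (n * p ^ m) a : cw_fil p (int (n * p ^ m) - 1)"
  using a(2) subgroup.one_closed[OF pred(1)[OF coprime_nats_multiplicity(2)[OF p n, of m]]] by simp
 then show "a = \<one>\<^bsub>Wk m\<^esub>" by (rule comonomial_cw_fil_pred_J[OF n a(1)])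
qed simp

lemma comonomial_fil_J: "n : J ==> comonomial p (n * p ^ m) (a :: 'k list) : cw_fil p (int (n * p ^ m))"
 by (rule comonomial_in_cw_fil[OF coprime_nats_multiplicity(2)[OF p]]) simp_all

lemma gr_cw_group_iso:
 assumes n: "n : J" and d: "d = n * p ^ m"
 shows "group_iso (Wk m) (gr E (cw_fil p) (int d)) (%x. cw_fil p (int d - 1) #>\<^bsub>E\<^esub> comonomial p d x)"
proof -
 note nm = coprime_nats_multiplicity[OF p n, of m, folded d]
 note g = gr_map[where F="cw_fil p" and d="int d", OF cE subgroup_cw_fil pred(1,2)[OF nm(2)]
   comonomial_group_hom[OF n, of m, folded d] comonomial_fil_J[OF n, of m, folded d]]
 show ?thesis
 proof (rule kernel_trivial_group_iso[OF g(1)])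
  show "(%x. cw_fil p (int d - 1) #>\<^bsub>E\<^esub> comonomial p d x) ` carrier (Wk m) = carrier (gr E (cw_fil p) (int d))"
   by (rule g(2)) (rule cw_fil_leading_term[OF nm(2), unfolded nm(1)])
  fix a assume "a : carrier (Wk m)" "cw_fil p (int d - 1) #>\<^bsub>E\<^esub> comonomial p d a = \<one>\<^bsub>gr E (cw_fil p) (int d)\<^esub>"
  then have "a : {a : carrier (Wk m). comonomial p d a : cw_fil p (int d - 1)}" using g(3) unfolding kernel_def by blast
  then show "a = \<one>\<^bsub>Wk m\<^esub>" using comonomial_cw_fil_pred_J[OF n, of a m, folded d] by blast
 qed
qed

private lemma of_p: "of_nat p = (0 :: 'k)" using of_nat_CHAR[where ?'a='k] unfolding ch .
private lemma witt_length: "a : carrier (Wk j) ==> length a = Suc j" by (simp add: witt_carrier_iff)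

lemma witt_p_multiples_0: "witt_p_multiples p (UNIV :: 'k set) 0 = {\<one>\<^bsub>Wk 0\<^esub>}"
proof -
 have "a [^]\<^bsub>Wk 0\<^esub> p = \<one>\<^bsub>Wk 0\<^esub>" if "a : carrier (Wk 0)" for a
  unfolding witt_pow_p[OF p of_p witt_length[OF that]] by (simp add: witt_def)
 then show ?thesis unfolding witt_p_multiples_def using monoid.one_closed[OF group.is_monoid[OF gk[of 0]]] by force
qed

text \<open>In length j + 2 the map p = V F pushes the last entry out of range, so only the first j
  + 1 entries matter, and these are arbitrary.\<close>

lemma witt_p_multiples_Suc: "witt_p_multiples p (UNIV :: 'k set) (Suc j) = (%b. 0 # witt_frob p b) ` carrier (Wk j)"
proof -
 have e: "a [^]\<^bsub>Wk (Suc j)\<^esub> p = 0 # witt_frob p (take (Suc j) a)" if "a : carrier (Wk (Suc j))" for a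
  unfolding witt_pow_p[OF p of_p witt_length[OF that]] by (simp add: witt_frob_def take_map)
 show ?thesis
 proof
  show "witt_p_multiples p (UNIV :: 'k set) (Suc j) <= (%b. 0 # witt_frob p b) ` carrier (Wk j)"
   unfolding witt_p_multiples_def by (rule image_subsetI) (simp add: e witt_carrier_iff)
  show "(%b. 0 # witt_frob p b) ` carrier (Wk j) <= witt_p_multiples p (UNIV :: 'k set) (Suc j)"
  proof (rule image_subsetI)
   fix b assume b: "b : carrier (Wk j)"
   have a: "b @ [0] : carrier (Wk (Suc j))" using b by (simp add: witt_carrier_iff)
   have "(b @ [0]) [^]\<^bsub>Wk (Suc j)\<^esub> p = 0 # witt_frob p b" unfolding e[OF a] using b by (simp add: witt_carrier_iff)
   then show "0 # witt_frob p b : witt_p_multiples p UNIV (Suc j)" unfolding witt_p_multiples_def using a by (metis imageI)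
  qed
 qed
qed

text \<open>Phi turns the question into one about a single component: when does the image of a at
  level m lie in the step belonging to degree n p^m - 1? That step is one level lower, and
  injectivity of \<open>cwt_inj\<close> at level m reduces membership to a being V F of a shorter
  vector.\<close>

lemma asw_comonomial_pred:
 assumes n: "n : J" and a: "a : carrier (Wk m)"
 shows "asw p (comonomial p (n * p ^ m) a) : h1_fil p (int (n * p ^ m) - 1) \<longleftrightarrow> a : witt_p_multiples p UNIV m"
proof -
 note nm = coprime_nats_multiplicity[OF p n, of m]
 let ?d = "n * p ^ m - 1"
 have n1: "n \<ge> 1" using n by (simp add: coprime_nats_def)
 have "int a - 1 = int (a - 1)" if "a > 0" for a :: nat using that by simp
 then have e: "int (n * p ^ m) - 1 = int ?d" using nm(2) by blast
 have i: "cwt_inj p UNIV m a : carrier CT" by (rule cwt_inj_closed[OF p ch a])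
 have sf: "single_fun J (%_. CT) n (cwt_inj p UNIV m a) : carrier ST" by (rule single_fun_in[OF gCT n i])
 have o: "\<one>\<^bsub>CT\<^esub> : cwt_fil p UNIV l" for l by (rule subgroup.one_closed[OF subgroup_cwt_fil])
 have sv: "single_fun J (%_. CT) n (cwt_inj p UNIV m a) l = (if l = n then cwt_inj p UNIV m a else \<one>\<^bsub>CT\<^esub>)" if "l : J" for l
  using that by (simp add: single_fun_def)
 have wq: "wpK : carrier (K11 Mod wpK)"
  using monoid.one_closed[OF group.is_monoid[OF comm_group_group[OF cQK]]] by (simp add: FactGroup_def)
 have "asw p (comonomial p (n * p ^ m) a) : h1_fil p (int ?d) \<longleftrightarrow>
   (single_fun J (%_. CT) n (cwt_inj p UNIV m a), wpK) : asw_target_fil p ?d"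
  using asw_in_h1_fil[of "comonomial p (n * p ^ m) a" ?d] group_hom.hom_closed[OF comonomial_group_hom[OF n] a]
  unfolding asw_phi_comonomial[OF n a] by blast
 also have "\<dots> \<longleftrightarrow> (\<forall>l\<in>J. if l \<le> ?d then single_fun J (%_. CT) n (cwt_inj p UNIV m a) l : cwt_fil p UNIV (Max {m. l * p ^ m \<le> ?d})
   else single_fun J (%_. CT) n (cwt_inj p UNIV m a) l = \<one>\<^bsub>CT\<^esub>)"
  unfolding asw_target_fil_def using sf wq by blast
 also have "\<dots> \<longleftrightarrow> (if n \<le> ?d then cwt_inj p UNIV m a : cwt_fil p UNIV (Max {m. n * p ^ m \<le> ?d}) else cwt_inj p UNIV m a = \<one>\<^bsub>CT\<^esub>)"
  using n o by (auto simp: sv)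
 also have "\<dots> \<longleftrightarrow> a : witt_p_multiples p UNIV m"
 proof (cases m)
  \<comment> \<open>Here n exceeds the lowered bound, so the component at n has to be trivial
    instead of lying in a step; this matches p W_0(k) = 0.\<close>
  case 0
  have "cwt_inj p UNIV 0 a = \<one>\<^bsub>CT\<^esub> \<longleftrightarrow> a = \<one>\<^bsub>Wk 0\<^esub>"
   unfolding cwt_one[OF p ch, of 0] by (rule cwt_inj_inj[OF p ch]) (use a 0 monoid.one_closed[OF group.is_monoid[OF gk]] in auto)
  moreover have "\<not> n \<le> ?d" using n1 0 by simp
  ultimately show ?thesis unfolding 0 witt_p_multiples_0 using 0 by simp
 next
  case (Suc j)
  \<comment> \<open>Lowering the bound by one removes exactly the top level m = j + 1, so the
    maximum becomes j.\<close>
  have lt: "n * p ^ i \<le> ?d \<longleftrightarrow> i \<le> j" for i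
  proof -
   have "n * p ^ i \<le> ?d \<longleftrightarrow> n * p ^ i < n * p ^ m" using nm(2) by linarith
   also have "\<dots> \<longleftrightarrow> i < m" using n1 prime_gt_1_nat[OF p] by simp
   also have "\<dots> \<longleftrightarrow> i \<le> j" unfolding Suc by (rule less_Suc_eq_le)
   finally show ?thesis .
  qed
  have "{i. n * p ^ i \<le> ?d} = {..j}" using lt by auto
  moreover have "Max {..j} = j" by (rule Max_eqI) auto
  ultimately have M: "Max {i. n * p ^ i \<le> ?d} = j" by simp
  have nd: "n \<le> ?d" using lt[of 0] by simp
  have "cwt_inj p UNIV m a : cwt_fil p UNIV j \<longleftrightarrow> (\<exists>b\<in>carrier (Wk j). cwt_inj p UNIV m a = cwt_inj p UNIV m (0 # witt_frob p b))"
   unfolding cwt_fil_def Suc using cwt_inj_Suc[OF p ch, of _ j] by auto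
  also have "\<dots> \<longleftrightarrow> (\<exists>b\<in>carrier (Wk j). a = 0 # witt_frob p b)"
   using cwt_inj_inj[OF p ch a] frob_witt(2)[of _ j] unfolding Suc by blast
  also have "\<dots> \<longleftrightarrow> a : witt_p_multiples p UNIV m" unfolding Suc witt_p_multiples_Suc by blast
  finally show ?thesis using nd M by simp
 qed
 finally show ?thesis unfolding e .
qed

lemma gr_theta:
 assumes n: "n : J" and d: "d = n * p ^ m"
 defines "tht \<equiv> %x. h1_fil p (int d - 1) #>\<^bsub>Hp\<^esub> asw p (comonomial p d x)"
 shows "group_hom (Wk m) (gr Hp (h1_fil p) (int d)) tht"
  and "tht ` carrier (Wk m) = carrier (gr Hp (h1_fil p) (int d))"
  and "kernel (Wk m) (gr Hp (h1_fil p) (int d)) tht = witt_p_multiples p UNIV m"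
proof -
 note nm = coprime_nats_multiplicity[OF p n, of m, folded d]
 note C = comonomial_group_hom[OF n, of m, folded d]
 have h: "group_hom (Wk m) Hp (%x. asw p (comonomial p d x))"
  using hom_compose[OF group_hom.homh[OF C] group_hom.homh[OF ghA]] gk comm_group_group[OF cHp]
  unfolding group_hom_def group_hom_axioms_def comp_def by blast
 have f: "asw p (comonomial p d a) : h1_fil p (int d)" if "a : carrier (Wk m)" for a
  unfolding h1_fil_image by (rule imageI) (rule comonomial_fil_J[OF n, of m, folded d])
 note g = gr_map[where F="h1_fil p" and d="int d", OF cHp subgroup_h1_fil pred(3,4)[OF nm(2)] h f]
 show "group_hom (Wk m) (gr Hp (h1_fil p) (int d)) tht" unfolding tht_def by (rule g(1))
 show "tht ` carrier (Wk m) = carrier (gr Hp (h1_fil p) (int d))"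
  unfolding tht_def
 proof (rule g(2))
  fix y :: "'k fls char" assume "y : h1_fil p (int d)"
  then obtain f where f: "f : cw_fil p (int d)" "y = asw p f" unfolding h1_fil_image by blast
  have fc: "f : carrier E" using f(1) by (simp add: cw_fil_def)
  obtain a where a: "a : carrier (Wk m)" "f \<otimes>\<^bsub>E\<^esub> inv\<^bsub>E\<^esub> comonomial p d a : cw_fil p (int d - 1)"
   using cw_fil_leading_term[OF nm(2) f(1)] unfolding nm(1) by blast
  have c: "comonomial p d a : carrier E" by (rule group_hom.hom_closed[OF C a(1)])
  have "asw p (f \<otimes>\<^bsub>E\<^esub> inv\<^bsub>E\<^esub> comonomial p d a) = y \<otimes>\<^bsub>Hp\<^esub> inv\<^bsub>Hp\<^esub> asw p (comonomial p d a)"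
   unfolding f(2) group_hom.hom_inv[OF ghA c, symmetric] by (rule group_hom.hom_mult[OF ghA fc group.inv_closed[OF gE c]])
  moreover have "asw p (f \<otimes>\<^bsub>E\<^esub> inv\<^bsub>E\<^esub> comonomial p d a) : h1_fil p (int d - 1)"
  proof -
   have e: "int d - 1 = int (d - 1)" using nm(2) by simp
   show ?thesis using imageI[OF a(2), of "asw p"] unfolding e h1_fil_image .
  qed
  ultimately show "\<exists>a\<in>carrier (Wk m). y \<otimes>\<^bsub>Hp\<^esub> inv\<^bsub>Hp\<^esub> asw p (comonomial p d a) : h1_fil p (int d - 1)" using a(1) by auto
 qed
 show "kernel (Wk m) (gr Hp (h1_fil p) (int d)) tht = witt_p_multiples p UNIV m"
 proof -
  have "witt_p_multiples p UNIV m <= carrier (Wk m)"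
   unfolding witt_p_multiples_def using monoid.nat_pow_closed[OF group.is_monoid[OF gk]] by blast
  moreover have "asw p (comonomial p d a) : h1_fil p (int d - 1) \<longleftrightarrow> a : witt_p_multiples p UNIV m" if "a : carrier (Wk m)" for a
   unfolding d by (rule asw_comonomial_pred[OF n that])
  ultimately have "{a : carrier (Wk m). asw p (comonomial p d a) : h1_fil p (int d - 1)} = witt_p_multiples p UNIV m"
   by blast
  with g(3) show ?thesis unfolding tht_def by (rule trans)
 qed
qed

text \<open>The quotient on the side of co-vectors is formed inside \<open>cw_fil\<close>; the map
  is well defined because \<open>asw\<close> respects both filtrations.\<close>

lemma gr_asw:
 assumes d: "d > 0"
 defines "ga \<equiv> quot_map (%f. h1_fil p (int d - 1) #>\<^bsub>Hp\<^esub> asw p f)"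
 shows "group_hom (gr E (cw_fil p) (int d)) (gr Hp (h1_fil p) (int d)) ga"
  and "\<And>f. f : cw_fil p (int d) ==> ga (cw_fil p (int d - 1) #>\<^bsub>E\<^esub> f) = h1_fil p (int d - 1) #>\<^bsub>Hp\<^esub> asw p f"
proof -
 let ?A = "E\<lparr>carrier := cw_fil p (int d)\<rparr>" and ?N = "cw_fil p (int d - 1) :: 'k fls covec set"
 have sE: "subgroup (cw_fil p (int d)) E" by (rule subgroup_cw_fil)
 have cA: "comm_group ?A" by (rule comm_group_restrict[OF cE sE])
 have h: "group_hom ?A Hp (asw p)"
  using group_hom.homh[OF ghA] subgroup.subset[OF sE] comm_group_group[OF cA] comm_group_group[OF cHp]
  unfolding group_hom_def group_hom_axioms_def hom_def by (auto simp: subset_iff)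
 have f: "asw p a : h1_fil p (int d)" if "a : carrier ?A" for a
  using that unfolding h1_fil_image by simp
 note g = gr_map[where F="h1_fil p" and d="int d", OF cHp subgroup_h1_fil pred(3,4)[OF d] h f]
 have sN: "subgroup ?N ?A" by (rule group.subgroup_incl[OF gE pred(1)[OF d] sE pred(2)[OF d]])
 have nN: "normal ?N ?A" by (rule comm_group.subgroup_imp_normal[OF cA sN])
 have k: "h1_fil p (int d - 1) #>\<^bsub>Hp\<^esub> asw p x = \<one>\<^bsub>gr Hp (h1_fil p) (int d)\<^esub>" if x: "x : ?N" for x
 proof -
  have e: "int d - 1 = int (d - 1)" using d by simp
  have "asw p x : h1_fil p (int d - 1)" using imageI[OF x, of "asw p"] unfolding e h1_fil_image .
  then have "x : kernel ?A (gr Hp (h1_fil p) (int d)) (%f. h1_fil p (int d - 1) #>\<^bsub>Hp\<^esub> asw p f)"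
   using g(3) pred(2)[OF d] x by auto
  then show ?thesis by (simp add: kernel_def)
 qed
 show "group_hom (gr E (cw_fil p) (int d)) (gr Hp (h1_fil p) (int d)) ga"
  unfolding ga_def gr_def[of E] by (rule quot_map_group_hom[OF g(1) nN k])
 fix f :: "'k fls covec" assume "f : cw_fil p (int d)"
 then have "f : carrier ?A" by simp
 from quot_map_coset[OF g(1) sN k this]
 show "ga (?N #>\<^bsub>E\<^esub> f) = h1_fil p (int d - 1) #>\<^bsub>Hp\<^esub> asw p f" unfolding ga_def by (simp add: r_coset_def)
qed

section \<open>All primary components together\<close>

private lemma Hp_eq: "l > 0 ==> h1 (prufer l) = Hf\<lparr>carrier := primary Hf l\<rparr>" by (rule h1_prufer_eq[OF p chE])
private lemma primes_eq: "{l. Factorial_Ring.prime l \<and> l ~= p} = primes - {p}" by auto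
private lemma sum_eq: "I <= primes ==> sum_group I (%l. h1 (prufer l)) = primary_sum Hf I"
 by (rule sum_group_cong) (use Hp_eq prime_gt_0_nat in blast)
private lemma tors: "x : carrier Hf ==> \<exists>N>0. x [^]\<^bsub>Hf\<^esub> (N::nat) = \<one>\<^bsub>Hf\<^esub>" by (rule h1_torsion[OF p chE])

lemma h1_decomposition: "group_iso (sum_group primes (%l. h1 (prufer l))) Hf (family_sum Hf primes)"
 unfolding sum_eq[OF order.refl]
 by (rule group_isoI[OF comm_group.family_sum_group_hom[OF cHf] comm_group.family_sum_inj[OF cHf]
   comm_group.family_sum_surj[OF cHf tors]]) simp_all

private lemma proj_eq: "h1_proj p chi = inv_into (carrier (primary_sum Hf primes)) (family_sum Hf primes) chi p"
 unfolding h1_proj_def sum_eq[OF order.refl] ..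

private lemma fil_sub: "subgroup (h1_fil p (int d)) Hf" "h1_fil p (int d) <= primary Hf p"
proof -
 have s: "subgroup (h1_fil p (int d)) (Hf\<lparr>carrier := primary Hf p\<rparr>)" using subgroup_h1_fil[of d] unfolding Hp_eq[OF p0_11] .
 show "subgroup (h1_fil p (int d)) Hf"
  by (rule group.incl_subgroup[OF comm_group_group[OF cHf] comm_group.subgroup_primary[OF cHf] s])
 show "h1_fil p (int d) <= primary Hf p" using subgroup.subset[OF s] by simp
qed

private lemma full_eq: "h1_fil_full p (int d) = {x : carrier Hf. inv_into (carrier (primary_sum Hf primes)) (family_sum Hf primes) x p : h1_fil p (int d)}"
 unfolding h1_fil_full_def proj_eq by simp

private lemma split2: "subgroup (h1_fil_full p (int d)) Hf"
 unfolding full_eq by (rule comm_group.primary_split(2)[OF cHf p tors fil_sub])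

private lemma split3: "a : primary Hf p ==> h1_proj p a = a"
 by (rule comm_group.primary_split(3)[OF cHf p tors fil_sub[of 0], folded proj_eq])

private lemma split4: "x : carrier Hf ==> h1_proj p x : h1_fil p (int d) ==>
  \<exists>a\<in>h1_fil p (int d). x \<otimes>\<^bsub>Hf\<^esub> inv\<^bsub>Hf\<^esub> a : carrier Hf \<and> h1_proj p (x \<otimes>\<^bsub>Hf\<^esub> inv\<^bsub>Hf\<^esub> a) = \<one>\<^bsub>Hf\<^esub>"
 by (rule comm_group.primary_split(4)[OF cHf p tors fil_sub, folded proj_eq])

private lemma split_eq: "h1_split p (int d) = Hf\<lparr>carrier := h1_fil p (int d)\<rparr> \<times>\<times> primary_sum Hf (primes - {p})"
 unfolding h1_split_def primes_eq sum_eq[OF Diff_subset] Hp_eq[OF p0_11] by simp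

private lemma split_sum_eq: "h1_split_sum p = (\<lambda>(chi, x). chi \<otimes>\<^bsub>Hf\<^esub> family_sum Hf (primes - {p}) x)"
 unfolding h1_split_sum_def primes_eq ..

lemma h1_split_group_iso: "group_iso (h1_split p (int d)) (Hf\<lparr>carrier := h1_fil_full p (int d)\<rparr>) (h1_split_sum p)"
 unfolding split_eq split_sum_eq full_eq by (rule comm_group.primary_split(1)[OF cHf p tors fil_sub])

text \<open>As d - 1 is at least 0, step d - 1 already contains all characters without p-part; so
  every class is represented by a p-primary character, and the projection is the identity on
  those.\<close>

lemma gr_full_induces_iso:
 assumes d: "d > 0"
 shows "induces_iso (Hp\<lparr>carrier := h1_fil p (int d)\<rparr>) (h1_fil p (int d - 1)) (gr Hf (h1_fil_full p) (int d))
  (%chi. h1_fil_full p (int d - 1) #>\<^bsub>Hf\<^esub> chi)"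
proof -
 let ?A = "Hp\<lparr>carrier := h1_fil p (int d)\<rparr>"
 have A: "?A = Hf\<lparr>carrier := h1_fil p (int d)\<rparr>" unfolding Hp_eq[OF p0_11] by simp
 have e: "int d - 1 = int (d - 1)" using d by simp
 have s: "h1_fil p (int d - 1) <= (h1_fil p (int d) :: 'k fls char set)" by (rule pred(4)[OF d])
 have fs: "h1_fil_full p (int d - 1) <= (h1_fil_full p (int d) :: 'k fls char set)"
  using s unfolding e h1_fil_full_def by auto
 have full: "subgroup (h1_fil_full p (int d - 1)) Hf" unfolding e by (rule split2)
 have pr: "h1_proj p x = x" if "x : h1_fil p (int d)" for x :: "'k fls char" using split3 fil_sub(2) that by blast
 have f: "a : h1_fil_full p (int d)" if "a : carrier ?A" for a
  using that pr[of a] subgroup.subset[OF fil_sub(1), of d] by (auto simp: h1_fil_full_def)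
 have id: "group_hom ?A Hf (%chi. chi)"
  unfolding A group_hom_def group_hom_axioms_def hom_def
  using subgroup.subgroup_is_group[OF fil_sub(1) comm_group_group[OF cHf]] comm_group_group[OF cHf] subgroup.subset[OF fil_sub(1), of d] by auto
 note g = gr_map[where F="h1_fil_full p" and d="int d", OF cHf split2 full fs id f]
 show ?thesis
 proof (rule induces_isoI[OF g(1)])
  show "(%chi. h1_fil_full p (int d - 1) #>\<^bsub>Hf\<^esub> chi) ` carrier ?A = carrier (gr Hf (h1_fil_full p) (int d))"
  proof (rule g(2))
   fix y :: "'k fls char" assume "y : h1_fil_full p (int d)"
   then have y: "y : carrier Hf" "h1_proj p y : h1_fil p (int d)" by (auto simp: h1_fil_full_def)
   obtain a where a: "a : h1_fil p (int d)" "y \<otimes>\<^bsub>Hf\<^esub> inv\<^bsub>Hf\<^esub> a : carrier Hf" "h1_proj p (y \<otimes>\<^bsub>Hf\<^esub> inv\<^bsub>Hf\<^esub> a) = \<one>\<^bsub>Hf\<^esub>"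
    using split4[OF y] by blast
   have "\<one>\<^bsub>Hf\<^esub> : h1_fil p (int (d - 1))" by (rule subgroup.one_closed[OF fil_sub(1)])
   then have "y \<otimes>\<^bsub>Hf\<^esub> inv\<^bsub>Hf\<^esub> a : h1_fil_full p (int d - 1)"
    unfolding e h1_fil_full_def using a(2,3) by simp
   then show "\<exists>a\<in>carrier ?A. y \<otimes>\<^bsub>Hf\<^esub> inv\<^bsub>Hf\<^esub> a : h1_fil_full p (int d - 1)" using a(1) by auto
  qed
  have "a : h1_fil_full p (int d - 1) \<longleftrightarrow> a : h1_fil p (int d - 1)" if "a : h1_fil p (int d)" for a :: "'k fls char"
   using pr[OF that] that subgroup.subset[OF fil_sub(1), of d] unfolding e h1_fil_full_def by auto
  then show "kernel ?A (gr Hf (h1_fil_full p) (int d)) (%chi. h1_fil_full p (int d - 1) #>\<^bsub>Hf\<^esub> chi) = h1_fil p (int d - 1)"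
   using g(3) s by auto
 qed
qed

text \<open>The step of index -1 is trivial by convention, so nothing is divided out and the
  components at the other primes survive.\<close>

lemma gr_full_0_group_iso:
 "group_iso (h1_split p 0) (gr Hf (h1_fil_full p) 0) (%x. h1_fil_full p (- 1) #>\<^bsub>Hf\<^esub> h1_split_sum p x)"
proof -
 note i = h1_split_group_iso[of 0, simplified of_nat_0]
 have sf: "subgroup (h1_fil_full p 0) Hf" using split2[of 0] by simp
 have t: "h1_fil_full p (- 1) = {\<one>\<^bsub>Hf\<^esub>}" by (simp add: h1_fil_full_def)
 have st: "subgroup (h1_fil_full p (- 1)) Hf" unfolding t by (rule group.triv_subgroup[OF comm_group_group[OF cHf]])
 have sub: "h1_fil_full p (- 1) <= (h1_fil_full p 0 :: 'k fls char set)" unfolding t using subgroup.one_closed[OF sf] by blast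
 have bij: "bij_betw (h1_split_sum p) (carrier (h1_split p 0)) (h1_fil_full p 0 :: 'k fls char set)"
  using i unfolding group_iso_def iso_def by simp
 have h: "group_hom (h1_split p 0) Hf (h1_split_sum p)"
  using i subgroup.subset[OF sf] comm_group_group[OF cHf]
  unfolding group_iso_def iso_def group_hom_def group_hom_axioms_def hom_def by auto
 have f: "h1_split_sum p a : (h1_fil_full p 0 :: 'k fls char set)" if "a : carrier (h1_split p 0)" for a
  using bij_betwE[OF bij] that by blast
 have m: "0 - 1 = (- 1 :: int)" by simp
 note g = gr_map[where F="h1_fil_full p" and d=0, unfolded m, OF cHf sf st sub h f]
 show ?thesis
 proof (rule kernel_trivial_group_iso[OF g(1)])
  show "(%x. h1_fil_full p (- 1) #>\<^bsub>Hf\<^esub> h1_split_sum p x) ` carrier (h1_split p 0) = carrier (gr Hf (h1_fil_full p) 0)"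
  proof (rule g(2))
   fix y :: "'k fls char" assume y: "y : h1_fil_full p 0"
   then obtain a where a: "a : carrier (h1_split p 0)" "y = h1_split_sum p a" using bij unfolding bij_betw_def by blast
   have "y \<otimes>\<^bsub>Hf\<^esub> inv\<^bsub>Hf\<^esub> h1_split_sum p a : h1_fil_full p (- 1)"
    unfolding t a(2)[symmetric] using group.r_inv[OF comm_group_group[OF cHf]] subgroup.mem_carrier[OF sf y] by blast
   then show "\<exists>a\<in>carrier (h1_split p 0). y \<otimes>\<^bsub>Hf\<^esub> inv\<^bsub>Hf\<^esub> h1_split_sum p a : h1_fil_full p (- 1)" using a(1) by blast
  qed
  fix x assume x: "x : carrier (h1_split p 0)" "h1_fil_full p (- 1) #>\<^bsub>Hf\<^esub> h1_split_sum p x = \<one>\<^bsub>gr Hf (h1_fil_full p) 0\<^esub>"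
  then have "x : {a : carrier (h1_split p 0). h1_split_sum p a : h1_fil_full p (- 1)}" using g(3) unfolding kernel_def by blast
  then have "h1_split_sum p x = \<one>\<^bsub>Hf\<^esub>" unfolding t by blast
  then show "x = \<one>\<^bsub>h1_split p 0\<^esub>"
   using group_hom.inj_on_one_iff[OF h] bij x(1) unfolding bij_betw_def by blast
 qed
qed

end











theorem theorem4p9:
  fixes p :: nat
  assumes "CHAR('k::field) = p" and "p > 0"
  shows
    \<comment> \<open>(1)\<close>
    "(bij_betw (laurent_sum p) (laurent_parts p) (carrier (cw p (UNIV :: 'k fls set))) \<and>
      induces_iso (cw p (UNIV :: 'k fls set)) (cw_wp p UNIV) (asw_target p) (asw_phi p) \<and>
      induces_iso (cw p (UNIV :: 'k fls set)) (cw_wp p UNIV) (h1 (prufer p)) (asw p) \<and>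
      group_iso (h1 (prufer p)) (asw_target p)
        (asw_psi p :: 'k fls char \<Rightarrow> (nat \<Rightarrow> 'k covec) \<times> 'k covec set))
     \<and>
     \<comment> \<open>(2)\<close>
     ((h1_fil p 0 :: 'k fls char set) =
        asw p ` cw_map p UNIV fls_const ` carrier (cw p (UNIV :: 'k set)) \<and>
      induces_iso (cw p (UNIV :: 'k set)) (cw_wp p UNIV)
        ((h1 (prufer p))\<lparr>carrier := h1_fil p 0\<rparr>)
        (\<lambda>f. asw p (cw_map p (UNIV :: 'k fls set) fls_const f)) \<and>
      (\<forall>d\<ge>1. asw_psi p ` (h1_fil p (int d) :: 'k fls char set) = asw_target_fil p d) \<and>
      (\<forall>d>0. \<exists>h. group_iso (gr (h1 (prufer p)) (h1_fil p :: int \<Rightarrow> 'k fls char set) (int d))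
        (witt p (UNIV :: 'k set) (multiplicity p d) Mod
           witt_p_multiples p UNIV (multiplicity p d)) h) \<and>
      (\<exists>h. group_iso (gr (h1 (prufer p)) (h1_fil p :: int \<Rightarrow> 'k fls char set) 0)
        (cw p (UNIV :: 'k set) Mod cw_wp p UNIV) h))
     \<and>
     \<comment> \<open>(3)\<close>
     ((\<forall>n m d. n \<ge> 1 \<longrightarrow> coprime n p \<longrightarrow> d = n * p ^ m \<longrightarrow>
        group_iso (witt p (UNIV :: 'k set) m)
          ((cw p UNIV)\<lparr>carrier := comonomial p d ` carrier (witt p (UNIV :: 'k set) m)\<rparr>)
          (comonomial p d) \<and>
        group_iso (witt p (UNIV :: 'k set) m) (gr (cw p UNIV) (cw_fil p) (int d))
          (\<lambda>x. cw_fil p (int d - 1) #>\<^bsub>cw p UNIV\<^esub> comonomial p d x) \<and>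
        (let gr_asw = quot_map (\<lambda>f. h1_fil p (int d - 1) #>\<^bsub>h1 (prufer p)\<^esub>
               asw p (f :: 'k fls covec));
             \<theta> = (\<lambda>x :: 'k list. h1_fil p (int d - 1) #>\<^bsub>h1 (prufer p)\<^esub> asw p (comonomial p d x))
         in group_hom (gr (cw p UNIV) (cw_fil p) (int d)) (gr (h1 (prufer p)) (h1_fil p) (int d))
              gr_asw \<and>
            (\<forall>f\<in>cw_fil p (int d). gr_asw (cw_fil p (int d - 1) #>\<^bsub>cw p UNIV\<^esub> f) =
               h1_fil p (int d - 1) #>\<^bsub>h1 (prufer p)\<^esub> asw p f) \<and>
            (\<forall>x\<in>carrier (witt p UNIV m).
               gr_asw (cw_fil p (int d - 1) #>\<^bsub>cw p UNIV\<^esub> comonomial p d x) = \<theta> x) \<and>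
            group_hom (witt p UNIV m) (gr (h1 (prufer p)) (h1_fil p) (int d)) \<theta> \<and>
            \<theta> ` carrier (witt p UNIV m) = carrier (gr (h1 (prufer p)) (h1_fil p) (int d)) \<and>
            kernel (witt p UNIV m) (gr (h1 (prufer p)) (h1_fil p) (int d)) \<theta> =
              witt_p_multiples p UNIV m)) \<and>
      group_iso (cw p (UNIV :: 'k fps set)) ((cw p UNIV)\<lparr>carrier := cw_fil p 0\<rparr>)
        (cw_map p UNIV fps_to_fls) \<and>
      cw_fil p 0 = cw_map p UNIV fps_to_fls ` carrier (cw p (UNIV :: 'k fps set)) \<and>
      (let \<kappa> = (\<lambda>f :: 'k covec. h1_fil p (- 1) #>\<^bsub>h1 (prufer p)\<^esub>
             asw p (cw_map p (UNIV :: 'k fls set) fls_const f))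
       in induces_iso (cw p UNIV) (cw_wp p UNIV) (gr (h1 (prufer p)) (h1_fil p) 0) \<kappa> \<and>
          (\<forall>f\<in>carrier (cw p (UNIV :: 'k fps set)).
             inv_into (carrier (cw p UNIV Mod cw_wp p UNIV)) (quot_map \<kappa>)
               (h1_fil p (- 1) #>\<^bsub>h1 (prufer p)\<^esub> asw p (cw_map p UNIV fps_to_fls f)) =
             cw_wp p UNIV #>\<^bsub>cw p UNIV\<^esub> cw_map p UNIV (\<lambda>a. fps_nth a 0) f)))
     \<and>
     \<comment> \<open>(4)\<close>
     (group_iso (sum_group {l. Factorial_Ring.prime l} (\<lambda>l. h1 (prufer l)))
        (h1 rat_mod_int :: 'k fls char monoid)
        (family_sum (h1 rat_mod_int) {l. Factorial_Ring.prime l}) \<and>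
      (\<forall>d::nat. group_iso (h1_split p (int d))
         ((h1 rat_mod_int :: 'k fls char monoid)\<lparr>carrier := h1_fil_full p (int d)\<rparr>)
         (h1_split_sum p)) \<and>
      (\<forall>d::nat. d > 0 \<longrightarrow>
         induces_iso ((h1 (prufer p) :: 'k fls char monoid)\<lparr>carrier := h1_fil p (int d)\<rparr>)
           (h1_fil p (int d - 1))
           (gr (h1 rat_mod_int) (h1_fil_full p) (int d))
           (\<lambda>\<chi>. h1_fil_full p (int d - 1) #>\<^bsub>h1 rat_mod_int\<^esub> \<chi>)) \<and>
      group_iso (h1_split p 0) (gr (h1 rat_mod_int) (h1_fil_full p) 0)
        (\<lambda>x. h1_fil_full p (- 1) #>\<^bsub>h1 rat_mod_int\<^esub>
           (h1_split_sum p x :: 'k fls char)))"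
proof -
  have "Factorial_Ring.prime CHAR('k)" by (rule prime_CHAR_semidom) (use assms in simp)
  then have p: "Factorial_Ring.prime p" unfolding assms(1) .
  note ch = assms(1)
  have chE: "CHAR('k fls) = p" by (simp add: CHAR_fls ch)
  have Jm: "n \<in> coprime_nats p" if "n \<ge> 1" "coprime n p" for n using that by (simp add: coprime_nats_def)
  have gr_d: "\<exists>h. group_iso (gr (h1 (prufer p)) (h1_fil p :: int \<Rightarrow> 'k fls char set) (int d))
      (witt p (UNIV :: 'k set) (multiplicity p d) Mod witt_p_multiples p UNIV (multiplicity p d)) h" if d: "d > 0" for d
  proof -
    obtain n where n: "n \<in> coprime_nats p" "d = n * p ^ multiplicity p d" by (rule coprime_nats_decomp[OF p d])
    have "induces_iso (witt p (UNIV :: 'k set) (multiplicity p d)) (witt_p_multiples p UNIV (multiplicity p d))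
        (gr (h1 (prufer p)) (h1_fil p :: int \<Rightarrow> 'k fls char set) (int d))
        (\<lambda>x. h1_fil p (int d - 1) #>\<^bsub>h1 (prufer p)\<^esub> asw p (comonomial p d x))"
      by (rule induces_isoI) (rule gr_theta[OF p ch n])+
    then show ?thesis unfolding induces_iso_def by (blast intro: group_iso_inverse)
  qed
  have gr_0: "\<exists>h. group_iso (gr (h1 (prufer p)) (h1_fil p :: int \<Rightarrow> 'k fls char set) 0) (cw p (UNIV :: 'k set) Mod cw_wp p UNIV) h"
    using gr_0_induces_iso[OF p ch] unfolding induces_iso_def by (blast intro: group_iso_inverse)
  have nz: "n * p ^ m > 0" if "n \<ge> 1" for n m :: nat using that prime_gt_0_nat[OF p] by simp
  show ?thesis
    unfolding Let_def
  \<comment> \<open>The cases follow the order of the statement: 1 to 4 belong to (1), 5 to 9 to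
    (2), 10 to 21 to (3) and 22 to 25 to (4).\<close>
  proof (intro conjI allI impI ballI, goal_cases)
    case 1 show ?case unfolding laurent_parts_eq[OF p ch] by (rule laurent_sum_bij[OF p ch])
  next
    case 2 show ?case by (rule asw_phi_induces_iso[OF p ch])
  next
    case 3 show ?case by (rule asw_induces_iso[OF p chE])
  next
    case 4 show ?case by (rule asw_psi_group_iso[OF p ch])
  next
    case 5 show ?case by (rule h1_fil_0[OF p ch])
  next
    case 6 show ?case by (rule asw_const_induces_iso[OF p ch])
  next
    case (7 d) show ?case by (rule asw_psi_h1_fil[OF p ch])
  next
    case (8 d) then show ?case by (rule gr_d)
  next
    case 9 show ?case by (rule gr_0)
  next
    case (10 n m d) show ?case unfolding 10(3) by (rule comonomial_group_iso[OF p ch Jm[OF 10(1,2)]])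
  next
    case (11 n m d) show ?case by (rule gr_cw_group_iso[OF p ch Jm[OF 11(1,2)] 11(3)])
  next
    case (12 n m d) show ?case unfolding 12(3) by (rule gr_asw(1)[OF p ch nz[OF 12(1)]])
  next
    case (13 n m d f) then show ?case unfolding 13(3) by (intro gr_asw(2)[OF p ch nz[OF 13(1)]])
  next
    case (14 n m d x) show ?case unfolding 14(3) by (rule gr_asw(2)[OF p ch nz[OF 14(1)] comonomial_fil_J[OF p ch Jm[OF 14(1,2)]]])
  next
    case (15 n m d) show ?case by (rule gr_theta(1)[OF p ch Jm[OF 15(1,2)] 15(3)])
  next
    case (16 n m d) show ?case by (rule gr_theta(2)[OF p ch Jm[OF 16(1,2)] 16(3)])
  next
    case (17 n m d) show ?case by (rule gr_theta(3)[OF p ch Jm[OF 17(1,2)] 17(3)])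
  next
    case 18 show ?case by (rule fps_group_iso[OF p ch])
  next
    case 19 show ?case by (rule cw_fil_0[OF p ch])
  next
    case 20 show ?case by (rule gr_0_induces_iso[OF p ch])
  next
    case (21 f) then show ?case by (rule gr_0_constant_term[OF p ch])
  next
    case 22 show ?case by (rule h1_decomposition[OF p ch])
  next
    case (23 d) show ?case by (rule h1_split_group_iso[OF p ch])
  next
    case (24 d) then show ?case by (rule gr_full_induces_iso[OF p ch])
  next
    case 25 show ?case by (rule gr_full_0_group_iso[OF p ch])
  qed
qed

end
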